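(* Let $N\ge 1$, $0<\gamma_2<\gamma_1<N$ and $\psi_0\in H^s(\mathbb{R}^N)$ with $s\ge\frac{\gamma_1}{2}$ and $s\ge 1$. Then there exists a positive time $T$ such that the Cauchy problem $$\mathrm{i}\,\psi_t=\Delta\psi+\left(|x|^{-\gamma_1}\ast|\psi|^2\right)\psi-\left(|x|^{-\gamma_2}\ast|\psi|^2\right)\psi,\qquad \psi(\cdot,0)=\psi_0,$$ has a unique solution $\psi\in C([0,T],H^s(\mathbb{R}^N))$, with $\|\psi\|_{L^\infty([0,T],H^s)}\lesssim\|\psi_0\|_{H^s}$. In addition, mass and energy are conserved, i.e. for any $t\in[0,T)$, $$\|\psi(t)\|_{L^2}=\|\psi_0\|_{L^2},\qquad E(\psi(t))=E(\psi_0).$$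
   Context: Functions are complex-valued. The energy is $E(u):=\frac12\int_{\mathbb{R}^N}|\nabla u|^2\,dx+\frac14\int_{\mathbb{R}^N}\int_{\mathbb{R}^N}\frac{|u(x)|^2|u(y)|^2}{|x-y|^{\gamma_2}}\,dx\,dy-\frac14\int_{\mathbb{R}^N}\int_{\mathbb{R}^N}\frac{|u(x)|^2|u(y)|^2}{|x-y|^{\gamma_1}}\,dx\,dy$. Solutions are understood in the integral (Duhamel) sense $\psi(t)=U(t)\psi_0-\mathrm{i}\int_0^tU(t-t')F(\psi(t'))\,dt'$, where $U(t)=e^{-\mathrm{i}\Delta t}$ and $F(u)=(|x|^{-\gamma_1}\ast|u|^2)u-(|x|^{-\gamma_2}\ast|u|^2)u$. $A\lesssim B$ means $A\le CB$ for a constant $C>0$ independent of $\psi_0$. *)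

theory Defs
  imports "HOL-Probability.Probability"
begin

section \<open>The Hilbert space of square-integrable complex functions\<close>

definition square_integrable :: "('a::euclidean_space \<Rightarrow> complex) \<Rightarrow> bool" where
  "square_integrable f \<longleftrightarrow>
     f \<in> borel_measurable lborel \<and> integrable lborel (\<lambda>x. (cmod (f x))\<^sup>2)"

lemma square_integrable_zero [simp]: "square_integrable (\<lambda>x. 0)"
  by (simp add: square_integrable_def)

lemma square_integrable_mult:
  assumes "square_integrable f"
  shows "square_integrable (\<lambda>x. c * f x)"
  using assms by (auto simp: square_integrable_def norm_mult power_mult_distrib)

lemma square_integrable_add:
  assumes "square_integrable f" "square_integrable g"
  shows "square_integrable (\<lambda>x. f x + g x)"
proof -
  have [measurable]: "f \<in> borel_measurable lborel" "g \<in> borel_measurable lborel"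
    using assms by (auto simp: square_integrable_def)
  have le: "(cmod (a + b))\<^sup>2 \<le> 2 * (cmod a)\<^sup>2 + 2 * (cmod b)\<^sup>2" for a b :: complex
  proof -
    have "(cmod (a + b))\<^sup>2 \<le> (cmod a + cmod b)\<^sup>2"
      by (intro power_mono norm_triangle_ineq) auto
    also have "\<dots> \<le> 2 * (cmod a)\<^sup>2 + 2 * (cmod b)\<^sup>2"
      using sum_squares_bound[of "cmod a" "cmod b"] by (simp add: power2_sum)
    finally show ?thesis .
  qed
  have "integrable lborel (\<lambda>x. (cmod (f x + g x))\<^sup>2)"
    by (rule Bochner_Integration.integrable_bound
          [where f = "\<lambda>x. 2 * (cmod (f x))\<^sup>2 + 2 * (cmod (g x))\<^sup>2"])
       (use assms le in \<open>auto simp: square_integrable_def intro!: AE_I2\<close>)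
  then show ?thesis by (auto simp: square_integrable_def)
qed

lemma square_integrable_diff:
  assumes "square_integrable f" "square_integrable g"
  shows "square_integrable (\<lambda>x. f x - g x)"
  using square_integrable_add[OF assms(1) square_integrable_mult[OF assms(2), of "-1"]] by simp

lemma integrable_inner_square_integrable:
  assumes "square_integrable f" "square_integrable g"
  shows "integrable lborel (\<lambda>x. f x \<bullet> g x)"
proof -
  have [measurable]: "f \<in> borel_measurable lborel" "g \<in> borel_measurable lborel"
    using assms by (auto simp: square_integrable_def)
  have le: "\<bar>a \<bullet> b\<bar> \<le> (cmod a)\<^sup>2 + (cmod b)\<^sup>2" for a b :: complex
  proof -
    have "\<bar>a \<bullet> b\<bar> \<le> cmod a * cmod b" by (rule Cauchy_Schwarz_ineq2)
    also have "\<dots> \<le> (cmod a)\<^sup>2 + (cmod b)\<^sup>2"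
    proof -
      have "0 \<le> cmod a * cmod b" by simp
      then show ?thesis using sum_squares_bound[of "cmod a" "cmod b"] by linarith
    qed
    finally show ?thesis .
  qed
  show ?thesis
    by (rule Bochner_Integration.integrable_bound
          [where f = "\<lambda>x. (cmod (f x))\<^sup>2 + (cmod (g x))\<^sup>2"])
       (use assms le in \<open>auto simp: square_integrable_def intro!: AE_I2\<close>)
qed

quotient_type (overloaded) 'a Ltwo = "'a::euclidean_space \<Rightarrow> complex" / partial:
  "\<lambda>f g. square_integrable f \<and> square_integrable g \<and> (AE x in lborel. f x = g x)"
  morphisms repr abs_Ltwo
proof (rule part_equivpI)
  show "\<exists>f :: 'a \<Rightarrow> complex.
      square_integrable f \<and> square_integrable f \<and> (AE x in lborel. f x = f x)"
    by (intro exI[of _ "\<lambda>x. 0"]) simp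
qed (auto intro!: sympI transpI)

text \<open>
  The class of a square-integrable function, with the fallback value 0 for functions that are not
  square-integrable; \<open>repr\<close> picks a representative of a class.
\<close>

definition to_Ltwo :: "('a::euclidean_space \<Rightarrow> complex) \<Rightarrow> 'a Ltwo" where
  "to_Ltwo f = (if square_integrable f then abs_Ltwo f else abs_Ltwo (\<lambda>x. 0))"

lemma square_integrable_repr [simp]: "square_integrable (repr u)"
  using Quotient3_rep_reflp[OF Quotient3_Ltwo, of u] by simp

lemma AE_repr_to_Ltwo:
  assumes "square_integrable f"
  shows "AE x in lborel. repr (to_Ltwo f) x = f x"
  using rep_abs_rsp_left[OF Quotient3_Ltwo, of f f] assms by (simp add: to_Ltwo_def)

lemma Ltwo_eq_iff: "u = v \<longleftrightarrow> (AE x in lborel. repr u x = repr v x)"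
  using Quotient3_rel_rep[OF Quotient3_Ltwo, of u v] by simp

instantiation Ltwo :: (euclidean_space) real_inner
begin

definition zero_Ltwo :: "'a Ltwo" where "0 = to_Ltwo (\<lambda>x. 0)"
definition plus_Ltwo :: "'a Ltwo \<Rightarrow> 'a Ltwo \<Rightarrow> 'a Ltwo"
  where "u + v = to_Ltwo (\<lambda>x. repr u x + repr v x)"
definition minus_Ltwo :: "'a Ltwo \<Rightarrow> 'a Ltwo \<Rightarrow> 'a Ltwo"
  where "u - v = to_Ltwo (\<lambda>x. repr u x - repr v x)"
definition uminus_Ltwo :: "'a Ltwo \<Rightarrow> 'a Ltwo"
  where "- u = to_Ltwo (\<lambda>x. - repr u x)"
definition scaleR_Ltwo :: "real \<Rightarrow> 'a Ltwo \<Rightarrow> 'a Ltwo"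
  where "c *\<^sub>R u = to_Ltwo (\<lambda>x. c *\<^sub>R repr u x)"

text \<open>The real part of the Hermitian inner product; it induces the usual norm.\<close>

definition inner_Ltwo :: "'a Ltwo \<Rightarrow> 'a Ltwo \<Rightarrow> real"
  where "u \<bullet> v = (LINT x|lborel. repr u x \<bullet> repr v x)"
definition norm_Ltwo :: "'a Ltwo \<Rightarrow> real"
  where "norm u = sqrt (LINT x|lborel. (cmod (repr u x))\<^sup>2)"
definition sgn_Ltwo :: "'a Ltwo \<Rightarrow> 'a Ltwo"
  where "sgn (u :: 'a Ltwo) = inverse (norm u) *\<^sub>R u"
definition dist_Ltwo :: "'a Ltwo \<Rightarrow> 'a Ltwo \<Rightarrow> real"
  where "dist (u :: 'a Ltwo) v = norm (u - v)"
definition uniformity_Ltwo :: "('a Ltwo \<times> 'a Ltwo) filter"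
  where "uniformity = (INF e\<in>{0<..}. principal {(u :: 'a Ltwo, v). dist u v < e})"
definition open_Ltwo :: "'a Ltwo set \<Rightarrow> bool"
  where "open (S :: 'a Ltwo set) \<longleftrightarrow> (\<forall>u\<in>S. \<forall>\<^sub>F (u', v) in uniformity. u' = u \<longrightarrow> v \<in> S)"

lemma AE_zero_Ltwo: "AE x in lborel. repr (0 :: 'a Ltwo) x = 0"
  unfolding zero_Ltwo_def by (rule AE_repr_to_Ltwo) simp

lemma AE_plus_Ltwo: "AE x in lborel. repr (u + v :: 'a Ltwo) x = repr u x + repr v x"
  unfolding plus_Ltwo_def by (rule AE_repr_to_Ltwo) (simp add: square_integrable_add)

lemma AE_minus_Ltwo: "AE x in lborel. repr (u - v :: 'a Ltwo) x = repr u x - repr v x"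
  unfolding minus_Ltwo_def by (rule AE_repr_to_Ltwo) (simp add: square_integrable_diff)

lemma AE_uminus_Ltwo: "AE x in lborel. repr (- u :: 'a Ltwo) x = - repr u x"
  unfolding uminus_Ltwo_def
  by (rule AE_repr_to_Ltwo)
     (use square_integrable_mult[OF square_integrable_repr, of "-1" u] in simp)

lemma AE_scaleR_Ltwo: "AE x in lborel. repr (c *\<^sub>R u :: 'a Ltwo) x = c *\<^sub>R repr u x"
  unfolding scaleR_Ltwo_def
  by (rule AE_repr_to_Ltwo)
     (use square_integrable_mult[OF square_integrable_repr, of "of_real c" u]
      in \<open>simp add: scaleR_conv_of_real\<close>)

lemma borel_measurable_repr [measurable]: "repr (u :: 'a Ltwo) \<in> borel_measurable lborel"
  using square_integrable_repr[of u] by (simp add: square_integrable_def)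

instance
proof
  fix u v w :: "'a Ltwo" and a b :: real
  show "u + v + w = u + (v + w)"
    unfolding Ltwo_eq_iff
    using AE_plus_Ltwo[of "u + v" w] AE_plus_Ltwo[of u v] AE_plus_Ltwo[of u "v + w"]
      AE_plus_Ltwo[of v w]
    by eventually_elim simp
  show "u + v = v + u"
    unfolding Ltwo_eq_iff using AE_plus_Ltwo[of u v] AE_plus_Ltwo[of v u]
    by eventually_elim simp
  show "0 + u = u"
    unfolding Ltwo_eq_iff using AE_plus_Ltwo[of 0 u] AE_zero_Ltwo
    by eventually_elim simp
  show "- u + u = 0"
    unfolding Ltwo_eq_iff using AE_plus_Ltwo[of "- u" u] AE_zero_Ltwo AE_uminus_Ltwo[of u]
    by eventually_elim simp
  show "u - v = u + - v"
    unfolding Ltwo_eq_iff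
    using AE_plus_Ltwo[of u "- v"] AE_minus_Ltwo[of u v] AE_uminus_Ltwo[of v]
    by eventually_elim simp
  show "a *\<^sub>R (u + v) = a *\<^sub>R u + a *\<^sub>R v"
    unfolding Ltwo_eq_iff
    using AE_plus_Ltwo[of u v] AE_plus_Ltwo[of "a *\<^sub>R u" "a *\<^sub>R v"] AE_scaleR_Ltwo[of a u]
      AE_scaleR_Ltwo[of a v] AE_scaleR_Ltwo[of a "u + v"]
    by eventually_elim (simp add: scaleR_add_right)
  show "(a + b) *\<^sub>R u = a *\<^sub>R u + b *\<^sub>R u"
    unfolding Ltwo_eq_iff
    using AE_plus_Ltwo[of "a *\<^sub>R u" "b *\<^sub>R u"] AE_scaleR_Ltwo[of a u]
      AE_scaleR_Ltwo[of b u] AE_scaleR_Ltwo[of "a + b" u]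
    by eventually_elim (simp add: scaleR_add_left)
  show "a *\<^sub>R b *\<^sub>R u = (a * b) *\<^sub>R u"
    unfolding Ltwo_eq_iff
    using AE_scaleR_Ltwo[of a "b *\<^sub>R u"] AE_scaleR_Ltwo[of b u] AE_scaleR_Ltwo[of "a * b" u]
    by eventually_elim simp
  show "1 *\<^sub>R u = u"
    unfolding Ltwo_eq_iff using AE_scaleR_Ltwo[of 1 u] by eventually_elim simp
  show "dist u v = norm (u - v)" by (rule dist_Ltwo_def)
  show "sgn u = inverse (norm u) *\<^sub>R u" by (rule sgn_Ltwo_def)
  show "uniformity = (INF e\<in>{0<..}. principal {(u, v :: 'a Ltwo). dist u v < e})"
    by (rule uniformity_Ltwo_def)
  show "open S \<longleftrightarrow> (\<forall>u\<in>S. \<forall>\<^sub>F (u', v) in uniformity. u' = u \<longrightarrow> v \<in> S)"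
    for S :: "'a Ltwo set"
    by (rule open_Ltwo_def)
  show "u \<bullet> v = v \<bullet> u" by (simp add: inner_Ltwo_def inner_commute)
  have int: "integrable lborel (\<lambda>x. repr u x \<bullet> repr v x)" for u v :: "'a Ltwo"
    by (simp add: integrable_inner_square_integrable)
  have "(u + v) \<bullet> w = (LINT x|lborel. repr u x \<bullet> repr w x + repr v x \<bullet> repr w x)"
    unfolding inner_Ltwo_def
    by (rule integral_cong_AE, measurable)
       (use AE_plus_Ltwo[of u v] in \<open>eventually_elim; simp add: inner_add_left\<close>)
  also have "\<dots> = u \<bullet> w + v \<bullet> w"
    by (simp add: inner_Ltwo_def int)
  finally show "(u + v) \<bullet> w = u \<bullet> w + v \<bullet> w" .
  have "(a *\<^sub>R u) \<bullet> v = (LINT x|lborel. a * (repr u x \<bullet> repr v x))"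
    unfolding inner_Ltwo_def
    by (rule integral_cong_AE, measurable)
       (use AE_scaleR_Ltwo[of a u] in \<open>eventually_elim; simp\<close>)
  then show "(a *\<^sub>R u) \<bullet> v = a * (u \<bullet> v)" by (simp add: inner_Ltwo_def)
  show "0 \<le> u \<bullet> u" unfolding inner_Ltwo_def by (rule Bochner_Integration.integral_nonneg) simp
  have "u \<bullet> u = 0 \<longleftrightarrow> (AE x in lborel. repr u x \<bullet> repr u x = 0)"
    unfolding inner_Ltwo_def by (rule integral_nonneg_eq_0_iff_AE) (auto simp: int)
  also have "\<dots> \<longleftrightarrow> (AE x in lborel. repr u x = repr 0 x)"
  proof
    assume "AE x in lborel. repr u x \<bullet> repr u x = 0"
    then show "AE x in lborel. repr u x = repr 0 x"
      using AE_zero_Ltwo by eventually_elim simp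
  next
    assume "AE x in lborel. repr u x = repr 0 x"
    then show "AE x in lborel. repr u x \<bullet> repr u x = 0"
      using AE_zero_Ltwo by eventually_elim simp
  qed
  finally show "u \<bullet> u = 0 \<longleftrightarrow> u = 0" by (simp add: Ltwo_eq_iff)
  show "norm u = sqrt (u \<bullet> u)"
    by (simp add: norm_Ltwo_def inner_Ltwo_def power2_norm_eq_inner)
qed

end

definition scaleC :: "complex \<Rightarrow> 'a::euclidean_space Ltwo \<Rightarrow> 'a Ltwo" where
  "scaleC c u = to_Ltwo (\<lambda>x. c * repr u x)"

section \<open>Fourier transform and Sobolev spaces\<close>

text \<open>Fourier integral with the unitary normalisation, under which \<open>-\<Delta>\<close> becomes \<open>|\<xi>|\<^sup>2\<close>.\<close>

definition fourier_integral :: "('a::euclidean_space \<Rightarrow> complex) \<Rightarrow> 'a \<Rightarrow> complex" where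
  "fourier_integral f \<xi> =
     complex_of_real ((2 * pi) powr (- real DIM('a) / 2)) *
     (LINT x|lborel. cis (- (x \<bullet> \<xi>)) * f x)"

text \<open>Plancherel transform: the limit in \<open>L\<^sup>2\<close> of the Fourier integrals over growing balls.\<close>

definition fourier :: "'a::euclidean_space Ltwo \<Rightarrow> 'a Ltwo" where
  "fourier u =
     Lim at_top (\<lambda>R::real. to_Ltwo (fourier_integral (\<lambda>x. indicator (cball 0 R) x * repr u x)))"

definition bessel_weight :: "real \<Rightarrow> 'a::euclidean_space Ltwo \<Rightarrow> 'a \<Rightarrow> complex" where
  "bessel_weight s u \<xi> = complex_of_real ((1 + (norm \<xi>)\<^sup>2) powr (s / 2)) * repr (fourier u) \<xi>"

text \<open>As a subset of \<open>L\<^sup>2\<close>, this is the Sobolev space only for \<open>s \<ge> 0\<close>.\<close>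

definition Sobolev :: "real \<Rightarrow> 'a::euclidean_space Ltwo set" where
  "Sobolev s = {u. square_integrable (bessel_weight s u)}"

definition Sobolev_norm :: "real \<Rightarrow> 'a::euclidean_space Ltwo \<Rightarrow> real" where
  "Sobolev_norm s u = sqrt (LINT \<xi>|lborel. (cmod (bessel_weight s u \<xi>))\<^sup>2)"

definition continuous_in_Sobolev :: "real \<Rightarrow> real \<Rightarrow> (real \<Rightarrow> 'a::euclidean_space Ltwo) \<Rightarrow> bool" where
  "continuous_in_Sobolev s T \<psi> \<longleftrightarrow>
     (\<forall>t\<in>{0..T}. \<psi> t \<in> Sobolev s \<and>
        ((\<lambda>r. Sobolev_norm s (\<psi> r - \<psi> t)) \<longlongrightarrow> 0) (at t within {0..T}))"

definition Linfty_Sobolev_norm :: "real \<Rightarrow> real \<Rightarrow> (real \<Rightarrow> 'a::euclidean_space Ltwo) \<Rightarrow> ereal" where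
  "Linfty_Sobolev_norm s T \<psi> =
     esssup (lebesgue_on {0..T}) (\<lambda>t. ereal (Sobolev_norm s (\<psi> t)))"

section \<open>Weak gradient\<close>

primrec Ck :: "nat \<Rightarrow> ('a::euclidean_space \<Rightarrow> real) \<Rightarrow> bool" where
  "Ck 0 \<phi> \<longleftrightarrow> continuous_on UNIV \<phi>"
| "Ck (Suc k) \<phi> \<longleftrightarrow>
     \<phi> differentiable_on UNIV \<and> (\<forall>b\<in>Basis. Ck k (\<lambda>x. frechet_derivative \<phi> (at x) b))"

definition test_function :: "('a::euclidean_space \<Rightarrow> real) \<Rightarrow> bool" where
  "test_function \<phi> \<longleftrightarrow> (\<forall>k. Ck k \<phi>) \<and> compact (closure {x. \<phi> x \<noteq> 0})"

definition weak_partial :: "'a::euclidean_space \<Rightarrow> 'a Ltwo \<Rightarrow> 'a Ltwo" where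
  "weak_partial b u =
     (THE v. \<forall>\<phi>. test_function \<phi> \<longrightarrow>
        (LINT x|lborel. repr u x * complex_of_real (frechet_derivative \<phi> (at x) b)) =
        - (LINT x|lborel. repr v x * complex_of_real (\<phi> x)))"

section \<open>The equation\<close>

definition convolution ::
    "('a::euclidean_space \<Rightarrow> real) \<Rightarrow> ('a \<Rightarrow> real) \<Rightarrow> 'a \<Rightarrow> real" where
  "convolution f g x = (LINT y|lborel. f (x - y) * g y)"

definition hartree_potential :: "real \<Rightarrow> 'a::euclidean_space Ltwo \<Rightarrow> 'a \<Rightarrow> real" where
  "hartree_potential \<gamma> u =
     convolution (\<lambda>x. norm x powr (- \<gamma>)) (\<lambda>x. (cmod (repr u x))\<^sup>2)"

text \<open>
  For \<open>u \<in> H\<^sup>s\<close> with \<open>s \<ge> \<gamma>/2\<close> and \<open>0 < \<gamma> < N\<close>, Hardy's inequality bounds the potential uniformly, so the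
  integral converges for every \<open>x\<close> and the product below is in \<open>L\<^sup>2\<close>: the fallback value of
  \<open>to_Ltwo\<close> does not occur.
\<close>

definition nonlinearity :: "real \<Rightarrow> real \<Rightarrow> 'a::euclidean_space Ltwo \<Rightarrow> 'a Ltwo" where
  "nonlinearity \<gamma>1 \<gamma>2 u =
     to_Ltwo (\<lambda>x. complex_of_real (hartree_potential \<gamma>1 u x) * repr u x
                - complex_of_real (hartree_potential \<gamma>2 u x) * repr u x)"

text \<open>
  The group \<open>exp (-\<i> t \<Delta>)\<close>: the Fourier multiplier \<open>exp (\<i> t |\<xi>|\<^sup>2)\<close>.  By Plancherel's theorem
  \<open>fourier\<close> is a bijection, so that \<open>inv fourier\<close> is its inverse.
\<close>

definition propagator :: "real \<Rightarrow> 'a::euclidean_space Ltwo \<Rightarrow> 'a Ltwo" where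
  "propagator t u = inv fourier (to_Ltwo (\<lambda>\<xi>. cis (t * (norm \<xi>)\<^sup>2) * repr (fourier u) \<xi>))"

text \<open>
  Solution in \<open>C([0,T], H\<^sup>s)\<close> of Duhamel's formula.  The time integral is an \<open>L\<^sup>2\<close>-valued
  Henstock-Kurzweil integral; for \<open>\<psi>\<close> in \<open>C([0,T], H\<^sup>s)\<close> with \<open>s \<ge> \<gamma>1/2\<close> its integrand is
  norm-continuous, so it is just the Riemann (or Bochner) integral.
\<close>

definition duhamel_solution ::
    "real \<Rightarrow> real \<Rightarrow> real \<Rightarrow> 'a::euclidean_space Ltwo \<Rightarrow> real \<Rightarrow> (real \<Rightarrow> 'a Ltwo) \<Rightarrow> bool" where
  "duhamel_solution \<gamma>1 \<gamma>2 s \<psi>0 T \<psi> \<longleftrightarrow>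
     continuous_in_Sobolev s T \<psi> \<and>
     (\<forall>t\<in>{0..T}.
        (\<lambda>t'. propagator (t - t') (nonlinearity \<gamma>1 \<gamma>2 (\<psi> t'))) integrable_on {0..t} \<and>
        \<psi> t = propagator t \<psi>0
          - scaleC \<i> (integral {0..t} (\<lambda>t'. propagator (t - t') (nonlinearity \<gamma>1 \<gamma>2 (\<psi> t')))))"

definition hartree_energy :: "real \<Rightarrow> 'a::euclidean_space Ltwo \<Rightarrow> real" where
  "hartree_energy \<gamma> u =
     (LINT x|lborel. LINT y|lborel.
        (cmod (repr u x))\<^sup>2 * (cmod (repr u y))\<^sup>2 / norm (x - y) powr \<gamma>)"

definition energy :: "real \<Rightarrow> real \<Rightarrow> 'a::euclidean_space Ltwo \<Rightarrow> real" where
  "energy \<gamma>1 \<gamma>2 u =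
     1/2 * (LINT x|lborel. (\<Sum>b\<in>Basis. (cmod (repr (weak_partial b u) x))\<^sup>2))
     + 1/4 * hartree_energy \<gamma>2 u - 1/4 * hartree_energy \<gamma>1 u"

end

theory Submission
  imports Defs
begin

text \<open>
  The Fourier transform turns \<open>H\<^sup>s\<close> into a weighted \<open>L\<^sup>2\<close> space with weight \<open>\<langle>\<xi>\<rangle>\<^sup>s\<close>, \<open>\<langle>\<xi>\<rangle> = sqrt (1 + |\<xi>|\<^sup>2)\<close>.
  In the interaction picture, where \<open>a t\<close> is \<open>\<langle>\<xi>\<rangle>\<^sup>s exp (-\<i> t |\<xi>|\<^sup>2)\<close> times the Fourier transform of
  \<open>\<psi> t\<close>, Duhamel's formula becomes an ordinary differential equation in \<open>L\<^sup>2\<close> with a locally Lipschitz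
  right-hand side of cubic growth.  Picard iteration solves it in the ball of radius \<open>2 \<parallel>\<psi>0\<parallel>\<close>, and a
  weighted supremum gives uniqueness.

  The trilinear estimate rests on the transform of \<open>|x| powr -\<gamma>\<close> being a multiple of
  \<open>|\<xi>| powr (\<gamma> - N)\<close>, which enters through Gaussian subordination.  On the Fourier side, a Schur test
  with quotients of brackets bounds the resulting quadrilinear form by the weights \<open>\<langle>\<xi>\<rangle> powr (\<gamma> / 2)\<close>,
  including the endpoint \<open>s = \<gamma> / 2\<close>; duality turns the bound on the form into a bound in \<open>H\<^sup>s\<close>.

  Mass is conserved because the potential is real.  The energy is delicate since \<open>\<psi>\<close> is differentiable
  in time only with values in \<open>H\<close> of order \<open>s - 2\<close>.  However, with \<open>V u\<close> the potential generated by
  \<open>u\<close>, the Hartree energies of \<open>v\<close> and \<open>u\<close> differ by exactly the inner product of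
  \<open>(V v + V u) (v + u)\<close> and \<open>v - u\<close>.  Pairing order \<open>1\<close> with order \<open>-1\<close> makes this difference
  quotient converge for \<open>s \<ge> 1\<close>.
\<close>

section \<open>Square-integrable functions\<close>

text \<open>Two obstacles shape the proof. The Riesz kernel lies in no Lebesgue space, so its
  transform would be a distribution; it is never formed. Gaussians are averaged instead, their
  explicit transform is inserted at each fixed time, and the remaining time integral is only bounded
  by a multiple of \<open>|\<xi>| powr (\<gamma> - N)\<close>. Absolute values are taken at that
  point, after which a derivative of fractional order \<open>s\<close> costs no more than the
  triangle inequality for \<langle>\<xi>\<rangle>. Secondly, every object is an element of
  \<open>Ltwo\<close>, so there are no spaces of negative order. Bounded multipliers replace them: a
  derivative that exists only in a weaker norm is taken after multiplication by a sufficiently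
  negative power of \<langle>\<xi>\<rangle>, and duality is tested with square-integrable functions
  that are merely measured in order \<open>-s\<close>. The condition \<open>1 \<le> s\<close> makes
  the multipliers in the energy argument bounded.\<close>

lemma square_integrableI_nn:
  assumes [measurable]: "f \<in> borel_measurable lborel"
    and "(\<integral>\<^sup>+x. ennreal ((cmod (f x))\<^sup>2) \<partial>lborel) < \<infinity>"
  shows "square_integrable f"
  unfolding square_integrable_def using assms by (auto intro!: integrableI_bounded)

lemma nn_integral_square_integrable:
  assumes "square_integrable f"
  shows "(\<integral>\<^sup>+x. ennreal ((cmod (f x))\<^sup>2) \<partial>lborel) = ennreal (LINT x|lborel. (cmod (f x))\<^sup>2)"
  using assms unfolding square_integrable_def by (intro nn_integral_eq_integral) auto

lemma to_Ltwo_eqI: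
  assumes "square_integrable f" "AE x in lborel. repr u x = f x"
  shows "to_Ltwo f = u"
  unfolding Ltwo_eq_iff using AE_repr_to_Ltwo[OF assms(1)] assms(2) by eventually_elim simp

lemma to_Ltwo_repr [simp]: "to_Ltwo (repr u) = u"
  by (rule to_Ltwo_eqI) auto

lemma square_integrable_cong_AE:
  assumes "square_integrable f" "AE x in lborel. f x = g x" "g \<in> borel_measurable borel"
  shows "square_integrable g"
proof -
  have [measurable]: "f \<in> borel_measurable borel" "g \<in> borel_measurable borel"
    using assms by (auto simp: square_integrable_def)
  have "integrable lborel (\<lambda>x. (cmod (g x))\<^sup>2)"
    using assms by (subst integrable_cong_AE[where g = "\<lambda>x. (cmod (f x))\<^sup>2"])
      (auto simp: square_integrable_def elim: eventually_mono)
  then show ?thesis by (simp add: square_integrable_def)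
qed

lemma to_Ltwo_cong_AE:
  assumes "square_integrable f" "square_integrable g" "AE x in lborel. f x = g x"
  shows "to_Ltwo f = to_Ltwo g"
  by (rule to_Ltwo_eqI[OF assms(1)])
     (use AE_repr_to_Ltwo[OF assms(2)] assms(3) in \<open>eventually_elim; simp\<close>)

lemma power2_norm_Ltwo: "(norm (u :: 'a::euclidean_space Ltwo))\<^sup>2 = (LINT x|lborel. (cmod (repr u x))\<^sup>2)"
  by (simp add: norm_Ltwo_def integral_nonneg_AE)

lemma nn_integral_repr:
  "(\<integral>\<^sup>+x. ennreal ((cmod (repr u x))\<^sup>2) \<partial>lborel) = ennreal ((norm (u :: 'a::euclidean_space Ltwo))\<^sup>2)"
  by (simp add: nn_integral_square_integrable power2_norm_Ltwo)

lemma nn_integral_to_Ltwo: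
  assumes "square_integrable f"
  shows "(\<integral>\<^sup>+x. ennreal ((cmod (f x))\<^sup>2) \<partial>lborel) = ennreal ((norm (to_Ltwo f))\<^sup>2)"
proof -
  have "(\<integral>\<^sup>+x. ennreal ((cmod (f x))\<^sup>2) \<partial>lborel) = (\<integral>\<^sup>+x. ennreal ((cmod (repr (to_Ltwo f) x))\<^sup>2) \<partial>lborel)"
    using AE_repr_to_Ltwo[OF assms] by (intro nn_integral_cong_AE) (auto elim: eventually_mono)
  then show ?thesis by (simp add: nn_integral_repr)
qed

lemma power2_norm_to_Ltwo:
  assumes "square_integrable f"
  shows "(norm (to_Ltwo f))\<^sup>2 = (LINT x|lborel. (cmod (f x))\<^sup>2)"
  using nn_integral_to_Ltwo[OF assms] nn_integral_square_integrable[OF assms]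
  by (simp add: integral_nonneg_AE)

lemma to_Ltwo_add:
  assumes "square_integrable f" "square_integrable g"
  shows "to_Ltwo (\<lambda>x. f x + g x) = to_Ltwo f + to_Ltwo g"
  by (rule to_Ltwo_eqI[OF square_integrable_add[OF assms]])
    (use AE_plus_Ltwo[of "to_Ltwo f" "to_Ltwo g"] AE_repr_to_Ltwo[OF assms(1)] AE_repr_to_Ltwo[OF assms(2)]
     in \<open>eventually_elim; simp\<close>)

lemma to_Ltwo_diff:
  assumes "square_integrable f" "square_integrable g"
  shows "to_Ltwo (\<lambda>x. f x - g x) = to_Ltwo f - to_Ltwo g"
  by (rule to_Ltwo_eqI[OF square_integrable_diff[OF assms]])
    (use AE_minus_Ltwo[of "to_Ltwo f" "to_Ltwo g"] AE_repr_to_Ltwo[OF assms(1)] AE_repr_to_Ltwo[OF assms(2)]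
     in \<open>eventually_elim; simp\<close>)

lemma AE_scaleC: "AE x in lborel. repr (scaleC c u) x = c * repr u x"
  unfolding scaleC_def by (rule AE_repr_to_Ltwo) (simp add: square_integrable_mult)

lemma to_Ltwo_mult:
  assumes "square_integrable f"
  shows "to_Ltwo (\<lambda>x. c * f x) = scaleC c (to_Ltwo f)"
  by (rule to_Ltwo_eqI[OF square_integrable_mult[OF assms]])
    (use AE_scaleC[of c "to_Ltwo f"] AE_repr_to_Ltwo[OF assms(1)] in \<open>eventually_elim; simp\<close>)

lemma square_integrable_bound:
  assumes "square_integrable f" "g \<in> borel_measurable borel" "AE x in lborel. cmod (g x) \<le> B * cmod (f x)"
  shows "square_integrable g"
proof -
  have [measurable]: "f \<in> borel_measurable borel" "g \<in> borel_measurable borel"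
    using assms by (auto simp: square_integrable_def)
  have "integrable lborel (\<lambda>x. (cmod (g x))\<^sup>2)"
  proof (rule Bochner_Integration.integrable_bound)
    show "integrable lborel (\<lambda>x. B\<^sup>2 * (cmod (f x))\<^sup>2)"
      using assms by (auto simp: square_integrable_def)
    show "AE x in lborel. norm ((cmod (g x))\<^sup>2) \<le> norm (B\<^sup>2 * (cmod (f x))\<^sup>2)"
      using assms(3)
    proof eventually_elim
      case (elim x)
      then have "(cmod (g x))\<^sup>2 \<le> (B * cmod (f x))\<^sup>2" by (intro power_mono) auto
      then show ?case by (simp add: power_mult_distrib)
    qed
  qed auto
  then show ?thesis by (simp add: square_integrable_def)
qed

lemma norm_to_Ltwo_le:
  assumes "square_integrable f" "square_integrable g" "AE x in lborel. cmod (g x) \<le> B * cmod (f x)" "0 \<le> B"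
  shows "norm (to_Ltwo g) \<le> B * norm (to_Ltwo f)"
proof (rule power2_le_imp_le)
  have "(LINT x|lborel. (cmod (g x))\<^sup>2) \<le> (LINT x|lborel. B\<^sup>2 * (cmod (f x))\<^sup>2)"
  proof (rule integral_mono_AE)
    show "AE x in lborel. (cmod (g x))\<^sup>2 \<le> B\<^sup>2 * (cmod (f x))\<^sup>2" using assms(3)
    proof eventually_elim
      case (elim x)
      then have "(cmod (g x))\<^sup>2 \<le> (B * cmod (f x))\<^sup>2" by (intro power_mono) auto
      then show ?case by (simp add: power_mult_distrib)
    qed
  qed (use assms in \<open>auto simp: square_integrable_def\<close>)
  then show "(norm (to_Ltwo g))\<^sup>2 \<le> (B * norm (to_Ltwo f))\<^sup>2"
    using assms by (simp add: power_mult_distrib power2_norm_to_Ltwo)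
qed (use assms in auto)

lemma norm_scaleC: "norm (scaleC c u) = cmod c * norm u"
proof -
  have "(norm (scaleC c u))\<^sup>2 = (cmod c * norm u)\<^sup>2"
    unfolding scaleC_def
    by (subst power2_norm_to_Ltwo)
      (auto simp: square_integrable_mult norm_mult power_mult_distrib power2_norm_Ltwo)
  then show ?thesis by (simp add: power2_eq_iff_nonneg)
qed

lemma scaleC_add_right: "scaleC c (u + v) = scaleC c u + scaleC c v"
  unfolding Ltwo_eq_iff
  using AE_scaleC[of c "u + v"] AE_plus_Ltwo[of u v] AE_plus_Ltwo[of "scaleC c u" "scaleC c v"]
    AE_scaleC[of c u] AE_scaleC[of c v]
  by eventually_elim (simp add: algebra_simps)

lemma scaleC_scaleR: "scaleC c (r *\<^sub>R u) = r *\<^sub>R scaleC c u"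
  unfolding Ltwo_eq_iff
  using AE_scaleC[of c "r *\<^sub>R u"] AE_scaleR_Ltwo[of r u] AE_scaleR_Ltwo[of r "scaleC c u"] AE_scaleC[of c u]
  by eventually_elim simp

lemma bounded_linear_scaleC: "bounded_linear (scaleC c)"
  by (rule bounded_linear_intro[where K = "cmod c"])
     (auto simp: scaleC_add_right scaleC_scaleR norm_scaleC mult.commute)

lemma scaleC_scaleC [simp]: "scaleC c (scaleC d u) = scaleC (c * d) u"
  unfolding Ltwo_eq_iff
  using AE_scaleC[of c "scaleC d u"] AE_scaleC[of d u] AE_scaleC[of "c * d" u]
  by eventually_elim simp

lemma scaleC_one [simp]: "scaleC 1 u = u"
  by (simp add: scaleC_def)

lemma scaleC_of_real: "scaleC (of_real r) u = r *\<^sub>R u"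
  by (simp add: scaleC_def scaleR_Ltwo_def scaleR_conv_of_real)

lemma inner_Ltwo_to_Ltwo:
  assumes "square_integrable f" "square_integrable g"
  shows "to_Ltwo f \<bullet> to_Ltwo g = (LINT x|lborel. f x \<bullet> g x)"
proof -
  have [measurable]: "f \<in> borel_measurable borel" "g \<in> borel_measurable borel"
    using assms by (auto simp: square_integrable_def)
  show ?thesis unfolding inner_Ltwo_def
    by (rule integral_cong_AE, measurable)
      (use AE_repr_to_Ltwo[OF assms(1)] AE_repr_to_Ltwo[OF assms(2)] in \<open>eventually_elim; simp\<close>)
qed

lemma inner_scaleC_ii [simp]: "scaleC \<i> u \<bullet> u = 0"
proof -
  have "scaleC \<i> u \<bullet> to_Ltwo (repr u) = (LINT x|lborel. (\<i> * repr u x) \<bullet> repr u x)"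
    unfolding scaleC_def by (subst inner_Ltwo_to_Ltwo) (auto simp: square_integrable_mult)
  also have "\<dots> = 0" by (simp add: inner_complex_def)
  finally show ?thesis by simp
qed

lemma inner_scaleC_scaleC: "scaleC c u \<bullet> scaleC c v = (cmod c)\<^sup>2 * (u \<bullet> v)"
proof -
  have *: "(c * a) \<bullet> (c * b) = (cmod c)\<^sup>2 * (a \<bullet> b)" for a b
    unfolding cmod_power2 by (simp add: inner_complex_def algebra_simps power2_eq_square)
  show ?thesis unfolding scaleC_def
    by (subst inner_Ltwo_to_Ltwo) (auto simp: square_integrable_mult * inner_Ltwo_def)
qed

section \<open>Completeness of \<open>Ltwo\<close>\<close>

lemma ennreal_le_suminf: "f k \<le> (\<Sum>k. f k :: ennreal)"
  using sum_le_suminf[OF summableI, of "{k}" f] by simp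

text \<open>The subsequence converges almost everywhere because \<open>\<Sum>k. 2^k |d k|\<^sup>2\<close> has finite integral
  for its increments \<open>d k\<close>; Fatou's lemma then gives convergence in norm.\<close>

lemma Ltwo_Cauchy_convergent:
  fixes X :: "nat \<Rightarrow> 'a::euclidean_space Ltwo"
  assumes "Cauchy X" shows "convergent X"
proof -
  have "\<exists>M. \<forall>m\<ge>M. \<forall>n\<ge>M. norm (X m - X n) < (1/2)^k" for k :: nat
    using assms unfolding Cauchy_iff by (meson half_gt_zero_iff zero_less_one zero_less_power)
  then obtain M where M: "norm (X m - X n) < (1/2)^k" if "m \<ge> M k" "n \<ge> M k" for k m n by metis
  \<comment> \<open>The sum makes \<open>r k\<close> at least \<open>M k\<close> and non-decreasing
    without a recursive choice; the extra \<open>k\<close> sends it to infinity.\<close>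
  define r where "r k = (\<Sum>j\<le>k. M j) + k" for k
  have r_ge: "M k \<le> r k" for k unfolding r_def by (simp add: member_le_sum trans_le_add1)
  have r_mono: "r k \<le> r (Suc k)" and r_idx: "k \<le> r k" for k by (auto simp: r_def)
  define d where "d k x = repr (X (r (Suc k))) x - repr (X (r k)) x" for k x
  have [measurable]: "d k \<in> borel_measurable borel" for k unfolding d_def by measurable
  have nd: "(\<integral>\<^sup>+x. ennreal ((cmod (d k x))\<^sup>2) \<partial>lborel) \<le> ennreal ((1/4)^k)" for k
  proof -
    have "norm (X (r (Suc k)) - X (r k)) < (1/2)^k"
      by (rule M) (use r_ge r_mono in \<open>auto intro: order_trans\<close>)
    then have "(norm (X (r (Suc k)) - X (r k)))\<^sup>2 \<le> ((1/2)^k)\<^sup>2" by (intro power_mono) auto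
    also have "((1/2)^k)\<^sup>2 = (1/4::real)^k" by (simp add: power2_eq_square flip: power_mult_distrib)
    finally have "ennreal ((norm (X (r (Suc k)) - X (r k)))\<^sup>2) \<le> ennreal ((1/4)^k)" by (rule ennreal_leI)
    moreover have "(\<integral>\<^sup>+x. ennreal ((cmod (d k x))\<^sup>2) \<partial>lborel) = ennreal ((norm (X (r (Suc k)) - X (r k)))\<^sup>2)"
      unfolding d_def minus_Ltwo_def by (rule nn_integral_to_Ltwo) (simp add: square_integrable_diff)
    ultimately show ?thesis by simp
  qed
  have "(\<integral>\<^sup>+x. (\<Sum>k. ennreal (2^k * (cmod (d k x))\<^sup>2)) \<partial>lborel)
      = (\<Sum>k. \<integral>\<^sup>+x. ennreal (2^k * (cmod (d k x))\<^sup>2) \<partial>lborel)"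
    by (rule nn_integral_suminf) auto
  also have "\<dots> = (\<Sum>k. ennreal (2^k) * (\<integral>\<^sup>+x. ennreal ((cmod (d k x))\<^sup>2) \<partial>lborel))"
    by (simp add: ennreal_mult' nn_integral_cmult)
  also have "\<dots> \<le> (\<Sum>k. ennreal (2^k) * ennreal ((1/4)^k))"
    by (intro suminf_le mult_left_mono nd) auto
  also have "\<dots> = (\<Sum>k. ennreal ((1/2)^k))"
    by (simp add: ennreal_mult'[symmetric] flip: power_mult_distrib)
  also have "\<dots> < \<infinity>" by (subst suminf_ennreal2) (auto simp: summable_geometric)
  finally have fin: "(\<integral>\<^sup>+x. (\<Sum>k. ennreal (2^k * (cmod (d k x))\<^sup>2)) \<partial>lborel) < \<infinity>" .
  have "AE x in lborel. (\<Sum>k. ennreal (2^k * (cmod (d k x))\<^sup>2)) \<noteq> \<infinity>"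
    using fin by (intro nn_integral_PInf_AE) auto
  then have conv: "AE x in lborel. convergent (\<lambda>k. repr (X (r k)) x)"
  proof eventually_elim
    case (elim x)
    define S where "S = enn2real (\<Sum>k. ennreal (2^k * (cmod (d k x))\<^sup>2))"
    have S: "ennreal S = (\<Sum>k. ennreal (2^k * (cmod (d k x))\<^sup>2))"
      using elim by (simp add: S_def less_top)
    have b: "2^k * (cmod (d k x))\<^sup>2 \<le> S" for k
    proof -
      have "ennreal (2^k * (cmod (d k x))\<^sup>2) \<le> (\<Sum>k. ennreal (2^k * (cmod (d k x))\<^sup>2))"
        by (rule ennreal_le_suminf)
      then have "ennreal (2^k * (cmod (d k x))\<^sup>2) \<le> ennreal S" by (simp only: S)
      moreover have "0 \<le> S" unfolding S_def by (rule enn2real_nonneg)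
      ultimately show ?thesis by (simp only: ennreal_le_iff)
    qed
    \<comment> \<open>The factor \<open>2^k\<close> in the series turns the bound on a single term
      into geometric decay, hence into absolute summability of the increments at
      \<open>x\<close>.\<close>
    have "cmod (d k x) \<le> sqrt S * (sqrt (1/2))^k" for k
    proof -
      have "(cmod (d k x))\<^sup>2 \<le> S * (1/2)^k" using b[of k] by (simp add: power_one_over field_simps)
      then have "cmod (d k x) \<le> sqrt (S * (1/2)^k)" by (rule real_le_rsqrt)
      then show ?thesis by (simp only: real_sqrt_mult real_sqrt_power)
    qed
    then have le: "norm (d k x) \<le> sqrt S * (sqrt (1/2))^k" for k .
    have "norm (sqrt (1/2)) < 1" by (simp add: real_sqrt_divide)
    then have "summable (\<lambda>k. sqrt S * (sqrt (1/2))^k)"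
      by (intro summable_mult summable_geometric)
    from summable_comparison_test'[OF this le] have "summable (\<lambda>k. d k x)" .
    then have "convergent (\<lambda>n. \<Sum>k<n. d k x)" by (simp add: summable_iff_convergent)
    moreover have "(\<Sum>k<n. d k x) = repr (X (r n)) x - repr (X (r 0)) x" for n
      unfolding d_def by (rule sum_lessThan_telescope)
    ultimately have "convergent (\<lambda>n. (repr (X (r n)) x - repr (X (r 0)) x) + repr (X (r 0)) x)"
      by (intro convergent_add convergent_const) auto
    then show ?case by simp
  qed
  define f where "f x = lim (\<lambda>k. repr (X (r k)) x)" for x
  have [measurable]: "f \<in> borel_measurable borel" unfolding f_def by measurable
  have lim: "AE x in lborel. (\<lambda>k. repr (X (r k)) x) \<longlonglongrightarrow> f x"
    using conv by eventually_elim (simp add: f_def convergent_LIMSEQ_iff)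
  have key: "(\<integral>\<^sup>+x. ennreal ((cmod (f x - repr (X n) x))\<^sup>2) \<partial>lborel) \<le> ennreal (((1/2)^k)\<^sup>2)"
    if n: "n \<ge> M k" for n k
  proof -
    have "(\<integral>\<^sup>+x. ennreal ((cmod (f x - repr (X n) x))\<^sup>2) \<partial>lborel)
        = (\<integral>\<^sup>+x. liminf (\<lambda>j. ennreal ((cmod (repr (X (r j)) x - repr (X n) x))\<^sup>2)) \<partial>lborel)"
    proof (rule nn_integral_cong_AE, use lim in eventually_elim)
      case (elim x)
      have "(\<lambda>j. ennreal ((cmod (repr (X (r j)) x - repr (X n) x))\<^sup>2)) \<longlonglongrightarrow> ennreal ((cmod (f x - repr (X n) x))\<^sup>2)"
        by (intro tendsto_intros elim)
      then show ?case by (rule lim_imp_Liminf[OF trivial_limit_sequentially, symmetric])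
    qed
    also have "\<dots> \<le> liminf (\<lambda>j. \<integral>\<^sup>+x. ennreal ((cmod (repr (X (r j)) x - repr (X n) x))\<^sup>2) \<partial>lborel)"
      by (rule nn_integral_liminf) auto
    also have "\<dots> \<le> liminf (\<lambda>j. ennreal (((1/2)^k)\<^sup>2))"
    proof (rule Liminf_mono, rule eventually_sequentiallyI[of "M k"])
      fix j assume "M k \<le> j"
      then have "norm (X (r j) - X n) < (1/2)^k" using r_idx[of j] n by (intro M) auto
      then have "(norm (X (r j) - X n))\<^sup>2 \<le> ((1/2)^k)\<^sup>2" by (intro power_mono) auto
      moreover have "(\<integral>\<^sup>+x. ennreal ((cmod (repr (X (r j)) x - repr (X n) x))\<^sup>2) \<partial>lborel) = ennreal ((norm (X (r j) - X n))\<^sup>2)"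
        unfolding minus_Ltwo_def by (rule nn_integral_to_Ltwo) (simp add: square_integrable_diff)
      ultimately show "(\<integral>\<^sup>+x. ennreal ((cmod (repr (X (r j)) x - repr (X n) x))\<^sup>2) \<partial>lborel) \<le> ennreal (((1/2)^k)\<^sup>2)"
        by (simp add: ennreal_leI)
    qed
    finally show ?thesis by (simp add: Liminf_const)
  qed
  have sq: "square_integrable (\<lambda>x. f x - repr (X (M 0)) x)"
    using order_le_less_trans[OF key[of 0 "M 0", OF order_refl] ennreal_less_top]
    by (intro square_integrableI_nn) auto
  have sf: "square_integrable f"
    using square_integrable_add[OF sq square_integrable_repr[of "X (M 0)"]] by simp
  have "X \<longlonglongrightarrow> to_Ltwo f"
  proof (rule LIMSEQ_I)
    fix e :: real assume "e > 0"
    then obtain k where k: "(1/2)^k < e" using real_arch_pow_inv[of e "1/2"] by auto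
    have "norm (X n - to_Ltwo f) < e" if "n \<ge> M k" for n
    proof -
      have "ennreal ((norm (to_Ltwo f - X n))\<^sup>2) \<le> ennreal (((1/2)^k)\<^sup>2)"
        using key[OF that] nn_integral_to_Ltwo[OF square_integrable_diff[OF sf square_integrable_repr[of "X n"]]]
        by (simp add: to_Ltwo_diff sf)
      then have "(norm (to_Ltwo f - X n))\<^sup>2 \<le> ((1/2)^k)\<^sup>2" by (subst (asm) ennreal_le_iff) auto
      then have "norm (to_Ltwo f - X n) \<le> (1/2)^k" by (rule power2_le_imp_le) auto
      with k show ?thesis by (simp add: norm_minus_commute)
    qed
    then show "\<exists>no. \<forall>n\<ge>no. norm (X n - to_Ltwo f) < e" by blast
  qed
  then show ?thesis by (rule convergentI)
qed

instance Ltwo :: (euclidean_space) banach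
  by intro_classes (rule Ltwo_Cauchy_convergent)


section \<open>Convergence in \<open>Ltwo\<close> by domination\<close>

lemma Ltwo_LIMSEQ_iff_integral:
  assumes "\<And>n. square_integrable (f n)" "square_integrable g"
  shows "(\<lambda>n. to_Ltwo (f n)) \<longlonglongrightarrow> to_Ltwo g \<longleftrightarrow> (\<lambda>n. LINT x|lborel. (cmod (f n x - g x))\<^sup>2) \<longlonglongrightarrow> 0"
proof -
  have eq: "(LINT x|lborel. (cmod (f n x - g x))\<^sup>2) = (norm (to_Ltwo (f n) - to_Ltwo g))\<^sup>2" for n
    using power2_norm_to_Ltwo[OF square_integrable_diff[OF assms(1)[of n] assms(2)]]
    by (simp add: to_Ltwo_diff assms)
  have "(\<lambda>n. norm (to_Ltwo (f n) - to_Ltwo g)) \<longlonglongrightarrow> 0 \<longleftrightarrow> (\<lambda>n. (norm (to_Ltwo (f n) - to_Ltwo g))\<^sup>2) \<longlonglongrightarrow> 0"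
  proof
    assume "(\<lambda>n. (norm (to_Ltwo (f n) - to_Ltwo g))\<^sup>2) \<longlonglongrightarrow> 0"
    then have "(\<lambda>n. sqrt ((norm (to_Ltwo (f n) - to_Ltwo g))\<^sup>2)) \<longlonglongrightarrow> sqrt 0" by (rule tendsto_real_sqrt)
    then show "(\<lambda>n. norm (to_Ltwo (f n) - to_Ltwo g)) \<longlonglongrightarrow> 0" by simp
  qed (auto intro: tendsto_eq_intros)
  then show ?thesis unfolding eq by (metis LIM_zero_iff tendsto_norm_zero_iff)
qed

text \<open>The scalar theorem applied to squared differences, which are dominated by
  \<open>(2 * B * |h|)^2\<close>. Limits of multipliers and difference quotients on the Fourier side
  are reduced to this.\<close>

lemma to_Ltwo_dominated_convergence:
  fixes h :: "'a::euclidean_space \<Rightarrow> complex"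
  assumes "\<And>n. f n \<in> borel_measurable borel" "g \<in> borel_measurable borel" "square_integrable h"
    and bd: "\<And>n. AE x in lborel. cmod (f n x) \<le> B * cmod (h x)"
    and lim: "AE x in lborel. (\<lambda>n. f n x) \<longlonglongrightarrow> g x"
  shows "(\<lambda>n. to_Ltwo (f n)) \<longlonglongrightarrow> to_Ltwo g" "square_integrable g" "\<And>n. square_integrable (f n)"
proof -
  have [measurable]: "f n \<in> borel_measurable borel" "g \<in> borel_measurable borel" "h \<in> borel_measurable borel" for n
    using assms by (auto simp: square_integrable_def)
  show sf: "square_integrable (f n)" for n
    using assms(1) bd by (intro square_integrable_bound[OF assms(3)])
  have bd': "AE x in lborel. \<forall>n. cmod (f n x) \<le> B * cmod (h x)" using bd by (simp add: AE_all_countable)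
  have bg: "AE x in lborel. cmod (g x) \<le> B * cmod (h x)"
    using lim bd'
  proof eventually_elim
    case (elim x)
    have "(\<lambda>n. cmod (f n x)) \<longlonglongrightarrow> cmod (g x)" using elim(1) by (rule tendsto_norm)
    then show ?case by (rule LIMSEQ_le_const2) (use elim in auto)
  qed
  then show sg: "square_integrable g"
    using assms(2) by (intro square_integrable_bound[OF assms(3)])
  have "(\<lambda>n. LINT x|lborel. (cmod (f n x - g x))\<^sup>2) \<longlonglongrightarrow> (LINT x|(lborel::'a measure). (0::real))"
  proof (rule integral_dominated_convergence[where w = "\<lambda>x. (2 * B)\<^sup>2 * (cmod (h x))\<^sup>2"])
    show "integrable lborel (\<lambda>x. (2 * B)\<^sup>2 * (cmod (h x))\<^sup>2)" using assms by (simp add: square_integrable_def)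
    show "AE x in lborel. (\<lambda>n. (cmod (f n x - g x))\<^sup>2) \<longlonglongrightarrow> 0"
      using lim
    proof eventually_elim
      case (elim x)
      have "(\<lambda>n. (cmod (f n x - g x))\<^sup>2) \<longlonglongrightarrow> (cmod (g x - g x))\<^sup>2" by (intro tendsto_intros elim)
      then show ?case by simp
    qed
    show "AE x in lborel. norm ((cmod (f n x - g x))\<^sup>2) \<le> (2 * B)\<^sup>2 * (cmod (h x))\<^sup>2" for n
      using bg bd[of n]
    proof eventually_elim
      case (elim x)
      have "cmod (f n x - g x) \<le> 2 * B * cmod (h x)" using norm_triangle_ineq4[of "f n x" "g x"] elim by linarith
      then have "(cmod (f n x - g x))\<^sup>2 \<le> (2 * B * cmod (h x))\<^sup>2" by (intro power_mono) auto
      then show ?case by (simp add: power_mult_distrib)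
    qed
  qed auto
  then show "(\<lambda>n. to_Ltwo (f n)) \<longlonglongrightarrow> to_Ltwo g"
    by (subst Ltwo_LIMSEQ_iff_integral[OF sf sg]) simp
qed

section \<open>Bounded multiplication operators\<close>

definition bounded_multiplier :: "('a::euclidean_space \<Rightarrow> complex) \<Rightarrow> bool" where
  "bounded_multiplier m \<longleftrightarrow> m \<in> borel_measurable borel \<and> (\<exists>B. \<forall>x. cmod (m x) \<le> B)"

text \<open>Total because of the fallback value in \<open>to_Ltwo\<close>; it acts as the
  multiplication operator whenever \<open>bounded_multiplier m\<close> holds, and the algebraic laws
  below carry that assumption.\<close>

definition fmul :: "('a::euclidean_space \<Rightarrow> complex) \<Rightarrow> 'a Ltwo \<Rightarrow> 'a Ltwo" where
  "fmul m u = to_Ltwo (\<lambda>x. m x * repr u x)"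

lemma bounded_multiplierI:
  "m \<in> borel_measurable borel \<Longrightarrow> (\<And>x. cmod (m x) \<le> B) \<Longrightarrow> bounded_multiplier m"
  by (auto simp: bounded_multiplier_def)

lemma bounded_multiplier_mult:
  assumes "bounded_multiplier m" "bounded_multiplier k"
  shows "bounded_multiplier (\<lambda>x. m x * k x)"
proof -
  obtain A B where A: "\<And>x. cmod (m x) \<le> A" and B: "\<And>x. cmod (k x) \<le> B"
    using assms by (auto simp: bounded_multiplier_def)
  have "cmod (m x * k x) \<le> A * B" for x
    using A B by (auto simp: norm_mult intro!: mult_mono order_trans[OF _ A])
  then show ?thesis using assms by (intro bounded_multiplierI[where B = "A * B"]) (auto simp: bounded_multiplier_def)
qed

lemma square_integrable_multiplier:
  assumes "bounded_multiplier m" "square_integrable f"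
  shows "square_integrable (\<lambda>x. m x * f x)"
proof -
  obtain B where B: "\<And>x. cmod (m x) \<le> B" using assms by (auto simp: bounded_multiplier_def)
  have [measurable]: "m \<in> borel_measurable borel" "f \<in> borel_measurable borel"
    using assms by (auto simp: bounded_multiplier_def square_integrable_def)
  show ?thesis
    by (rule square_integrable_bound[OF assms(2), where B = B]) (auto simp: norm_mult intro!: mult_right_mono B)
qed

lemma AE_fmul: "bounded_multiplier m \<Longrightarrow> AE x in lborel. repr (fmul m u) x = m x * repr u x"
  unfolding fmul_def by (intro AE_repr_to_Ltwo square_integrable_multiplier) auto

lemma fmul_to_Ltwo:
  assumes "bounded_multiplier m" "square_integrable f"
  shows "fmul m (to_Ltwo f) = to_Ltwo (\<lambda>x. m x * f x)"
  unfolding fmul_def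
  by (rule to_Ltwo_cong_AE)
    (use AE_repr_to_Ltwo[OF assms(2)] in \<open>auto intro: square_integrable_multiplier assms elim: eventually_mono\<close>)

lemma norm_fmul_le:
  assumes "m \<in> borel_measurable borel" "\<And>x. cmod (m x) \<le> B"
  shows "norm (fmul m u) \<le> B * norm u"
proof -
  have "bounded_multiplier m" using assms by (auto simp: bounded_multiplier_def)
  moreover have "0 \<le> B" using order_trans[OF norm_ge_zero assms(2)] .
  ultimately have "norm (fmul m u) \<le> B * norm (to_Ltwo (repr u))"
    unfolding fmul_def
    by (intro norm_to_Ltwo_le square_integrable_multiplier) (auto simp: norm_mult intro!: mult_right_mono assms)
  then show ?thesis by simp
qed

lemma norm_fmul_eq:
  assumes "m \<in> borel_measurable borel" "\<And>x. cmod (m x) = 1"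
  shows "norm (fmul m u) = norm u"
proof -
  have "bounded_multiplier m" using assms by (intro bounded_multiplierI[where B = 1]) auto
  then have "(norm (fmul m u))\<^sup>2 = (norm u)\<^sup>2"
    unfolding fmul_def
    by (subst power2_norm_to_Ltwo)
      (auto simp: square_integrable_multiplier norm_mult assms power2_norm_Ltwo)
  then show ?thesis by (simp add: power2_eq_iff_nonneg)
qed

lemma fmul_fmul:
  assumes "bounded_multiplier m" "bounded_multiplier k"
  shows "fmul m (fmul k u) = fmul (\<lambda>x. m x * k x) u"
  unfolding Ltwo_eq_iff
  using AE_fmul[OF assms(1), of "fmul k u"] AE_fmul[OF assms(2), of u] AE_fmul[OF bounded_multiplier_mult[OF assms], of u]
  by eventually_elim simp

lemma fmul_one [simp]: "fmul (\<lambda>x. 1) u = u"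
  by (simp add: fmul_def)

lemma fmul_add:
  assumes "bounded_multiplier m" shows "fmul m (u + v) = fmul m u + fmul m v"
  unfolding Ltwo_eq_iff
  using AE_fmul[OF assms, of "u + v"] AE_fmul[OF assms, of u] AE_fmul[OF assms, of v] AE_plus_Ltwo[of u v]
    AE_plus_Ltwo[of "fmul m u" "fmul m v"]
  by eventually_elim (simp add: algebra_simps)

lemma fmul_scaleC:
  assumes "bounded_multiplier m" shows "fmul m (scaleC c u) = scaleC c (fmul m u)"
  unfolding Ltwo_eq_iff
  using AE_fmul[OF assms, of "scaleC c u"] AE_fmul[OF assms, of u] AE_scaleC[of c u]
    AE_scaleC[of c "fmul m u"]
  by eventually_elim (simp add: algebra_simps)

lemma bounded_linear_fmul:
  assumes "bounded_multiplier m" shows "bounded_linear (fmul m)"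
proof -
  obtain B where B: "\<And>x. cmod (m x) \<le> B" using assms by (auto simp: bounded_multiplier_def)
  show ?thesis
  proof (rule bounded_linear_intro[where K = B])
    show "norm (fmul m u) \<le> norm u * B" for u
      using norm_fmul_le[of m B u] assms B by (auto simp: bounded_multiplier_def mult.commute)
    show "fmul m (r *\<^sub>R u) = r *\<^sub>R fmul m u" for r u
      using fmul_scaleC[OF assms, of "of_real r" u] by (simp add: scaleC_of_real)
  qed (rule fmul_add[OF assms])
qed

text \<open>Dominated convergence with \<open>B * |u|\<close> as majorant. Pointwise convergence of
  uniformly bounded symbols gives strong convergence only, not convergence in operator norm, so
  \<open>u\<close> is fixed.\<close>

lemma fmul_tendsto:
  assumes "\<And>n. m n \<in> borel_measurable borel" "k \<in> borel_measurable borel"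
    and "\<And>n x. cmod (m n x) \<le> B" "\<And>x. (\<lambda>n. m n x) \<longlonglongrightarrow> k x"
  shows "(\<lambda>n. fmul (m n) u) \<longlonglongrightarrow> fmul k u"
proof -
  have [measurable]: "\<And>n. m n \<in> borel_measurable borel" "k \<in> borel_measurable borel" by fact+
  show ?thesis unfolding fmul_def
    by (rule to_Ltwo_dominated_convergence(1)[OF _ _ square_integrable_repr[of u], where B = B])
      (auto simp: norm_mult intro!: mult_right_mono tendsto_mult assms)
qed

section \<open>Affine substitutions, translation and reflection\<close>

lemma nn_integral_affine:
  fixes f :: "'a::euclidean_space \<Rightarrow> ennreal" and c :: real
  assumes [measurable]: "f \<in> borel_measurable borel" and "c \<noteq> 0"
  shows "(\<integral>\<^sup>+x. f x \<partial>lborel) = ennreal (\<bar>c\<bar> ^ DIM('a)) * (\<integral>\<^sup>+x. f (t + c *\<^sub>R x) \<partial>lborel)"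
  by (subst lborel_affine[OF assms(2), of t])
     (simp add: nn_integral_density nn_integral_distr nn_integral_cmult)

text \<open>A Borel null set containing the exceptional set is pulled back by the affine map; the
  substitution rule for its indicator shows that the preimage is null again.\<close>

lemma AE_affine:
  fixes c :: real and t :: "'a::euclidean_space"
  assumes "AE x in lborel. P x" and "c \<noteq> 0"
  shows "AE x in lborel. P (t + c *\<^sub>R x)"
proof -
  obtain N where N: "{x. \<not> P x} \<subseteq> N" "N \<in> sets borel" "emeasure lborel N = 0"
    using assms(1) by (auto elim!: AE_E)
  have "0 = (\<integral>\<^sup>+x. indicator N x \<partial>lborel)" using N by simp
  also have "\<dots> = ennreal (\<bar>c\<bar> ^ DIM('a)) * (\<integral>\<^sup>+x. indicator N (t + c *\<^sub>R x) \<partial>lborel)"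
    using N assms(2) by (intro nn_integral_affine) auto
  finally have "(\<integral>\<^sup>+x. indicator N (t + c *\<^sub>R x) \<partial>lborel) = 0" using assms(2) by auto
  then have "AE x in lborel. indicator N (t + c *\<^sub>R x) = (0::ennreal)"
    using N by (subst (asm) nn_integral_0_iff_AE) auto
  then show ?thesis by (rule eventually_mono) (use N(1) in \<open>auto simp: indicator_def split: if_splits\<close>)
qed

lemma integrable_affine_iff:
  fixes f :: "'a::euclidean_space \<Rightarrow> 'b::{banach, second_countable_topology}"
  assumes "c \<noteq> 0"
  shows "integrable lborel (\<lambda>x. f (t + c *\<^sub>R x)) \<longleftrightarrow> integrable lborel f"
proof -
  have *: "integrable lborel (\<lambda>x. g (t + c *\<^sub>R x))" if g: "integrable lborel g" and "c \<noteq> 0"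
    for c t and g :: "'a \<Rightarrow> 'b"
  proof (rule integrableI_bounded)
    have [measurable]: "g \<in> borel_measurable borel" using g by auto
    show "(\<lambda>x. g (t + c *\<^sub>R x)) \<in> borel_measurable lborel" by measurable
    have "(\<integral>\<^sup>+x. norm (g x) \<partial>lborel) < \<infinity>" using g by (simp add: integrable_iff_bounded)
    also have "(\<integral>\<^sup>+x. norm (g x) \<partial>lborel) = ennreal (\<bar>c\<bar> ^ DIM('a)) * (\<integral>\<^sup>+x. norm (g (t + c *\<^sub>R x)) \<partial>lborel)"
      using that by (intro nn_integral_affine) auto
    finally show "(\<integral>\<^sup>+x. norm (g (t + c *\<^sub>R x)) \<partial>lborel) < \<infinity>"
      using \<open>c \<noteq> 0\<close> by (auto simp: ennreal_mult_less_top)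
  qed
  \<comment> \<open>Applying \<open>*\<close> once more with the inverse affine map yields the
    converse implication.\<close>
  have eq: "t + c *\<^sub>R (- (1/c) *\<^sub>R t + (1/c) *\<^sub>R x) = x" for x using assms by (simp add: algebra_simps)
  show ?thesis
  proof
    assume "integrable lborel (\<lambda>x. f (t + c *\<^sub>R x))"
    from *[OF this, of "1/c" "- (1/c) *\<^sub>R t"] assms show "integrable lborel f" unfolding eq by simp
  qed (use * assms in auto)
qed

lemma integral_affine:
  fixes f :: "'a::euclidean_space \<Rightarrow> 'b::{banach, second_countable_topology}"
  assumes "c \<noteq> 0"
  shows "(LINT x|lborel. f x) = \<bar>c\<bar> ^ DIM('a) *\<^sub>R (LINT x|lborel. f (t + c *\<^sub>R x))"
proof (cases "integrable lborel f")
  case True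
  then have [measurable]: "f \<in> borel_measurable borel" by auto
  show ?thesis
    by (subst lborel_affine[OF assms, of t]) (simp add: integral_density integral_distr)
next
  case False
  then show ?thesis by (simp add: integrable_affine_iff[OF assms] not_integrable_integral_eq)
qed

lemmas integral_translate = integral_affine[where c = 1, simplified]
lemmas integral_reflect = integral_affine[where c = "-1" and t = 0, simplified]
lemmas nn_integral_translate = nn_integral_affine[where c = 1, simplified]
lemmas nn_integral_reflect = nn_integral_affine[where c = "-1", simplified]

text \<open>The argument is moved by \<open>+ h\<close>; this fixes the sign of the phases in
  \<open>fourier_transl\<close> and \<open>fourier_modulate\<close>.\<close>

definition transl :: "'a \<Rightarrow> 'a::euclidean_space Ltwo \<Rightarrow> 'a Ltwo" where
  "transl h u = to_Ltwo (\<lambda>x. repr u (h + x))"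

definition reflect :: "'a::euclidean_space Ltwo \<Rightarrow> 'a Ltwo" where
  "reflect u = to_Ltwo (\<lambda>x. repr u (- x))"

lemma square_integrable_affine:
  assumes "square_integrable f" "c \<noteq> 0"
  shows "square_integrable (\<lambda>x. f (t + c *\<^sub>R x))"
proof -
  have [measurable]: "f \<in> borel_measurable borel" using assms by (simp add: square_integrable_def)
  show ?thesis using assms integrable_affine_iff[of c "\<lambda>x. (cmod (f x))\<^sup>2" t] by (auto simp: square_integrable_def)
qed

lemmas square_integrable_translate = square_integrable_affine[where c = 1, simplified]
lemmas square_integrable_reflect = square_integrable_affine[where c = "-1" and t = 0, simplified]

lemma transl_to_Ltwo:
  assumes "square_integrable f" shows "transl h (to_Ltwo f) = to_Ltwo (\<lambda>x. f (h + x))"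
  unfolding transl_def
  using AE_affine[OF AE_repr_to_Ltwo[OF assms], of 1 h]
  by (intro to_Ltwo_cong_AE square_integrable_translate) (auto simp: assms)

lemma reflect_to_Ltwo:
  assumes "square_integrable f" shows "reflect (to_Ltwo f) = to_Ltwo (\<lambda>x. f (- x))"
  unfolding reflect_def
  using AE_affine[OF AE_repr_to_Ltwo[OF assms], of "-1" 0]
  by (intro to_Ltwo_cong_AE square_integrable_reflect) (auto simp: assms)

lemma norm_transl [simp]: "norm (transl h u) = norm u"
proof -
  have "(norm (transl h u))\<^sup>2 = (norm u)\<^sup>2"
    unfolding transl_def
    using integral_translate[of "\<lambda>x. (cmod (repr u x))\<^sup>2" h]
    by (subst power2_norm_to_Ltwo) (auto simp: square_integrable_translate power2_norm_Ltwo)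
  then show ?thesis by (simp add: power2_eq_iff_nonneg)
qed

lemma norm_reflect [simp]: "norm (reflect u) = norm u"
proof -
  have "(norm (reflect u))\<^sup>2 = (norm u)\<^sup>2"
    unfolding reflect_def
    using integral_reflect[of "\<lambda>x. (cmod (repr u x))\<^sup>2"]
    by (subst power2_norm_to_Ltwo) (auto simp: square_integrable_reflect power2_norm_Ltwo)
  then show ?thesis by (simp add: power2_eq_iff_nonneg)
qed

lemma bounded_linear_transl: "bounded_linear (transl h)"
proof (rule bounded_linear_intro[where K = 1])
  show "transl h (u + v) = transl h u + transl h v" for u v
    using transl_to_Ltwo[of "\<lambda>x. repr u x + repr v x" h]
    by (simp add: square_integrable_add to_Ltwo_add square_integrable_translate flip: transl_def)
  show "transl h (r *\<^sub>R u) = r *\<^sub>R transl h u" for u r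
    using transl_to_Ltwo[of "\<lambda>x. of_real r * repr u x" h]
    by (simp add: square_integrable_mult to_Ltwo_mult square_integrable_translate scaleC_of_real flip: transl_def)
qed auto

lemma bounded_linear_reflect: "bounded_linear reflect"
proof (rule bounded_linear_intro[where K = 1])
  show "reflect (u + v) = reflect u + reflect v" for u v :: "'a Ltwo"
    using reflect_to_Ltwo[of "\<lambda>x. repr u x + repr v x"]
    by (simp add: square_integrable_add to_Ltwo_add square_integrable_reflect flip: reflect_def)
  show "reflect (r *\<^sub>R u) = r *\<^sub>R reflect u" for u :: "'a Ltwo" and r
    using reflect_to_Ltwo[of "\<lambda>x. of_real r * repr u x"]
    by (simp add: square_integrable_mult to_Ltwo_mult square_integrable_reflect scaleC_of_real flip: reflect_def)
qed auto

lemma reflect_reflect [simp]: "reflect (reflect u) = u"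
  unfolding reflect_def[of u] by (subst reflect_to_Ltwo) (auto simp: square_integrable_reflect)

section \<open>Truncation to balls and density of integrable functions\<close>

definition trunc :: "real \<Rightarrow> 'a::euclidean_space Ltwo \<Rightarrow> 'a Ltwo" where
  "trunc R = fmul (indicator (cball 0 R))"

lemma bounded_multiplier_indicator: "A \<in> sets borel \<Longrightarrow> bounded_multiplier (indicator A)"
  by (rule bounded_multiplierI[where B = 1]) (auto simp: indicator_def)

lemma trunc_tendsto_at_top: "((\<lambda>R. trunc R u) \<longlongrightarrow> u) at_top"
proof (rule tendsto_at_topI_sequentially)
  fix X :: "nat \<Rightarrow> real" assume X: "filterlim X at_top sequentially"
  have "(\<lambda>n. trunc (X n) u) \<longlonglongrightarrow> fmul (\<lambda>x. 1) u"
    unfolding trunc_def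
  proof (rule fmul_tendsto[where B = 1])
    fix x :: 'a
    show "(\<lambda>n. indicator (cball 0 (X n)) x :: complex) \<longlonglongrightarrow> 1"
    proof (rule tendsto_eventually)
      have "eventually (\<lambda>n. norm x \<le> X n) sequentially"
        using X by (simp add: filterlim_at_top)
      then show "eventually (\<lambda>n. (indicator (cball 0 (X n)) x :: complex) = 1) sequentially"
        by eventually_elim simp
    qed
    show "indicator (cball 0 (X n)) \<in> borel_measurable borel" for n
      by (rule borel_measurable_indicator) auto
  qed (auto simp: indicator_def)
  then show "(\<lambda>n. trunc (X n) u) \<longlonglongrightarrow> u" by simp
qed

lemma trunc_tendsto: "(\<lambda>n. trunc (real n) u) \<longlonglongrightarrow> u"
  using filterlim_compose[OF trunc_tendsto_at_top filterlim_real_sequentially] .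

lemma square_integrable_trunc: "square_integrable (\<lambda>x. indicator (cball 0 R) x * repr u x)"
  by (intro square_integrable_multiplier bounded_multiplier_indicator) auto

lemma integrable_indicator_square_integrable:
  fixes f :: "'a::euclidean_space \<Rightarrow> complex"
  assumes "square_integrable f" "A \<in> sets borel" "emeasure lborel A < \<infinity>"
  shows "integrable lborel (\<lambda>x. indicator A x * f x)"
proof (rule Bochner_Integration.integrable_bound)
  have [measurable]: "f \<in> borel_measurable borel" "A \<in> sets borel" using assms by (auto simp: square_integrable_def)
  show "integrable lborel (\<lambda>x. indicator A x + (cmod (f x))\<^sup>2 :: real)"
    using assms by (intro Bochner_Integration.integrable_add) (auto simp: square_integrable_def)
  \<comment> \<open>On a set of finite measure this dominates a square-integrable function by the
    sum of an indicator and its square.\<close>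
  have "t \<le> 1 + t\<^sup>2" for t :: real
    using zero_le_power2[of "t - 1/2"] by (simp add: power2_eq_square algebra_simps)
  then show "AE x in lborel. norm (indicator A x * f x) \<le> norm (indicator A x + (cmod (f x))\<^sup>2)"
    by (auto simp: indicator_def norm_mult)
  show "(\<lambda>x. indicator A x * f x) \<in> borel_measurable lborel"
    by (intro borel_measurable_times borel_measurable_indicator) auto
qed

lemma integrable_trunc: "integrable lborel (\<lambda>x. indicator (cball 0 R) x * repr u x)"
  using emeasure_lborel_cball_finite[of 0 R]
  by (intro integrable_indicator_square_integrable) auto

text \<open>Truncated functions are integrable, and they are dense.\<close>

lemma Ltwo_continuous_ext:
  fixes f g :: "'a::euclidean_space Ltwo \<Rightarrow> 'b::t2_space"
  assumes "\<And>u. isCont f u" "\<And>u. isCont g u"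
    and "\<And>h. square_integrable h \<Longrightarrow> integrable lborel h \<Longrightarrow> f (to_Ltwo h) = g (to_Ltwo h)"
  shows "f u = g u"
proof (rule LIMSEQ_unique)
  show "(\<lambda>n. f (trunc (real n) u)) \<longlonglongrightarrow> f u"
    by (rule isCont_tendsto_compose[OF assms(1) trunc_tendsto])
  have "f (trunc (real n) u) = g (trunc (real n) u)" for n
    unfolding trunc_def fmul_def by (intro assms(3) square_integrable_trunc integrable_trunc)
  then show "(\<lambda>n. f (trunc (real n) u)) \<longlonglongrightarrow> g u"
    using isCont_tendsto_compose[OF assms(2) trunc_tendsto] by simp
qed

text \<open>The type class provides the real inner product only. The Hermitian one, conjugate-linear
  in the second argument, is rebuilt from it, so that continuity and Parseval's identity carry over
  from the real part.\<close>

definition cinner :: "'a::euclidean_space Ltwo \<Rightarrow> 'a Ltwo \<Rightarrow> complex" where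
  "cinner u v = Complex (u \<bullet> v) (u \<bullet> scaleC \<i> v)"

lemma integrable_mult_square_integrable:
  assumes "square_integrable f" "square_integrable g"
  shows "integrable lborel (\<lambda>x. f x * g x)"
proof (rule Bochner_Integration.integrable_bound)
  have [measurable]: "f \<in> borel_measurable borel" "g \<in> borel_measurable borel" using assms by (auto simp: square_integrable_def)
  show "integrable lborel (\<lambda>x. (cmod (f x))\<^sup>2 + (cmod (g x))\<^sup>2)"
    using assms by (intro Bochner_Integration.integrable_add) (auto simp: square_integrable_def)
  have "a * b \<le> a\<^sup>2 + b\<^sup>2" if "a \<ge> 0" "b \<ge> 0" for a b :: real
    using sum_squares_bound[of a b] that mult_nonneg_nonneg[of a b] by linarith
  then show "AE x in lborel. norm (f x * g x) \<le> norm ((cmod (f x))\<^sup>2 + (cmod (g x))\<^sup>2)"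
    by (auto simp: norm_mult)  show "(\<lambda>x. f x * g x) \<in> borel_measurable lborel" by measurable
qed

lemma square_integrable_cnj: "square_integrable f \<Longrightarrow> square_integrable (\<lambda>x. cnj (f x))"
proof -
  assume f: "square_integrable f"
  then have [measurable]: "f \<in> borel_measurable borel" by (simp add: square_integrable_def)
  have "(\<lambda>x. cnj (f x)) \<in> borel_measurable borel"
    by (rule measurable_compose[OF _ borel_measurable_continuous_onI[OF continuous_on_cnj[OF continuous_on_id]]]) measurable
  with f show ?thesis by (simp add: square_integrable_def)
qed

lemma cinner_to_Ltwo:
  assumes "square_integrable f" "square_integrable g"
  shows "cinner (to_Ltwo f) (to_Ltwo g) = (LINT x|lborel. f x * cnj (g x))"
proof -
  have int: "integrable lborel (\<lambda>x. f x * cnj (g x))"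
    using assms by (intro integrable_mult_square_integrable square_integrable_cnj)
  have "Re (LINT x|lborel. f x * cnj (g x)) = to_Ltwo f \<bullet> to_Ltwo g"
    by (simp add: inner_Ltwo_to_Ltwo assms integral_Re[OF int, symmetric] inner_complex_def)
  moreover have "Im (LINT x|lborel. f x * cnj (g x)) = to_Ltwo f \<bullet> scaleC \<i> (to_Ltwo g)"
    by (simp add: inner_Ltwo_to_Ltwo square_integrable_mult assms integral_Im[OF int, symmetric] inner_complex_def
        algebra_simps flip: to_Ltwo_mult)
  ultimately show ?thesis by (simp add: cinner_def complex_eq_iff)
qed

lemma cinner_repr: "cinner u v = (LINT x|lborel. repr u x * cnj (repr v x))"
  using cinner_to_Ltwo[of "repr u" "repr v"] by simp

lemma tendsto_cinner [tendsto_intros]: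
  assumes "(f \<longlongrightarrow> u) F" "(g \<longlongrightarrow> v) F"
  shows "((\<lambda>x. cinner (f x) (g x)) \<longlongrightarrow> cinner u v) F"
  unfolding cinner_def
  by (intro tendsto_Complex tendsto_inner assms bounded_linear.tendsto[OF bounded_linear_scaleC])

section \<open>Gaussian integrals\<close>

text \<open>Packages the recurring pattern: Tonelli for the norms gives integrability on the
  product, and that licenses the exchange of the two integrals.\<close>

lemma (in pair_sigma_finite) Fubini_bounded:
  fixes f :: "_ \<Rightarrow> _ \<Rightarrow> _ :: {banach, second_countable_topology}"
  assumes [measurable]: "case_prod f \<in> borel_measurable (M1 \<Otimes>\<^sub>M M2)"
    and fin: "(\<integral>\<^sup>+x. \<integral>\<^sup>+y. norm (f x y) \<partial>M2 \<partial>M1) < \<infinity>"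
  shows "integrable (M1 \<Otimes>\<^sub>M M2) (case_prod f)"
    and "(\<integral>y. (\<integral>x. f x y \<partial>M1) \<partial>M2) = (\<integral>x. (\<integral>y. f x y \<partial>M2) \<partial>M1)"
proof -
  show *: "integrable (M1 \<Otimes>\<^sub>M M2) (case_prod f)"
  proof (rule integrableI_bounded)
    show "(\<integral>\<^sup>+z. norm (case_prod f z) \<partial>(M1 \<Otimes>\<^sub>M M2)) < \<infinity>"
      using fin by (subst M2.nn_integral_fst[symmetric]) auto
  qed auto
  show "(\<integral>y. (\<integral>x. f x y \<partial>M1) \<partial>M2) = (\<integral>x. (\<integral>y. f x y \<partial>M2) \<partial>M1)"
    by (rule Fubini_integral[OF *])
qed

text \<open>\<open>lborel\<close> is the image of the product of one-dimensional Lebesgue measures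
  over \<open>Basis\<close>, where the product formula is available.\<close>

lemma integral_lborel_prod:
  fixes f :: "'a::euclidean_space \<Rightarrow> real \<Rightarrow> complex"
  assumes "\<And>b. b \<in> Basis \<Longrightarrow> integrable lborel (f b)"
  shows "(LINT x|lborel. (\<Prod>b\<in>Basis. f b (x \<bullet> b))) = (\<Prod>b\<in>Basis. LINT x|lborel. f b x)"
    and "integrable lborel (\<lambda>x. \<Prod>b\<in>Basis. f b (x \<bullet> b))"
proof -
  interpret P: product_sigma_finite "\<lambda>_::'a. lborel :: real measure" ..
  have [measurable]: "f b \<in> borel_measurable borel" if "b \<in> Basis" for b using assms[OF that] by auto
  have eq: "(\<Prod>b\<in>Basis. f b ((\<Sum>c\<in>Basis. x c *\<^sub>R c) \<bullet> b)) = (\<Prod>b\<in>Basis. f b (x b))" for x :: "'a \<Rightarrow> real"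
    by (intro prod.cong refl) simp
  have m: "(\<lambda>x. \<Prod>b\<in>Basis. f b (x \<bullet> b)) \<in> borel_measurable borel" by measurable
  have m2: "(\<lambda>f. \<Sum>b\<in>Basis. f b *\<^sub>R b) \<in> (\<Pi>\<^sub>M b\<in>Basis. lborel) \<rightarrow>\<^sub>M (borel :: 'a measure)" by measurable
  show "(LINT x|lborel. (\<Prod>b\<in>Basis. f b (x \<bullet> b))) = (\<Prod>b\<in>Basis. LINT x|lborel. f b x)"
    unfolding lborel_eq[where 'a='a] using P.product_integral_prod[of Basis f] assms
    by (subst integral_distr[OF m2 m]) (simp add: eq)
  show "integrable lborel (\<lambda>x. \<Prod>b\<in>Basis. f b (x \<bullet> b))"
    unfolding lborel_eq[where 'a='a] using P.product_integrable_prod[of Basis f] assms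
    by (subst integrable_distr_eq[OF m2 m]) (simp add: eq)
qed

text \<open>The characteristic function \<open>exp (- s^2 / 2)\<close> of the standard normal
  distribution, rescaled by \<open>sqrt (2 * t)\<close>. The frequency \<open>s\<close> is chosen so
  that the phase \<open>s * (sqrt (2 * t) * x)\<close> becomes \<open>- (x * \<xi>)\<close>.\<close>

lemma gaussian_fourier_real:
  fixes t \<xi> :: real assumes t: "0 < t"
  shows "integrable lborel (\<lambda>x. cis (- (x * \<xi>)) * exp (- t * x\<^sup>2))"
    and "(LINT x|lborel. cis (- (x * \<xi>)) * exp (- t * x\<^sup>2)) = sqrt (pi / t) * exp (- \<xi>\<^sup>2 / (4 * t))"
proof -
  define s where "s = - \<xi> / sqrt (2 * t)"
  have c: "sqrt (2 * t) \<noteq> 0" using t by simp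
  have sq: "(sqrt (2 * t) * x)\<^sup>2 = 2 * t * x\<^sup>2" for x using t by (simp add: power_mult_distrib)
  define g where "g x = complex_of_real (std_normal_density x) * iexp (s * x)" for x
  have ig: "integrable lborel g"
  proof (rule Bochner_Integration.integrable_bound)
    show "integrable lborel std_normal_density" by simp
    have "continuous_on UNIV (\<lambda>x. iexp (s * x))" by (intro continuous_intros)
    then show "g \<in> borel_measurable lborel"
      unfolding g_def by (auto intro!: borel_measurable_times borel_measurable_continuous_onI)
  qed (auto simp: g_def norm_mult norm_exp_i_times)
  have "(LINT x|lborel. g x) = char std_normal_distribution s"
    unfolding char_def g_def
    by (subst integral_density) (auto simp: scaleR_conv_of_real)
  then have int_g: "(LINT x|lborel. g x) = exp (- s\<^sup>2 / 2)" by (simp add: char_std_normal_distribution)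
  have geq: "g (0 + sqrt (2 * t) * x) = (1 / sqrt (2 * pi)) * (cis (- (x * \<xi>)) * exp (- t * x\<^sup>2))" for x
  proof -
    have e: "- (sqrt (2 * t) * x)\<^sup>2 / 2 = - t * x\<^sup>2" by (simp add: sq)
    have c': "s * (sqrt (2 * t) * x) = - (x * \<xi>)" using t by (simp add: s_def)
    show ?thesis
      unfolding g_def std_normal_density_def add_0_left diff_0_right e c' by (simp add: cis_conv_exp)
  qed
  have "integrable lborel (\<lambda>x. g (0 + sqrt (2 * t) * x))"
    using lborel_integrable_real_affine[OF ig c] .
  from integrable_mult_right[OF this[unfolded geq], of "complex_of_real (sqrt (2 * pi))"]
  show "integrable lborel (\<lambda>x. cis (- (x * \<xi>)) * exp (- t * x\<^sup>2))"
    by (simp add: mult.assoc[symmetric] flip: of_real_mult)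
  have "(LINT x|lborel. g x) = sqrt (2 * t) *\<^sub>R (LINT x|lborel. g (0 + sqrt (2 * t) * x))"
    using lborel_integral_real_affine[OF c, of g 0] t by simp
  also have "\<dots> = sqrt (2 * t) * ((1 / sqrt (2 * pi)) * (LINT x|lborel. cis (- (x * \<xi>)) * exp (- t * x\<^sup>2)))"
    unfolding geq by (simp add: scaleR_conv_of_real)
  finally have eq1: "complex_of_real (exp (- s\<^sup>2 / 2)) = sqrt (2 * t) * ((1 / sqrt (2 * pi)) * (LINT x|lborel. cis (- (x * \<xi>)) * exp (- t * x\<^sup>2)))"
    using int_g by simp
  then have "(LINT x|lborel. cis (- (x * \<xi>)) * exp (- t * x\<^sup>2)) = of_real (sqrt (2 * pi) / sqrt (2 * t) * exp (- s\<^sup>2 / 2))"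
  proof -
    have nz: "complex_of_real (sqrt (2 * t)) \<noteq> 0" "complex_of_real (sqrt (2 * pi)) \<noteq> 0" using t by simp_all
    have "e = a * (1 / b * I) \<Longrightarrow> a \<noteq> 0 \<Longrightarrow> b \<noteq> 0 \<Longrightarrow> I = b / a * e" for e a b I :: complex
      by (simp add: field_simps)
    from this[OF eq1[unfolded of_real_divide[of 1] of_real_1] nz]
    show ?thesis by (simp only: of_real_mult of_real_divide)
  qed
  also have "sqrt (2 * pi) / sqrt (2 * t) = sqrt (pi / t)" by (simp add: real_sqrt_divide real_sqrt_mult)
  also have "- s\<^sup>2 / 2 = - \<xi>\<^sup>2 / (4 * t)" using t by (simp add: s_def power_divide)
  finally show "(LINT x|lborel. cis (- (x * \<xi>)) * exp (- t * x\<^sup>2)) = sqrt (pi / t) * exp (- \<xi>\<^sup>2 / (4 * t))"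
    by (simp only: of_real_mult)
qed

lemma cis_sum: "finite A \<Longrightarrow> cis (\<Sum>x\<in>A. f x) = (\<Prod>x\<in>A. cis (f x))"
  by (induction rule: finite_induct) (auto simp flip: cis_mult)

text \<open>Both the phase and the Gaussian are exponentials of sums over \<open>Basis\<close>, so
  the integrand is a product of one-dimensional ones.\<close>

lemma gaussian_fourier:
  fixes \<xi> :: "'a::euclidean_space" assumes t: "0 < t"
  shows "integrable lborel (\<lambda>x. cis (- (x \<bullet> \<xi>)) * exp (- t * (norm x)\<^sup>2))"
    and "(LINT x|lborel. cis (- (x \<bullet> \<xi>)) * exp (- t * (norm x)\<^sup>2))
      = (pi / t) powr (real DIM('a) / 2) * exp (- (norm \<xi>)\<^sup>2 / (4 * t))"
proof -
  have norm_sq: "(norm x)\<^sup>2 = (\<Sum>b\<in>Basis. (x \<bullet> b)\<^sup>2)" for x :: 'a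
    unfolding power2_norm_eq_inner by (subst euclidean_inner) (simp add: power2_eq_square)
  have eq: "cis (- (x \<bullet> \<xi>)) * exp (- t * (norm x)\<^sup>2) =
      (\<Prod>b\<in>Basis. cis (- ((x \<bullet> b) * (\<xi> \<bullet> b))) * exp (- t * (x \<bullet> b)\<^sup>2))" for x
    by (simp add: norm_sq euclidean_inner[of x \<xi>] sum_distrib_left prod.distrib exp_sum
        flip: sum_negf cis_sum of_real_prod exp_sum)
  show "integrable lborel (\<lambda>x. cis (- (x \<bullet> \<xi>)) * exp (- t * (norm x)\<^sup>2))"
    unfolding eq by (rule integral_lborel_prod) (rule gaussian_fourier_real[OF t])
  have "(LINT x|lborel. cis (- (x \<bullet> \<xi>)) * exp (- t * (norm x)\<^sup>2))
      = (\<Prod>b\<in>(Basis::'a set). sqrt (pi / t) * exp (- (\<xi> \<bullet> b)\<^sup>2 / (4 * t)))"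
    unfolding eq of_real_prod
    by (subst integral_lborel_prod(1), rule gaussian_fourier_real[OF t])
       (intro prod.cong refl, subst gaussian_fourier_real(2)[OF t], simp)
  also have "\<dots> = complex_of_real ((\<Prod>b\<in>(Basis::'a set). sqrt (pi / t)) * exp (\<Sum>b\<in>Basis. - (\<xi> \<bullet> b)\<^sup>2 / (4 * t)))"
    by (simp only: of_real_prod of_real_mult prod.distrib exp_sum finite_Basis)
  also have "(\<Prod>b\<in>(Basis::'a set). sqrt (pi / t)) = (pi / t) powr (real DIM('a) / 2)"
  proof -
    have "(\<Prod>b\<in>(Basis::'a set). sqrt (pi / t)) = ((pi / t) powr (1/2)) ^ DIM('a)"
      using t by (simp only: prod_constant powr_half_sqrt[of "pi / t"] divide_nonneg_pos pi_ge_zero)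
    also have "\<dots> = ((pi / t) powr (1/2)) powr real DIM('a)" using t by (intro powr_realpow[symmetric]) auto
    finally show ?thesis by (simp only: powr_powr) simp
  qed
  also have "(\<Sum>b\<in>Basis. - (\<xi> \<bullet> b)\<^sup>2 / (4 * t)) = - (norm \<xi>)\<^sup>2 / (4 * t)"
    by (simp add: norm_sq sum_divide_distrib sum_negf)
  finally show "(LINT x|lborel. cis (- (x \<bullet> \<xi>)) * exp (- t * (norm x)\<^sup>2))
      = (pi / t) powr (real DIM('a) / 2) * exp (- (norm \<xi>)\<^sup>2 / (4 * t))" by simp
qed

lemma gaussian_integral:
  assumes t: "0 < t"
  shows "integrable lborel (\<lambda>x::'a::euclidean_space. exp (- t * (norm x)\<^sup>2))"
    and "(LINT x|lborel. exp (- t * (norm (x::'a))\<^sup>2)) = (pi / t) powr (real DIM('a) / 2)"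
    and "(\<integral>\<^sup>+x. exp (- t * (norm (x::'a))\<^sup>2) \<partial>lborel) = (pi / t) powr (real DIM('a) / 2)"
proof -
  have "integrable lborel (\<lambda>x::'a. complex_of_real (exp (- t * (norm x)\<^sup>2)))"
    using gaussian_fourier(1)[OF t, of 0] by simp
  then show i: "integrable lborel (\<lambda>x::'a. exp (- t * (norm x)\<^sup>2))"
    by (drule_tac integrable_Re) (simp del: of_real_exp)
  have "(LINT x|lborel. complex_of_real (exp (- t * (norm (x::'a))\<^sup>2))) = (pi / t) powr (real DIM('a) / 2)"
    using gaussian_fourier(2)[OF t, of 0] by simp
  then have "complex_of_real (LINT x|lborel. exp (- t * (norm (x::'a))\<^sup>2)) = (pi / t) powr (real DIM('a) / 2)"
    by (simp only: integral_complex_of_real)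
  then show e: "(LINT x|lborel. exp (- t * (norm (x::'a))\<^sup>2)) = (pi / t) powr (real DIM('a) / 2)"
    by (simp only: of_real_eq_iff)
  show "(\<integral>\<^sup>+x. exp (- t * (norm (x::'a))\<^sup>2) \<partial>lborel) = (pi / t) powr (real DIM('a) / 2)"
    using nn_integral_eq_integral[OF i] e by simp
qed

section \<open>Test functions\<close>

text \<open>Differentiating \<open>exp (- 1 / x)\<close> produces powers of \<open>1 / x\<close>.
  The whole family is closed under differentiation up to linear combinations, so smoothness follows
  by an induction over the order with \<open>n\<close> arbitrary.\<close>

definition expinv :: "nat \<Rightarrow> real \<Rightarrow> real" where
  "expinv n x = (if 0 < x then exp (- inverse x) * inverse x ^ n else 0)"

lemma expinv_tendsto_0: "(expinv n \<longlongrightarrow> 0) (at_right 0)"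
proof -
  have "((\<lambda>x::real. inverse x ^ n / exp (inverse x)) \<longlongrightarrow> 0) (at_right 0)"
    by (rule filterlim_compose[OF tendsto_power_div_exp_0 filterlim_inverse_at_top_right])
  then show ?thesis
    by (rule Lim_transform_eventually)
       (auto simp: expinv_def eventually_at_filter exp_minus field_simps)
qed

lemma expinv_deriv:
  "(expinv n has_real_derivative (- real n * expinv (n + 1) x + expinv (n + 2) x)) (at x)"
proof -
  consider "x > 0" | "x < 0" | "x = 0" by linarith
  then show ?thesis
  proof cases
    case 1
    have "((\<lambda>x. exp (- inverse x) * inverse x ^ n) has_real_derivative (- real n * expinv (n + 1) x + expinv (n + 2) x)) (at x)"
      using 1 by (auto intro!: derivative_eq_intros simp: expinv_def power2_eq_square divide_simps)
        (cases n; simp add: field_simps)?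
    then show ?thesis
      by (rule has_field_derivative_transform_within_open[where S = "{0<..}"]) (use 1 in \<open>auto simp: expinv_def\<close>)
  next
    case 2
    have "((\<lambda>x. 0) has_real_derivative (- real n * expinv (n + 1) x + expinv (n + 2) x)) (at x)"
      using 2 by (simp add: expinv_def)
    then show ?thesis
      by (rule has_field_derivative_transform_within_open[where S = "{..<0}"]) (use 2 in \<open>auto simp: expinv_def\<close>)
  next
    case 3
    \<comment> \<open>At the origin the right-hand difference quotient is
      \<open>expinv (Suc n) h\<close>, which tends to 0; on the left everything is constantly
      0.\<close>
    have "((\<lambda>h. (expinv n (0 + h) - expinv n 0) / h) \<longlongrightarrow> 0) (at_right 0)"
      by (rule Lim_transform_eventually[OF expinv_tendsto_0[of "Suc n"]])
         (auto simp: expinv_def eventually_at_filter field_simps)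
    moreover have "((\<lambda>h. (expinv n (0 + h) - expinv n 0) / h) \<longlongrightarrow> 0) (at_left 0)"
      by (rule Lim_transform_eventually[OF tendsto_const[of 0]])
         (auto simp: expinv_def eventually_at_filter field_simps)
    ultimately show ?thesis
      unfolding 3 DERIV_def by (subst filterlim_at_split) (simp add: expinv_def)
  qed
qed

lemma Ck_SucI:
  assumes "\<And>x. (f has_derivative f' x) (at x)" "\<And>b. b \<in> Basis \<Longrightarrow> Ck k (\<lambda>x. f' x b)"
  shows "Ck (Suc k) f"
proof -
  have "frechet_derivative f (at x) = f' x" for x using frechet_derivative_at[OF assms(1)] by simp
  then show ?thesis using assms
    by (auto simp: differentiable_on_def differentiable_def intro: has_derivative_at_withinI)
qed

lemma Ck_Suc_has_derivative:
  assumes "Ck (Suc k) f"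
  shows "(f has_derivative frechet_derivative f (at x)) (at x)"
  using assms by (auto simp: differentiable_on_def frechet_derivative_works)

lemma Ck_Suc_imp_Ck: "Ck (Suc k) f \<Longrightarrow> Ck k f"
  by (induction k arbitrary: f) (auto simp: differentiable_imp_continuous_on)

lemma Ck_add: "Ck k f \<Longrightarrow> Ck k g \<Longrightarrow> Ck k (\<lambda>x. f x + g x)"
proof (induction k arbitrary: f g)
  case (Suc k)
  show ?case
  proof (rule Ck_SucI[where f' = "\<lambda>x h. frechet_derivative f (at x) h + frechet_derivative g (at x) h"])
    show "((\<lambda>x. f x + g x) has_derivative (\<lambda>h. frechet_derivative f (at x) h + frechet_derivative g (at x) h)) (at x)" for x
      by (rule has_derivative_add) (use Suc.prems Ck_Suc_has_derivative in blast)+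
    show "Ck k (\<lambda>x. frechet_derivative f (at x) b + frechet_derivative g (at x) b)" if "b \<in> Basis" for b
      by (intro Suc.IH) (use Suc.prems that in auto)
  qed
qed (auto intro: continuous_on_add)

lemma Ck_mult: "Ck k f \<Longrightarrow> Ck k g \<Longrightarrow> Ck k (\<lambda>x. f x * g x)"
proof (induction k arbitrary: f g)
  case (Suc k)
  show ?case
  proof (rule Ck_SucI[where f' = "\<lambda>x h. f x * frechet_derivative g (at x) h + frechet_derivative f (at x) h * g x"])
    show "((\<lambda>x. f x * g x) has_derivative (\<lambda>h. f x * frechet_derivative g (at x) h + frechet_derivative f (at x) h * g x)) (at x)" for x
      by (rule has_derivative_mult) (use Suc.prems Ck_Suc_has_derivative in blast)+
    show "Ck k (\<lambda>x. f x * frechet_derivative g (at x) b + frechet_derivative f (at x) b * g x)" if "b \<in> Basis" for b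
      by (intro Ck_add Suc.IH) (use Suc.prems that Ck_Suc_imp_Ck in auto)
  qed
qed (auto intro: continuous_on_mult)

lemma Ck_const: "Ck k (\<lambda>x. c)"
proof (induction k arbitrary: c)
  case (Suc k)
  show ?case by (rule Ck_SucI[where f' = "\<lambda>x h. 0"]) (use Suc in auto)
qed simp

lemma Ck_prod: "finite A \<Longrightarrow> (\<And>i. i \<in> A \<Longrightarrow> Ck k (f i)) \<Longrightarrow> Ck k (\<lambda>x. \<Prod>i\<in>A. f i x)"
  by (induction rule: finite_induct) (auto intro: Ck_const Ck_mult)

lemma Ck_expinv: "Ck k (\<lambda>x::'a::euclidean_space. expinv n (c * (x \<bullet> b - d)))"
proof (induction k arbitrary: n)
  case 0
  have "continuous_on UNIV (expinv n)"
    by (rule DERIV_continuous_on[OF expinv_deriv[THEN DERIV_subset]]) auto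
  then show ?case
    by (auto intro!: continuous_on_compose2[where g = "expinv n" and t = UNIV] continuous_intros)
next
  case (Suc k)
  show ?case
  proof (rule Ck_SucI[where f' = "\<lambda>x h. (- real n * expinv (n + 1) (c * (x \<bullet> b - d)) + expinv (n + 2) (c * (x \<bullet> b - d))) * (c * (h \<bullet> b))"])
    show "((\<lambda>x::'a. expinv n (c * (x \<bullet> b - d))) has_derivative
       (\<lambda>h. (- real n * expinv (n + 1) (c * (x \<bullet> b - d)) + expinv (n + 2) (c * (x \<bullet> b - d))) * (c * (h \<bullet> b)))) (at x)" for x
      by (rule has_derivative_compose[OF _ expinv_deriv[unfolded has_field_derivative_def]])
         (auto intro!: derivative_eq_intros)
    show "Ck k (\<lambda>x::'a. (- real n * expinv (n + 1) (c * (x \<bullet> b - d)) + expinv (n + 2) (c * (x \<bullet> b - d))) * (c * (b' \<bullet> b)))" for b'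
      by (intro Ck_add Ck_mult Ck_const Suc.IH)
  qed
qed

text \<open>Since \<open>exp (- 1 / (k * y))\<close> tends to 1 for every positive \<open>y\<close>,
  these functions approach the indicator of the open box pointwise as \<open>k\<close> grows. They
  stay below it and vanish outside, so the indicator also serves as majorant.\<close>

definition bump :: "real \<Rightarrow> 'a::euclidean_space \<Rightarrow> 'a \<Rightarrow> 'a \<Rightarrow> real" where
  "bump k l u x = (\<Prod>b\<in>Basis. expinv 0 (k * (x \<bullet> b - l \<bullet> b)) * expinv 0 ((- k) * (x \<bullet> b - u \<bullet> b)))"

lemma expinv_0_bounds: "0 \<le> expinv 0 x" "expinv 0 x \<le> 1"
  by (auto simp: expinv_def)

lemma bump_bounds: "0 < k \<Longrightarrow> 0 \<le> bump k l u x" "0 < k \<Longrightarrow> bump k l u x \<le> indicator (box l u) x"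
proof -
  assume k: "0 < k"
  show "0 \<le> bump k l u x" by (auto simp: bump_def intro!: prod_nonneg mult_nonneg_nonneg expinv_0_bounds)
  show "bump k l u x \<le> indicator (box l u) x"
  proof (cases "x \<in> box l u")
    case True
    have "bump k l u x \<le> (\<Prod>b\<in>(Basis::'a set). 1)"
      unfolding bump_def by (intro prod_mono conjI mult_nonneg_nonneg mult_le_one expinv_0_bounds)
    with True show ?thesis by simp
  next
    case False
    then obtain b where b: "b \<in> Basis" "x \<bullet> b \<le> l \<bullet> b \<or> u \<bullet> b \<le> x \<bullet> b" by (auto simp: mem_box not_less)
    then have "expinv 0 (k * (x \<bullet> b - l \<bullet> b)) * expinv 0 ((- k) * (x \<bullet> b - u \<bullet> b)) = 0"
      using k by (auto simp: expinv_def zero_less_mult_iff mult_less_0_iff)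
    then have "bump k l u x = 0" unfolding bump_def using b(1) by (intro prod_zero) auto
    then show ?thesis by simp
  qed
qed

lemma test_function_bump: assumes "0 < k" shows "test_function (bump k l u)"
proof -
  have "{x. bump k l u x \<noteq> 0} \<subseteq> box l u"
  proof
    fix x assume "x \<in> {x. bump k l u x \<noteq> 0}"
    then show "x \<in> box l u" using bump_bounds[OF assms, of l u x] by (cases "x \<in> box l u") auto
  qed
  then have "bounded {x. bump k l u x \<noteq> 0}" using bounded_box bounded_subset by blast
  moreover have "Ck j (bump k l u)" for j
    unfolding bump_def[abs_def] by (intro Ck_prod Ck_mult Ck_expinv) auto
  ultimately show ?thesis by (simp add: test_function_def compact_closure)
qed

lemma bump_tendsto: "(\<lambda>n. bump (real (Suc n)) l u x) \<longlonglongrightarrow> indicator (box l u) x"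
proof (cases "x \<in> box l u")
  case True
  have *: "(\<lambda>n. expinv 0 (real (Suc n) * y)) \<longlonglongrightarrow> 1" if "y > 0" for y
  proof -
    have "(\<lambda>n. exp (- (inverse (real (Suc n)) * inverse y))) \<longlonglongrightarrow> exp (- (0 * inverse y))"
      by (intro tendsto_intros LIMSEQ_inverse_real_of_nat)
    then show ?thesis using that by (simp add: expinv_def)
  qed
  have "(\<lambda>n. bump (real (Suc n)) l u x) \<longlonglongrightarrow> (\<Prod>b\<in>(Basis::'a set). 1 * 1)"
    unfolding bump_def
  proof (intro tendsto_prod tendsto_mult)
    fix b :: 'a assume b: "b \<in> Basis"
    show "(\<lambda>n. expinv 0 (real (Suc n) * (x \<bullet> b - l \<bullet> b))) \<longlonglongrightarrow> 1"
      using True b by (intro *) (auto simp: mem_box)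
    have "(\<lambda>n. expinv 0 (real (Suc n) * (u \<bullet> b - x \<bullet> b))) \<longlonglongrightarrow> 1"
      using True b by (intro *) (auto simp: mem_box)
    then show "(\<lambda>n. expinv 0 (- real (Suc n) * (x \<bullet> b - u \<bullet> b))) \<longlonglongrightarrow> 1"
      by (simp add: algebra_simps)
  qed
  then show ?thesis using True by simp
next
  case False
  have "bump (real (Suc n)) l u x = 0" for n
    using bump_bounds[of "real (Suc n)" l u x] False by simp
  then show ?thesis using False by simp
qed

text \<open>\<open>ennreal\<close> cuts off negative values, so the two densities are the positive
  and the negative part of \<open>w\<close>. Their measures agree and are finite on boxes, which are
  stable under intersection, generate the Borel sets and exhaust the space. Hence the measures
  coincide, both parts agree almost everywhere, and since one of them always vanishes, so does
  \<open>w\<close>.\<close>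

lemma AE_zero_if_box_integrals_zero:
  fixes w :: "'a::euclidean_space \<Rightarrow> real"
  assumes [measurable]: "w \<in> borel_measurable borel"
    and int: "\<And>l u. integrable lborel (\<lambda>x. indicator (box l u) x * w x)"
    and zero: "\<And>l u. (LINT x|lborel. indicator (box l u) x * w x) = 0"
  shows "AE x in lborel. w x = 0"
proof -
  let ?M = "density lborel (\<lambda>x. ennreal (w x))" and ?N = "density lborel (\<lambda>x. ennreal (- w x))"
  have M: "emeasure ?M (box l u) = (\<integral>\<^sup>+x. ennreal (indicator (box l u) x * w x) \<partial>lborel)" for l u
    by (subst emeasure_density) (auto intro!: nn_integral_cong simp: indicator_def)
  have N: "emeasure ?N (box l u) = (\<integral>\<^sup>+x. ennreal (- (indicator (box l u) x * w x)) \<partial>lborel)" for l u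
    by (subst emeasure_density) (auto intro!: nn_integral_cong simp: indicator_def)
  have finM: "emeasure ?M (box l u) \<noteq> \<infinity>" and finN: "emeasure ?N (box l u) \<noteq> \<infinity>" for l u
    using int[of l u] unfolding M N real_integrable_def by auto
  have "?M = ?N"
  proof (rule measure_eqI_generator_eq)
    let ?E = "range (\<lambda>(a, b). box a b::'a set)"
    show "Int_stable ?E" by (auto simp: Int_stable_def box_Int_box)
    show "?E \<subseteq> Pow UNIV" "sets ?M = sigma_sets UNIV ?E" "sets ?N = sigma_sets UNIV ?E"
      by (simp_all add: borel_eq_box)
    show "emeasure ?M X = emeasure ?N X" if X: "X \<in> ?E" for X
    proof -
      obtain l u where X: "X = box l u" using X by auto
      have "enn2real (emeasure ?M X) = enn2real (emeasure ?N X)"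
        using zero[of l u] unfolding X M N by (subst (asm) real_lebesgue_integral_def[OF int]) simp
      then show ?thesis using finM finN unfolding X
        by (metis enn2real_ennreal ennreal_enn2real top.not_eq_extremum infinity_ennreal_def)
    qed
    let ?A = "\<lambda>n::nat. box (- (real n *\<^sub>R One)) (real n *\<^sub>R One) :: 'a set"
    show "range ?A \<subseteq> ?E" by auto
    show "(\<Union>i. ?A i) = UNIV" by (rule UN_box_eq_UNIV)
    show "emeasure ?M (?A i) \<noteq> \<infinity>" for i by (rule finM)
  qed
  then have "AE x in lborel. ennreal (w x) = ennreal (- w x)"
    by (intro sigma_finite_measure.density_unique[OF sigma_finite_lborel]) auto
  then show ?thesis
  proof eventually_elim
    case (elim x)
    show ?case
    proof (cases "w x \<ge> 0")
      case True
      with elim have "ennreal (w x) = 0" by (simp add: ennreal_neg)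
      with True show ?thesis by simp
    next
      case False
      with elim have "ennreal (- w x) = 0" by (simp add: ennreal_neg)
      with False show ?thesis by simp
    qed
  qed
qed

text \<open>The fundamental lemma of the calculus of variations: along \<open>bump\<close> the
  integrals against test functions converge to integrals over boxes, and real and imaginary part are
  then treated separately.\<close>

lemma test_function_separation:
  fixes v :: "'a::euclidean_space \<Rightarrow> complex"
  assumes [measurable]: "v \<in> borel_measurable borel"
    and int: "\<And>l u. integrable lborel (\<lambda>x. indicator (box l u) x *\<^sub>R v x)"
    and zero: "\<And>\<phi>. test_function \<phi> \<Longrightarrow> (LINT x|lborel. v x * complex_of_real (\<phi> x)) = 0"
  shows "AE x in lborel. v x = 0"
proof -
  have z: "(LINT x|lborel. indicator (box l u) x *\<^sub>R v x) = 0" for l u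
  proof (rule LIMSEQ_unique)
    have m: "bump (real (Suc n)) l u \<in> borel_measurable borel" for n
      using test_function_bump[of "real (Suc n)" l u] unfolding test_function_def
      by (intro borel_measurable_continuous_onI) (metis Ck.simps(1) of_nat_0_less_iff zero_less_Suc)
    show "(\<lambda>n. LINT x|lborel. v x * complex_of_real (bump (real (Suc n)) l u x)) \<longlonglongrightarrow> (LINT x|lborel. indicator (box l u) x *\<^sub>R v x)"
    proof (rule integral_dominated_convergence)
      show "integrable lborel (\<lambda>x. norm (indicator (box l u) x *\<^sub>R v x))" by (rule integrable_norm[OF int])
      show "AE x in lborel. (\<lambda>n. v x * complex_of_real (bump (real (Suc n)) l u x)) \<longlonglongrightarrow> indicator (box l u) x *\<^sub>R v x"
        by (rule AE_I2) (auto intro!: tendsto_intros bump_tendsto simp: scaleR_conv_of_real mult.commute[of "v _"] simp del: of_nat_Suc)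
      show "AE x in lborel. norm (v x * complex_of_real (bump (real (Suc n)) l u x)) \<le> norm (indicator (box l u) x *\<^sub>R v x)" for n
        using bump_bounds[of "real (Suc n)" l u]
        by (intro AE_I2) (auto simp: norm_mult mult.commute[of "cmod _"] intro!: mult_right_mono)
    qed (use m in auto)
    show "(\<lambda>n. LINT x|lborel. v x * complex_of_real (bump (real (Suc n)) l u x)) \<longlonglongrightarrow> 0"
      using zero[OF test_function_bump] by simp
  qed
  have "AE x in lborel. Re (v x) = 0"
  proof (rule AE_zero_if_box_integrals_zero)
    show "integrable lborel (\<lambda>x. indicator (box l u) x * Re (v x))" for l u
      using integrable_Re[OF int[of l u]] by simp
    show "(LINT x|lborel. indicator (box l u) x * Re (v x)) = 0" for l u
      using integral_Re[OF int[of l u]] z[of l u] by simp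
  qed measurable
  moreover have "AE x in lborel. Im (v x) = 0"
  proof (rule AE_zero_if_box_integrals_zero)
    show "integrable lborel (\<lambda>x. indicator (box l u) x * Im (v x))" for l u
      using integrable_Im[OF int[of l u]] by simp
    show "(LINT x|lborel. indicator (box l u) x * Im (v x)) = 0" for l u
      using integral_Im[OF int[of l u]] z[of l u] by simp
  qed measurable
  ultimately show ?thesis by eventually_elim (simp add: complex_eq_iff)
qed

section \<open>Plancherel's theorem\<close>

lemma measurable_cis [measurable (raw)]:
  "f \<in> borel_measurable M \<Longrightarrow> (\<lambda>x. cis (f x)) \<in> borel_measurable M"
  by (rule measurable_compose[where g = cis and N = borel])
     (auto intro!: borel_measurable_continuous_onI continuous_intros simp: cis_conv_exp)

lemma measurable_cnj [measurable (raw)]: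
  "f \<in> borel_measurable M \<Longrightarrow> (\<lambda>x. cnj (f x)) \<in> borel_measurable M"
  by (rule measurable_compose[where g = cnj and N = borel])
     (auto intro!: borel_measurable_continuous_onI continuous_intros)

text \<open>The inner integral is merely a bounded function of \<open>\<xi>\<close>; the Gaussian
  makes the outer one absolutely convergent, and Fubini with the Gaussian transform turns it into a
  convolution. It serves Plancherel's theorem, the inversion formula and, read from right to left,
  the Riesz potential.\<close>

lemma gaussian_smoothing:
  fixes f :: "'a::euclidean_space \<Rightarrow> complex"
  assumes t: "0 < t" and f: "integrable lborel f"
  shows "(LINT \<xi>|lborel. cis (- (x \<bullet> \<xi>)) * exp (- t * (norm \<xi>)\<^sup>2) * (LINT y|lborel. cis (y \<bullet> \<xi>) * f y))
    = (pi / t) powr (real DIM('a) / 2) * (LINT y|lborel. exp (- (norm (x - y))\<^sup>2 / (4 * t)) * f y)"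
proof -
  have [measurable]: "f \<in> borel_measurable borel" using f by auto
  define g where "g \<xi> y = cis (- (x \<bullet> \<xi>)) * exp (- t * (norm \<xi>)\<^sup>2) * (cis (y \<bullet> \<xi>) * f y)" for \<xi> y :: 'a
  have [measurable]: "case_prod g \<in> borel_measurable (lborel \<Otimes>\<^sub>M lborel)"
    unfolding g_def[abs_def] by measurable
  have "(\<integral>\<^sup>+\<xi>. \<integral>\<^sup>+y. norm (g \<xi> y) \<partial>lborel \<partial>lborel)
      = (\<integral>\<^sup>+\<xi>. ennreal (exp (- t * (norm (\<xi>::'a))\<^sup>2)) * (\<integral>\<^sup>+y. norm (f y) \<partial>lborel) \<partial>lborel)"
    by (simp add: g_def norm_mult ennreal_mult' nn_integral_cmult)
  also have "\<dots> = (\<integral>\<^sup>+\<xi>. ennreal (exp (- t * (norm (\<xi>::'a))\<^sup>2)) \<partial>lborel) * (\<integral>\<^sup>+y. norm (f y) \<partial>lborel)"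
    by (rule nn_integral_multc) measurable
  also have "\<dots> < \<infinity>"
    using f by (subst gaussian_integral(3)[OF t]) (auto simp: ennreal_mult_less_top integrable_iff_bounded)
  finally have fin: "(\<integral>\<^sup>+\<xi>. \<integral>\<^sup>+y. norm (g \<xi> y) \<partial>lborel \<partial>lborel) < \<infinity>" .
  have "(LINT \<xi>|lborel. cis (- (x \<bullet> \<xi>)) * exp (- t * (norm \<xi>)\<^sup>2) * (LINT y|lborel. cis (y \<bullet> \<xi>) * f y))
      = (LINT \<xi>|lborel. LINT y|lborel. g \<xi> y)"
    by (simp add: g_def)
  also have "\<dots> = (LINT y|lborel. LINT \<xi>|lborel. g \<xi> y)"
    by (rule lborel_pair.Fubini_bounded(2)[OF _ fin, symmetric]) measurable
  also have "\<dots> = (LINT y|lborel. f y * ((pi / t) powr (real DIM('a) / 2) * exp (- (norm (x - y))\<^sup>2 / (4 * t))))"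
  proof (rule Bochner_Integration.integral_cong[OF refl])
    fix y :: 'a
    have "(LINT \<xi>|lborel. g \<xi> y) = (LINT \<xi>|lborel. f y * (cis (- (\<xi> \<bullet> (x - y))) * exp (- t * (norm \<xi>)\<^sup>2)))"
    proof (rule Bochner_Integration.integral_cong[OF refl])
      fix \<xi> :: 'a
      have "cis (- (\<xi> \<bullet> (x - y))) = cis (- (x \<bullet> \<xi>)) * cis (y \<bullet> \<xi>)"
        by (simp add: cis_mult inner_diff_right inner_commute)
      then show "g \<xi> y = f y * (cis (- (\<xi> \<bullet> (x - y))) * exp (- t * (norm \<xi>)\<^sup>2))"
        by (simp add: g_def)
    qed
    also have "\<dots> = f y * (LINT \<xi>|lborel. cis (- (\<xi> \<bullet> (x - y))) * exp (- t * (norm \<xi>)\<^sup>2))"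
      by (rule integral_mult_right_zero)
    finally show "(LINT \<xi>|lborel. g \<xi> y) = f y * ((pi / t) powr (real DIM('a) / 2) * exp (- (norm (x - y))\<^sup>2 / (4 * t)))"
      by (simp only: gaussian_fourier(2)[OF t] of_real_mult)
  qed
  also have "\<dots> = (LINT y|lborel. (pi / t) powr (real DIM('a) / 2) * (exp (- (norm (x - y))\<^sup>2 / (4 * t)) * f y))"
    by (rule Bochner_Integration.integral_cong) (simp_all only: mult_ac of_real_mult)
  finally show ?thesis by (simp only: integral_mult_right_zero)
qed

section \<open>Elementary rules for the Fourier integral\<close>

lemma measurable_fourier_integral [measurable]:
  assumes [measurable]: "f \<in> borel_measurable borel"
  shows "fourier_integral f \<in> borel_measurable borel"
  unfolding fourier_integral_def[abs_def] by measurable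

lemma fourier_integral_integrable:
  assumes "integrable lborel f" shows "integrable lborel (\<lambda>x. cis (- (x \<bullet> \<xi>)) * f x)"
proof -
  have [measurable]: "f \<in> borel_measurable borel" using assms by auto
  have m: "(\<lambda>x. cis (- (x \<bullet> \<xi>)) * f x) \<in> borel_measurable lborel" by measurable
  show ?thesis by (rule Bochner_Integration.integrable_bound[OF assms m]) (auto simp: norm_mult)
qed

lemma fourier_integral_add:
  "integrable lborel f \<Longrightarrow> integrable lborel g \<Longrightarrow>
    fourier_integral (\<lambda>x. f x + g x) \<xi> = fourier_integral f \<xi> + fourier_integral g \<xi>"
  by (simp add: fourier_integral_def ring_distribs fourier_integral_integrable)

lemma fourier_integral_diff:
  "integrable lborel f \<Longrightarrow> integrable lborel g \<Longrightarrow>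
    fourier_integral (\<lambda>x. f x - g x) \<xi> = fourier_integral f \<xi> - fourier_integral g \<xi>"
  by (simp add: fourier_integral_def ring_distribs fourier_integral_integrable)

lemma fourier_integral_mult:
  "fourier_integral (\<lambda>x. c * f x) \<xi> = c * fourier_integral f \<xi>"
  by (simp add: fourier_integral_def mult.left_commute[of _ c])

lemma fourier_integral_cong_AE:
  assumes "AE x in lborel. f x = g x" "f \<in> borel_measurable borel" "g \<in> borel_measurable borel"
  shows "fourier_integral f \<xi> = fourier_integral g \<xi>"
proof -
  have [measurable]: "f \<in> borel_measurable borel" "g \<in> borel_measurable borel" by fact+
  have "(LINT x|lborel. cis (- (x \<bullet> \<xi>)) * f x) = (LINT x|lborel. cis (- (x \<bullet> \<xi>)) * g x)"
    by (rule integral_cong_AE; (measurable)?) (use assms(1) in \<open>auto elim: eventually_mono\<close>)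
  then show ?thesis by (simp add: fourier_integral_def)
qed

lemma norm_fourier_integral_le:
  "cmod (fourier_integral f \<xi>) \<le> (2 * pi) powr (- real DIM('a) / 2) * (LINT x|lborel. cmod (f (x::'a::euclidean_space)))"
proof -
  have "cmod (LINT x|lborel. cis (- (x \<bullet> \<xi>)) * f x) \<le> (LINT x|lborel. cmod (cis (- (x \<bullet> \<xi>)) * f x))"
    by (rule integral_norm_bound)
  then show ?thesis by (simp add: fourier_integral_def norm_mult mult_left_mono)
qed

text \<open>With \<open>n\<close> the dimension, the two normalising factors of the transform and
  the factor from \<open>gaussian_smoothing\<close> combine to the constant that gives the heat
  kernel at time \<open>t\<close> total mass 1.\<close>

lemma gaussian_constant:
  assumes "0 < t"
  shows "((2 * pi) powr (- n / 2))\<^sup>2 * (pi / t) powr (n / 2) = (4 * pi * t) powr (- n / 2)"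
proof -
  have "((2 * pi) powr (- n / 2))\<^sup>2 = ((2 * pi)\<^sup>2) powr (- n / 2)"
    unfolding power2_eq_square by (subst powr_mult) auto
  moreover have "(pi / t) powr (n / 2) = (t / pi) powr (- n / 2)"
    using assms powr_minus_divide[of "t / pi" "n / 2"] by (simp add: powr_divide)
  moreover have "(2 * pi)\<^sup>2 * (t / pi) = 4 * pi * t" by (simp add: power2_eq_square)
  ultimately show ?thesis using assms by (simp flip: powr_mult)
qed

text \<open>A Schur bound: the product of the two moduli is at most half the sum of their squares,
  and the Gaussian has the same total mass in either variable.\<close>

lemma gaussian_convolution_bound:
  fixes f :: "'a::euclidean_space \<Rightarrow> complex"
  assumes [measurable]: "f \<in> borel_measurable borel" and t: "0 < t"
  shows "(\<integral>\<^sup>+x. \<integral>\<^sup>+y. ennreal (cmod (f x) * cmod (f y) * exp (- (norm (x - y))\<^sup>2 / (4 * t))) \<partial>lborel \<partial>lborel)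
    \<le> ennreal ((4 * pi * t) powr (real DIM('a) / 2)) * (\<integral>\<^sup>+x. ennreal ((cmod (f x))\<^sup>2) \<partial>lborel)"
proof -
  define E where "E x = ennreal (exp (- (1 / (4 * t)) * (norm (x::'a))\<^sup>2))" for x
  have [measurable]: "E \<in> borel_measurable borel" unfolding E_def by measurable
  define c where "c = ennreal ((4 * pi * t) powr (real DIM('a) / 2))"
  have E: "(\<integral>\<^sup>+x. E x \<partial>lborel) = c"
    unfolding E_def c_def using gaussian_integral(3)[of "1 / (4 * t)", where 'a = 'a] t by (simp add: mult_ac)
  have E1: "(\<integral>\<^sup>+y. E (x - y) \<partial>lborel) = c" for x
    using nn_integral_affine[of E "-1" x] E by simp
  have E2: "(\<integral>\<^sup>+x. E (x - y) \<partial>lborel) = c" for y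
    using nn_integral_affine[of E 1 "- y"] E by simp
  have sq: "ennreal (a * b) \<le> ennreal (1/2) * (ennreal (a\<^sup>2) + ennreal (b\<^sup>2))" if "a \<ge> 0" "b \<ge> 0" for a b
  proof -
    have "a * b \<le> 1/2 * (a\<^sup>2 + b\<^sup>2)" using sum_squares_bound[of a b] by simp
    then have "ennreal (a * b) \<le> ennreal (1/2 * (a\<^sup>2 + b\<^sup>2))" by (rule ennreal_leI)
    then show ?thesis by (subst (asm) ennreal_mult) (auto simp: ennreal_plus[symmetric] simp del: ennreal_plus)
  qed
  have "(\<integral>\<^sup>+x. \<integral>\<^sup>+y. ennreal (cmod (f x) * cmod (f y) * exp (- (norm (x - y))\<^sup>2 / (4 * t))) \<partial>lborel \<partial>lborel)
    = (\<integral>\<^sup>+x. \<integral>\<^sup>+y. ennreal (cmod (f x) * cmod (f y)) * E (x - y) \<partial>lborel \<partial>lborel)"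
    by (simp add: E_def ennreal_mult' mult.commute)
  also have "\<dots> \<le> (\<integral>\<^sup>+x. \<integral>\<^sup>+y. ennreal (1/2) * (ennreal ((cmod (f x))\<^sup>2) + ennreal ((cmod (f y))\<^sup>2)) * E (x - y) \<partial>lborel \<partial>lborel)"
    by (intro nn_integral_mono mult_right_mono sq) auto
  also have "\<dots> = ennreal (1/2) * ((\<integral>\<^sup>+x. \<integral>\<^sup>+y. ennreal ((cmod (f x))\<^sup>2) * E (x - y) \<partial>lborel \<partial>lborel)
      + (\<integral>\<^sup>+x. \<integral>\<^sup>+y. ennreal ((cmod (f y))\<^sup>2) * E (x - y) \<partial>lborel \<partial>lborel))"
    by (simp add: mult.assoc distrib_right nn_integral_cmult nn_integral_add)
  also have "(\<integral>\<^sup>+x. \<integral>\<^sup>+y. ennreal ((cmod (f y))\<^sup>2) * E (x - y) \<partial>lborel \<partial>lborel)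
     = (\<integral>\<^sup>+y. \<integral>\<^sup>+x. ennreal ((cmod (f y))\<^sup>2) * E (x - y) \<partial>lborel \<partial>lborel)"
    by (rule lborel_pair.Fubini'[symmetric]) measurable
  also have "\<dots> = c * (\<integral>\<^sup>+x. ennreal ((cmod (f x))\<^sup>2) \<partial>lborel)"
    by (simp add: nn_integral_cmult E2 nn_integral_multc mult.commute)
  also have "(\<integral>\<^sup>+x. \<integral>\<^sup>+y. ennreal ((cmod (f x))\<^sup>2) * E (x - y) \<partial>lborel \<partial>lborel) = c * (\<integral>\<^sup>+x. ennreal ((cmod (f x))\<^sup>2) \<partial>lborel)"
    by (simp add: nn_integral_cmult E1 nn_integral_multc mult.commute)
  also have "ennreal (1/2) * (c * (\<integral>\<^sup>+x. ennreal ((cmod (f x))\<^sup>2) \<partial>lborel) + c * (\<integral>\<^sup>+x. ennreal ((cmod (f x))\<^sup>2) \<partial>lborel))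
     = c * (\<integral>\<^sup>+x. ennreal ((cmod (f x))\<^sup>2) \<partial>lborel)"
  proof -
    have "ennreal (1/2) * (a + a) = a" for a :: ennreal
    proof -
      have "ennreal (1/2) * (a + a) = (ennreal (1/2) + ennreal (1/2)) * a" by (simp add: algebra_simps)
      also have "ennreal (1/2) + ennreal (1/2) = 1" by (subst ennreal_plus[symmetric]) auto
      finally show ?thesis by simp
    qed
    then show ?thesis .
  qed
  finally show ?thesis by (simp add: c_def)
qed

text \<open>The inequality half of Plancherel's theorem. With a Gaussian damping factor the left
  side becomes a quadratic form in \<open>f\<close> whose kernel has mass 1, hence is at most the
  right side; Fatou removes the damping as \<open>t\<close> tends to 0. Equality is recovered later
  from the inversion formula.\<close>

lemma fourier_integral_contraction:
  fixes f :: "'a::euclidean_space \<Rightarrow> complex"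
  assumes f: "integrable lborel f" "square_integrable f"
  shows "(\<integral>\<^sup>+\<xi>. ennreal ((cmod (fourier_integral f \<xi>))\<^sup>2) \<partial>lborel) \<le> (\<integral>\<^sup>+x. ennreal ((cmod (f x))\<^sup>2) \<partial>lborel)"
proof -
  have [measurable]: "f \<in> borel_measurable borel" using f by auto
  define F where "F = fourier_integral f"
  have [measurable]: "F \<in> borel_measurable borel" unfolding F_def by measurable
  define c where "c = (2 * pi) powr (- real DIM('a) / 2)"
  define C where "C = c * (LINT x|lborel. cmod (f x))"
  have FC: "cmod (F \<xi>) \<le> C" for \<xi> unfolding F_def C_def c_def by (rule norm_fourier_integral_le)
  have C0: "0 \<le> C" by (rule order_trans[OF norm_ge_zero FC])
  have bound: "(\<integral>\<^sup>+\<xi>. ennreal (exp (- t * (norm \<xi>)\<^sup>2) * (cmod (F \<xi>))\<^sup>2) \<partial>lborel) \<le> (\<integral>\<^sup>+x. ennreal ((cmod (f x))\<^sup>2) \<partial>lborel)"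
    if t: "0 < t" for t
  proof -
    have int: "integrable lborel (\<lambda>\<xi>. exp (- t * (norm \<xi>)\<^sup>2) * (cmod (F \<xi>))\<^sup>2)"
    proof (rule Bochner_Integration.integrable_bound)
      show "integrable lborel (\<lambda>x::'a. C\<^sup>2 * exp (- t * (norm x)\<^sup>2))"
        by (rule integrable_mult_right[OF gaussian_integral(1)[OF t]])
      show "AE \<xi> in lborel. norm (exp (- t * (norm \<xi>)\<^sup>2) * (cmod (F \<xi>))\<^sup>2) \<le> norm (C\<^sup>2 * exp (- t * (norm \<xi>)\<^sup>2))"
        using FC by (intro AE_I2) (auto simp: mult.commute intro!: mult_right_mono power_mono)
    qed measurable
    \<comment> \<open>Only one factor \<open>F\<close> is expanded into its integral. The other is
      kept as a bounded function, so that the Gaussian suffices for Fubini.\<close>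
    define h where "h \<xi> x = exp (- t * (norm \<xi>)\<^sup>2) * cnj (F \<xi>) * (cis (- (x \<bullet> \<xi>)) * f x)" for \<xi> x :: 'a
    have [measurable]: "case_prod h \<in> borel_measurable (lborel \<Otimes>\<^sub>M lborel)" unfolding h_def[abs_def] by measurable
    have fin: "(\<integral>\<^sup>+\<xi>. \<integral>\<^sup>+x. norm (h \<xi> x) \<partial>lborel \<partial>lborel) < \<infinity>"
    proof -
      have "(\<integral>\<^sup>+\<xi>. \<integral>\<^sup>+x. norm (h \<xi> x) \<partial>lborel \<partial>lborel)
          = (\<integral>\<^sup>+\<xi>. ennreal (exp (- t * (norm \<xi>)\<^sup>2) * cmod (F \<xi>)) * (\<integral>\<^sup>+x. norm (f x) \<partial>lborel) \<partial>lborel)"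
        by (simp add: h_def norm_mult ennreal_mult' nn_integral_cmult)
      also have "\<dots> \<le> (\<integral>\<^sup>+\<xi>. ennreal (exp (- t * (norm (\<xi>::'a))\<^sup>2)) * ennreal C * (\<integral>\<^sup>+x. norm (f x) \<partial>lborel) \<partial>lborel)"
        using FC C0 by (intro nn_integral_mono mult_right_mono) (auto simp: ennreal_mult'[symmetric] intro!: ennreal_leI mult_left_mono)
      also have "\<dots> = ennreal ((pi / t) powr (real DIM('a) / 2)) * ennreal C * (\<integral>\<^sup>+x. norm (f x) \<partial>lborel)"
        by (simp only: mult.assoc gaussian_integral(3)[OF t, symmetric]) (rule nn_integral_multc, measurable)
      also have "\<dots> < \<infinity>" using f by (auto simp: ennreal_mult_less_top integrable_iff_bounded)
      finally show ?thesis .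
    qed
    have "complex_of_real (LINT \<xi>|lborel. exp (- t * (norm \<xi>)\<^sup>2) * (cmod (F \<xi>))\<^sup>2)
        = (LINT \<xi>|lborel. exp (- t * (norm \<xi>)\<^sup>2) * cnj (F \<xi>) * F \<xi>)"
      by (simp only: integral_complex_of_real[symmetric] of_real_mult complex_norm_square mult_ac)
    also have "\<dots> = c * (LINT \<xi>|lborel. LINT x|lborel. h \<xi> x)"
    proof -
      have "exp (- t * (norm \<xi>)\<^sup>2) * cnj (F \<xi>) * F \<xi> = c * (LINT x|lborel. h \<xi> x)" for \<xi>
        by (simp add: h_def F_def fourier_integral_def c_def)
      then show ?thesis by (simp only: integral_mult_right_zero)
    qed
    also have "(LINT \<xi>|lborel. LINT x|lborel. h \<xi> x) = (LINT x|lborel. LINT \<xi>|lborel. h \<xi> x)"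
      by (rule lborel_pair.Fubini_bounded(2)[OF _ fin, symmetric]) measurable
    also have "\<dots> = (LINT x|lborel. f x * (c * ((pi / t) powr (real DIM('a) / 2) * (LINT y|lborel. exp (- (norm (x - y))\<^sup>2 / (4 * t)) * cnj (f y)))))"
    proof (rule Bochner_Integration.integral_cong[OF refl])
      fix x
      have cF: "cnj (F \<xi>) = c * (LINT y|lborel. cis (y \<bullet> \<xi>) * cnj (f y))" for \<xi>
      proof -
        have "cnj (LINT y|lborel. cis (- (y \<bullet> \<xi>)) * f y) = (LINT y|lborel. cnj (cis (- (y \<bullet> \<xi>)) * f y))"
          by (rule Bochner_Integration.integral_cnj[symmetric])
        then show ?thesis by (simp add: F_def fourier_integral_def c_def cis_cnj)
      qed
      have "(LINT \<xi>|lborel. h \<xi> x)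
         = (LINT \<xi>|lborel. (f x * c) * (cis (- (x \<bullet> \<xi>)) * exp (- t * (norm \<xi>)\<^sup>2) * (LINT y|lborel. cis (y \<bullet> \<xi>) * cnj (f y))))"
        unfolding h_def cF by (rule Bochner_Integration.integral_cong) (simp_all only: mult_ac)
      also have "\<dots> = (f x * c) * ((pi / t) powr (real DIM('a) / 2) * (LINT y|lborel. exp (- (norm (x - y))\<^sup>2 / (4 * t)) * cnj (f y)))"
        using f by (subst integral_mult_right_zero, subst gaussian_smoothing[OF t]) auto
      finally show "(LINT \<xi>|lborel. h \<xi> x) = f x * (c * ((pi / t) powr (real DIM('a) / 2) * (LINT y|lborel. exp (- (norm (x - y))\<^sup>2 / (4 * t)) * cnj (f y))))"
        by (simp only: mult.assoc)
    qed
    also have "\<dots> = (LINT x|lborel. complex_of_real (c * (pi / t) powr (real DIM('a) / 2)) * (f x * (LINT y|lborel. exp (- (norm (x - y))\<^sup>2 / (4 * t)) * cnj (f y))))"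
      by (rule Bochner_Integration.integral_cong) (simp_all only: mult_ac of_real_mult)
    also have "\<dots> = complex_of_real (c * (pi / t) powr (real DIM('a) / 2)) * (LINT x|lborel. f x * (LINT y|lborel. exp (- (norm (x - y))\<^sup>2 / (4 * t)) * cnj (f y)))"
      by (rule integral_mult_right_zero)
    finally have I: "complex_of_real (LINT \<xi>|lborel. exp (- t * (norm \<xi>)\<^sup>2) * (cmod (F \<xi>))\<^sup>2)
       = of_real (c\<^sup>2 * (pi / t) powr (real DIM('a) / 2)) * (LINT x|lborel. f x * (LINT y|lborel. exp (- (norm (x - y))\<^sup>2 / (4 * t)) * cnj (f y)))"
      by (simp add: power2_eq_square mult.assoc)
    define K where "K = (LINT x|lborel. f x * (LINT y|lborel. exp (- (norm (x - y))\<^sup>2 / (4 * t)) * cnj (f y)))"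
    have "ennreal (cmod K) \<le> (\<integral>\<^sup>+x. \<integral>\<^sup>+y. ennreal (cmod (f x) * cmod (f y) * exp (- (norm (x - y))\<^sup>2 / (4 * t))) \<partial>lborel \<partial>lborel)"
    \<comment> \<open>If the outer integrand is not integrable, its Bochner integral is 0 and the
      bound is trivial.\<close>
    proof (cases "integrable lborel (\<lambda>x. f x * (LINT y|lborel. exp (- (norm (x - y))\<^sup>2 / (4 * t)) * cnj (f y)))")
      case True
      have "ennreal (cmod K) \<le> (\<integral>\<^sup>+x. ennreal (cmod (f x * (LINT y|lborel. exp (- (norm (x - y))\<^sup>2 / (4 * t)) * cnj (f y)))) \<partial>lborel)"
        unfolding K_def by (rule integral_norm_bound_ennreal[OF True])
      also have "\<dots> \<le> (\<integral>\<^sup>+x. ennreal (cmod (f x)) * (\<integral>\<^sup>+y. ennreal (cmod (f y) * exp (- (norm (x - y))\<^sup>2 / (4 * t))) \<partial>lborel) \<partial>lborel)"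
      proof (intro nn_integral_mono)
        fix x
        have "integrable lborel (\<lambda>y. exp (- (norm (x - y))\<^sup>2 / (4 * t)) * cnj (f y))"
        proof (rule Bochner_Integration.integrable_bound[OF f(1)])
          show "AE y in lborel. cmod (exp (- (norm (x - y))\<^sup>2 / (4 * t)) * cnj (f y)) \<le> cmod (f y)"
            using t by (intro AE_I2) (auto simp: norm_mult intro!: mult_left_le_one_le)
        qed measurable
        from integral_norm_bound_ennreal[OF this]
        have "ennreal (cmod (LINT y|lborel. exp (- (norm (x - y))\<^sup>2 / (4 * t)) * cnj (f y))) \<le> (\<integral>\<^sup>+y. ennreal (cmod (f y) * exp (- (norm (x - y))\<^sup>2 / (4 * t))) \<partial>lborel)"
          by (simp add: norm_mult mult.commute)
        then show "ennreal (cmod (f x * (LINT y|lborel. exp (- (norm (x - y))\<^sup>2 / (4 * t)) * cnj (f y))))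
          \<le> ennreal (cmod (f x)) * (\<integral>\<^sup>+y. ennreal (cmod (f y) * exp (- (norm (x - y))\<^sup>2 / (4 * t))) \<partial>lborel)"
          by (simp add: norm_mult ennreal_mult mult_left_mono)
      qed
      also have "\<dots> = (\<integral>\<^sup>+x. \<integral>\<^sup>+y. ennreal (cmod (f x) * cmod (f y) * exp (- (norm (x - y))\<^sup>2 / (4 * t))) \<partial>lborel \<partial>lborel)"
        by (subst nn_integral_cmult[symmetric]) (auto simp: ennreal_mult mult.assoc)
      finally show ?thesis .
    qed (simp add: K_def not_integrable_integral_eq)
    also have "\<dots> \<le> ennreal ((4 * pi * t) powr (real DIM('a) / 2)) * (\<integral>\<^sup>+x. ennreal ((cmod (f x))\<^sup>2) \<partial>lborel)"
      by (rule gaussian_convolution_bound) (use t in measurable)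
    finally have K: "ennreal (cmod K) \<le> ennreal ((4 * pi * t) powr (real DIM('a) / 2)) * (\<integral>\<^sup>+x. ennreal ((cmod (f x))\<^sup>2) \<partial>lborel)" .
    have cc: "c\<^sup>2 * (pi / t) powr (real DIM('a) / 2) = (4 * pi * t) powr (- real DIM('a) / 2)"
      unfolding c_def by (rule gaussian_constant[OF t])
    have pos: "0 \<le> (LINT \<xi>|lborel. exp (- t * (norm \<xi>)\<^sup>2) * (cmod (F \<xi>))\<^sup>2)" by (rule integral_nonneg_AE) simp
    have "(\<integral>\<^sup>+\<xi>. ennreal (exp (- t * (norm \<xi>)\<^sup>2) * (cmod (F \<xi>))\<^sup>2) \<partial>lborel) = ennreal (LINT \<xi>|lborel. exp (- t * (norm \<xi>)\<^sup>2) * (cmod (F \<xi>))\<^sup>2)"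
      by (rule nn_integral_eq_integral[OF int]) auto
    also have "(LINT \<xi>|lborel. exp (- t * (norm \<xi>)\<^sup>2) * (cmod (F \<xi>))\<^sup>2) = cmod (complex_of_real (LINT \<xi>|lborel. exp (- t * (norm \<xi>)\<^sup>2) * (cmod (F \<xi>))\<^sup>2))"
      by (simp only: norm_of_real abs_of_nonneg[OF pos])
    also have "\<dots> = (4 * pi * t) powr (- real DIM('a) / 2) * cmod K"
      unfolding I K_def[symmetric] cc by (simp add: norm_mult)
    also have "ennreal \<dots> \<le> ennreal ((4 * pi * t) powr (- real DIM('a) / 2)) * (ennreal ((4 * pi * t) powr (real DIM('a) / 2)) * (\<integral>\<^sup>+x. ennreal ((cmod (f x))\<^sup>2) \<partial>lborel))"
      by (subst ennreal_mult) (auto intro: mult_left_mono K)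
    also have "\<dots> = (\<integral>\<^sup>+x. ennreal ((cmod (f x))\<^sup>2) \<partial>lborel)"
    proof -
      have "(4 * pi * t) powr (- real DIM('a) / 2) * (4 * pi * t) powr (real DIM('a) / 2) = 1"
        using t by (subst powr_add[symmetric]) simp
      then show ?thesis by (simp only: mult.assoc[symmetric] ennreal_mult[symmetric] powr_ge_zero ennreal_1 mult_1)
    qed
    finally show ?thesis .
  qed
  have "(\<integral>\<^sup>+\<xi>. ennreal ((cmod (F \<xi>))\<^sup>2) \<partial>lborel)
    = (\<integral>\<^sup>+\<xi>. liminf (\<lambda>n. ennreal (exp (- (inverse (real (Suc n))) * (norm \<xi>)\<^sup>2) * (cmod (F \<xi>))\<^sup>2)) \<partial>lborel)"
  proof (rule nn_integral_cong)
    fix \<xi>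
    have "(\<lambda>n. ennreal (exp (- (inverse (real (Suc n))) * (norm \<xi>)\<^sup>2) * (cmod (F \<xi>))\<^sup>2)) \<longlonglongrightarrow> ennreal (exp (- 0 * (norm \<xi>)\<^sup>2) * (cmod (F \<xi>))\<^sup>2)"
      by (intro tendsto_intros LIMSEQ_inverse_real_of_nat)
    then show "ennreal ((cmod (F \<xi>))\<^sup>2) = liminf (\<lambda>n. ennreal (exp (- (inverse (real (Suc n))) * (norm \<xi>)\<^sup>2) * (cmod (F \<xi>))\<^sup>2))"
      unfolding minus_zero mult_zero_left exp_zero mult_1
      by (rule lim_imp_Liminf[OF trivial_limit_sequentially, symmetric])
  qed
  also have "\<dots> \<le> liminf (\<lambda>n. \<integral>\<^sup>+\<xi>. ennreal (exp (- (inverse (real (Suc n))) * (norm \<xi>)\<^sup>2) * (cmod (F \<xi>))\<^sup>2) \<partial>lborel)"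
    by (rule nn_integral_liminf) measurable
  also have "\<dots> \<le> liminf (\<lambda>n::nat. \<integral>\<^sup>+x. ennreal ((cmod (f x))\<^sup>2) \<partial>lborel)"
    by (intro Liminf_mono always_eventually allI bound) auto
  also have "\<dots> = (\<integral>\<^sup>+x. ennreal ((cmod (f x))\<^sup>2) \<partial>lborel)" by (simp add: Liminf_const)
  finally show ?thesis unfolding F_def .
qed

lemma square_integrable_fourier_integral:
  assumes "integrable lborel f" "square_integrable f"
  shows "square_integrable (fourier_integral f)"
proof (rule square_integrableI_nn)
  have [measurable]: "f \<in> borel_measurable borel" using assms by auto
  show "fourier_integral f \<in> borel_measurable lborel" by measurable
  show "(\<integral>\<^sup>+x. ennreal ((cmod (fourier_integral f x))\<^sup>2) \<partial>lborel) < \<infinity>"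
    using fourier_integral_contraction[OF assms] nn_integral_to_Ltwo[OF assms(2)] order_le_less_trans by fastforce
qed

lemma norm_to_Ltwo_fourier_integral_le:
  assumes "integrable lborel f" "square_integrable f"
  shows "norm (to_Ltwo (fourier_integral f)) \<le> norm (to_Ltwo f)"
proof -
  have "ennreal ((norm (to_Ltwo (fourier_integral f)))\<^sup>2) \<le> ennreal ((norm (to_Ltwo f))\<^sup>2)"
    using fourier_integral_contraction[OF assms]
    by (simp add: nn_integral_to_Ltwo assms square_integrable_fourier_integral)
  then show ?thesis by (subst (asm) ennreal_le_iff) (auto intro: power2_le_imp_le)
qed

section \<open>The Plancherel transform as a limit in \<open>Ltwo\<close>\<close>

definition fourier_trunc :: "real \<Rightarrow> 'a::euclidean_space Ltwo \<Rightarrow> 'a Ltwo" where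
  "fourier_trunc R u = to_Ltwo (fourier_integral (\<lambda>x. indicator (cball 0 R) x * repr u x))"

lemma norm_diff_fourier_integral_le:
  assumes "integrable lborel f" "square_integrable f" "integrable lborel g" "square_integrable g"
  shows "norm (to_Ltwo (fourier_integral f) - to_Ltwo (fourier_integral g)) \<le> norm (to_Ltwo f - to_Ltwo g)"
proof -
  have "to_Ltwo (fourier_integral f) - to_Ltwo (fourier_integral g) = to_Ltwo (fourier_integral (\<lambda>x. f x - g x))"
    using assms by (subst to_Ltwo_diff[symmetric])
      (auto simp: square_integrable_fourier_integral fourier_integral_diff fun_eq_iff intro!: arg_cong[where f = to_Ltwo])
  also have "norm \<dots> \<le> norm (to_Ltwo (\<lambda>x. f x - g x))"
    using assms by (intro norm_to_Ltwo_fourier_integral_le) (auto intro: square_integrable_diff)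
  finally show ?thesis using assms by (simp add: to_Ltwo_diff)
qed

lemma fourier_trunc_diff: "norm (fourier_trunc R u - fourier_trunc R' u) \<le> norm (trunc R u - trunc R' u)"
  unfolding fourier_trunc_def trunc_def fmul_def
  by (intro norm_diff_fourier_integral_le square_integrable_trunc integrable_trunc)

text \<open>\<open>fourier\<close> is given by \<open>Lim\<close>, which says nothing until
  convergence is known. The contraction property transfers the Cauchy property from truncations to
  their transforms, and completeness provides a limit.\<close>

lemma fourier_trunc_tendsto: "((\<lambda>R. fourier_trunc R u) \<longlongrightarrow> fourier u) at_top"
proof -
  have "Cauchy (\<lambda>n. fourier_trunc (real n) u)"
  proof (rule CauchyI)
    fix e :: real assume "e > 0"
    then obtain M where "\<forall>m\<ge>M. \<forall>n\<ge>M. norm (trunc (real m) u - trunc (real n) u) < e"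
      using LIMSEQ_imp_Cauchy[OF trunc_tendsto[of u]] unfolding Cauchy_iff by blast
    then show "\<exists>M. \<forall>m\<ge>M. \<forall>n\<ge>M. norm (fourier_trunc (real m) u - fourier_trunc (real n) u) < e"
      by (intro exI[of _ M] allI impI order_le_less_trans[OF fourier_trunc_diff]) blast
  qed
  then obtain L where L: "(\<lambda>n. fourier_trunc (real n) u) \<longlonglongrightarrow> L"
    by (blast dest: Cauchy_convergent convergentD)
  \<comment> \<open>Sending the integer radius to infinity leaves an estimate for every real
    \<open>R\<close>, which is what the filter in \<open>fourier\<close> requires.\<close>
  have le: "norm (fourier_trunc R u - L) \<le> norm (trunc R u - u)" for R
  proof (rule LIMSEQ_le)
    show "(\<lambda>n. norm (fourier_trunc R u - fourier_trunc (real n) u)) \<longlonglongrightarrow> norm (fourier_trunc R u - L)"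
      by (intro tendsto_intros L)
    show "(\<lambda>n. norm (trunc R u - trunc (real n) u)) \<longlonglongrightarrow> norm (trunc R u - u)"
      by (intro tendsto_intros trunc_tendsto)
  qed (auto intro: fourier_trunc_diff)
  have "((\<lambda>R. norm (trunc R u - u)) \<longlongrightarrow> 0) at_top"
    using tendsto_norm[OF tendsto_diff[OF trunc_tendsto_at_top[of u] tendsto_const[of u]]] by simp
  then have "((\<lambda>R. fourier_trunc R u - L) \<longlongrightarrow> 0) at_top"
    by (rule Lim_null_comparison[rotated]) (use le in simp)
  then have *: "((\<lambda>R. fourier_trunc R u) \<longlongrightarrow> L) at_top" by (simp add: LIM_zero_iff)
  then have "fourier u = L"
    unfolding fourier_def fourier_trunc_def by (intro tendsto_Lim) auto
  with * show ?thesis by simp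
qed

text \<open>The difference to the truncated transforms is controlled by the contraction property.
  Together with \<open>Ltwo_continuous_ext\<close> this reduces identities for
  \<open>fourier\<close> to identities between ordinary integrals.\<close>

lemma fourier_to_Ltwo:
  assumes "integrable lborel f" "square_integrable f"
  shows "fourier (to_Ltwo f) = to_Ltwo (fourier_integral f)"
proof -
  have le: "norm (fourier_trunc R (to_Ltwo f) - to_Ltwo (fourier_integral f)) \<le> norm (trunc R (to_Ltwo f) - to_Ltwo f)" for R
  proof -
    have "trunc R (to_Ltwo f) = to_Ltwo (\<lambda>x. indicator (cball 0 R) x * repr (to_Ltwo f) x)"
      by (simp add: trunc_def fmul_def)
    then show ?thesis unfolding fourier_trunc_def
      using norm_diff_fourier_integral_le[OF integrable_trunc square_integrable_trunc assms, of R "to_Ltwo f"] by simp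
  qed
  have lim: "((\<lambda>R. norm (trunc R (to_Ltwo f) - to_Ltwo f)) \<longlongrightarrow> 0) at_top"
    using tendsto_norm[OF tendsto_diff[OF trunc_tendsto_at_top[of "to_Ltwo f"] tendsto_const[of "to_Ltwo f"]]] by simp
  have "((\<lambda>R. fourier_trunc R (to_Ltwo f) - to_Ltwo (fourier_integral f)) \<longlongrightarrow> 0) at_top"
    by (rule Lim_null_comparison[OF always_eventually[OF allI[OF le]] lim])
  then have "((\<lambda>R. fourier_trunc R (to_Ltwo f)) \<longlongrightarrow> to_Ltwo (fourier_integral f)) at_top" by (simp add: LIM_zero_iff)
  then show ?thesis by (rule tendsto_unique[OF trivial_limit_at_top_linorder fourier_trunc_tendsto])
qed

lemma norm_fourier_le: "norm (fourier u) \<le> norm u"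
proof (rule tendsto_upperbound)
  show "((\<lambda>R. norm (fourier_trunc R u)) \<longlongrightarrow> norm (fourier u)) at_top"
    by (intro tendsto_norm fourier_trunc_tendsto)
  have "norm (fourier_trunc R u) \<le> 1 * norm u" for R
  proof -
    have "norm (fourier_trunc R u) \<le> norm (trunc R u)"
      unfolding fourier_trunc_def trunc_def fmul_def
      by (intro norm_to_Ltwo_fourier_integral_le integrable_trunc square_integrable_trunc)
    also have "\<dots> \<le> 1 * norm u" unfolding trunc_def
      by (intro norm_fmul_le borel_measurable_indicator) (auto simp: indicator_def)
    finally show ?thesis .
  qed
  then show "\<forall>\<^sub>F R in at_top. norm (fourier_trunc R u) \<le> norm u" by simp
qed auto

lemma bounded_linear_fourier: "bounded_linear (fourier :: 'a::euclidean_space Ltwo \<Rightarrow> 'a Ltwo)"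
proof (rule bounded_linear_intro[where K = 1])
  fix u v :: "'a Ltwo" and r :: real
  have add: "fourier_trunc R (u + v) = fourier_trunc R u + fourier_trunc R v" for R
  proof -
    have "fourier_integral (\<lambda>x. indicator (cball 0 R) x * repr (u + v) x) \<xi>
        = fourier_integral (\<lambda>x. indicator (cball 0 R) x * repr u x + indicator (cball 0 R) x * repr v x) \<xi>" for \<xi>
      using AE_plus_Ltwo[of u v]
      by (intro fourier_integral_cong_AE borel_measurable_add borel_measurable_times borel_measurable_indicator)
         (auto simp: distrib_left elim: eventually_mono)
    then show ?thesis unfolding fourier_trunc_def
      by (subst to_Ltwo_add[symmetric])
        (auto simp: square_integrable_fourier_integral integrable_trunc square_integrable_trunc fourier_integral_add fun_eq_iff intro!: arg_cong[where f = to_Ltwo])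
  qed
  have "((\<lambda>R. fourier_trunc R u + fourier_trunc R v) \<longlongrightarrow> fourier u + fourier v) at_top"
    by (intro tendsto_add fourier_trunc_tendsto)
  then show "fourier (u + v) = fourier u + fourier v"
    by (rule tendsto_unique[OF trivial_limit_at_top_linorder fourier_trunc_tendsto[of "u + v", unfolded add]])
  have scale: "fourier_trunc R (r *\<^sub>R u) = r *\<^sub>R fourier_trunc R u" for R
  proof -
    have "fourier_integral (\<lambda>x. indicator (cball 0 R) x * repr (r *\<^sub>R u) x) \<xi>
        = fourier_integral (\<lambda>x. of_real r * (indicator (cball 0 R) x * repr u x)) \<xi>" for \<xi>
      using AE_scaleR_Ltwo[of r u]
      by (intro fourier_integral_cong_AE borel_measurable_times borel_measurable_indicator)
         (auto simp: scaleR_conv_of_real elim: eventually_mono)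
    then have "fourier_trunc R (r *\<^sub>R u) = to_Ltwo (\<lambda>\<xi>. of_real r * fourier_integral (\<lambda>x. indicator (cball 0 R) x * repr u x) \<xi>)"
      unfolding fourier_trunc_def by (intro arg_cong[where f = to_Ltwo] ext) (simp add: fourier_integral_mult)
    also have "\<dots> = scaleC (of_real r) (fourier_trunc R u)"
      unfolding fourier_trunc_def by (intro to_Ltwo_mult square_integrable_fourier_integral integrable_trunc square_integrable_trunc)
    finally show ?thesis by (simp add: scaleC_of_real)
  qed
  have "((\<lambda>R. r *\<^sub>R fourier_trunc R u) \<longlongrightarrow> r *\<^sub>R fourier u) at_top"
    by (intro tendsto_intros fourier_trunc_tendsto)
  then show "fourier (r *\<^sub>R u) = r *\<^sub>R fourier u"
    by (rule tendsto_unique[OF trivial_limit_at_top_linorder fourier_trunc_tendsto[of "r *\<^sub>R u", unfolded scale]])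
qed (simp add: norm_fourier_le)

lemma isCont_bounded_linear: "bounded_linear f \<Longrightarrow> isCont f x"
  by (rule linear_continuous_at)

lemma fourier_scaleC: "fourier (scaleC c u) = scaleC c (fourier u)"
proof (rule Ltwo_continuous_ext[where f = "\<lambda>u. fourier (scaleC c u)" and g = "\<lambda>u. scaleC c (fourier u)"])
  show "isCont (\<lambda>u. fourier (scaleC c u)) u" "isCont (\<lambda>u. scaleC c (fourier u)) u" for u :: "'a Ltwo"
    by (intro isCont_bounded_linear bounded_linear_compose[OF bounded_linear_fourier bounded_linear_scaleC]
        bounded_linear_compose[OF bounded_linear_scaleC bounded_linear_fourier])+
  fix h :: "'a \<Rightarrow> complex" assume h: "square_integrable h" "integrable lborel h"
  then show "fourier (scaleC c (to_Ltwo h)) = scaleC c (fourier (to_Ltwo h))"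
    using fourier_to_Ltwo[of "\<lambda>x. c * h x"]
    by (simp add: square_integrable_mult fourier_integral_mult[abs_def] to_Ltwo_mult fourier_to_Ltwo square_integrable_fourier_integral)
qed

text \<open>Both sides are continuous in \<open>u\<close>, so it suffices to substitute in the
  integral of an integrable representative.\<close>

lemma fourier_transl: "fourier (transl h u) = fmul (\<lambda>\<xi>. cis (h \<bullet> \<xi>)) (fourier u)"
proof (rule Ltwo_continuous_ext[where f = "\<lambda>u. fourier (transl h u)" and g = "\<lambda>u. fmul (\<lambda>\<xi>. cis (h \<bullet> \<xi>)) (fourier u)"])
  have bm: "bounded_multiplier (\<lambda>\<xi>. cis (h \<bullet> \<xi>))" by (rule bounded_multiplierI[where B = 1]) auto
  show "isCont (\<lambda>u. fourier (transl h u)) u" "isCont (\<lambda>u. fmul (\<lambda>\<xi>. cis (h \<bullet> \<xi>)) (fourier u)) u" for u :: "'a Ltwo"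
    by (intro isCont_bounded_linear bounded_linear_compose[OF bounded_linear_fourier bounded_linear_transl]
        bounded_linear_compose[OF bounded_linear_fmul[OF bm] bounded_linear_fourier])+
  fix f :: "'a \<Rightarrow> complex" assume f: "square_integrable f" "integrable lborel f"
  have "fourier_integral (\<lambda>x. f (h + x)) \<xi> = cis (h \<bullet> \<xi>) * fourier_integral f \<xi>" for \<xi>
  proof -
    have "(LINT x|lborel. cis (- (x \<bullet> \<xi>)) * f x) = (LINT x|lborel. cis (- ((h + x) \<bullet> \<xi>)) * f (h + x))"
      by (rule integral_translate)
    also have "\<dots> = (LINT x|lborel. cis (- (h \<bullet> \<xi>)) * (cis (- (x \<bullet> \<xi>)) * f (h + x)))"
    proof -
      have e: "cis (- ((h + x) \<bullet> \<xi>)) = cis (- (h \<bullet> \<xi>)) * cis (- (x \<bullet> \<xi>))" for x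
        by (simp add: cis_mult inner_add_left)
      show ?thesis by (simp only: e mult.assoc)
    qed
    also have "\<dots> = cis (- (h \<bullet> \<xi>)) * (LINT x|lborel. cis (- (x \<bullet> \<xi>)) * f (h + x))"
      by (rule integral_mult_right_zero)
    finally have "cis (h \<bullet> \<xi>) * (LINT x|lborel. cis (- (x \<bullet> \<xi>)) * f x) = (LINT x|lborel. cis (- (x \<bullet> \<xi>)) * f (h + x))"
      by (simp add: cis_mult flip: mult.assoc)
    then show ?thesis by (simp add: fourier_integral_def mult.left_commute)
  qed
  moreover have "integrable lborel (\<lambda>x. f (h + x))"
    using integrable_affine_iff[of 1 f h] f by simp
  ultimately show "fourier (transl h (to_Ltwo f)) = fmul (\<lambda>\<xi>. cis (h \<bullet> \<xi>)) (fourier (to_Ltwo f))"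
    using f by (simp add: transl_to_Ltwo fourier_to_Ltwo square_integrable_translate fmul_to_Ltwo[OF bm]
        square_integrable_fourier_integral fun_eq_iff arg_cong[where f = to_Ltwo] cong: to_Ltwo_cong_AE)
qed

lemma fourier_modulate: "fourier (fmul (\<lambda>x. cis (- (x \<bullet> h))) u) = transl h (fourier u)"
proof (rule Ltwo_continuous_ext[where f = "\<lambda>u. fourier (fmul (\<lambda>x. cis (- (x \<bullet> h))) u)" and g = "\<lambda>u. transl h (fourier u)"])
  have bm: "bounded_multiplier (\<lambda>x. cis (- (x \<bullet> h)))" by (rule bounded_multiplierI[where B = 1]) auto
  show "isCont (\<lambda>u. fourier (fmul (\<lambda>x. cis (- (x \<bullet> h))) u)) u" "isCont (\<lambda>u. transl h (fourier u)) u" for u :: "'a Ltwo"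
    by (intro isCont_bounded_linear bounded_linear_compose[OF bounded_linear_transl bounded_linear_fourier]
        bounded_linear_compose[OF bounded_linear_fourier bounded_linear_fmul[OF bm]])+
  fix f :: "'a \<Rightarrow> complex" assume f: "square_integrable f" "integrable lborel f"
  have "fourier_integral (\<lambda>x. cis (- (x \<bullet> h)) * f x) \<xi> = fourier_integral f (h + \<xi>)" for \<xi>
  proof -
    have e: "cis (- (x \<bullet> \<xi>)) * (cis (- (x \<bullet> h)) * f x) = cis (- (x \<bullet> (h + \<xi>))) * f x" for x
      by (simp add: cis_mult inner_add_right add.commute flip: mult.assoc)
    show ?thesis unfolding fourier_integral_def e ..
  qed
  then have "fourier_integral (\<lambda>x. cis (- (x \<bullet> h)) * f x) = (\<lambda>\<xi>. fourier_integral f (h + \<xi>))" by (rule ext)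
  then show "fourier (fmul (\<lambda>x. cis (- (x \<bullet> h))) (to_Ltwo f)) = transl h (fourier (to_Ltwo f))"
    using f by (simp add: transl_to_Ltwo fourier_to_Ltwo fmul_to_Ltwo[OF bm] square_integrable_multiplier[OF bm]
        fourier_integral_integrable square_integrable_fourier_integral)
qed

text \<open>Heat kernels regularise \<open>fourier (to_Ltwo f)\<close> so that its inverse transform is an absolutely
  convergent integral; the limit is identified weakly, by testing against test functions.\<close>

lemma heat_kernel_tendsto:
  fixes \<phi> :: "'a::euclidean_space \<Rightarrow> real"
  assumes cont: "continuous_on UNIV \<phi>" and bd: "\<And>x. \<bar>\<phi> x\<bar> \<le> B"
    and t: "\<And>n. 0 < t n" "t \<longlonglongrightarrow> 0"
  shows "(\<lambda>n. (4 * pi * t n) powr (- real DIM('a) / 2) * (LINT y|lborel. exp (- (norm (x - y))\<^sup>2 / (4 * t n)) * \<phi> y)) \<longlonglongrightarrow> \<phi> x"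
proof -
  have [measurable]: "\<phi> \<in> borel_measurable borel" by (rule borel_measurable_continuous_onI[OF cont])
  have B0: "0 \<le> B" using bd[of 0] by linarith
  \<comment> \<open>The substitution \<open>y = x + 2 * sqrt (t n) * z\<close> freezes the Gaussian
    and moves the time dependence into the argument of \<open>\<phi>\<close>, where continuity
    applies.\<close>
  have eq: "(4 * pi * t n) powr (- real DIM('a) / 2) * (LINT y|lborel. exp (- (norm (x - y))\<^sup>2 / (4 * t n)) * \<phi> y)
      = pi powr (- real DIM('a) / 2) * (LINT z|lborel. exp (- 1 * (norm z)\<^sup>2) * \<phi> (x + (2 * sqrt (t n)) *\<^sub>R z))" for n
  proof -
    let ?c = "2 * sqrt (t n)"
    have c: "?c > 0" using t(1)[of n] by simp
    have "(LINT y|lborel. exp (- (norm (x - y))\<^sup>2 / (4 * t n)) * \<phi> y)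
        = \<bar>?c\<bar> ^ DIM('a) *\<^sub>R (LINT z|lborel. exp (- (norm (x - (x + ?c *\<^sub>R z)))\<^sup>2 / (4 * t n)) * \<phi> (x + ?c *\<^sub>R z))"
      using c by (intro integral_affine) simp
    also have "\<bar>?c\<bar> ^ DIM('a) = ?c powr real DIM('a)" using c by (simp add: powr_realpow)
    also have "\<dots> = (4 * t n) powr (real DIM('a) / 2)"
    proof -
      have "?c = (4 * t n) powr (1/2)" using t(1)[of n] by (simp add: powr_half_sqrt real_sqrt_mult)
      then show ?thesis by (simp only: powr_powr) simp
    qed
    also have "(\<lambda>z. exp (- (norm (x - (x + ?c *\<^sub>R z)))\<^sup>2 / (4 * t n)) * \<phi> (x + ?c *\<^sub>R z)) = (\<lambda>z. exp (- 1 * (norm z)\<^sup>2) * \<phi> (x + ?c *\<^sub>R z))"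
      using t(1)[of n] by (auto simp: fun_eq_iff power_mult_distrib)
    finally have "(LINT y|lborel. exp (- (norm (x - y))\<^sup>2 / (4 * t n)) * \<phi> y) = (4 * t n) powr (real DIM('a) / 2) * (LINT z|lborel. exp (- 1 * (norm z)\<^sup>2) * \<phi> (x + ?c *\<^sub>R z))"
      by simp
    moreover have "(4 * pi * t n) powr (- real DIM('a) / 2) * (4 * t n) powr (real DIM('a) / 2) = pi powr (- real DIM('a) / 2)"
    proof -
      have "(4 * pi * t n) powr (- real DIM('a) / 2) = pi powr (- real DIM('a) / 2) * (4 * t n) powr (- real DIM('a) / 2)"
        using t(1)[of n] by (subst powr_mult[symmetric]) (auto simp: mult_ac)
      moreover have "(4 * t n) powr (- real DIM('a) / 2) * (4 * t n) powr (real DIM('a) / 2) = 1"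
        using t(1)[of n] by (subst powr_add[symmetric]) simp
      ultimately show ?thesis by (simp only: mult.assoc mult_1_right)
    qed
    ultimately show ?thesis by (simp only: mult.assoc[symmetric])
  qed
  have "(\<lambda>n. LINT z|lborel. exp (- 1 * (norm z)\<^sup>2) * \<phi> (x + (2 * sqrt (t n)) *\<^sub>R z)) \<longlonglongrightarrow> (LINT z|(lborel::'a measure). exp (- 1 * (norm z)\<^sup>2) * \<phi> x)"
  proof (rule integral_dominated_convergence)
    show "integrable lborel (\<lambda>z::'a. exp (- 1 * (norm z)\<^sup>2) * B)"
      by (rule integrable_mult_left) (rule gaussian_integral, simp)
    have "(\<lambda>n. x + (2 * sqrt (t n)) *\<^sub>R z) \<longlonglongrightarrow> x + (2 * sqrt 0) *\<^sub>R z" for z :: 'a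
      by (intro tendsto_intros t)
    then have "(\<lambda>n. \<phi> (x + (2 * sqrt (t n)) *\<^sub>R z)) \<longlonglongrightarrow> \<phi> x" for z
      using cont by (intro isCont_tendsto_compose[where g = \<phi>]) (auto simp: continuous_on_eq_continuous_at)
    then show "AE z in lborel. (\<lambda>n. exp (- 1 * (norm z)\<^sup>2) * \<phi> (x + (2 * sqrt (t n)) *\<^sub>R z)) \<longlonglongrightarrow> exp (- 1 * (norm z)\<^sup>2) * \<phi> x"
      by (intro AE_I2 tendsto_intros)
    show "AE z in lborel. norm (exp (- 1 * (norm z)\<^sup>2) * \<phi> (x + (2 * sqrt (t n)) *\<^sub>R z)) \<le> exp (- 1 * (norm z)\<^sup>2) * B" for n
      using bd by (intro AE_I2) (auto simp: abs_mult)
  qed measurable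
  also have "(LINT z|(lborel::'a measure). exp (- 1 * (norm z)\<^sup>2) * \<phi> x) = pi powr (real DIM('a) / 2) * \<phi> x"
    using gaussian_integral(2)[of 1, where 'a = 'a] by simp
  finally have "(\<lambda>n. pi powr (- real DIM('a) / 2) * (LINT z|lborel. exp (- 1 * (norm z)\<^sup>2) * \<phi> (x + (2 * sqrt (t n)) *\<^sub>R z)))
     \<longlonglongrightarrow> pi powr (- real DIM('a) / 2) * (pi powr (real DIM('a) / 2) * \<phi> x)"
    by (rule tendsto_mult_left)
  also have "pi powr (- real DIM('a) / 2) * (pi powr (real DIM('a) / 2) * \<phi> x) = \<phi> x"
    by (simp add: powr_add[symmetric] flip: mult.assoc)
  finally show ?thesis unfolding eq .
qed

lemma test_function_props:
  fixes \<phi> :: "'a::euclidean_space \<Rightarrow> real"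
  assumes "test_function \<phi>"
  shows "continuous_on UNIV \<phi>" "\<exists>B. \<forall>x. \<bar>\<phi> x\<bar> \<le> B" "integrable lborel \<phi>"
    "square_integrable (\<lambda>x. complex_of_real (\<phi> x))"
proof -
  have "Ck 0 \<phi>" using assms by (simp add: test_function_def)
  then show c: "continuous_on UNIV \<phi>" by simp
  then have [measurable]: "\<phi> \<in> borel_measurable borel" by (rule borel_measurable_continuous_onI)
  let ?K = "closure {x. \<phi> x \<noteq> 0}"
  have K: "compact ?K" using assms by (simp add: test_function_def)
  have "bounded (\<phi> ` ?K)" by (intro compact_imp_bounded compact_continuous_image continuous_on_subset[OF c] K) auto
  then obtain B where B: "\<And>x. x \<in> ?K \<Longrightarrow> \<bar>\<phi> x\<bar> \<le> B" by (auto simp: bounded_iff)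
  have z: "x \<notin> ?K \<Longrightarrow> \<phi> x = 0" for x using closure_subset[of "{x. \<phi> x \<noteq> 0}"] by auto
  have B': "\<bar>\<phi> x\<bar> \<le> max 0 B" for x using B[of x] z[of x] by (cases "x \<in> ?K") auto
  then show "\<exists>B. \<forall>x. \<bar>\<phi> x\<bar> \<le> B" by blast
  have fin: "integrable lborel (\<lambda>x. c * indicator ?K x :: real)" for c
    using emeasure_compact_finite[OF K] K
    by (intro integrable_mult_right integrable_real_indicator) (auto intro: compact_imp_closed)
  have "\<bar>\<phi> x\<bar> \<le> max 0 B * indicator ?K x" for x
    using B'[of x] z[of x] by (cases "x \<in> ?K") simp_all
  then have "AE x in lborel. norm (\<phi> x) \<le> norm (max 0 B * indicator ?K x :: real)"
    by (intro AE_I2) (simp add: order_trans[OF _ abs_ge_self])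
  then show "integrable lborel \<phi>"
    by (rule Bochner_Integration.integrable_bound[OF fin[of "max 0 B"], rotated]) measurable
  have "integrable lborel (\<lambda>x. (\<phi> x)\<^sup>2)"
  proof (rule Bochner_Integration.integrable_bound[OF fin[of "(max 0 B)\<^sup>2"]])
    have "(\<phi> x)\<^sup>2 \<le> (max 0 B)\<^sup>2" for x using power_mono[OF B'[of x], of 2] by simp
    then have "(\<phi> x)\<^sup>2 \<le> (max 0 B)\<^sup>2 * indicator ?K x" for x
      using z[of x] by (cases "x \<in> ?K") simp_all
    then show "AE x in lborel. norm ((\<phi> x)\<^sup>2) \<le> norm ((max 0 B)\<^sup>2 * indicator ?K x :: real)"
      by (intro AE_I2) (simp add: order_trans[OF _ abs_ge_self])
  qed measurable
  then show "square_integrable (\<lambda>x. complex_of_real (\<phi> x))"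
    unfolding square_integrable_def by simp
qed

lemma Ltwo_test_function_separation:
  assumes "\<And>\<phi>. test_function \<phi> \<Longrightarrow>
    (LINT x|lborel. repr u x * complex_of_real (\<phi> x)) = (LINT x|lborel. repr v x * complex_of_real (\<phi> x))"
  shows "u = v"
proof -
  have "AE x in lborel. repr u x - repr v x = 0"
  proof (rule test_function_separation)
    have "integrable lborel (\<lambda>x. indicator (box a b) x * (repr u x - repr v x))" for a b
      by (rule integrable_indicator_square_integrable[OF square_integrable_diff _ emeasure_bounded_finite[OF bounded_box]]) auto
    then show "integrable lborel (\<lambda>x. indicator (box a b) x *\<^sub>R (repr u x - repr v x))" for a b
      by (simp only: scaleR_conv_of_real of_real_indicator)
    fix \<phi> :: "'a \<Rightarrow> real" assume \<phi>: "test_function \<phi>"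
    have "integrable lborel (\<lambda>x. repr w x * complex_of_real (\<phi> x))" for w
      by (intro integrable_mult_square_integrable test_function_props(4) \<phi>) auto
    then show "(LINT x|lborel. (repr u x - repr v x) * complex_of_real (\<phi> x)) = 0"
      using assms[OF \<phi>] by (simp add: left_diff_distrib)
  qed measurable
  then show ?thesis unfolding Ltwo_eq_iff by eventually_elim simp
qed

text \<open>The damped transforms \<open>g n\<close> converge to \<open>F\<close> in
  \<open>Ltwo\<close>, and their inverse transforms \<open>K n\<close> are heat-kernel averages of
  \<open>f\<close>. Against a test function the symmetric kernel moves from \<open>f\<close> onto
  \<open>\<phi>\<close>, so that pointwise convergence for a bounded continuous function is enough
  to identify the limit.\<close>

lemma reflect_fourier_fourier_to_Ltwo:
  fixes f :: "'a::euclidean_space \<Rightarrow> complex"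
  assumes f: "square_integrable f" "integrable lborel f"
  shows "reflect (fourier (fourier (to_Ltwo f))) = to_Ltwo f"
proof (rule Ltwo_test_function_separation)
  have [measurable]: "f \<in> borel_measurable borel" using f by auto
  define F where "F = fourier_integral f"
  have [measurable]: "F \<in> borel_measurable borel" unfolding F_def by measurable
  have sF: "square_integrable F" unfolding F_def by (rule square_integrable_fourier_integral[OF f(2,1)])
  define c where "c = (2 * pi) powr (- real DIM('a) / 2)"
  define t where "t n = inverse (real (Suc n))" for n
  have t: "0 < t n" for n by (simp add: t_def)
  have t0: "t \<longlonglongrightarrow> 0" unfolding t_def by (rule LIMSEQ_inverse_real_of_nat)
  define E where "E n x y = exp (- (norm (x - y))\<^sup>2 / (4 * t n))" for n and x y :: 'a
  have [measurable]: "(\<lambda>(x, y). E n x y) \<in> borel_measurable (borel \<Otimes>\<^sub>M borel)" for n unfolding E_def by measurable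
  define q where "q n = (4 * pi * t n) powr (- real DIM('a) / 2)" for n
  define g where "g n \<xi> = complex_of_real (exp (- t n * (norm \<xi>)\<^sup>2)) * F \<xi>" for n \<xi>
  have [measurable]: "g n \<in> borel_measurable borel" for n unfolding g_def by measurable
  have gle: "cmod (g n \<xi>) \<le> 1 * cmod (F \<xi>)" for n \<xi>
    using t[of n] mult_left_le_one_le[of "cmod (F \<xi>)" "exp (- (t n * (norm \<xi>)\<^sup>2))"] by (simp add: g_def norm_mult)
  have sg: "square_integrable (g n)" for n
    by (rule square_integrable_bound[OF sF, where B = 1]) (use gle in auto)
  have ig: "integrable lborel (g n)" for n
  proof (rule Bochner_Integration.integrable_bound)
    show "integrable lborel (\<lambda>\<xi>::'a. (c * (LINT x|lborel. cmod (f x))) * exp (- t n * (norm \<xi>)\<^sup>2))"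
      by (rule integrable_mult_right[OF gaussian_integral(1)[OF t]])
    show "AE \<xi> in lborel. norm (g n \<xi>) \<le> norm ((c * (LINT x|lborel. cmod (f x))) * exp (- t n * (norm \<xi>)\<^sup>2))"
    proof (rule AE_I2)
      fix \<xi>
      have "cmod (F \<xi>) \<le> c * (LINT x|lborel. cmod (f x))" unfolding F_def c_def by (rule norm_fourier_integral_le)
      then have "cmod (F \<xi>) * exp (- t n * (norm \<xi>)\<^sup>2) \<le> \<bar>c * (LINT x|lborel. cmod (f x))\<bar> * exp (- t n * (norm \<xi>)\<^sup>2)"
        by (intro mult_right_mono) auto
      then show "norm (g n \<xi>) \<le> norm ((c * (LINT x|lborel. cmod (f x))) * exp (- t n * (norm \<xi>)\<^sup>2))"
        by (simp add: g_def norm_mult abs_mult mult.commute)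
    qed
  qed measurable
  have "(\<lambda>n. to_Ltwo (g n)) \<longlonglongrightarrow> to_Ltwo F"
  proof (rule to_Ltwo_dominated_convergence(1)[OF _ _ sF])
    show "AE \<xi> in lborel. cmod (g n \<xi>) \<le> 1 * cmod (F \<xi>)" for n using gle by simp
    have "(\<lambda>n. g n \<xi>) \<longlonglongrightarrow> complex_of_real (exp (- 0 * (norm \<xi>)\<^sup>2)) * F \<xi>" for \<xi>
      unfolding g_def by (intro tendsto_intros t0)
    then show "AE \<xi> in lborel. (\<lambda>n. g n \<xi>) \<longlonglongrightarrow> F \<xi>" by simp
  qed measurable
  then have lim: "(\<lambda>n. reflect (fourier (to_Ltwo (g n)))) \<longlonglongrightarrow> reflect (fourier (to_Ltwo F))"
    by (intro bounded_linear.tendsto[OF bounded_linear_reflect] bounded_linear.tendsto[OF bounded_linear_fourier])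
  define K where "K n x = complex_of_real (q n) * (LINT y|lborel. E n x y * f y)" for n x
  \<comment> \<open>Reflecting the frequency variable brings the integral into the shape of
    \<open>gaussian_smoothing\<close>; the constants then collapse to the heat normalisation
    \<open>q n\<close>.\<close>
  have FK: "fourier_integral (g n) (- x) = K n x" for n x
  proof -
    have "(LINT \<xi>|lborel. cis (- (\<xi> \<bullet> (- x))) * g n \<xi>) = (LINT \<xi>|lborel. cis (- ((- \<xi>) \<bullet> (- x))) * g n (- \<xi>))"
      by (rule integral_reflect)
    also have "\<dots> = (LINT \<xi>|lborel. c * (cis (- (x \<bullet> \<xi>)) * exp (- t n * (norm \<xi>)\<^sup>2) * (LINT y|lborel. cis (y \<bullet> \<xi>) * f y)))"
      by (rule Bochner_Integration.integral_cong)
        (simp_all add: g_def F_def fourier_integral_def c_def inner_commute mult_ac)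
    also have "\<dots> = c * (LINT \<xi>|lborel. cis (- (x \<bullet> \<xi>)) * exp (- t n * (norm \<xi>)\<^sup>2) * (LINT y|lborel. cis (y \<bullet> \<xi>) * f y))"
      by (rule integral_mult_right_zero)
    also have "\<dots> = c * ((pi / t n) powr (real DIM('a) / 2) * (LINT y|lborel. E n x y * f y))"
      unfolding E_def by (subst gaussian_smoothing[OF t f(2)]) simp
    finally have "fourier_integral (g n) (- x) = complex_of_real (c\<^sup>2 * (pi / t n) powr (real DIM('a) / 2)) * (LINT y|lborel. E n x y * f y)"
      unfolding fourier_integral_def c_def[symmetric] by (simp only: power2_eq_square mult.assoc of_real_mult)
    then show ?thesis unfolding c_def gaussian_constant[OF t] K_def q_def .
  qed
  have sK: "square_integrable (K n)" for n
  proof -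
    have "square_integrable (\<lambda>x. fourier_integral (g n) (- x))"
      by (intro square_integrable_reflect square_integrable_fourier_integral ig sg)
    then show ?thesis unfolding FK .
  qed
  have limK: "(\<lambda>n. to_Ltwo (K n)) \<longlonglongrightarrow> reflect (fourier (fourier (to_Ltwo f)))"
  proof -
    have "reflect (fourier (to_Ltwo (g n))) = to_Ltwo (K n)" for n
      by (simp add: fourier_to_Ltwo[OF ig sg] reflect_to_Ltwo square_integrable_fourier_integral[OF ig sg] FK)
    then show ?thesis using lim fourier_to_Ltwo[OF f(2,1)] by (simp add: F_def)
  qed
  fix \<phi> :: "'a \<Rightarrow> real" assume \<phi>: "test_function \<phi>"
  note props = test_function_props[OF \<phi>]
  have [measurable]: "\<phi> \<in> borel_measurable borel" using props(1) by (rule borel_measurable_continuous_onI)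
  obtain B where B: "\<And>x. \<bar>\<phi> x\<bar> \<le> B" using props(2) by auto
  let ?\<phi> = "to_Ltwo (\<lambda>x. complex_of_real (\<phi> x))"
  have *: "(LINT x|lborel. repr w x * complex_of_real (\<phi> x)) = cinner w ?\<phi>" for w
    using cinner_to_Ltwo[OF square_integrable_repr[of w] props(4)] by simp
  have intK: "cinner (to_Ltwo (K n)) ?\<phi> = (LINT y|lborel. f y * complex_of_real (q n * (LINT x|lborel. E n y x * \<phi> x)))" for n
  proof -
    define h where "h x y = complex_of_real (E n x y) * f y * complex_of_real (\<phi> x)" for x y
    have [measurable]: "case_prod h \<in> borel_measurable (lborel \<Otimes>\<^sub>M lborel)"
      unfolding h_def[abs_def] by measurable
    have "(\<integral>\<^sup>+x. \<integral>\<^sup>+y. norm (h x y) \<partial>lborel \<partial>lborel) \<le> (\<integral>\<^sup>+x. \<integral>\<^sup>+y. ennreal (norm (\<phi> x)) * ennreal (norm (f y)) \<partial>lborel \<partial>lborel)"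
    proof (intro nn_integral_mono)
      fix x y :: 'a
      have "E n x y \<le> 1" "0 \<le> E n x y" using t[of n] by (auto simp: E_def divide_nonpos_nonneg)
      then have "norm (h x y) \<le> 1 * cmod (f y) * \<bar>\<phi> x\<bar>"
        unfolding h_def norm_mult norm_of_real by (intro mult_right_mono) auto
      then show "ennreal (norm (h x y)) \<le> ennreal (norm (\<phi> x)) * ennreal (norm (f y))"
        by (subst ennreal_mult[symmetric]) (auto intro: ennreal_leI simp: mult.commute)
    qed
    also have "\<dots> = (\<integral>\<^sup>+x. ennreal (norm (\<phi> x)) \<partial>lborel) * (\<integral>\<^sup>+y. ennreal (norm (f y)) \<partial>lborel)"
      by (simp add: nn_integral_cmult nn_integral_multc)
    also have "\<dots> < \<infinity>" using f(2) props(3) by (auto simp: ennreal_mult_less_top integrable_iff_bounded)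
    finally have fin: "(\<integral>\<^sup>+x. \<integral>\<^sup>+y. norm (h x y) \<partial>lborel \<partial>lborel) < \<infinity>" .
    have "cinner (to_Ltwo (K n)) ?\<phi> = (LINT x|lborel. K n x * complex_of_real (\<phi> x))"
      by (subst cinner_to_Ltwo[OF sK props(4)]) simp
    also have "\<dots> = (LINT x|lborel. complex_of_real (q n) * (LINT y|lborel. h x y))"
      by (rule Bochner_Integration.integral_cong) (simp_all add: K_def h_def)
    also have "\<dots> = complex_of_real (q n) * (LINT x|lborel. LINT y|lborel. h x y)"
      by (rule integral_mult_right_zero)
    also have "(LINT x|lborel. LINT y|lborel. h x y) = (LINT y|lborel. LINT x|lborel. h x y)"
      by (rule lborel_pair.Fubini_bounded(2)[OF _ fin, symmetric]) measurable
    also have "\<dots> = (LINT y|lborel. f y * complex_of_real (LINT x|lborel. E n y x * \<phi> x))"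
    proof (rule Bochner_Integration.integral_cong[OF refl])
      fix y
      have "(LINT x|lborel. h x y) = (LINT x|lborel. f y * complex_of_real (E n y x * \<phi> x))"
        by (rule Bochner_Integration.integral_cong) (simp_all add: h_def E_def norm_minus_commute)
      also have "\<dots> = f y * complex_of_real (LINT x|lborel. E n y x * \<phi> x)"
        by (simp only: integral_mult_right_zero integral_complex_of_real)
      finally show "(LINT x|lborel. h x y) = f y * complex_of_real (LINT x|lborel. E n y x * \<phi> x)" .
    qed
    also have "complex_of_real (q n) * \<dots> = (LINT y|lborel. complex_of_real (q n) * (f y * complex_of_real (LINT x|lborel. E n y x * \<phi> x)))"
      by (rule integral_mult_right_zero[symmetric])
    also have "\<dots> = (LINT y|lborel. f y * complex_of_real (q n * (LINT x|lborel. E n y x * \<phi> x)))"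
      by (rule Bochner_Integration.integral_cong) (simp_all only: of_real_mult mult_ac)
    finally show ?thesis .
  qed
  have "(\<lambda>n. cinner (to_Ltwo (K n)) ?\<phi>) \<longlonglongrightarrow> (LINT y|lborel. f y * complex_of_real (\<phi> y))"
    unfolding intK
  proof (rule integral_dominated_convergence)
    show "integrable lborel (\<lambda>y. cmod (f y) * B)" using f(2) by (intro integrable_mult_left integrable_norm)
    have "(\<lambda>n. q n * (LINT x|lborel. E n y x * \<phi> x)) \<longlonglongrightarrow> \<phi> y" for y
      unfolding q_def E_def by (rule heat_kernel_tendsto[OF props(1) B t t0])
    then show "AE y in lborel. (\<lambda>n. f y * complex_of_real (q n * (LINT x|lborel. E n y x * \<phi> x))) \<longlonglongrightarrow> f y * complex_of_real (\<phi> y)"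
      by (intro AE_I2 tendsto_intros)
    \<comment> \<open>The normalised kernel has mass 1, so averaging does not enlarge the bound
      \<open>B\<close>; this provides the integrable majorant \<open>|f| * B\<close>.\<close>
    have "\<bar>q n * (LINT x|lborel. E n y x * \<phi> x)\<bar> \<le> B" for n y
    proof -
      have t4: "1 / (4 * t n) > 0" using t by simp
      have Eg: "E n y (y - z) = exp (- (1 / (4 * t n)) * (norm z)\<^sup>2)" for z by (simp add: E_def)
      have iE: "integrable lborel (E n y)"
        using integrable_affine_iff[of "-1" "E n y" y] gaussian_integral(1)[OF t4, where 'a = 'a] Eg by simp
      have "(LINT x|lborel. E n y x) = (LINT z|lborel. exp (- (1 / (4 * t n)) * (norm (z::'a))\<^sup>2))"
        using integral_affine[of "-1" "E n y" y] Eg by simp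
      also have "\<dots> = (4 * pi * t n) powr (real DIM('a) / 2)"
        using gaussian_integral(2)[OF t4, where 'a = 'a] by (simp add: mult_ac)
      finally have "(LINT x|lborel. E n y x) = (4 * pi * t n) powr (real DIM('a) / 2)" .
      then have qE: "q n * (LINT x|lborel. E n y x) = 1"
        using t[of n] by (simp add: q_def flip: powr_add)
      have "\<bar>LINT x|lborel. E n y x * \<phi> x\<bar> \<le> (LINT x|lborel. \<bar>E n y x * \<phi> x\<bar>)"
        using integral_norm_bound[of lborel "\<lambda>x. E n y x * \<phi> x"] by simp
      also have "\<dots> \<le> (LINT x|lborel. E n y x * B)"
      proof (rule integral_mono')
        show "integrable lborel (\<lambda>x. E n y x * B)" using iE by (rule integrable_mult_left)
        show "\<bar>E n y x * \<phi> x\<bar> \<le> E n y x * B" for x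
          using B[of x] by (auto simp: abs_mult E_def intro!: mult_left_mono)
        show "0 \<le> E n y x * B" for x using order_trans[OF abs_ge_zero B[of x]] by (simp add: E_def)
      qed
      also have "\<dots> = (LINT x|lborel. E n y x) * B" by simp
      finally have "\<bar>q n * (LINT x|lborel. E n y x * \<phi> x)\<bar> \<le> q n * ((LINT x|lborel. E n y x) * B)"
        by (simp add: abs_mult q_def mult_left_mono)
      also have "\<dots> = B" using qE by (simp add: mult.assoc[symmetric])
      finally show ?thesis .
    qed
    then show "AE y in lborel. norm (f y * complex_of_real (q n * (LINT x|lborel. E n y x * \<phi> x))) \<le> cmod (f y) * B" for n
      by (intro AE_I2) (simp only: norm_mult norm_of_real, rule mult_left_mono, auto)
  qed measurable
  moreover have "(\<lambda>n. cinner (to_Ltwo (K n)) ?\<phi>) \<longlonglongrightarrow> cinner (reflect (fourier (fourier (to_Ltwo f)))) ?\<phi>"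
    by (intro tendsto_intros limK)
  ultimately have "cinner (reflect (fourier (fourier (to_Ltwo f)))) ?\<phi> = (LINT y|lborel. f y * complex_of_real (\<phi> y))"
    by (rule LIMSEQ_unique[rotated])
  also have "\<dots> = cinner (to_Ltwo f) ?\<phi>" by (simp add: cinner_to_Ltwo[OF f(1) props(4)])
  finally show "(LINT x|lborel. repr (reflect (fourier (fourier (to_Ltwo f)))) x * complex_of_real (\<phi> x)) =
      (LINT x|lborel. repr (to_Ltwo f) x * complex_of_real (\<phi> x))" unfolding * .
qed

lemma reflect_fourier_fourier: "reflect (fourier (fourier u)) = u"
proof (rule Ltwo_continuous_ext[where f = "\<lambda>u. reflect (fourier (fourier u))" and g = "\<lambda>u. u"])
  show "isCont (\<lambda>u. reflect (fourier (fourier u))) u" for u :: "'a Ltwo"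
    by (intro isCont_bounded_linear bounded_linear_compose[OF bounded_linear_reflect]
        bounded_linear_compose[OF bounded_linear_fourier bounded_linear_fourier])
qed (auto intro: reflect_fourier_fourier_to_Ltwo)

lemma fourier_fourier: "fourier (fourier u) = reflect u"
  by (metis reflect_fourier_fourier reflect_reflect)

lemma fourier_reflect_fourier: "fourier (reflect (fourier u)) = u"
  by (metis fourier_fourier reflect_reflect)

section \<open>The inverse transform and Parseval's identity\<close>

definition ifourier :: "'a::euclidean_space Ltwo \<Rightarrow> 'a Ltwo" where
  "ifourier u = reflect (fourier u)"

lemma ifourier_fourier [simp]: "ifourier (fourier u) = u"
  by (simp add: ifourier_def reflect_fourier_fourier)

lemma fourier_ifourier [simp]: "fourier (ifourier u) = u"
  by (simp add: ifourier_def fourier_reflect_fourier)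

lemma inv_fourier: "inv fourier = ifourier"
  by (rule inv_unique_comp) (auto simp: fun_eq_iff)

text \<open>Reflection after two transforms is the identity, and each transform is a contraction; so
  neither can lose norm.\<close>

lemma norm_fourier [simp]: "norm (fourier u) = norm u"
proof (rule antisym[OF norm_fourier_le])
  have "norm u = norm (reflect (fourier (fourier u)))" by (simp add: reflect_fourier_fourier)
  also have "\<dots> \<le> norm (fourier u)" by (simp add: norm_fourier_le)
  finally show "norm u \<le> norm (fourier u)" .
qed

lemma norm_ifourier [simp]: "norm (ifourier u) = norm u"
  by (simp add: ifourier_def)

lemma bounded_linear_ifourier: "bounded_linear ifourier"
  unfolding ifourier_def[abs_def]
  by (rule bounded_linear_compose[OF bounded_linear_reflect bounded_linear_fourier])

lemma inner_fourier: "fourier u \<bullet> fourier v = u \<bullet> v"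
proof -
  have "norm (fourier u + fourier v) = norm (u + v)"
    by (simp only: linear_add[OF bounded_linear.linear[OF bounded_linear_fourier], symmetric] norm_fourier)
  then show ?thesis by (simp only: dot_norm norm_fourier)
qed

lemma cinner_fourier: "cinner (fourier u) (fourier v) = cinner u v"
  by (simp only: cinner_def inner_fourier fourier_scaleC[symmetric])

lemma ifourier_scaleC: "ifourier (scaleC c u) = scaleC c (ifourier u)"
  by (metis fourier_ifourier fourier_scaleC ifourier_fourier)

text \<open>The phase is absorbed into \<open>u\<close>, where the transform turns it into a
  translation; Parseval does the rest. No integrability of the transforms themselves is
  involved.\<close>

lemma fourier_product:
  "(LINT x|lborel. cis (- (x \<bullet> \<xi>)) * (repr u x * cnj (repr v x)))
    = (LINT \<eta>|lborel. repr (fourier u) (\<xi> + \<eta>) * cnj (repr (fourier v) \<eta>))"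
proof -
  have bm: "bounded_multiplier (\<lambda>x. cis (- (x \<bullet> \<xi>)))" by (rule bounded_multiplierI[where B = 1]) auto
  have "(LINT x|lborel. cis (- (x \<bullet> \<xi>)) * (repr u x * cnj (repr v x))) = cinner (fmul (\<lambda>x. cis (- (x \<bullet> \<xi>))) u) v"
    using cinner_to_Ltwo[OF square_integrable_multiplier[OF bm square_integrable_repr[of u]] square_integrable_repr[of v]]
    by (simp add: fmul_def mult.assoc)
  also have "\<dots> = cinner (transl \<xi> (fourier u)) (fourier v)"
    by (simp only: fourier_modulate[symmetric] cinner_fourier)
  also have "\<dots> = (LINT \<eta>|lborel. repr (fourier u) (\<xi> + \<eta>) * cnj (repr (fourier v) \<eta>))"
    using cinner_to_Ltwo[OF square_integrable_translate[OF square_integrable_repr[of "fourier u"], of \<xi>] square_integrable_repr[of "fourier v"]]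
    by (simp add: transl_def)
  finally show ?thesis .
qed

section \<open>The weak gradient on the Fourier side\<close>

lemma norm_indicator_eq_indicator: "cmod (indicator A x) = indicator A x"
  by (simp add: indicator_def)

text \<open>The chord has length \<open>2 * |sin (a / 2)|\<close>.\<close>

lemma norm_cis_minus_one_le: "cmod (cis a - 1) \<le> \<bar>a\<bar>"
proof -
  have "(cmod (cis a - 1))\<^sup>2 = (cos a - 1)\<^sup>2 + (sin a)\<^sup>2" by (simp add: cmod_power2)
  also have "\<dots> = 2 - 2 * cos a" using sin_cos_squared_add[of a] by (simp add: power2_eq_square algebra_simps)
  also have "\<dots> = (2 * sin (a / 2))\<^sup>2" using cos_double_sin[of "a / 2"] by (simp add: power2_eq_square)
  also have "\<dots> \<le> a\<^sup>2" 
  proof -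
    have "\<bar>2 * sin (a / 2)\<bar> \<le> \<bar>a\<bar>" using abs_sin_x_le_abs_x[of "a / 2"] by (simp add: abs_mult)
    then show ?thesis by (simp only: abs_le_square_iff)
  qed
  finally have "(cmod (cis a - 1))\<^sup>2 \<le> \<bar>a\<bar>\<^sup>2" by simp
  then show ?thesis by (rule power2_le_imp_le) simp
qed

lemma cis_difference_quotient_tendsto:
  assumes "h \<longlonglongrightarrow> 0" "\<And>n. h n \<noteq> 0"
  shows "(\<lambda>n. (cis (h n * a) - 1) / of_real (h n)) \<longlonglongrightarrow> \<i> * of_real a"
proof -
  have "((\<lambda>t. exp (\<i> * of_real a * t)) has_field_derivative (\<i> * of_real a)) (at 0)"
    by (auto intro!: derivative_eq_intros)
  then have "((\<lambda>t. (exp (\<i> * of_real a * t) - 1) / t) \<longlongrightarrow> \<i> * of_real a) (at 0)"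
    by (simp add: DERIV_def)
  moreover have "filterlim (\<lambda>n. complex_of_real (h n)) (at 0) sequentially"
  proof -
    have "(\<lambda>n. complex_of_real (h n)) \<longlonglongrightarrow> complex_of_real 0" by (intro tendsto_intros assms(1))
    then show ?thesis using assms(2) by (auto simp: filterlim_at intro!: always_eventually)
  qed
  ultimately have "(\<lambda>n. (exp (\<i> * of_real a * of_real (h n)) - 1) / of_real (h n)) \<longlonglongrightarrow> \<i> * of_real a"
    by (rule filterlim_compose)
  then show ?thesis by (simp add: cis_conv_exp mult_ac)
qed

lemma test_function_difference_quotient:
  fixes \<phi> :: "'a::euclidean_space \<Rightarrow> real"
  assumes \<phi>: "test_function \<phi>" and b: "b \<in> Basis"
  shows "\<exists>M R. \<forall>x h. 0 < h \<longrightarrow> h \<le> 1 \<longrightarrow> \<bar>(\<phi> (x - h *\<^sub>R b) - \<phi> x) / h\<bar> \<le> M * indicator (cball 0 R) x"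
    and "\<And>x. ((\<lambda>h. (\<phi> (x - h *\<^sub>R b) - \<phi> x) / h) \<longlongrightarrow> - frechet_derivative \<phi> (at x) b) (at_right 0)"
proof -
  have C1: "Ck (Suc 0) \<phi>" using \<phi> by (simp add: test_function_def)
  have der: "(\<phi> has_derivative frechet_derivative \<phi> (at x)) (at x)" for x
    by (rule Ck_Suc_has_derivative[OF C1])
  have cont: "continuous_on UNIV (\<lambda>x. frechet_derivative \<phi> (at x) b)" using C1 b by simp
  have dline: "((\<lambda>h. \<phi> (x - h *\<^sub>R b)) has_real_derivative (- frechet_derivative \<phi> (at (x - h *\<^sub>R b)) b)) (at h)" for x h
  proof -
    have "((\<lambda>h. \<phi> (x - h *\<^sub>R b)) has_derivative (\<lambda>k. frechet_derivative \<phi> (at (x - h *\<^sub>R b)) (- (k *\<^sub>R b)))) (at h)"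
      by (rule has_derivative_compose[OF _ der]) (auto intro!: derivative_eq_intros)
    moreover have "(\<lambda>k. frechet_derivative \<phi> (at (x - h *\<^sub>R b)) (- (k *\<^sub>R b))) = (*) (- frechet_derivative \<phi> (at (x - h *\<^sub>R b)) b)"
      using has_derivative_linear[OF der[of "x - h *\<^sub>R b"]] by (simp add: fun_eq_iff linear_neg linear_scale)
    ultimately show ?thesis by (simp only: has_field_derivative_def)
  qed
  show "((\<lambda>h. (\<phi> (x - h *\<^sub>R b) - \<phi> x) / h) \<longlongrightarrow> - frechet_derivative \<phi> (at x) b) (at_right 0)" for x
  proof -
    have "((\<lambda>h. (\<phi> (x - h *\<^sub>R b) - \<phi> x) / h) \<longlongrightarrow> - frechet_derivative \<phi> (at x) b) (at 0)"
      using dline[of x 0] by (simp add: DERIV_def)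
    then show ?thesis by (rule tendsto_within_subset) auto
  qed
  have "bounded (closure {x. \<phi> x \<noteq> 0})" using \<phi> by (simp add: test_function_def compact_imp_bounded)
  then obtain R where R: "\<And>x. \<phi> x \<noteq> 0 \<Longrightarrow> norm x \<le> R"
    using closure_subset[of "{x. \<phi> x \<noteq> 0}"] by (auto simp: bounded_iff subset_iff)
  have "bounded ((\<lambda>x. frechet_derivative \<phi> (at x) b) ` cball 0 (R + 2))"
    by (intro compact_imp_bounded compact_continuous_image continuous_on_subset[OF cont]) auto
  then obtain M where "\<forall>y\<in>(\<lambda>x. frechet_derivative \<phi> (at x) b) ` cball 0 (R + 2). norm y \<le> M"
    unfolding bounded_iff by blast
  then have M: "norm x \<le> R + 2 \<Longrightarrow> \<bar>frechet_derivative \<phi> (at x) b\<bar> \<le> M" for x by simp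
  show "\<exists>M R. \<forall>x h. 0 < h \<longrightarrow> h \<le> 1 \<longrightarrow> \<bar>(\<phi> (x - h *\<^sub>R b) - \<phi> x) / h\<bar> \<le> M * indicator (cball 0 R) x"
  \<comment> \<open>For steps of length at most 1 the quotient vanishes outside radius
    \<open>R + 1\<close>, and the intermediate point of the mean value theorem stays within radius
    \<open>R + 2\<close>, where \<open>M\<close> bounds the derivative.\<close>
  proof (rule exI[of _ M], rule exI[of _ "R + 1"], intro allI impI)
    fix x :: 'a and h :: real assume h: "0 < h" "h \<le> 1"
    have nb: "norm (k *\<^sub>R b) = \<bar>k\<bar>" for k using b by simp
    show "\<bar>(\<phi> (x - h *\<^sub>R b) - \<phi> x) / h\<bar> \<le> M * indicator (cball 0 (R + 1)) x"
    proof (cases "norm x \<le> R + 1")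
      case True
      obtain z where z: "0 < z" "z < h" "\<phi> (x - h *\<^sub>R b) - \<phi> (x - 0 *\<^sub>R b) = (h - 0) * (- frechet_derivative \<phi> (at (x - z *\<^sub>R b)) b)"
        using MVT2[OF h(1), of "\<lambda>h. \<phi> (x - h *\<^sub>R b)" "\<lambda>h. - frechet_derivative \<phi> (at (x - h *\<^sub>R b)) b"] dline by auto
      have "norm (x - z *\<^sub>R b) \<le> R + 2" using norm_triangle_ineq4[of x "z *\<^sub>R b"] nb[of z] z h True by linarith
      then have "\<bar>frechet_derivative \<phi> (at (x - z *\<^sub>R b)) b\<bar> \<le> M" by (rule M)
      then show ?thesis using True z h by (simp add: abs_mult)
    next
      case False
      have "norm (x - h *\<^sub>R b) > R" using norm_triangle_ineq2[of x "h *\<^sub>R b"] nb[of h] h False by linarith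
      then have "\<phi> (x - h *\<^sub>R b) = 0" "\<phi> x = 0" using R[of x] R[of "x - h *\<^sub>R b"] False by force+
      then show ?thesis using False by simp
    qed
  qed
qed

text \<open>The candidate for the weak derivative: multiplication by
  \<open>\<i> * (\<xi> \<bullet> b)\<close> on the Fourier side.\<close>

definition fourier_partial :: "'a \<Rightarrow> 'a::euclidean_space Ltwo \<Rightarrow> 'a Ltwo" where
  "fourier_partial b u = ifourier (to_Ltwo (\<lambda>\<xi>. (\<i> * of_real (\<xi> \<bullet> b)) * repr (fourier u) \<xi>))"

lemma square_integrable_partial:
  fixes u :: "'a::euclidean_space Ltwo"
  assumes u: "square_integrable (\<lambda>\<xi>. of_real (norm \<xi>) * repr (fourier u) \<xi>)" and b: "b \<in> Basis"
  shows "square_integrable (\<lambda>\<xi>. (\<i> * of_real (\<xi> \<bullet> b)) * repr (fourier u) \<xi>)"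
proof (rule square_integrable_bound[OF u])
  show "(\<lambda>\<xi>. \<i> * complex_of_real (\<xi> \<bullet> b) * repr (fourier u) \<xi>) \<in> borel_measurable borel"
    using borel_measurable_repr[of "fourier u"] by simp
  show "AE \<xi> in lborel. cmod ((\<i> * of_real (\<xi> \<bullet> b)) * repr (fourier u) \<xi>) \<le> 1 * cmod (of_real (norm \<xi>) * repr (fourier u) \<xi>)"
    using b Basis_le_norm by (intro AE_I2) (auto simp: norm_mult intro!: mult_right_mono)
qed

text \<open>Integration by parts with difference quotients. Those of \<open>u\<close> converge in
  \<open>Ltwo\<close>, because on the Fourier side they are dominated by
  \<open>|\<xi> \<bullet> b|\<close> times the transform. Translation invariance moves them onto the
  test function, where they converge boundedly with a common compact support.\<close>

lemma fourier_partial_weak: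
  fixes u :: "'a::euclidean_space Ltwo"
  assumes u: "square_integrable (\<lambda>\<xi>. of_real (norm \<xi>) * repr (fourier u) \<xi>)" and b: "b \<in> Basis"
    and \<phi>: "test_function \<phi>"
  shows "(LINT x|lborel. repr u x * complex_of_real (frechet_derivative \<phi> (at x) b)) =
      - (LINT x|lborel. repr (fourier_partial b u) x * complex_of_real (\<phi> x))"
proof -
  define h where "h n = inverse (real (Suc n))" for n
  have h: "0 < h n" "h n \<le> 1" for n by (auto simp: h_def field_simps)
  have h0: "h \<longlonglongrightarrow> 0" unfolding h_def by (rule LIMSEQ_inverse_real_of_nat)
  define D where "D n = (1 / h n) *\<^sub>R (transl (h n *\<^sub>R b) u - u)" for n
  note sp = square_integrable_partial[OF u b]
  have bm: "bounded_multiplier (\<lambda>\<xi>. cis (k *\<^sub>R b \<bullet> \<xi>))" for k by (rule bounded_multiplierI[where B = 1]) auto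
  have FD: "fourier (D n) = to_Ltwo (\<lambda>\<xi>. ((cis (h n * (\<xi> \<bullet> b)) - 1) / of_real (h n)) * repr (fourier u) \<xi>)" for n
  proof -
    have "fourier (D n) = (1 / h n) *\<^sub>R (fmul (\<lambda>\<xi>. cis (h n *\<^sub>R b \<bullet> \<xi>)) (fourier u) - fourier u)"
      unfolding D_def
      by (simp add: linear_scale[OF bounded_linear.linear[OF bounded_linear_fourier]]
         linear_diff[OF bounded_linear.linear[OF bounded_linear_fourier]] fourier_transl)
    also have "\<dots> = scaleC (of_real (1 / h n)) (to_Ltwo (\<lambda>\<xi>. cis (h n *\<^sub>R b \<bullet> \<xi>) * repr (fourier u) \<xi> - repr (fourier u) \<xi>))"
      by (simp only: scaleC_of_real fmul_def to_Ltwo_diff[OF square_integrable_multiplier[OF bm square_integrable_repr] square_integrable_repr] to_Ltwo_repr)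
    also have "\<dots> = to_Ltwo (\<lambda>\<xi>. of_real (1 / h n) * (cis (h n *\<^sub>R b \<bullet> \<xi>) * repr (fourier u) \<xi> - repr (fourier u) \<xi>))"
      by (rule to_Ltwo_mult[symmetric, OF square_integrable_diff[OF square_integrable_multiplier[OF bm square_integrable_repr] square_integrable_repr]])
    also have "(\<lambda>\<xi>. of_real (1 / h n) * (cis (h n *\<^sub>R b \<bullet> \<xi>) * repr (fourier u) \<xi> - repr (fourier u) \<xi>))
        = (\<lambda>\<xi>. ((cis (h n * (\<xi> \<bullet> b)) - 1) / of_real (h n)) * repr (fourier u) \<xi>)"
      by (simp add: fun_eq_iff left_diff_distrib diff_divide_distrib inner_commute)
    finally show ?thesis .
  qed
  have "(\<lambda>n. fourier (D n)) \<longlonglongrightarrow> fourier (fourier_partial b u)"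
    unfolding FD fourier_partial_def fourier_ifourier
  proof (rule to_Ltwo_dominated_convergence(1)[OF _ _ sp])
    have "(\<lambda>n. (cis (h n * (\<xi> \<bullet> b)) - 1) / of_real (h n)) \<longlonglongrightarrow> \<i> * of_real (\<xi> \<bullet> b)" for \<xi>
      by (rule cis_difference_quotient_tendsto[OF h0]) (simp add: h_def)
    then show "AE \<xi> in lborel. (\<lambda>n. ((cis (h n * (\<xi> \<bullet> b)) - 1) / of_real (h n)) * repr (fourier u) \<xi>) \<longlonglongrightarrow> (\<i> * of_real (\<xi> \<bullet> b)) * repr (fourier u) \<xi>"
      by (intro AE_I2 tendsto_intros)
    show "AE \<xi> in lborel. cmod (((cis (h n * (\<xi> \<bullet> b)) - 1) / of_real (h n)) * repr (fourier u) \<xi>) \<le> 1 * cmod ((\<i> * of_real (\<xi> \<bullet> b)) * repr (fourier u) \<xi>)" for n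
    proof (rule AE_I2)
      fix \<xi>
      have "cmod (cis (h n * (\<xi> \<bullet> b)) - 1) \<le> h n * \<bar>\<xi> \<bullet> b\<bar>"
        using norm_cis_minus_one_le[of "h n * (\<xi> \<bullet> b)"] h(1)[of n] by (simp add: abs_mult)
      then have "cmod (cis (h n * (\<xi> \<bullet> b)) - 1) / h n \<le> \<bar>\<xi> \<bullet> b\<bar>"
        using h(1)[of n] by (simp add: field_simps)
      from mult_right_mono[OF this norm_ge_zero[of "repr (fourier u) \<xi>"]]
      show "cmod (((cis (h n * (\<xi> \<bullet> b)) - 1) / of_real (h n)) * repr (fourier u) \<xi>) \<le> 1 * cmod ((\<i> * of_real (\<xi> \<bullet> b)) * repr (fourier u) \<xi>)"
        using h(1)[of n] by (simp add: norm_mult norm_divide)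
    qed
  qed (use borel_measurable_repr[of "fourier u"] in \<open>measurable\<close>)
  then have "(\<lambda>n. ifourier (fourier (D n))) \<longlonglongrightarrow> ifourier (fourier (fourier_partial b u))"
    by (rule bounded_linear.tendsto[OF bounded_linear_ifourier])
  then have limD: "D \<longlonglongrightarrow> fourier_partial b u" by simp
  note props = test_function_props[OF \<phi>]
  have [measurable]: "\<phi> \<in> borel_measurable borel" using props(1) by (rule borel_measurable_continuous_onI)
  let ?\<phi> = "to_Ltwo (\<lambda>x. complex_of_real (\<phi> x))"
  have c\<phi>: "cinner w ?\<phi> = (LINT x|lborel. repr w x * complex_of_real (\<phi> x))" for w
    using cinner_to_Ltwo[OF square_integrable_repr[of w] props(4)] by simp
  obtain M R where MR: "\<And>x h. 0 < h \<Longrightarrow> h \<le> 1 \<Longrightarrow> \<bar>(\<phi> (x - h *\<^sub>R b) - \<phi> x) / h\<bar> \<le> M * indicator (cball 0 R) x"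
    using test_function_difference_quotient(1)[OF \<phi> b] by blast
  have cD: "cinner (D n) ?\<phi> = (LINT x|lborel. repr u x * complex_of_real ((\<phi> (x - h n *\<^sub>R b) - \<phi> x) / h n))" for n
  proof -
    have int1: "integrable lborel (\<lambda>x. repr u (h n *\<^sub>R b + x) * complex_of_real (\<phi> x))"
      by (intro integrable_mult_square_integrable square_integrable_translate props) auto
    have int2: "integrable lborel (\<lambda>x. repr u x * complex_of_real (\<phi> x))"
      by (intro integrable_mult_square_integrable props) auto
    have int3: "integrable lborel (\<lambda>x. repr u x * complex_of_real (\<phi> (x - h n *\<^sub>R b)))"
      using integrable_affine_iff[of 1 "\<lambda>x. repr u x * complex_of_real (\<phi> (x - h n *\<^sub>R b))" "h n *\<^sub>R b"] int1 by simp
    have "D n = to_Ltwo (\<lambda>x. of_real (1 / h n) * (repr u (h n *\<^sub>R b + x) - repr u x))"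
      by (subst to_Ltwo_mult) (auto simp: D_def transl_def square_integrable_diff square_integrable_translate to_Ltwo_diff scaleC_of_real[symmetric])
    then have "cinner (D n) ?\<phi> = (LINT x|lborel. of_real (1 / h n) * (repr u (h n *\<^sub>R b + x) - repr u x) * complex_of_real (\<phi> x))"
      using cinner_to_Ltwo[OF square_integrable_mult[OF square_integrable_diff[OF square_integrable_translate[OF square_integrable_repr[of u]] square_integrable_repr[of u]]] props(4), of "of_real (1 / h n)" "h n *\<^sub>R b"]
      by (simp only: complex_cnj_complex_of_real)
    also have "\<dots> = (LINT x|lborel. of_real (1 / h n) * (repr u (h n *\<^sub>R b + x) * complex_of_real (\<phi> x) - repr u x * complex_of_real (\<phi> x)))"
      by (simp add: left_diff_distrib right_diff_distrib mult.assoc)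
    also have "\<dots> = of_real (1 / h n) * ((LINT x|lborel. repr u (h n *\<^sub>R b + x) * complex_of_real (\<phi> x)) - (LINT x|lborel. repr u x * complex_of_real (\<phi> x)))"
      by (simp only: integral_mult_right_zero Bochner_Integration.integral_diff[OF int1 int2])
    also have "(LINT x|lborel. repr u (h n *\<^sub>R b + x) * complex_of_real (\<phi> x)) = (LINT x|lborel. repr u x * complex_of_real (\<phi> (x - h n *\<^sub>R b)))"
      using integral_translate[of "\<lambda>x. repr u x * complex_of_real (\<phi> (x - h n *\<^sub>R b))" "h n *\<^sub>R b"] by simp
    also have "of_real (1 / h n) * ((LINT x|lborel. repr u x * complex_of_real (\<phi> (x - h n *\<^sub>R b))) - (LINT x|lborel. repr u x * complex_of_real (\<phi> x)))
        = (LINT x|lborel. of_real (1 / h n) * (repr u x * complex_of_real (\<phi> (x - h n *\<^sub>R b)) - repr u x * complex_of_real (\<phi> x)))"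
      by (simp only: integral_mult_right_zero Bochner_Integration.integral_diff[OF int3 int2])
    also have "\<dots> = (LINT x|lborel. repr u x * complex_of_real ((\<phi> (x - h n *\<^sub>R b) - \<phi> x) / h n))"
      by (rule Bochner_Integration.integral_cong) (simp_all add: right_diff_distrib diff_divide_distrib)
    finally show ?thesis .
  qed
  have mD: "(\<lambda>x. frechet_derivative \<phi> (at x) b) \<in> borel_measurable borel"
  proof (rule borel_measurable_continuous_onI)
    have "Ck (Suc 0) \<phi>" using \<phi> unfolding test_function_def by blast
    then show "continuous_on UNIV (\<lambda>x. frechet_derivative \<phi> (at x) b)" using b by simp
  qed
  have "(\<lambda>n. cinner (D n) ?\<phi>) \<longlonglongrightarrow> (LINT x|lborel. repr u x * complex_of_real (- frechet_derivative \<phi> (at x) b))"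
    unfolding cD
  proof (rule integral_dominated_convergence)
    show "integrable lborel (\<lambda>x. M * cmod (indicator (cball 0 R) x * repr u x))"
      by (intro integrable_mult_right integrable_norm integrable_trunc)
    show "AE x in lborel. norm (repr u x * complex_of_real ((\<phi> (x - h n *\<^sub>R b) - \<phi> x) / h n)) \<le> M * cmod (indicator (cball 0 R) x * repr u x)" for n
    proof (rule AE_I2)
      fix x
      have "cmod (repr u x) * \<bar>(\<phi> (x - h n *\<^sub>R b) - \<phi> x) / h n\<bar> \<le> cmod (repr u x) * (M * indicator (cball 0 R) x)"
        by (intro mult_left_mono MR h) auto
      then show "norm (repr u x * complex_of_real ((\<phi> (x - h n *\<^sub>R b) - \<phi> x) / h n)) \<le> M * cmod (indicator (cball 0 R) x * repr u x)"
        by (simp only: norm_mult norm_of_real norm_indicator_eq_indicator mult_ac)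
    qed
    have "filterlim h (at_right 0) sequentially"
      using h0 h(1) less_imp_neq[OF h(1)] by (auto simp: filterlim_at intro!: always_eventually)
    then have "(\<lambda>n. (\<phi> (x - h n *\<^sub>R b) - \<phi> x) / h n) \<longlonglongrightarrow> - frechet_derivative \<phi> (at x) b" for x
      by (rule filterlim_compose[OF test_function_difference_quotient(2)[OF \<phi> b]])
    then show "AE x in lborel. (\<lambda>n. repr u x * complex_of_real ((\<phi> (x - h n *\<^sub>R b) - \<phi> x) / h n)) \<longlonglongrightarrow> repr u x * complex_of_real (- frechet_derivative \<phi> (at x) b)"
      by (intro AE_I2 tendsto_intros)
  qed (use borel_measurable_repr[of u] mD in \<open>measurable\<close>)
  moreover have "(\<lambda>n. cinner (D n) ?\<phi>) \<longlonglongrightarrow> cinner (fourier_partial b u) ?\<phi>" by (intro tendsto_intros limD)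
  ultimately have "cinner (fourier_partial b u) ?\<phi> = (LINT x|lborel. repr u x * complex_of_real (- frechet_derivative \<phi> (at x) b))"
    by (rule LIMSEQ_unique[rotated])
  then show ?thesis unfolding c\<phi> by simp
qed

text \<open>\<open>THE\<close> in \<open>weak_partial\<close> demands uniqueness, which is the
  separation of \<open>Ltwo\<close> by test functions.\<close>

lemma weak_partial_eq:
  fixes u :: "'a::euclidean_space Ltwo"
  assumes u: "square_integrable (\<lambda>\<xi>. of_real (norm \<xi>) * repr (fourier u) \<xi>)" and b: "b \<in> Basis"
  shows "weak_partial b u = fourier_partial b u"
  unfolding weak_partial_def
proof (rule the_equality)
  show "\<forall>\<phi>. test_function \<phi> \<longrightarrow>
        (LINT x|lborel. repr u x * complex_of_real (frechet_derivative \<phi> (at x) b)) =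
        - (LINT x|lborel. repr (fourier_partial b u) x * complex_of_real (\<phi> x))"
    using fourier_partial_weak[OF u b] by blast
  fix v assume "\<forall>\<phi>. test_function \<phi> \<longrightarrow>
        (LINT x|lborel. repr u x * complex_of_real (frechet_derivative \<phi> (at x) b)) =
        - (LINT x|lborel. repr v x * complex_of_real (\<phi> x))"
  then show "v = fourier_partial b u"
    using fourier_partial_weak[OF u b] by (intro Ltwo_test_function_separation) (metis neg_equal_iff_equal)
qed

text \<open>Parseval for each coordinate together with the coordinate formula for
  \<open>|\<xi>|^2\<close>. This links the kinetic energy, which is defined through weak
  derivatives, to the multiplier \<open>|\<xi>|\<close>.\<close>

lemma weak_gradient_norm:
  fixes u :: "'a::euclidean_space Ltwo"
  assumes u: "square_integrable (\<lambda>\<xi>. of_real (norm \<xi>) * repr (fourier u) \<xi>)"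
  shows "(LINT x|lborel. (\<Sum>b\<in>Basis. (cmod (repr (weak_partial b u) x))\<^sup>2))
    = (norm (to_Ltwo (\<lambda>\<xi>. of_real (norm \<xi>) * repr (fourier u) \<xi>)))\<^sup>2"
proof -
  have int: "integrable lborel (\<lambda>x. (cmod (repr v x))\<^sup>2)" for v :: "'a Ltwo"
    using square_integrable_repr[of v] by (simp add: square_integrable_def)
  have intb: "integrable lborel (\<lambda>\<xi>. (cmod ((\<i> * of_real (\<xi> \<bullet> b)) * repr (fourier u) \<xi>))\<^sup>2)" if "b \<in> Basis" for b
    using square_integrable_partial[OF u that] by (simp add: square_integrable_def)
  have "(LINT x|lborel. (\<Sum>b\<in>Basis. (cmod (repr (weak_partial b u) x))\<^sup>2)) = (\<Sum>b\<in>Basis. (norm (weak_partial b u))\<^sup>2)"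
    by (subst Bochner_Integration.integral_sum) (auto simp: int power2_norm_Ltwo)
  also have "\<dots> = (\<Sum>b\<in>Basis. LINT \<xi>|lborel. (cmod ((\<i> * of_real (\<xi> \<bullet> b)) * repr (fourier u) \<xi>))\<^sup>2)"
    by (intro sum.cong refl) (simp add: weak_partial_eq[OF u] fourier_partial_def power2_norm_to_Ltwo[OF square_integrable_partial[OF u]])
  also have "\<dots> = (LINT \<xi>|lborel. (\<Sum>b\<in>Basis. (cmod ((\<i> * of_real (\<xi> \<bullet> b)) * repr (fourier u) \<xi>))\<^sup>2))"
    by (rule Bochner_Integration.integral_sum[symmetric]) (rule intb)
  also have "\<dots> = (LINT \<xi>|lborel. (cmod (of_real (norm \<xi>) * repr (fourier u) \<xi>))\<^sup>2)"
  proof (rule Bochner_Integration.integral_cong[OF refl])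
    fix \<xi> :: 'a
    have "(norm \<xi>)\<^sup>2 = (\<Sum>b\<in>Basis. (\<xi> \<bullet> b)\<^sup>2)"
      unfolding power2_norm_eq_inner by (subst euclidean_inner) (simp add: power2_eq_square)
    then show "(\<Sum>b\<in>Basis. (cmod ((\<i> * of_real (\<xi> \<bullet> b)) * repr (fourier u) \<xi>))\<^sup>2) = (cmod (of_real (norm \<xi>) * repr (fourier u) \<xi>))\<^sup>2"
      by (simp add: norm_mult power_mult_distrib sum_distrib_right)
  qed
  also have "\<dots> = (norm (to_Ltwo (\<lambda>\<xi>. of_real (norm \<xi>) * repr (fourier u) \<xi>)))\<^sup>2"
    by (rule power2_norm_to_Ltwo[OF u, symmetric])
  finally show ?thesis .
qed

section \<open>Schur-type estimates for the Riesz kernel\<close>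

lemma sets_cball [measurable]: "cball (c :: 'a::euclidean_space) r \<in> sets borel"
  by (rule borel_closed) simp

section \<open>The bracket \<langle>\<xi>\<rangle> and its elementary inequalities\<close>

definition bracket :: "'a::euclidean_space \<Rightarrow> real" where
  "bracket x = sqrt (1 + (norm x)\<^sup>2)"

lemma bracket_ge_1: "1 \<le> bracket x" by (simp add: bracket_def)
lemma bracket_pos [simp]: "0 < bracket x" using bracket_ge_1[of x] by linarith
lemma bracket_nonneg [simp]: "0 \<le> bracket x" using bracket_pos[of x] by linarith
lemma bracket_ge_norm: "norm x \<le> bracket x" by (simp add: bracket_def real_le_rsqrt)
lemma bracket_minus [simp]: "bracket (- x) = bracket x" by (simp add: bracket_def)
lemma bracket_mono: "norm x \<le> norm y \<Longrightarrow> bracket x \<le> bracket y"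
  by (simp add: bracket_def power_mono)
lemma power2_bracket: "(bracket x)\<^sup>2 = 1 + (norm x)\<^sup>2" by (simp add: bracket_def)

lemma bracket_powr: "(1 + (norm x)\<^sup>2) powr (s / 2) = bracket x powr s"
proof -
  have p: "0 < 1 + (norm x)\<^sup>2" by (rule add_pos_nonneg) auto
  have "bracket x = (1 + (norm x)\<^sup>2) powr (1/2)" using p by (simp add: bracket_def powr_half_sqrt)
  then show ?thesis by (simp add: powr_powr)
qed

lemma measurable_bracket [measurable]: "bracket \<in> borel_measurable borel"
  unfolding bracket_def[abs_def] by measurable

lemma bracket_triangle: "bracket (x + y) \<le> bracket x + bracket y"
proof -
  have "norm x * norm y \<le> bracket x * bracket y"
    by (intro mult_mono bracket_ge_norm) auto
  moreover have "(norm (x + y))\<^sup>2 \<le> (norm x + norm y)\<^sup>2" by (intro power_mono norm_triangle_ineq) auto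
  ultimately have "1 + (norm (x + y))\<^sup>2 \<le> (bracket x + bracket y)\<^sup>2"
    by (simp add: power2_sum power2_bracket)
  then show ?thesis unfolding bracket_def[of "x + y"] by (intro real_le_lsqrt) auto
qed

text \<open>Adding 1 to numerator and denominator of a quotient that is at least 1 brings it closer
  to 1; this is applied to the squares of the norms.\<close>

lemma bracket_ratio:
  assumes "norm y \<le> norm x" "0 < norm y"
  shows "bracket x / bracket y \<le> norm x / norm y"
proof -
  have "bracket x * norm y \<le> norm x * bracket y"
  proof (rule power2_le_imp_le)
    have "(norm y)\<^sup>2 \<le> (norm x)\<^sup>2" using assms by (intro power_mono) auto
    then show "(bracket x * norm y)\<^sup>2 \<le> (norm x * bracket y)\<^sup>2"
      by (simp add: power_mult_distrib power2_bracket algebra_simps)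
  qed simp
  then show ?thesis using assms by (simp add: divide_simps)
qed

section \<open>Integrals of powers over balls and over their complements\<close>

lemma ennreal_geometric_bound:
  fixes c q :: real
  assumes "0 \<le> c" "0 \<le> q" "q < 1"
  shows "(\<Sum>k. ennreal (c * q ^ k)) = ennreal (c / (1 - q))"
proof (rule suminf_ennreal_eq)
  show "(\<lambda>k. c * q ^ k) sums (c / (1 - q))"
    using sums_mult[OF geometric_sums[of q], of c] assms by simp
qed (use assms in simp)

text \<open>Dyadic shells instead of polar coordinates: on each shell the integrand is at most its
  value at the inner radius, and the shell is enlarged to a ball of known volume. The terms form a
  geometric series of ratio \<open>(1/2) powr (N - \<beta>)\<close>, where \<open>N\<close> is the
  dimension.\<close>

lemma nn_integral_powr_cball:
  assumes \<beta>: "0 \<le> \<beta>" "\<beta> < real DIM('a)"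
  shows "\<exists>C\<ge>0. \<forall>r>0. (\<integral>\<^sup>+x. ennreal (norm x powr (- \<beta>)) * indicator (cball 0 r) x \<partial>(lborel :: 'a::euclidean_space measure))
    \<le> ennreal (C * r powr (real DIM('a) - \<beta>))"
proof -
  let ?N = "real DIM('a)"
  define V where "V = unit_ball_vol ?N"
  have V: "0 \<le> V" by (simp add: V_def)
  define q where "q = (1/2::real) powr (?N - \<beta>)"
  have q: "0 \<le> q" "q < 1" using \<beta> powr_less_mono2[of "?N - \<beta>" "1/2" 1] by (auto simp: q_def)
  define C where "C = V * 2 powr \<beta> / (1 - q)"
  have "(\<integral>\<^sup>+x. ennreal (norm x powr (- \<beta>)) * indicator (cball 0 r) x \<partial>(lborel :: 'a measure)) \<le> ennreal (C * r powr (?N - \<beta>))"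
    if r: "r > 0" for r :: real
  proof -
    have pw: "ennreal (norm x powr (- \<beta>)) * indicator (cball 0 r) x
        \<le> (\<Sum>k. ennreal ((r * (1/2)^(k+1)) powr (- \<beta>)) * indicator (cball 0 (r * (1/2)^k)) x)" for x :: 'a
    proof (cases "x = 0 \<or> norm x > r")
      case False
      then have x: "norm x > 0" "norm x \<le> r" by auto
      obtain n where n: "(1/2::real)^n < norm x / r" using real_arch_pow_inv[of "norm x / r" "1/2"] x r by auto
      \<comment> \<open>The first dyadic radius below \<open>norm x\<close>. It is not the radius
        \<open>r\<close> itself, because \<open>norm x \<le> r\<close>, so its predecessor bounds
        \<open>norm x\<close> from above.\<close>
      define m where "m = (LEAST n. r * (1/2::real)^n < norm x)"
      have "r * (1/2::real)^n < norm x" using n r by (simp add: field_simps)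
      then have m: "r * (1/2::real)^m < norm x" unfolding m_def by (rule LeastI)
      have "m \<noteq> 0" using m x by (intro notI) simp
      then obtain k where k: "m = Suc k" using not0_implies_Suc by blast
      have "\<not> r * (1/2::real)^k < norm x" using not_less_Least[of k "\<lambda>n. r * (1/2::real)^n < norm x"] k m_def by simp
      then have "ennreal (norm x powr (- \<beta>)) * indicator (cball 0 r) x \<le> ennreal ((r * (1/2)^(k+1)) powr (- \<beta>)) * indicator (cball 0 (r * (1/2)^k)) x"
        using m k x r \<beta> by (auto intro!: ennreal_leI powr_mono2')
      also have "\<dots> \<le> (\<Sum>k. ennreal ((r * (1/2)^(k+1)) powr (- \<beta>)) * indicator (cball 0 (r * (1/2)^k)) x)"
        by (rule ennreal_le_suminf)
      finally show ?thesis .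
    qed auto
    have trm: "(r * (1/2)^(k+1)) powr (- \<beta>) * (V * (r * (1/2)^k) ^ DIM('a)) = (V * 2 powr \<beta> * r powr (?N - \<beta>)) * q ^ k" for k
    proof -
      have "(r * (1/2)^k) ^ DIM('a) = (r * (1/2)^k) powr ?N" using r by (simp add: powr_realpow)
      moreover have "(r * (1/2)^(k+1)) powr (- \<beta>) = 2 powr \<beta> * (r * (1/2)^k) powr (- \<beta>)"
        using r powr_mult[of "1/2" "r * (1/2)^k" "- \<beta>"] by (simp add: powr_divide powr_minus field_simps)
      moreover have "(r * (1/2)^k) powr (- \<beta>) * (r * (1/2)^k) powr ?N = (r * (1/2)^k) powr (?N - \<beta>)"
        by (simp add: powr_add[symmetric])
      moreover have "(r * (1/2)^k) powr (?N - \<beta>) = r powr (?N - \<beta>) * q ^ k"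
      proof -
        have "((1/2)^k) powr (?N - \<beta>) = q ^ k"
          unfolding q_def by (simp add: powr_powr powr_realpow[symmetric] mult.commute)
        then show ?thesis using r by (simp add: powr_mult)
      qed
      ultimately show ?thesis by (simp add: mult_ac)
    qed
    have "(\<integral>\<^sup>+x. ennreal (norm x powr (- \<beta>)) * indicator (cball 0 r) x \<partial>(lborel :: 'a measure))
       \<le> (\<integral>\<^sup>+x. (\<Sum>k. ennreal ((r * (1/2)^(k+1)) powr (- \<beta>)) * indicator (cball 0 (r * (1/2)^k)) x) \<partial>(lborel :: 'a measure))"
      by (rule nn_integral_mono) (rule pw)
    also have "\<dots> = (\<Sum>k. \<integral>\<^sup>+x. ennreal ((r * (1/2)^(k+1)) powr (- \<beta>)) * indicator (cball 0 (r * (1/2)^k)) x \<partial>(lborel :: 'a measure))"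
      by (rule nn_integral_suminf) measurable
    also have "\<dots> = (\<Sum>k. ennreal ((r * (1/2)^(k+1)) powr (- \<beta>)) * ennreal (V * (r * (1/2)^k) ^ DIM('a)))"
      using r by (intro suminf_cong) (simp add: nn_integral_cmult emeasure_cball V_def)
    also have "\<dots> = (\<Sum>k. ennreal ((V * 2 powr \<beta> * r powr (?N - \<beta>)) * q ^ k))"
      by (simp only: trm ennreal_mult'[symmetric] powr_ge_zero)
    also have "\<dots> = ennreal ((V * 2 powr \<beta> * r powr (?N - \<beta>)) / (1 - q))"
      using q V by (intro ennreal_geometric_bound) auto
    also have "(V * 2 powr \<beta> * r powr (?N - \<beta>)) / (1 - q) = C * r powr (?N - \<beta>)" by (simp add: C_def)
    finally show ?thesis .
  qed
  moreover have "0 \<le> C" using q V by (simp add: C_def)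
  ultimately show ?thesis by blast
qed

text \<open>The same decomposition into shells of growing radius; now the ratio
  \<open>2 powr (N - \<beta>)\<close> of the series is below 1 because the exponent exceeds the
  dimension.\<close>

lemma nn_integral_powr_outside_cball:
  assumes \<beta>: "real DIM('a) < \<beta>"
  shows "\<exists>C\<ge>0. \<forall>r>0. (\<integral>\<^sup>+x. ennreal (norm x powr (- \<beta>)) * indicator (- cball 0 r) x \<partial>(lborel :: 'a::euclidean_space measure))
    \<le> ennreal (C * r powr (real DIM('a) - \<beta>))"
proof -
  let ?N = "real DIM('a)"
  define V where "V = unit_ball_vol ?N"
  have V: "0 \<le> V" by (simp add: V_def)
  define q where "q = (2::real) powr (?N - \<beta>)"
  have q: "0 \<le> q" "q < 1" using \<beta> powr_less_mono[of "?N - \<beta>" 0 2] by (auto simp: q_def)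
  define C where "C = V * 2 powr ?N / (1 - q)"
  have \<beta>0: "0 \<le> \<beta>" using \<beta> by linarith
  have "(\<integral>\<^sup>+x. ennreal (norm x powr (- \<beta>)) * indicator (- cball 0 r) x \<partial>(lborel :: 'a measure)) \<le> ennreal (C * r powr (?N - \<beta>))"
    if r: "r > 0" for r :: real
  proof -
    have pw: "ennreal (norm x powr (- \<beta>)) * indicator (- cball 0 r) x
        \<le> (\<Sum>k. ennreal ((r * 2^k) powr (- \<beta>)) * indicator (cball 0 (r * 2^(k+1))) x)" for x :: 'a
    proof (cases "norm x \<le> r")
      case False
      then have x: "norm x > 0" "norm x > r" using r by auto
      obtain n where n: "norm x / r < (2::real)^n" using real_arch_pow[of 2 "norm x / r"] by auto
      define m where "m = (LEAST n. norm x \<le> r * 2^n)"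
      have "norm x \<le> r * 2^n" using n r by (simp add: field_simps)
      then have m: "norm x \<le> r * 2^m" unfolding m_def by (rule LeastI)
      have "m \<noteq> 0" using m x by (intro notI) simp
      then obtain k where k: "m = Suc k" using not0_implies_Suc by blast
      have "\<not> norm x \<le> r * 2^k" using not_less_Least[of k "\<lambda>n. norm x \<le> r * 2^n"] k m_def by simp
      then have "ennreal (norm x powr (- \<beta>)) * indicator (- cball 0 r) x \<le> ennreal ((r * 2^k) powr (- \<beta>)) * indicator (cball 0 (r * 2^(k+1))) x"
        using m k x r \<beta>0 by (auto intro!: ennreal_leI powr_mono2')
      also have "\<dots> \<le> (\<Sum>k. ennreal ((r * 2^k) powr (- \<beta>)) * indicator (cball 0 (r * 2^(k+1))) x)"
        by (rule ennreal_le_suminf)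
      finally show ?thesis .
    qed auto
    have trm: "(r * 2^k) powr (- \<beta>) * (V * (r * 2^(k+1)) ^ DIM('a)) = (V * 2 powr ?N * r powr (?N - \<beta>)) * q ^ k" for k
    proof -
      have "(r * 2^(k+1)) ^ DIM('a) = (2 * (r * 2^k)) powr ?N" using r by (subst powr_realpow) (auto simp: mult_ac)
      moreover have "(2 * (r * 2^k)) powr ?N = 2 powr ?N * (r * 2^k) powr ?N" using r by (intro powr_mult)
      moreover have "(r * 2^k) powr (- \<beta>) * (r * 2^k) powr ?N = (r * 2^k) powr (?N - \<beta>)"
        by (simp add: powr_add[symmetric])
      moreover have "(r * 2^k) powr (?N - \<beta>) = r powr (?N - \<beta>) * q ^ k"
      proof -
        have "(2^k) powr (?N - \<beta>) = q ^ k"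
          unfolding q_def by (simp add: powr_powr powr_realpow[symmetric] mult.commute)
        then show ?thesis using r by (simp add: powr_mult)
      qed
      ultimately show ?thesis by (simp add: mult_ac)
    qed
    have "(\<integral>\<^sup>+x. ennreal (norm x powr (- \<beta>)) * indicator (- cball 0 r) x \<partial>(lborel :: 'a measure))
       \<le> (\<integral>\<^sup>+x. (\<Sum>k. ennreal ((r * 2^k) powr (- \<beta>)) * indicator (cball 0 (r * 2^(k+1))) x) \<partial>(lborel :: 'a measure))"
      by (rule nn_integral_mono) (rule pw)
    also have "\<dots> = (\<Sum>k. \<integral>\<^sup>+x. ennreal ((r * 2^k) powr (- \<beta>)) * indicator (cball 0 (r * 2^(k+1))) x \<partial>(lborel :: 'a measure))"
      by (rule nn_integral_suminf) measurable
    also have "\<dots> = (\<Sum>k. ennreal ((r * 2^k) powr (- \<beta>)) * ennreal (V * (r * 2^(k+1)) ^ DIM('a)))"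
      using r by (intro suminf_cong) (simp add: nn_integral_cmult emeasure_cball V_def)
    also have "\<dots> = (\<Sum>k. ennreal ((V * 2 powr ?N * r powr (?N - \<beta>)) * q ^ k))"
      by (simp only: trm ennreal_mult'[symmetric] powr_ge_zero)
    also have "\<dots> = ennreal ((V * 2 powr ?N * r powr (?N - \<beta>)) / (1 - q))"
      using q V by (intro ennreal_geometric_bound) auto
    also have "(V * 2 powr ?N * r powr (?N - \<beta>)) / (1 - q) = C * r powr (?N - \<beta>)" by (simp add: C_def)
    finally show ?thesis .
  qed
  moreover have "0 \<le> C" using q V by (simp add: C_def)
  ultimately show ?thesis by blast
qed

text \<open>The weight of the Schur test. Capping the numerator at the bracket of
  \<open>\<xi>\<close> keeps low frequencies from contributing more than
  \<open>bracket p powr \<gamma>\<close>. Capping the denominator in the same way makes the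
  reciprocal a weight of the same kind with \<open>p\<close> and \<open>q\<close> exchanged.\<close>

definition weight_ratio :: "real \<Rightarrow> 'a::euclidean_space \<Rightarrow> 'a \<Rightarrow> 'a \<Rightarrow> real" where
  "weight_ratio \<alpha> p q \<xi> = (min (bracket p) (bracket \<xi>) / min (bracket q) (bracket \<xi>)) powr \<alpha>"

lemma weight_ratio_pos: "0 < weight_ratio \<alpha> p q \<xi>"
proof -
  have "0 < min (bracket p) (bracket \<xi>)" "0 < min (bracket q) (bracket \<xi>)" by auto
  then show ?thesis unfolding weight_ratio_def by (metis divide_pos_pos powr_gt_zero less_irrefl)
qed

lemma weight_ratio_swap: "weight_ratio \<alpha> p q \<xi> * weight_ratio \<alpha> q p \<xi> = 1"
proof -
  have "min (bracket p) (bracket \<xi>) \<noteq> 0" "min (bracket q) (bracket \<xi>) \<noteq> 0"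
    using bracket_pos[of p] bracket_pos[of q] bracket_pos[of \<xi>] by (auto simp: min_def simp del: bracket_pos)
  then have "(min (bracket p) (bracket \<xi>) / min (bracket q) (bracket \<xi>)) * (min (bracket q) (bracket \<xi>) / min (bracket p) (bracket \<xi>)) = 1"
    by simp
  then show ?thesis unfolding weight_ratio_def by (subst powr_mult[symmetric]) simp
qed

lemma weight_ratio_minus [simp]: "weight_ratio \<alpha> p (- q) \<xi> = weight_ratio \<alpha> p q \<xi>" by (simp add: weight_ratio_def)

lemma measurable_weight_ratio [measurable (raw)]:
  "p \<in> borel_measurable M \<Longrightarrow> q \<in> borel_measurable M \<Longrightarrow> \<xi> \<in> borel_measurable M \<Longrightarrow>
    (\<lambda>x. weight_ratio \<alpha> (p x) (q x) (\<xi> x)) \<in> borel_measurable M"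
proof -
  assume [measurable]: "p \<in> borel_measurable M" "q \<in> borel_measurable M" "\<xi> \<in> borel_measurable M"
  have [measurable]: "(\<lambda>x. bracket (f x)) \<in> borel_measurable M" if [measurable]: "f \<in> borel_measurable M" for f
    unfolding bracket_def by measurable
  show "(\<lambda>x. weight_ratio \<alpha> (p x) (q x) (\<xi> x)) \<in> borel_measurable M"
    unfolding weight_ratio_def by measurable
qed

text \<open>The point of the weight \<open>weight_ratio\<close> is that the bound is uniform in \<open>p\<close>: this yields the endpoint
  \<open>s = \<gamma> / 2\<close>.\<close>

lemma riesz_kernel_pointwise:
  fixes a q r \<alpha> \<gamma> N x :: real
  assumes "0 < a" "0 < q" "0 < r" and \<alpha>: "0 < \<gamma>" "\<gamma> < \<alpha>" "\<alpha> < N" "N \<le> \<gamma> + \<alpha>"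
    and x: "0 \<le> x" "a \<le> r \<Longrightarrow> a \<le> q \<Longrightarrow> x \<le> 1" "a \<le> r \<Longrightarrow> q \<le> a \<Longrightarrow> x \<le> a / q"
      "r < a \<Longrightarrow> x \<le> r / q"
  shows "a powr (\<gamma> - N) * x powr \<alpha> \<le> a powr (\<gamma> - N) * indicator {..r} a + r powr \<alpha> * a powr (\<gamma> - N - \<alpha>) * indicator {r<..} a
      + r powr (\<gamma> - N + \<alpha>) * q powr (- \<alpha>) * indicator {..r} q + r powr \<alpha> * q powr (\<gamma> - N - \<alpha>) * indicator {r<..} q"
    (is "?L \<le> ?A1 + ?A2 + ?B1 + ?B2")
proof -
  have nn: "0 \<le> ?A1" "0 \<le> ?A2" "0 \<le> ?B1" "0 \<le> ?B2" by auto
  have q_div: "(c / q) powr \<alpha> = c powr \<alpha> * q powr (- \<alpha>)" if "0 < c" for c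
    using that assms by (simp add: powr_divide powr_minus_divide)
  have add: "a powr (\<gamma> - N) * a powr \<alpha> = a powr (\<gamma> - N + \<alpha>)" "a powr (\<gamma> - N) * a powr (- \<alpha>) = a powr (\<gamma> - N - \<alpha>)"
    "q powr (\<gamma> - N) * q powr (- \<alpha>) = q powr (\<gamma> - N - \<alpha>)" "r powr (\<gamma> - N) * r powr \<alpha> = r powr (\<gamma> - N + \<alpha>)"
    by (simp_all add: powr_add[symmetric])
  \<comment> \<open>Here \<open>a\<close>, \<open>q\<close>, \<open>r\<close> stand for
    \<open>|\<xi>|\<close>, \<open>|p - \<xi>|\<close> and the bracket of \<open>z\<close>, and
    \<open>x\<close> for a quotient of brackets. The condition \<open>\<gamma> < \<alpha>\<close>
    will make the terms outside radius \<open>r\<close> integrable at infinity,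
    \<open>\<alpha> < N\<close> the terms with \<open>q powr (- \<alpha>)\<close> at the origin, and
    \<open>N \<le> \<gamma> + \<alpha>\<close> gives the power in the second case a non-negative
    exponent.\<close>
  consider "a \<le> r" "a \<le> q" | "a \<le> r" "q < a" | "r < a" "a \<le> q" | "r < a" "q < a" "r < q" | "r < a" "q < a" "q \<le> r"
    by linarith
  then show ?thesis
  proof cases
    case 1
    have "x powr \<alpha> \<le> 1 powr \<alpha>" using x 1 assms by (intro powr_mono2) auto
    then have "?L \<le> a powr (\<gamma> - N) * 1" by (intro mult_left_mono) auto
    then have "?L \<le> ?A1" using 1 by simp
    with nn show ?thesis by linarith
  next
    case 2
    have "x powr \<alpha> \<le> (a / q) powr \<alpha>" using x 2 assms by (intro powr_mono2) auto
    then have "?L \<le> a powr (\<gamma> - N) * (a powr \<alpha> * q powr (- \<alpha>))" unfolding q_div[OF \<open>0 < a\<close>] by (intro mult_left_mono) auto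
    also have "\<dots> = a powr (\<gamma> - N + \<alpha>) * q powr (- \<alpha>)" by (simp only: add[symmetric] mult.assoc)
    also have "\<dots> \<le> r powr (\<gamma> - N + \<alpha>) * q powr (- \<alpha>)"
      using 2 assms by (intro mult_right_mono powr_mono2) auto
    finally have "?L \<le> ?B1" using 2 by simp
    with nn show ?thesis by linarith
  next
    case 3
    have "x powr \<alpha> \<le> (r / q) powr \<alpha>" using x 3 assms by (intro powr_mono2) auto
    also have "\<dots> \<le> r powr \<alpha> * a powr (- \<alpha>)" unfolding q_div[OF \<open>0 < r\<close>]
      using 3 assms by (intro mult_left_mono powr_mono2') auto
    finally have "?L \<le> a powr (\<gamma> - N) * (r powr \<alpha> * a powr (- \<alpha>))" by (intro mult_left_mono) auto
    also have "\<dots> = r powr \<alpha> * a powr (\<gamma> - N - \<alpha>)" by (simp only: add[symmetric] mult_ac)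
    finally have "?L \<le> ?A2" using 3 by simp
    with nn show ?thesis by linarith
  next
    case 4
    have "x powr \<alpha> \<le> (r / q) powr \<alpha>" using x 4 assms by (intro powr_mono2) auto
    then have "?L \<le> a powr (\<gamma> - N) * (r powr \<alpha> * q powr (- \<alpha>))" unfolding q_div[OF \<open>0 < r\<close>] by (intro mult_left_mono) auto
    also have "\<dots> \<le> q powr (\<gamma> - N) * (r powr \<alpha> * q powr (- \<alpha>))"
      using 4 assms by (intro mult_right_mono powr_mono2') auto
    also have "\<dots> = r powr \<alpha> * q powr (\<gamma> - N - \<alpha>)" by (simp only: add[symmetric] mult_ac)
    finally have "?L \<le> ?B2" using 4 by simp
    with nn show ?thesis by linarith
  next
    case 5
    have "x powr \<alpha> \<le> (r / q) powr \<alpha>" using x 5 assms by (intro powr_mono2) auto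
    then have "?L \<le> a powr (\<gamma> - N) * (r powr \<alpha> * q powr (- \<alpha>))" unfolding q_div[OF \<open>0 < r\<close>] by (intro mult_left_mono) auto
    also have "\<dots> \<le> r powr (\<gamma> - N) * (r powr \<alpha> * q powr (- \<alpha>))"
      using 5 assms by (intro mult_right_mono powr_mono2') auto
    also have "\<dots> = r powr (\<gamma> - N + \<alpha>) * q powr (- \<alpha>)" by (simp only: add[symmetric] mult.assoc)
    finally have "?L \<le> ?B1" using 5 by simp
    with nn show ?thesis by linarith
  qed
qed

text \<open>Every term of the pointwise bound scales to a multiple of
  \<open>bracket z powr \<gamma>\<close>. The terms in \<open>p - \<xi>\<close> are integrated after
  a substitution that removes \<open>p\<close>, which is why the constant does not depend on
  it.\<close>

lemma riesz_kernel_bound: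
  fixes \<gamma> :: real
  assumes \<gamma>: "0 < \<gamma>" "\<gamma> < real DIM('a::euclidean_space)"
  shows "\<exists>\<alpha> C. 0 \<le> C \<and> (\<forall>p z::'a. (\<integral>\<^sup>+\<xi>. ennreal (norm \<xi> powr (\<gamma> - real DIM('a)) * weight_ratio \<alpha> z (p - \<xi>) \<xi>) \<partial>lborel)
      \<le> ennreal (C * bracket z powr \<gamma>))"
proof -
  define N where "N = real DIM('a)"
  \<comment> \<open>Both candidates lie below \<open>N\<close>; the first is above
    \<open>\<gamma>\<close>, and the second makes \<open>\<gamma> + \<alpha>\<close> at least
    \<open>N\<close>.\<close>
  define \<alpha> where "\<alpha> = max ((\<gamma> + N) / 2) (N - \<gamma> / 2)"
  have \<alpha>: "0 < \<gamma>" "\<gamma> < \<alpha>" "\<alpha> < N" "N \<le> \<gamma> + \<alpha>"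
    using \<gamma> by (auto simp: \<alpha>_def N_def max_def field_simps)
  obtain C1 where C1: "0 \<le> C1" "\<And>r. r > 0 \<Longrightarrow> (\<integral>\<^sup>+x. ennreal (norm x powr (- (N - \<gamma>))) * indicator (cball 0 r) x \<partial>(lborel :: 'a measure)) \<le> ennreal (C1 * r powr (N - (N - \<gamma>)))"
    using nn_integral_powr_cball[of "N - \<gamma>", where 'a = 'a] \<gamma> unfolding N_def by auto
  obtain C2 where C2: "0 \<le> C2" "\<And>r. r > 0 \<Longrightarrow> (\<integral>\<^sup>+x. ennreal (norm x powr (- (N - \<gamma> + \<alpha>))) * indicator (- cball 0 r) x \<partial>(lborel :: 'a measure)) \<le> ennreal (C2 * r powr (N - (N - \<gamma> + \<alpha>)))"
    using nn_integral_powr_outside_cball[of "N - \<gamma> + \<alpha>", where 'a = 'a] \<alpha> unfolding N_def by auto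
  obtain C3 where C3: "0 \<le> C3" "\<And>r. r > 0 \<Longrightarrow> (\<integral>\<^sup>+x. ennreal (norm x powr (- \<alpha>)) * indicator (cball 0 r) x \<partial>(lborel :: 'a measure)) \<le> ennreal (C3 * r powr (N - \<alpha>))"
    using nn_integral_powr_cball[of \<alpha>, where 'a = 'a] \<alpha> unfolding N_def by auto
  define C where "C = 2 * C1 + 4 * C2 + 2 * C3"
  have "(\<integral>\<^sup>+\<xi>. ennreal (norm \<xi> powr (\<gamma> - N) * weight_ratio \<alpha> z (p - \<xi>) \<xi>) \<partial>lborel) \<le> ennreal (C * bracket z powr \<gamma>)" for p z :: 'a
  proof -
    define r where "r = bracket z"
    have r: "0 < r" by (simp add: r_def)
    define g where "g a = a powr (\<gamma> - N) * indicator {..r} a" for a :: real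
    define h where "h a = r powr \<alpha> * a powr (\<gamma> - N - \<alpha>) * indicator {r<..} a" for a :: real
    define k where "k a = r powr (\<gamma> - N + \<alpha>) * a powr (- \<alpha>) * indicator {..r} a" for a :: real
    have [measurable]: "g \<in> borel_measurable borel" "h \<in> borel_measurable borel" "k \<in> borel_measurable borel"
      unfolding g_def h_def k_def by measurable
    have ghk: "0 \<le> g a" "0 \<le> h a" "0 \<le> k a" for a by (auto simp: g_def h_def k_def)
    have iG: "(\<integral>\<^sup>+\<xi>. ennreal (g (norm (\<xi>::'a))) \<partial>lborel) \<le> ennreal (C1 * r powr \<gamma>)"
    proof -
      have "(\<integral>\<^sup>+\<xi>. ennreal (g (norm (\<xi>::'a))) \<partial>lborel) = (\<integral>\<^sup>+x. ennreal (norm x powr (- (N - \<gamma>))) * indicator (cball 0 r) x \<partial>(lborel :: 'a measure))"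
        by (intro nn_integral_cong) (auto simp: g_def indicator_def)
      then show ?thesis using C1(2)[OF r] by simp
    qed
    have iH: "(\<integral>\<^sup>+\<xi>. ennreal (h (norm (\<xi>::'a))) \<partial>lborel) \<le> ennreal (C2 * r powr \<gamma>)"
    proof -
      have "(\<integral>\<^sup>+\<xi>. ennreal (h (norm (\<xi>::'a))) \<partial>lborel) = (\<integral>\<^sup>+x. ennreal (r powr \<alpha>) * (ennreal (norm x powr (- (N - \<gamma> + \<alpha>))) * indicator (- cball 0 r) x) \<partial>(lborel :: 'a measure))"
        by (intro nn_integral_cong) (auto simp: h_def indicator_def ennreal_mult' algebra_simps)
      also have "\<dots> = ennreal (r powr \<alpha>) * (\<integral>\<^sup>+x. ennreal (norm x powr (- (N - \<gamma> + \<alpha>))) * indicator (- cball 0 r) x \<partial>(lborel :: 'a measure))"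
        by (rule nn_integral_cmult) measurable
      also have "\<dots> \<le> ennreal (r powr \<alpha>) * ennreal (C2 * r powr (N - (N - \<gamma> + \<alpha>)))"
        by (intro mult_left_mono C2(2) r) auto
      also have "\<dots> = ennreal (C2 * r powr \<gamma>)"
      proof -
        have "r powr \<alpha> * (C2 * r powr (N - (N - \<gamma> + \<alpha>))) = C2 * r powr \<gamma>"
          using r by (simp add: mult.left_commute[of _ C2] powr_add[symmetric])
        then show ?thesis by (simp only: ennreal_mult'[symmetric] powr_ge_zero)
      qed
      finally show ?thesis .
    qed
    have iK: "(\<integral>\<^sup>+\<xi>. ennreal (k (norm (\<xi>::'a))) \<partial>lborel) \<le> ennreal (C3 * r powr \<gamma>)"
    proof -
      have "(\<integral>\<^sup>+\<xi>. ennreal (k (norm (\<xi>::'a))) \<partial>lborel) = (\<integral>\<^sup>+x. ennreal (r powr (\<gamma> - N + \<alpha>)) * (ennreal (norm x powr (- \<alpha>)) * indicator (cball 0 r) x) \<partial>(lborel :: 'a measure))"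
        by (intro nn_integral_cong) (auto simp: k_def indicator_def ennreal_mult' algebra_simps)
      also have "\<dots> = ennreal (r powr (\<gamma> - N + \<alpha>)) * (\<integral>\<^sup>+x. ennreal (norm x powr (- \<alpha>)) * indicator (cball 0 r) x \<partial>(lborel :: 'a measure))"
        by (rule nn_integral_cmult) measurable
      also have "\<dots> \<le> ennreal (r powr (\<gamma> - N + \<alpha>)) * ennreal (C3 * r powr (N - \<alpha>))"
        by (intro mult_left_mono C3(2) r) auto
      also have "\<dots> = ennreal (C3 * r powr \<gamma>)"
      proof -
        have "r powr (\<gamma> - N + \<alpha>) * (C3 * r powr (N - \<alpha>)) = C3 * r powr \<gamma>"
          using r by (simp add: mult.left_commute[of _ C3] powr_add[symmetric])
        then show ?thesis by (simp only: ennreal_mult'[symmetric] powr_ge_zero)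
      qed
      finally show ?thesis .
    qed
    have AE0: "AE \<xi> in lborel. \<xi> \<noteq> 0 \<and> \<xi> \<noteq> p"
      using AE_lborel_singleton[of 0] AE_lborel_singleton[of p] by eventually_elim auto
    let ?S = "\<lambda>\<xi>. g (norm \<xi>) + h (norm \<xi>) + k (norm \<xi>) + h (norm \<xi>) + (g (norm \<xi>) + h (norm \<xi>) + k (norm (p - \<xi>)) + h (norm (p - \<xi>)))"
    have pw: "AE \<xi> in lborel. norm \<xi> powr (\<gamma> - N) * weight_ratio \<alpha> z (p - \<xi>) \<xi> \<le> ?S \<xi>"
      using AE0
    proof eventually_elim
      case (elim \<xi>)
      define a where "a = norm \<xi>"
      define q where "q = norm (p - \<xi>)"
      have aq: "0 < a" "0 < q" using elim by (auto simp: a_def q_def)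
      define m where "m = min (bracket z) (bracket \<xi>)"
      have m: "0 \<le> m" "m \<le> r" "m \<le> bracket \<xi>" by (auto simp: m_def r_def)
      have b1: "a powr (\<gamma> - N) * (m / bracket \<xi>) powr \<alpha> \<le> g a + h a + k a + h a"
        unfolding g_def h_def k_def
      proof (rule riesz_kernel_pointwise[OF aq(1) aq(1) r \<alpha>])
        show "m / bracket \<xi> \<le> r / a"
          using m aq bracket_ge_norm[of \<xi>] r unfolding a_def by (intro frac_le) auto
        show "m / bracket \<xi> \<le> 1" using m by simp
        show "m / bracket \<xi> \<le> a / a" using m aq by simp
      qed (use m in simp)
      have b2: "a powr (\<gamma> - N) * (m / bracket (p - \<xi>)) powr \<alpha> \<le> g a + h a + k q + h q"
        unfolding g_def h_def k_def
      proof (rule riesz_kernel_pointwise[OF aq r \<alpha>])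
        show "m / bracket (p - \<xi>) \<le> r / q"
          using m aq bracket_ge_norm[of "p - \<xi>"] r unfolding q_def by (intro frac_le) auto
        show "m / bracket (p - \<xi>) \<le> 1" if "a \<le> q"
          using that m bracket_mono[of \<xi> "p - \<xi>"] by (simp add: a_def q_def)
        show "m / bracket (p - \<xi>) \<le> a / q" if "q \<le> a"
        proof -
          have "m / bracket (p - \<xi>) \<le> bracket \<xi> / bracket (p - \<xi>)" using m by (intro divide_right_mono) auto
          also have "\<dots> \<le> a / q" using bracket_ratio[of "p - \<xi>" \<xi>] that aq by (simp add: a_def q_def)
          finally show ?thesis .
        qed
      qed (use m in simp)
      \<comment> \<open>The minimum in the denominator is one of the two brackets, so the weight is
        at most the sum of the two quotients estimated in \<open>b1\<close> and
        \<open>b2\<close>.\<close>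
      have "weight_ratio \<alpha> z (p - \<xi>) \<xi> \<le> (m / bracket \<xi>) powr \<alpha> + (m / bracket (p - \<xi>)) powr \<alpha>"
        unfolding weight_ratio_def m_def[symmetric] by (cases "bracket (p - \<xi>) \<le> bracket \<xi>") (auto simp: min_def)
      then have "a powr (\<gamma> - N) * weight_ratio \<alpha> z (p - \<xi>) \<xi> \<le> a powr (\<gamma> - N) * ((m / bracket \<xi>) powr \<alpha> + (m / bracket (p - \<xi>)) powr \<alpha>)"
        by (intro mult_left_mono) auto
      also have "\<dots> \<le> (g a + h a + k a + h a) + (g a + h a + k q + h q)"
        using b1 b2 by (simp add: distrib_left)
      finally show ?case by (simp add: a_def q_def)
    qed
    have shift: "(\<integral>\<^sup>+\<xi>. ennreal (f (norm (p - \<xi>))) \<partial>lborel) = (\<integral>\<^sup>+\<xi>. ennreal (f (norm (\<xi>::'a))) \<partial>lborel)"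
      if "f \<in> borel_measurable borel" for f :: "real \<Rightarrow> real"
      using nn_integral_affine[of "\<lambda>\<xi>. ennreal (f (norm \<xi>))" "-1" p] that by simp
    have "(\<integral>\<^sup>+\<xi>. ennreal (norm \<xi> powr (\<gamma> - N) * weight_ratio \<alpha> z (p - \<xi>) \<xi>) \<partial>lborel) \<le> (\<integral>\<^sup>+\<xi>. ennreal (?S \<xi>) \<partial>lborel)"
      using pw by (intro nn_integral_mono_AE) (auto elim: eventually_mono intro: ennreal_leI)
    also have "\<dots> = (\<integral>\<^sup>+\<xi>. ennreal (g (norm (\<xi>::'a))) \<partial>lborel) + (\<integral>\<^sup>+\<xi>. ennreal (h (norm (\<xi>::'a))) \<partial>lborel)
       + (\<integral>\<^sup>+\<xi>. ennreal (k (norm (\<xi>::'a))) \<partial>lborel) + (\<integral>\<^sup>+\<xi>. ennreal (h (norm (\<xi>::'a))) \<partial>lborel)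
       + ((\<integral>\<^sup>+\<xi>. ennreal (g (norm (\<xi>::'a))) \<partial>lborel) + (\<integral>\<^sup>+\<xi>. ennreal (h (norm (\<xi>::'a))) \<partial>lborel)
       + (\<integral>\<^sup>+\<xi>. ennreal (k (norm (\<xi>::'a))) \<partial>lborel) + (\<integral>\<^sup>+\<xi>. ennreal (h (norm (\<xi>::'a))) \<partial>lborel))"
      by (simp only: ennreal_plus ghk add_nonneg_nonneg) (simp add: nn_integral_add shift)
    also have "\<dots> \<le> ennreal (C1 * r powr \<gamma>) + ennreal (C2 * r powr \<gamma>) + ennreal (C3 * r powr \<gamma>) + ennreal (C2 * r powr \<gamma>)
       + (ennreal (C1 * r powr \<gamma>) + ennreal (C2 * r powr \<gamma>) + ennreal (C3 * r powr \<gamma>) + ennreal (C2 * r powr \<gamma>))"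
      by (intro add_mono iG iH iK)
    also have "\<dots> = ennreal (C * r powr \<gamma>)"
      using C1(1) C2(1) C3(1) by (simp add: ennreal_plus[symmetric] C_def algebra_simps del: ennreal_plus)
    finally show ?thesis by (simp add: r_def)
  qed
  moreover have "0 \<le> C" using C1 C2 C3 by (simp add: C_def)
  ultimately show ?thesis unfolding N_def by blast
qed

section \<open>Cauchy-Schwarz and Schur tests for iterated integrals\<close>

lemma nn_integral_triple:
  assumes [measurable]: "f \<in> borel_measurable (lborel \<Otimes>\<^sub>M (lborel \<Otimes>\<^sub>M (lborel :: 'a::euclidean_space measure)))"
  shows "(\<integral>\<^sup>+z. f z \<partial>((lborel :: 'a measure) \<Otimes>\<^sub>M ((lborel :: 'a measure) \<Otimes>\<^sub>M lborel)))
    = (\<integral>\<^sup>+x. \<integral>\<^sup>+y. \<integral>\<^sup>+z. f (x, y, z) \<partial>lborel \<partial>lborel \<partial>lborel)"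
proof -
  have P: "sigma_finite_measure ((lborel :: 'a measure) \<Otimes>\<^sub>M (lborel :: 'a measure))"
    by (simp add: lborel_prod sigma_finite_lborel)
  show ?thesis
    by (subst sigma_finite_measure.nn_integral_fst[OF P, symmetric])
       (simp_all add: lborel.nn_integral_fst[symmetric])
qed

lemma ennreal_le_of_square:
  assumes "I\<^sup>2 \<le> ennreal (x\<^sup>2)" "0 \<le> x" shows "I \<le> ennreal x"
proof (cases I)
  case (real r)
  then have "ennreal (r\<^sup>2) \<le> ennreal (x\<^sup>2)" using assms by (simp add: ennreal_power)
  then have "r\<^sup>2 \<le> x\<^sup>2" by (simp add: ennreal_le_iff)
  then have "r \<le> x" using assms(2) by (rule power2_le_imp_le)
  then show ?thesis using real by (simp add: ennreal_leI)
next
  case top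
  then show ?thesis using assms by (simp add: top_unique)
qed

text \<open>Formulated with upper bounds for the square integrals, so that finite constants can be
  passed on directly.\<close>

lemma Cauchy_Schwarz_ennreal:
  assumes [measurable]: "f \<in> borel_measurable M" "g \<in> borel_measurable M"
    and nn: "\<And>z. 0 \<le> f z" "\<And>z. 0 \<le> g z" "0 \<le> x" "0 \<le> y"
    and f: "(\<integral>\<^sup>+z. ennreal ((f z)\<^sup>2) \<partial>M) \<le> ennreal (x\<^sup>2)" and g: "(\<integral>\<^sup>+z. ennreal ((g z)\<^sup>2) \<partial>M) \<le> ennreal (y\<^sup>2)"
  shows "(\<integral>\<^sup>+z. ennreal (f z * g z) \<partial>M) \<le> ennreal (x * y)"
proof (rule ennreal_le_of_square)
  have "(\<integral>\<^sup>+z. ennreal (f z * g z) \<partial>M)\<^sup>2 = (\<integral>\<^sup>+z. ennreal (f z) * ennreal (g z) \<partial>M)\<^sup>2"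
    by (simp add: ennreal_mult nn)
  also have "\<dots> \<le> (\<integral>\<^sup>+z. (ennreal (f z))\<^sup>2 \<partial>M) * (\<integral>\<^sup>+z. (ennreal (g z))\<^sup>2 \<partial>M)"
    by (rule Cauchy_Schwarz_nn_integral) measurable
  also have "\<dots> = (\<integral>\<^sup>+z. ennreal ((f z)\<^sup>2) \<partial>M) * (\<integral>\<^sup>+z. ennreal ((g z)\<^sup>2) \<partial>M)"
    by (simp add: ennreal_power nn)
  also have "\<dots> \<le> ennreal (x\<^sup>2) * ennreal (y\<^sup>2)" by (rule mult_mono[OF f g]) auto
  also have "\<dots> = ennreal ((x * y)\<^sup>2)" by (simp add: ennreal_mult' power_mult_distrib)
  finally show "(\<integral>\<^sup>+z. ennreal (f z * g z) \<partial>M)\<^sup>2 \<le> ennreal ((x * y)\<^sup>2)" .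
qed (use nn in simp)

text \<open>Tonelli places \<open>\<xi>\<close> innermost, where the kernel bound is uniform in
  \<open>\<eta>\<close> and costs only a weight in \<open>\<zeta>\<close>; afterwards the two
  remaining integrals separate. The second conclusion serves the grouping in which the weighted
  variable is integrated before the last step.\<close>

lemma Schur_triple:
  fixes K :: "'a::euclidean_space \<times> 'a \<times> 'a \<Rightarrow> real"
  assumes [measurable]: "K \<in> borel_measurable (borel \<Otimes>\<^sub>M (borel \<Otimes>\<^sub>M borel))"
    and [measurable]: "g \<in> borel_measurable borel" "h \<in> borel_measurable borel" "w \<in> borel_measurable borel"
    and nn: "\<And>x. 0 \<le> g x" "\<And>x. 0 \<le> h x" "\<And>x. 0 \<le> w x" "0 \<le> C" "0 \<le> x" "0 \<le> y"
    and bound: "\<And>\<eta> \<zeta>. (\<integral>\<^sup>+\<xi>. ennreal (K (\<xi>, \<eta>, \<zeta>)) \<partial>lborel) \<le> ennreal (C * w \<zeta>)"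
    and g: "(\<integral>\<^sup>+\<eta>. ennreal (g \<eta>) \<partial>lborel) \<le> ennreal x" and h: "(\<integral>\<^sup>+\<zeta>. ennreal (w \<zeta> * h \<zeta>) \<partial>lborel) \<le> ennreal y"
  shows "(\<integral>\<^sup>+\<xi>. \<integral>\<^sup>+\<eta>. \<integral>\<^sup>+\<zeta>. ennreal (K (\<xi>, \<eta>, \<zeta>) * (g \<eta> * h \<zeta>)) \<partial>lborel \<partial>lborel \<partial>lborel) \<le> ennreal (C * x * y)"
    and "(\<integral>\<^sup>+\<xi>. \<integral>\<^sup>+\<zeta>. \<integral>\<^sup>+\<eta>. ennreal (K (\<xi>, \<eta>, \<zeta>) * (g \<eta> * h \<zeta>)) \<partial>lborel \<partial>lborel \<partial>lborel) \<le> ennreal (C * x * y)"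
proof -
  have "(\<integral>\<^sup>+\<xi>. \<integral>\<^sup>+\<eta>. \<integral>\<^sup>+\<zeta>. ennreal (K (\<xi>, \<eta>, \<zeta>) * (g \<eta> * h \<zeta>)) \<partial>lborel \<partial>lborel \<partial>lborel)
     = (\<integral>\<^sup>+\<eta>. \<integral>\<^sup>+\<xi>. \<integral>\<^sup>+\<zeta>. ennreal (K (\<xi>, \<eta>, \<zeta>) * (g \<eta> * h \<zeta>)) \<partial>lborel \<partial>lborel \<partial>lborel)"
    by (rule lborel_pair.Fubini'[symmetric]) measurable
  also have "\<dots> = (\<integral>\<^sup>+\<eta>. \<integral>\<^sup>+\<zeta>. \<integral>\<^sup>+\<xi>. ennreal (K (\<xi>, \<eta>, \<zeta>) * (g \<eta> * h \<zeta>)) \<partial>lborel \<partial>lborel \<partial>lborel)"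
    by (intro nn_integral_cong lborel_pair.Fubini'[symmetric]) measurable
  also have "\<dots> \<le> (\<integral>\<^sup>+\<eta>. \<integral>\<^sup>+\<zeta>. ennreal (g \<eta>) * (ennreal C * ennreal (w \<zeta> * h \<zeta>)) \<partial>lborel \<partial>lborel)"
  proof (intro nn_integral_mono)
    fix \<eta> \<zeta>
    have "(\<integral>\<^sup>+\<xi>. ennreal (K (\<xi>, \<eta>, \<zeta>) * (g \<eta> * h \<zeta>)) \<partial>lborel) = (\<integral>\<^sup>+\<xi>. ennreal (K (\<xi>, \<eta>, \<zeta>)) \<partial>lborel) * ennreal (g \<eta> * h \<zeta>)"
      using nn by (simp add: ennreal_mult'' nn_integral_multc)
    also have "\<dots> \<le> ennreal (C * w \<zeta>) * ennreal (g \<eta> * h \<zeta>)" by (intro mult_right_mono bound) auto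
    also have "\<dots> = ennreal (g \<eta>) * (ennreal C * ennreal (w \<zeta> * h \<zeta>))"
      using nn by (simp add: ennreal_mult'[symmetric] ennreal_mult''[symmetric] mult_ac)
    finally show "(\<integral>\<^sup>+\<xi>. ennreal (K (\<xi>, \<eta>, \<zeta>) * (g \<eta> * h \<zeta>)) \<partial>lborel) \<le> ennreal (g \<eta>) * (ennreal C * ennreal (w \<zeta> * h \<zeta>))" .
  qed
  also have "\<dots> = (\<integral>\<^sup>+\<eta>. ennreal (g \<eta>) \<partial>lborel) * (ennreal C * (\<integral>\<^sup>+\<zeta>. ennreal (w \<zeta> * h \<zeta>) \<partial>lborel))"
    by (simp add: nn_integral_cmult nn_integral_multc)
  also have "\<dots> \<le> ennreal x * (ennreal C * ennreal y)" by (intro mult_mono g h order_refl) auto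
  also have "\<dots> = ennreal (C * x * y)"
    using nn by (simp add: ennreal_mult'[symmetric] ennreal_mult''[symmetric] mult_ac)
  finally show *: "(\<integral>\<^sup>+\<xi>. \<integral>\<^sup>+\<eta>. \<integral>\<^sup>+\<zeta>. ennreal (K (\<xi>, \<eta>, \<zeta>) * (g \<eta> * h \<zeta>)) \<partial>lborel \<partial>lborel \<partial>lborel) \<le> ennreal (C * x * y)" .
  have "(\<integral>\<^sup>+\<xi>. \<integral>\<^sup>+\<zeta>. \<integral>\<^sup>+\<eta>. ennreal (K (\<xi>, \<eta>, \<zeta>) * (g \<eta> * h \<zeta>)) \<partial>lborel \<partial>lborel \<partial>lborel)
     = (\<integral>\<^sup>+\<xi>. \<integral>\<^sup>+\<eta>. \<integral>\<^sup>+\<zeta>. ennreal (K (\<xi>, \<eta>, \<zeta>) * (g \<eta> * h \<zeta>)) \<partial>lborel \<partial>lborel \<partial>lborel)"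
    by (intro nn_integral_cong lborel_pair.Fubini') measurable
  with * show "(\<integral>\<^sup>+\<xi>. \<integral>\<^sup>+\<zeta>. \<integral>\<^sup>+\<eta>. ennreal (K (\<xi>, \<eta>, \<zeta>) * (g \<eta> * h \<zeta>)) \<partial>lborel \<partial>lborel \<partial>lborel) \<le> ennreal (C * x * y)"
    by simp
qed

lemma Schur_double:
  fixes K :: "'a::euclidean_space \<times> 'a \<Rightarrow> real"
  assumes [measurable]: "K \<in> borel_measurable (borel \<Otimes>\<^sub>M borel)"
    and [measurable]: "h \<in> borel_measurable borel" "w \<in> borel_measurable borel"
    and nn: "\<And>x. 0 \<le> h x" "\<And>x. 0 \<le> w x" "0 \<le> C" "0 \<le> y"
    and bound: "\<And>\<zeta>. (\<integral>\<^sup>+\<xi>. ennreal (K (\<xi>, \<zeta>)) \<partial>lborel) \<le> ennreal (C * w \<zeta>)"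
    and h: "(\<integral>\<^sup>+\<zeta>. ennreal (w \<zeta> * h \<zeta>) \<partial>lborel) \<le> ennreal y"
  shows "(\<integral>\<^sup>+\<xi>. \<integral>\<^sup>+\<zeta>. ennreal (K (\<xi>, \<zeta>) * h \<zeta>) \<partial>lborel \<partial>lborel) \<le> ennreal (C * y)"
proof -
  have "(\<integral>\<^sup>+\<xi>. \<integral>\<^sup>+\<zeta>. ennreal (K (\<xi>, \<zeta>) * h \<zeta>) \<partial>lborel \<partial>lborel) = (\<integral>\<^sup>+\<zeta>. \<integral>\<^sup>+\<xi>. ennreal (K (\<xi>, \<zeta>) * h \<zeta>) \<partial>lborel \<partial>lborel)"
    by (rule lborel_pair.Fubini'[symmetric]) measurable
  also have "\<dots> \<le> (\<integral>\<^sup>+\<zeta>. ennreal C * ennreal (w \<zeta> * h \<zeta>) \<partial>lborel)"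
  proof (intro nn_integral_mono)
    fix \<zeta>
    have "(\<integral>\<^sup>+\<xi>. ennreal (K (\<xi>, \<zeta>) * h \<zeta>) \<partial>lborel) = (\<integral>\<^sup>+\<xi>. ennreal (K (\<xi>, \<zeta>)) \<partial>lborel) * ennreal (h \<zeta>)"
      using nn by (simp add: ennreal_mult'' nn_integral_multc)
    also have "\<dots> \<le> ennreal (C * w \<zeta>) * ennreal (h \<zeta>)" by (intro mult_right_mono bound) auto
    also have "\<dots> = ennreal C * ennreal (w \<zeta> * h \<zeta>)"
      using nn by (simp add: ennreal_mult'[symmetric] ennreal_mult''[symmetric] mult_ac)
    finally show "(\<integral>\<^sup>+\<xi>. ennreal (K (\<xi>, \<zeta>) * h \<zeta>) \<partial>lborel) \<le> ennreal C * ennreal (w \<zeta> * h \<zeta>)" .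
  qed
  also have "\<dots> = ennreal C * (\<integral>\<^sup>+\<zeta>. ennreal (w \<zeta> * h \<zeta>) \<partial>lborel)" by (rule nn_integral_cmult) measurable
  also have "\<dots> \<le> ennreal C * ennreal y" by (intro mult_left_mono h) auto
  also have "\<dots> = ennreal (C * y)" using nn by (simp add: ennreal_mult')
  finally show ?thesis .
qed

text \<open>An upper bound instead of the norm itself: a weight can be lowered while keeping the
  same number \<open>n\<close>, as in \<open>sq_bound_mono\<close>.\<close>

definition sq_bound :: "('a::euclidean_space \<Rightarrow> real) \<Rightarrow> real \<Rightarrow> bool" where
  "sq_bound f n \<longleftrightarrow> f \<in> borel_measurable borel \<and> (\<forall>x. 0 \<le> f x) \<and> 0 \<le> n \<and>
     (\<integral>\<^sup>+x. ennreal ((f x)\<^sup>2) \<partial>lborel) \<le> ennreal (n\<^sup>2)"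

text \<open>The Hartree form on the Fourier side with absolute values inserted: the correlations of
  \<open>a\<close>, \<open>b\<close> and of \<open>c\<close>, \<open>d\<close>, integrated against
  the transform of the Riesz kernel without its constant (see \<open>quad_corr\<close>).\<close>

definition quad :: "real \<Rightarrow> ('a::euclidean_space \<Rightarrow> real) \<Rightarrow> ('a \<Rightarrow> real) \<Rightarrow> ('a \<Rightarrow> real) \<Rightarrow> ('a \<Rightarrow> real) \<Rightarrow> ennreal" where
  "quad \<gamma> a b c d = (\<integral>\<^sup>+\<xi>. \<integral>\<^sup>+\<eta>. \<integral>\<^sup>+\<zeta>.
     ennreal (norm \<xi> powr (\<gamma> - real DIM('a)) * (a (\<xi> + \<eta>) * b \<eta> * (c (\<xi> + \<zeta>) * d \<zeta>))) \<partial>lborel \<partial>lborel \<partial>lborel)"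

text \<open>The exponent and the constant that \<open>riesz_kernel_bound\<close> provides become
  parameters, so that later constants can be expressed through \<open>C\<close>.\<close>

locale riesz =
  fixes \<gamma> \<alpha> C :: real and dim_type :: "'a::euclidean_space itself"
  assumes C0: "0 \<le> C"
    and kernel: "\<And>p z::'a. (\<integral>\<^sup>+\<xi>. ennreal (norm \<xi> powr (\<gamma> - real DIM('a)) * weight_ratio \<alpha> z (p - \<xi>) \<xi>) \<partial>lborel)
      \<le> ennreal (C * bracket z powr \<gamma>)"
begin

abbreviation kap :: "'a \<Rightarrow> real" where "kap \<xi> \<equiv> norm \<xi> powr (\<gamma> - real DIM('a))"

lemma kernel': "(\<integral>\<^sup>+\<xi>. ennreal (kap \<xi> * weight_ratio \<alpha> z (\<xi> + q) \<xi>) \<partial>lborel) \<le> ennreal (C * bracket z powr \<gamma>)"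
proof -
  have "weight_ratio \<alpha> z (\<xi> + q) \<xi> = weight_ratio \<alpha> z (- q - \<xi>) \<xi>" for \<xi>
  proof -
    have "- q - \<xi> = - (\<xi> + q)" by simp
    then show ?thesis by (simp only: weight_ratio_minus)
  qed
  then show ?thesis using kernel[of z "- q"] by simp
qed

text \<open>Since \<open>R * R' = 1\<close>, the kernel is the product of
  \<open>sqrt (kap \<xi> * R)\<close> and \<open>sqrt (kap \<xi> * R')\<close>, and each root
  accompanies one of the two factors.\<close>

lemma Cauchy_Schwarz_triple:
  fixes F G R R' :: "'a \<times> 'a \<times> 'a \<Rightarrow> real"
  assumes [measurable]: "F \<in> borel_measurable (borel \<Otimes>\<^sub>M (borel \<Otimes>\<^sub>M borel))"
      "G \<in> borel_measurable (borel \<Otimes>\<^sub>M (borel \<Otimes>\<^sub>M borel))"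
      "R \<in> borel_measurable (borel \<Otimes>\<^sub>M (borel \<Otimes>\<^sub>M borel))"
      "R' \<in> borel_measurable (borel \<Otimes>\<^sub>M (borel \<Otimes>\<^sub>M borel))"
    and nn: "\<And>z. 0 \<le> F z" "\<And>z. 0 \<le> G z" "\<And>z. 0 < R z" "\<And>z. 0 < R' z" "0 \<le> x" "0 \<le> y"
    and RR: "\<And>\<xi> \<eta> \<zeta>. R (\<xi>, \<eta>, \<zeta>) * R' (\<xi>, \<eta>, \<zeta>) = 1"
    and F: "(\<integral>\<^sup>+\<xi>. \<integral>\<^sup>+\<eta>. \<integral>\<^sup>+\<zeta>. ennreal (kap \<xi> * R (\<xi>, \<eta>, \<zeta>) * (F (\<xi>, \<eta>, \<zeta>))\<^sup>2) \<partial>lborel \<partial>lborel \<partial>lborel) \<le> ennreal (C * x\<^sup>2)"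
    and G: "(\<integral>\<^sup>+\<xi>. \<integral>\<^sup>+\<eta>. \<integral>\<^sup>+\<zeta>. ennreal (kap \<xi> * R' (\<xi>, \<eta>, \<zeta>) * (G (\<xi>, \<eta>, \<zeta>))\<^sup>2) \<partial>lborel \<partial>lborel \<partial>lborel) \<le> ennreal (C * y\<^sup>2)"
  shows "(\<integral>\<^sup>+\<xi>. \<integral>\<^sup>+\<eta>. \<integral>\<^sup>+\<zeta>. ennreal (kap \<xi> * (F (\<xi>, \<eta>, \<zeta>) * G (\<xi>, \<eta>, \<zeta>))) \<partial>lborel \<partial>lborel \<partial>lborel) \<le> ennreal (C * (x * y))"
proof -
  define f where "f = (\<lambda>(\<xi>, \<eta>, \<zeta>). sqrt (kap \<xi> * R (\<xi>, \<eta>, \<zeta>)) * F (\<xi>, \<eta>, \<zeta>))"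
  define g where "g = (\<lambda>(\<xi>, \<eta>, \<zeta>). sqrt (kap \<xi> * R' (\<xi>, \<eta>, \<zeta>)) * G (\<xi>, \<eta>, \<zeta>))"
  have [measurable]: "f \<in> borel_measurable (borel \<Otimes>\<^sub>M (borel \<Otimes>\<^sub>M borel))" "g \<in> borel_measurable (borel \<Otimes>\<^sub>M (borel \<Otimes>\<^sub>M borel))"
    unfolding f_def g_def by measurable
  have f2: "(f (\<xi>, \<eta>, \<zeta>))\<^sup>2 = kap \<xi> * R (\<xi>, \<eta>, \<zeta>) * (F (\<xi>, \<eta>, \<zeta>))\<^sup>2" for \<xi> \<eta> \<zeta>
    using nn(3)[of "(\<xi>, \<eta>, \<zeta>)"] by (simp add: f_def power_mult_distrib)
  have g2: "(g (\<xi>, \<eta>, \<zeta>))\<^sup>2 = kap \<xi> * R' (\<xi>, \<eta>, \<zeta>) * (G (\<xi>, \<eta>, \<zeta>))\<^sup>2" for \<xi> \<eta> \<zeta>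
    using nn(4)[of "(\<xi>, \<eta>, \<zeta>)"] by (simp add: g_def power_mult_distrib)
  have fg: "f (\<xi>, \<eta>, \<zeta>) * g (\<xi>, \<eta>, \<zeta>) = kap \<xi> * (F (\<xi>, \<eta>, \<zeta>) * G (\<xi>, \<eta>, \<zeta>))" for \<xi> \<eta> \<zeta>
  proof -
    have "(kap \<xi> * R (\<xi>, \<eta>, \<zeta>)) * (kap \<xi> * R' (\<xi>, \<eta>, \<zeta>)) = (kap \<xi>)\<^sup>2 * (R (\<xi>, \<eta>, \<zeta>) * R' (\<xi>, \<eta>, \<zeta>))"
      by (simp only: power2_eq_square mult_ac)
    then have "sqrt (kap \<xi> * R (\<xi>, \<eta>, \<zeta>)) * sqrt (kap \<xi> * R' (\<xi>, \<eta>, \<zeta>)) = kap \<xi>"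
      by (simp only: real_sqrt_mult[symmetric] RR mult_1_right real_sqrt_abs abs_of_nonneg powr_ge_zero)
    then have "(sqrt (kap \<xi> * R (\<xi>, \<eta>, \<zeta>)) * sqrt (kap \<xi> * R' (\<xi>, \<eta>, \<zeta>))) * (F (\<xi>, \<eta>, \<zeta>) * G (\<xi>, \<eta>, \<zeta>)) = kap \<xi> * (F (\<xi>, \<eta>, \<zeta>) * G (\<xi>, \<eta>, \<zeta>))" by simp
    then show ?thesis by (simp only: f_def g_def prod.case mult_ac)
  qed
  have "(\<integral>\<^sup>+z. ennreal (f z * g z) \<partial>(lborel \<Otimes>\<^sub>M (lborel \<Otimes>\<^sub>M lborel))) \<le> ennreal ((sqrt C * x) * (sqrt C * y))"
  proof (rule Cauchy_Schwarz_ennreal)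
    show "0 \<le> f z" "0 \<le> g z" for z using nn by (cases z; simp add: f_def g_def less_imp_le)+
    show "0 \<le> sqrt C * x" "0 \<le> sqrt C * y" using nn C0 by auto
    show "(\<integral>\<^sup>+z. ennreal ((f z)\<^sup>2) \<partial>(lborel \<Otimes>\<^sub>M (lborel \<Otimes>\<^sub>M lborel))) \<le> ennreal ((sqrt C * x)\<^sup>2)"
      using F C0 by (subst nn_integral_triple) (simp_all add: f2 power_mult_distrib)
    show "(\<integral>\<^sup>+z. ennreal ((g z)\<^sup>2) \<partial>(lborel \<Otimes>\<^sub>M (lborel \<Otimes>\<^sub>M lborel))) \<le> ennreal ((sqrt C * y)\<^sup>2)"
      using G C0 by (subst nn_integral_triple) (simp_all add: g2 power_mult_distrib)
  qed measurable
  moreover have "(sqrt C * x) * (sqrt C * y) = C * (x * y)"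
    using C0 by (simp add: mult_ac) (simp flip: mult.assoc)?
  ultimately show ?thesis
    by (subst (asm) nn_integral_triple) (simp_all add: fg)
qed

lemma shift1: "f \<in> borel_measurable borel \<Longrightarrow> (\<integral>\<^sup>+\<eta>. f (\<xi> + \<eta>) \<partial>lborel) = (\<integral>\<^sup>+p. f (p :: 'a) \<partial>lborel)"
  using nn_integral_translate[of f \<xi>] by simp

lemma sq_weight: "sq_bound (\<lambda>x. bracket x powr (\<gamma> / 2) * c x) n \<Longrightarrow>
    (\<integral>\<^sup>+x. ennreal (bracket x powr \<gamma> * (c x)\<^sup>2) \<partial>lborel) \<le> ennreal (n\<^sup>2)"
proof -
  assume a: "sq_bound (\<lambda>x. bracket x powr (\<gamma> / 2) * c x) n"
  have "(bracket x powr (\<gamma> / 2) * c x)\<^sup>2 = bracket x powr \<gamma> * (c x)\<^sup>2" for x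
  proof -
    have "(bracket x powr (\<gamma> / 2))\<^sup>2 = bracket x powr \<gamma>" by (simp add: power2_eq_square powr_add[symmetric])
    then show ?thesis by (simp add: power_mult_distrib)
  qed
  with a show ?thesis by (simp add: sq_bound_def)
qed

text \<open>The unweighted factors \<open>a\<close> and \<open>d\<close> are put into different
  groups, each with one weighted partner: \<open>a\<close> with \<open>c\<close>, and
  \<open>b\<close> with \<open>d\<close>. Each group then meets the Schur test, the weight
  \<open>bracket z powr \<gamma>\<close> falling on the partner.\<close>

lemma quad_bound_1:
  fixes a b c d :: "'a \<Rightarrow> real"
  assumes a: "sq_bound a na" and d: "sq_bound d nd"
    and b: "sq_bound (\<lambda>x. bracket x powr (\<gamma> / 2) * b x) nb" and c: "sq_bound (\<lambda>x. bracket x powr (\<gamma> / 2) * c x) nc"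
    and m [measurable]: "b \<in> borel_measurable borel" "c \<in> borel_measurable borel" and nnbc: "\<And>x. 0 \<le> b x" "\<And>x. 0 \<le> c x"
  shows "quad \<gamma> a b c d \<le> ennreal (C * ((na * nc) * (nb * nd)))"
proof -
  have [measurable]: "a \<in> borel_measurable borel" "d \<in> borel_measurable borel" using a d by (auto simp: sq_bound_def)
  have nn: "0 \<le> na" "0 \<le> nb" "0 \<le> nc" "0 \<le> nd" "\<And>x. 0 \<le> a x" "\<And>x. 0 \<le> d x"
    using a b c d by (auto simp: sq_bound_def)
  have F: "(\<integral>\<^sup>+\<xi>. \<integral>\<^sup>+\<eta>. \<integral>\<^sup>+\<zeta>. ennreal (kap \<xi> * weight_ratio \<alpha> (\<xi> + \<zeta>) \<eta> \<xi> * (a (\<xi> + \<eta>) * c (\<xi> + \<zeta>))\<^sup>2) \<partial>lborel \<partial>lborel \<partial>lborel)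
      \<le> ennreal (C * (na * nc)\<^sup>2)"
  proof -
    have "(\<integral>\<^sup>+\<xi>. \<integral>\<^sup>+\<eta>. \<integral>\<^sup>+\<zeta>. ennreal (kap \<xi> * weight_ratio \<alpha> (\<xi> + \<zeta>) \<eta> \<xi> * (a (\<xi> + \<eta>) * c (\<xi> + \<zeta>))\<^sup>2) \<partial>lborel \<partial>lborel \<partial>lborel)
       = (\<integral>\<^sup>+\<xi>. \<integral>\<^sup>+p. \<integral>\<^sup>+q. ennreal (kap \<xi> * weight_ratio \<alpha> q (p - \<xi>) \<xi> * ((a p)\<^sup>2 * (c q)\<^sup>2)) \<partial>lborel \<partial>lborel \<partial>lborel)"
    proof (rule nn_integral_cong)
      fix \<xi> :: 'a
      have "(\<integral>\<^sup>+\<eta>. \<integral>\<^sup>+\<zeta>. ennreal (kap \<xi> * weight_ratio \<alpha> (\<xi> + \<zeta>) \<eta> \<xi> * (a (\<xi> + \<eta>) * c (\<xi> + \<zeta>))\<^sup>2) \<partial>lborel \<partial>lborel)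
        = (\<integral>\<^sup>+\<eta>. \<integral>\<^sup>+q. ennreal (kap \<xi> * weight_ratio \<alpha> q \<eta> \<xi> * (a (\<xi> + \<eta>) * c q)\<^sup>2) \<partial>lborel \<partial>lborel)"
        by (intro nn_integral_cong shift1[of "\<lambda>q. ennreal (kap \<xi> * weight_ratio \<alpha> q _ \<xi> * (a (\<xi> + _) * c q)\<^sup>2)"]) measurable
      also have "\<dots> = (\<integral>\<^sup>+\<eta>. (\<lambda>p. \<integral>\<^sup>+q. ennreal (kap \<xi> * weight_ratio \<alpha> q (p - \<xi>) \<xi> * ((a p)\<^sup>2 * (c q)\<^sup>2)) \<partial>lborel) (\<xi> + \<eta>) \<partial>lborel)"
        by (simp add: power_mult_distrib)
      also have "\<dots> = (\<integral>\<^sup>+p. \<integral>\<^sup>+q. ennreal (kap \<xi> * weight_ratio \<alpha> q (p - \<xi>) \<xi> * ((a p)\<^sup>2 * (c q)\<^sup>2)) \<partial>lborel \<partial>lborel)"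
        by (rule shift1) measurable
      finally show "(\<integral>\<^sup>+\<eta>. \<integral>\<^sup>+\<zeta>. ennreal (kap \<xi> * weight_ratio \<alpha> (\<xi> + \<zeta>) \<eta> \<xi> * (a (\<xi> + \<eta>) * c (\<xi> + \<zeta>))\<^sup>2) \<partial>lborel \<partial>lborel)
        = (\<integral>\<^sup>+p. \<integral>\<^sup>+q. ennreal (kap \<xi> * weight_ratio \<alpha> q (p - \<xi>) \<xi> * ((a p)\<^sup>2 * (c q)\<^sup>2)) \<partial>lborel \<partial>lborel)" .
    qed
    also have "\<dots> \<le> ennreal (C * na\<^sup>2 * nc\<^sup>2)"
      by (rule Schur_triple(1)[where w = "\<lambda>z. bracket z powr \<gamma>" and K = "\<lambda>(\<xi>, p, q). kap \<xi> * weight_ratio \<alpha> q (p - \<xi>) \<xi>", unfolded prod.case])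
        (use a C0 nn in \<open>auto simp: sq_bound_def intro: kernel sq_weight[OF c]\<close>)
    finally show ?thesis by (simp add: power_mult_distrib mult.assoc)
  qed
  have G: "(\<integral>\<^sup>+\<xi>. \<integral>\<^sup>+\<eta>. \<integral>\<^sup>+\<zeta>. ennreal (kap \<xi> * weight_ratio \<alpha> \<eta> (\<xi> + \<zeta>) \<xi> * (b \<eta> * d \<zeta>)\<^sup>2) \<partial>lborel \<partial>lborel \<partial>lborel)
      \<le> ennreal (C * (nb * nd)\<^sup>2)"
  proof -
    have "(\<integral>\<^sup>+\<xi>. \<integral>\<^sup>+\<eta>. \<integral>\<^sup>+\<zeta>. ennreal (kap \<xi> * weight_ratio \<alpha> \<eta> (\<xi> + \<zeta>) \<xi> * ((d \<zeta>)\<^sup>2 * (b \<eta>)\<^sup>2)) \<partial>lborel \<partial>lborel \<partial>lborel) \<le> ennreal (C * nd\<^sup>2 * nb\<^sup>2)"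
      by (rule Schur_triple(2)[where w = "\<lambda>z. bracket z powr \<gamma>" and K = "\<lambda>(\<xi>, \<zeta>, \<eta>). kap \<xi> * weight_ratio \<alpha> \<eta> (\<xi> + \<zeta>) \<xi>", unfolded prod.case])
        (use d C0 nn in \<open>auto simp: sq_bound_def intro: kernel' sq_weight[OF b]\<close>)
    then show ?thesis by (simp add: power_mult_distrib mult_ac)
  qed
  have "(\<integral>\<^sup>+\<xi>. \<integral>\<^sup>+\<eta>. \<integral>\<^sup>+\<zeta>. ennreal (kap \<xi> * ((a (\<xi> + \<eta>) * c (\<xi> + \<zeta>)) * (b \<eta> * d \<zeta>))) \<partial>lborel \<partial>lborel \<partial>lborel)
      \<le> ennreal (C * ((na * nc) * (nb * nd)))"
    by (rule Cauchy_Schwarz_triple[where F = "\<lambda>(\<xi>, \<eta>, \<zeta>). a (\<xi> + \<eta>) * c (\<xi> + \<zeta>)" and G = "\<lambda>(\<xi>, \<eta>, \<zeta>). b \<eta> * d \<zeta>"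
          and R = "\<lambda>(\<xi>, \<eta>, \<zeta>). weight_ratio \<alpha> (\<xi> + \<zeta>) \<eta> \<xi>" and R' = "\<lambda>(\<xi>, \<eta>, \<zeta>). weight_ratio \<alpha> \<eta> (\<xi> + \<zeta>) \<xi>", unfolded prod.case, OF _ _ _ _ _ _ _ _ _ _ _ F G]) (use nn nnbc in \<open>auto intro: weight_ratio_pos weight_ratio_swap\<close>)
  then show ?thesis unfolding quad_def by (simp only: mult_ac)
qed

text \<open>Now \<open>b\<close> and \<open>d\<close> are unweighted, so the grouping changes to
  \<open>b\<close> with \<open>c\<close> and \<open>a\<close> with \<open>d\<close>; the weight
  compares \<open>\<xi> + \<zeta>\<close> with \<open>\<xi> + \<eta>\<close>.\<close>

lemma quad_bound_2:
  fixes a b c d :: "'a \<Rightarrow> real"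
  assumes b: "sq_bound b nb" and d: "sq_bound d nd"
    and a: "sq_bound (\<lambda>x. bracket x powr (\<gamma> / 2) * a x) na" and c: "sq_bound (\<lambda>x. bracket x powr (\<gamma> / 2) * c x) nc"
    and m [measurable]: "a \<in> borel_measurable borel" "c \<in> borel_measurable borel" and nnac: "\<And>x. 0 \<le> a x" "\<And>x. 0 \<le> c x"
  shows "quad \<gamma> a b c d \<le> ennreal (C * ((nb * nc) * (na * nd)))"
proof -
  have [measurable]: "b \<in> borel_measurable borel" "d \<in> borel_measurable borel" using b d by (auto simp: sq_bound_def)
  have nn: "0 \<le> na" "0 \<le> nb" "0 \<le> nc" "0 \<le> nd" "\<And>x. 0 \<le> b x" "\<And>x. 0 \<le> d x"
    using a b c d by (auto simp: sq_bound_def)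
  have F: "(\<integral>\<^sup>+\<xi>. \<integral>\<^sup>+\<eta>. \<integral>\<^sup>+\<zeta>. ennreal (kap \<xi> * weight_ratio \<alpha> (\<xi> + \<zeta>) (\<xi> + \<eta>) \<xi> * (b \<eta> * c (\<xi> + \<zeta>))\<^sup>2) \<partial>lborel \<partial>lborel \<partial>lborel)
      \<le> ennreal (C * (nb * nc)\<^sup>2)"
  proof -
    have "(\<integral>\<^sup>+\<xi>. \<integral>\<^sup>+\<eta>. \<integral>\<^sup>+\<zeta>. ennreal (kap \<xi> * weight_ratio \<alpha> (\<xi> + \<zeta>) (\<xi> + \<eta>) \<xi> * (b \<eta> * c (\<xi> + \<zeta>))\<^sup>2) \<partial>lborel \<partial>lborel \<partial>lborel)
       = (\<integral>\<^sup>+\<xi>. \<integral>\<^sup>+\<eta>. \<integral>\<^sup>+q. ennreal (kap \<xi> * weight_ratio \<alpha> q (\<xi> + \<eta>) \<xi> * ((b \<eta>)\<^sup>2 * (c q)\<^sup>2)) \<partial>lborel \<partial>lborel \<partial>lborel)"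
      unfolding power_mult_distrib
      by (intro nn_integral_cong shift1[of "\<lambda>q. ennreal (kap _ * weight_ratio \<alpha> q (_ + _) _ * ((b _)\<^sup>2 * (c q)\<^sup>2))"]) measurable
    also have "\<dots> \<le> ennreal (C * nb\<^sup>2 * nc\<^sup>2)"
      by (rule Schur_triple(1)[where w = "\<lambda>z. bracket z powr \<gamma>" and K = "\<lambda>(\<xi>, \<eta>, q). kap \<xi> * weight_ratio \<alpha> q (\<xi> + \<eta>) \<xi>", unfolded prod.case])
        (use b C0 nn in \<open>auto simp: sq_bound_def intro: kernel' sq_weight[OF c]\<close>)
    finally show ?thesis by (simp add: power_mult_distrib mult.assoc)
  qed
  have G: "(\<integral>\<^sup>+\<xi>. \<integral>\<^sup>+\<eta>. \<integral>\<^sup>+\<zeta>. ennreal (kap \<xi> * weight_ratio \<alpha> (\<xi> + \<eta>) (\<xi> + \<zeta>) \<xi> * (a (\<xi> + \<eta>) * d \<zeta>)\<^sup>2) \<partial>lborel \<partial>lborel \<partial>lborel)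
      \<le> ennreal (C * (na * nd)\<^sup>2)"
  proof -
    have "(\<integral>\<^sup>+\<xi>. \<integral>\<^sup>+\<eta>. \<integral>\<^sup>+\<zeta>. ennreal (kap \<xi> * weight_ratio \<alpha> (\<xi> + \<eta>) (\<xi> + \<zeta>) \<xi> * (a (\<xi> + \<eta>) * d \<zeta>)\<^sup>2) \<partial>lborel \<partial>lborel \<partial>lborel)
       = (\<integral>\<^sup>+\<xi>. \<integral>\<^sup>+p. \<integral>\<^sup>+\<zeta>. ennreal (kap \<xi> * weight_ratio \<alpha> p (\<xi> + \<zeta>) \<xi> * ((d \<zeta>)\<^sup>2 * (a p)\<^sup>2)) \<partial>lborel \<partial>lborel \<partial>lborel)"
    proof (rule nn_integral_cong)
      fix \<xi> :: 'a
      have "(\<integral>\<^sup>+\<eta>. (\<lambda>p. \<integral>\<^sup>+\<zeta>. ennreal (kap \<xi> * weight_ratio \<alpha> p (\<xi> + \<zeta>) \<xi> * ((d \<zeta>)\<^sup>2 * (a p)\<^sup>2)) \<partial>lborel) (\<xi> + \<eta>) \<partial>lborel)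
        = (\<integral>\<^sup>+p. \<integral>\<^sup>+\<zeta>. ennreal (kap \<xi> * weight_ratio \<alpha> p (\<xi> + \<zeta>) \<xi> * ((d \<zeta>)\<^sup>2 * (a p)\<^sup>2)) \<partial>lborel \<partial>lborel)"
        by (rule shift1) measurable
      then show "(\<integral>\<^sup>+\<eta>. \<integral>\<^sup>+\<zeta>. ennreal (kap \<xi> * weight_ratio \<alpha> (\<xi> + \<eta>) (\<xi> + \<zeta>) \<xi> * (a (\<xi> + \<eta>) * d \<zeta>)\<^sup>2) \<partial>lborel \<partial>lborel)
        = (\<integral>\<^sup>+p. \<integral>\<^sup>+\<zeta>. ennreal (kap \<xi> * weight_ratio \<alpha> p (\<xi> + \<zeta>) \<xi> * ((d \<zeta>)\<^sup>2 * (a p)\<^sup>2)) \<partial>lborel \<partial>lborel)"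
        by (simp add: power_mult_distrib mult_ac)
    qed
    also have "\<dots> \<le> ennreal (C * nd\<^sup>2 * na\<^sup>2)"
      by (rule Schur_triple(2)[where w = "\<lambda>z. bracket z powr \<gamma>" and K = "\<lambda>(\<xi>, \<zeta>, p). kap \<xi> * weight_ratio \<alpha> p (\<xi> + \<zeta>) \<xi>", unfolded prod.case])
        (use d C0 nn in \<open>auto simp: sq_bound_def intro: kernel' sq_weight[OF a]\<close>)
    finally show ?thesis by (simp add: power_mult_distrib mult_ac)
  qed
  have "(\<integral>\<^sup>+\<xi>. \<integral>\<^sup>+\<eta>. \<integral>\<^sup>+\<zeta>. ennreal (kap \<xi> * ((b \<eta> * c (\<xi> + \<zeta>)) * (a (\<xi> + \<eta>) * d \<zeta>))) \<partial>lborel \<partial>lborel \<partial>lborel)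
      \<le> ennreal (C * ((nb * nc) * (na * nd)))"
    by (rule Cauchy_Schwarz_triple[where F = "\<lambda>(\<xi>, \<eta>, \<zeta>). b \<eta> * c (\<xi> + \<zeta>)" and G = "\<lambda>(\<xi>, \<eta>, \<zeta>). a (\<xi> + \<eta>) * d \<zeta>"
          and R = "\<lambda>(\<xi>, \<eta>, \<zeta>). weight_ratio \<alpha> (\<xi> + \<zeta>) (\<xi> + \<eta>) \<xi>" and R' = "\<lambda>(\<xi>, \<eta>, \<zeta>). weight_ratio \<alpha> (\<xi> + \<eta>) (\<xi> + \<zeta>) \<xi>", unfolded prod.case, OF _ _ _ _ _ _ _ _ _ _ _ F G]) (use nn nnac in \<open>auto intro: weight_ratio_pos weight_ratio_swap\<close>)
  then show ?thesis unfolding quad_def by (simp only: mult_ac)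
qed

text \<open>The same splitting with two factors, both of order \<open>\<gamma> / 2\<close>. This is
  Hardy's inequality on the Fourier side, endpoint included.\<close>

lemma corr_bound:
  fixes a b :: "'a \<Rightarrow> real"
  assumes a: "sq_bound (\<lambda>x. bracket x powr (\<gamma> / 2) * a x) na" and b: "sq_bound (\<lambda>x. bracket x powr (\<gamma> / 2) * b x) nb"
    and m [measurable]: "a \<in> borel_measurable borel" "b \<in> borel_measurable borel" and nnab: "\<And>x. 0 \<le> a x" "\<And>x. 0 \<le> b x"
  shows "(\<integral>\<^sup>+\<xi>. \<integral>\<^sup>+\<eta>. ennreal (kap \<xi> * (a (\<xi> + \<eta>) * b \<eta>)) \<partial>lborel \<partial>lborel) \<le> ennreal (C * (na * nb))"
proof -
  have nn: "0 \<le> na" "0 \<le> nb" using a b by (auto simp: sq_bound_def)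
  define f where "f = (\<lambda>(\<xi>, \<eta>). sqrt (kap \<xi> * weight_ratio \<alpha> (\<xi> + \<eta>) \<eta> \<xi>) * a (\<xi> + \<eta>))"
  define g where "g = (\<lambda>(\<xi>, \<eta>). sqrt (kap \<xi> * weight_ratio \<alpha> \<eta> (\<xi> + \<eta>) \<xi>) * b \<eta>)"
  have [measurable]: "f \<in> borel_measurable (lborel \<Otimes>\<^sub>M lborel)" "g \<in> borel_measurable (lborel \<Otimes>\<^sub>M lborel)"
    unfolding f_def g_def by measurable
  have f2: "(f (\<xi>, \<eta>))\<^sup>2 = kap \<xi> * weight_ratio \<alpha> (\<xi> + \<eta>) \<eta> \<xi> * (a (\<xi> + \<eta>))\<^sup>2" for \<xi> \<eta>
    using weight_ratio_pos[of \<alpha> "\<xi> + \<eta>" \<eta> \<xi>] by (simp add: f_def power_mult_distrib)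
  have g2: "(g (\<xi>, \<eta>))\<^sup>2 = kap \<xi> * weight_ratio \<alpha> \<eta> (\<xi> + \<eta>) \<xi> * (b \<eta>)\<^sup>2" for \<xi> \<eta>
    using weight_ratio_pos[of \<alpha> \<eta> "\<xi> + \<eta>" \<xi>] by (simp add: g_def power_mult_distrib)
  have fg: "f (\<xi>, \<eta>) * g (\<xi>, \<eta>) = kap \<xi> * (a (\<xi> + \<eta>) * b \<eta>)" for \<xi> \<eta>
  proof -
    have "(kap \<xi> * weight_ratio \<alpha> (\<xi> + \<eta>) \<eta> \<xi>) * (kap \<xi> * weight_ratio \<alpha> \<eta> (\<xi> + \<eta>) \<xi>) = (kap \<xi>)\<^sup>2 * (weight_ratio \<alpha> (\<xi> + \<eta>) \<eta> \<xi> * weight_ratio \<alpha> \<eta> (\<xi> + \<eta>) \<xi>)"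
      by (simp only: power2_eq_square mult_ac)
    then have "sqrt (kap \<xi> * weight_ratio \<alpha> (\<xi> + \<eta>) \<eta> \<xi>) * sqrt (kap \<xi> * weight_ratio \<alpha> \<eta> (\<xi> + \<eta>) \<xi>) = kap \<xi>"
      by (simp only: real_sqrt_mult[symmetric] weight_ratio_swap mult_1_right real_sqrt_abs abs_of_nonneg powr_ge_zero)
    then have "(sqrt (kap \<xi> * weight_ratio \<alpha> (\<xi> + \<eta>) \<eta> \<xi>) * sqrt (kap \<xi> * weight_ratio \<alpha> \<eta> (\<xi> + \<eta>) \<xi>)) * (a (\<xi> + \<eta>) * b \<eta>) = kap \<xi> * (a (\<xi> + \<eta>) * b \<eta>)" by simp
    then show ?thesis by (simp only: f_def g_def prod.case mult_ac)
  qed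
  have F: "(\<integral>\<^sup>+\<xi>. \<integral>\<^sup>+\<eta>. ennreal (kap \<xi> * weight_ratio \<alpha> (\<xi> + \<eta>) \<eta> \<xi> * (a (\<xi> + \<eta>))\<^sup>2) \<partial>lborel \<partial>lborel) \<le> ennreal (C * na\<^sup>2)"
  proof -
    have "(\<integral>\<^sup>+\<xi>. \<integral>\<^sup>+\<eta>. ennreal (kap \<xi> * weight_ratio \<alpha> (\<xi> + \<eta>) \<eta> \<xi> * (a (\<xi> + \<eta>))\<^sup>2) \<partial>lborel \<partial>lborel)
      = (\<integral>\<^sup>+\<xi>. \<integral>\<^sup>+p. ennreal (kap \<xi> * weight_ratio \<alpha> p (p - \<xi>) \<xi> * (a p)\<^sup>2) \<partial>lborel \<partial>lborel)"
    proof (rule nn_integral_cong)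
      fix \<xi> :: 'a
      have "(\<integral>\<^sup>+\<eta>. (\<lambda>p. ennreal (kap \<xi> * weight_ratio \<alpha> p (p - \<xi>) \<xi> * (a p)\<^sup>2)) (\<xi> + \<eta>) \<partial>lborel) = (\<integral>\<^sup>+p. ennreal (kap \<xi> * weight_ratio \<alpha> p (p - \<xi>) \<xi> * (a p)\<^sup>2) \<partial>lborel)"
        by (rule shift1) measurable
      then show "(\<integral>\<^sup>+\<eta>. ennreal (kap \<xi> * weight_ratio \<alpha> (\<xi> + \<eta>) \<eta> \<xi> * (a (\<xi> + \<eta>))\<^sup>2) \<partial>lborel) = (\<integral>\<^sup>+p. ennreal (kap \<xi> * weight_ratio \<alpha> p (p - \<xi>) \<xi> * (a p)\<^sup>2) \<partial>lborel)"
        by simp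
    qed
    also have "\<dots> \<le> ennreal (C * na\<^sup>2)"
      by (rule Schur_double[where w = "\<lambda>z. bracket z powr \<gamma>" and K = "\<lambda>(\<xi>, p). kap \<xi> * weight_ratio \<alpha> p (p - \<xi>) \<xi>", unfolded prod.case])
        (use C0 nn in \<open>auto intro: kernel sq_weight[OF a]\<close>)
    finally show ?thesis .
  qed
  have G: "(\<integral>\<^sup>+\<xi>. \<integral>\<^sup>+\<eta>. ennreal (kap \<xi> * weight_ratio \<alpha> \<eta> (\<xi> + \<eta>) \<xi> * (b \<eta>)\<^sup>2) \<partial>lborel \<partial>lborel) \<le> ennreal (C * nb\<^sup>2)"
    by (rule Schur_double[where w = "\<lambda>z. bracket z powr \<gamma>" and K = "\<lambda>(\<xi>, \<eta>). kap \<xi> * weight_ratio \<alpha> \<eta> (\<xi> + \<eta>) \<xi>", unfolded prod.case])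
      (use C0 nn in \<open>auto intro: kernel' sq_weight[OF b]\<close>)
  have "(\<integral>\<^sup>+z. ennreal (f z * g z) \<partial>(lborel \<Otimes>\<^sub>M lborel)) \<le> ennreal ((sqrt C * na) * (sqrt C * nb))"
  proof (rule Cauchy_Schwarz_ennreal)
    have "0 \<le> f (\<xi>, \<eta>)" "0 \<le> g (\<xi>, \<eta>)" for \<xi> \<eta>
      unfolding f_def g_def prod.case
      by (intro mult_nonneg_nonneg real_sqrt_ge_zero nnab powr_ge_zero less_imp_le[OF weight_ratio_pos])+
    then show "0 \<le> f z" "0 \<le> g z" for z by (cases z; simp)+
    show "0 \<le> sqrt C * na" "0 \<le> sqrt C * nb" using nn C0 by auto
    show "(\<integral>\<^sup>+z. ennreal ((f z)\<^sup>2) \<partial>(lborel \<Otimes>\<^sub>M lborel)) \<le> ennreal ((sqrt C * na)\<^sup>2)"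
      using F C0 by (subst lborel.nn_integral_fst[symmetric]) (simp_all add: f2 power_mult_distrib)
    show "(\<integral>\<^sup>+z. ennreal ((g z)\<^sup>2) \<partial>(lborel \<Otimes>\<^sub>M lborel)) \<le> ennreal ((sqrt C * nb)\<^sup>2)"
      using G C0 by (subst lborel.nn_integral_fst[symmetric]) (simp_all add: g2 power_mult_distrib)
  qed measurable
  moreover have "(sqrt C * na) * (sqrt C * nb) = C * (na * nb)"
    using C0 by (simp add: mult_ac) (simp flip: mult.assoc)?
  ultimately show ?thesis
    by (subst (asm) lborel.nn_integral_fst[symmetric]) (simp_all add: fg)
qed

text \<open>Here \<open>c\<close> and \<open>d\<close> are unweighted and occur in the same
  correlation. Plain Cauchy-Schwarz bounds that correlation uniformly in \<open>\<xi>\<close>, which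
  leaves \<open>corr_bound\<close> for the other one.\<close>

lemma quad_bound_3:
  fixes a b c d :: "'a \<Rightarrow> real"
  assumes c: "sq_bound c nc" and d: "sq_bound d nd"
    and a: "sq_bound (\<lambda>x. bracket x powr (\<gamma> / 2) * a x) na" and b: "sq_bound (\<lambda>x. bracket x powr (\<gamma> / 2) * b x) nb"
    and m [measurable]: "a \<in> borel_measurable borel" "b \<in> borel_measurable borel" and nnab: "\<And>x. 0 \<le> a x" "\<And>x. 0 \<le> b x"
  shows "quad \<gamma> a b c d \<le> ennreal (C * ((na * nb) * (nc * nd)))"
proof -
  have [measurable]: "c \<in> borel_measurable borel" "d \<in> borel_measurable borel" using c d by (auto simp: sq_bound_def)
  have nn: "0 \<le> na" "0 \<le> nb" "0 \<le> nc" "0 \<le> nd" "\<And>x. 0 \<le> c x" "\<And>x. 0 \<le> d x"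
    using a b c d by (auto simp: sq_bound_def)
  have cd: "(\<integral>\<^sup>+\<zeta>. ennreal (c (\<xi> + \<zeta>) * d \<zeta>) \<partial>lborel) \<le> ennreal (nc * nd)" for \<xi>
    by (rule Cauchy_Schwarz_ennreal)
      (use c d nn shift1[of "\<lambda>x. ennreal ((c x)\<^sup>2)" \<xi>] in \<open>auto simp: sq_bound_def\<close>)
  have "quad \<gamma> a b c d = (\<integral>\<^sup>+\<xi>. \<integral>\<^sup>+\<eta>. ennreal (kap \<xi> * (a (\<xi> + \<eta>) * b \<eta>)) * (\<integral>\<^sup>+\<zeta>. ennreal (c (\<xi> + \<zeta>) * d \<zeta>) \<partial>lborel) \<partial>lborel \<partial>lborel)"
    unfolding quad_def
    by (simp only: mult.assoc[symmetric], subst nn_integral_cmult[symmetric])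
       (auto simp: ennreal_mult' nnab mult.assoc)
  also have "\<dots> \<le> (\<integral>\<^sup>+\<xi>. \<integral>\<^sup>+\<eta>. ennreal (kap \<xi> * (a (\<xi> + \<eta>) * b \<eta>)) * ennreal (nc * nd) \<partial>lborel \<partial>lborel)"
    by (intro nn_integral_mono mult_left_mono cd) auto
  also have "\<dots> = (\<integral>\<^sup>+\<xi>. \<integral>\<^sup>+\<eta>. ennreal (kap \<xi> * (a (\<xi> + \<eta>) * b \<eta>)) \<partial>lborel \<partial>lborel) * ennreal (nc * nd)"
    by (simp add: nn_integral_multc)
  also have "\<dots> \<le> ennreal (C * (na * nb)) * ennreal (nc * nd)"
    by (intro mult_right_mono corr_bound[OF a b m nnab]) auto
  also have "\<dots> = ennreal (C * ((na * nb) * (nc * nd)))"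
    using nn C0 by (simp add: ennreal_mult'[symmetric] mult_ac)
  finally show ?thesis .
qed

lemma sq_bound_mono:
  assumes "sq_bound f n" "g \<in> borel_measurable borel" "\<And>x. 0 \<le> g x" "\<And>x. g x \<le> f x"
  shows "sq_bound g n"
proof -
  have "(\<integral>\<^sup>+x. ennreal ((g x)\<^sup>2) \<partial>lborel) \<le> (\<integral>\<^sup>+x. ennreal ((f x)\<^sup>2) \<partial>lborel)"
    using assms by (intro nn_integral_mono ennreal_leI power_mono) auto
  with assms show ?thesis by (auto simp: sq_bound_def)
qed

text \<open>Leibniz rule on the Fourier side: \<open>\<zeta> = (\<xi> + \<zeta>) - (\<xi> + \<eta>) + \<eta>\<close>, so the weight falls on one of the
  three factors.\<close>

lemma quad_bound:
  fixes a b c d :: "'a \<Rightarrow> real"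
  assumes s: "\<gamma> / 2 \<le> s" "0 \<le> s"
    and a: "sq_bound (\<lambda>x. bracket x powr s * a x) na" and b: "sq_bound (\<lambda>x. bracket x powr s * b x) nb"
    and c: "sq_bound (\<lambda>x. bracket x powr s * c x) nc" and d: "sq_bound d nd"
    and m [measurable]: "a \<in> borel_measurable borel" "b \<in> borel_measurable borel" "c \<in> borel_measurable borel"
    and nnabc: "\<And>x. 0 \<le> a x" "\<And>x. 0 \<le> b x" "\<And>x. 0 \<le> c x"
  shows "quad \<gamma> a b c (\<lambda>\<zeta>. bracket \<zeta> powr s * d \<zeta>) \<le> ennreal (3 * 3 powr s * C * (na * nb * nc * nd))"
proof -
  have [measurable]: "d \<in> borel_measurable borel" using d by (auto simp: sq_bound_def)
  have nn: "0 \<le> na" "0 \<le> nb" "0 \<le> nc" "0 \<le> nd" "\<And>x. 0 \<le> d x"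
    using a b c d by (auto simp: sq_bound_def)
  define A B D where "A x = bracket x powr s * a x" and "B x = bracket x powr s * b x" and "D x = bracket x powr s * c x" for x
  have [measurable]: "A \<in> borel_measurable borel" "B \<in> borel_measurable borel" "D \<in> borel_measurable borel"
    unfolding A_def B_def D_def by measurable
  have nnA: "0 \<le> A x" "0 \<le> B x" "0 \<le> D x" for x using nnabc by (auto simp: A_def B_def D_def)
  \<comment> \<open>The factor that receives the weight of order \<open>s\<close> becomes an
    unweighted square-integrable function; of the other two only order \<open>\<gamma> / 2\<close>
    is used, and the bracket is at least 1.\<close>
  have half: "sq_bound (\<lambda>x. bracket x powr (\<gamma> / 2) * f x) n"
    if "sq_bound (\<lambda>x. bracket x powr s * f x) n" "f \<in> borel_measurable borel" "\<And>x. 0 \<le> f x" for f n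
    by (rule sq_bound_mono[OF that(1)])
      (use that s bracket_ge_1 in \<open>auto intro!: mult_right_mono powr_mono\<close>)
  have pw: "norm \<xi> powr (\<gamma> - real DIM('a)) * (a (\<xi> + \<eta>) * b \<eta> * (c (\<xi> + \<zeta>) * (bracket \<zeta> powr s * d \<zeta>)))
    \<le> 3 powr s * (kap \<xi> * (A (\<xi> + \<eta>) * b \<eta> * (c (\<xi> + \<zeta>) * d \<zeta>)))
     + 3 powr s * (kap \<xi> * (a (\<xi> + \<eta>) * B \<eta> * (c (\<xi> + \<zeta>) * d \<zeta>)))
     + 3 powr s * (kap \<xi> * (a (\<xi> + \<eta>) * b \<eta> * (D (\<xi> + \<zeta>) * d \<zeta>)))" (is "_ \<le> ?R") for \<xi> \<eta> \<zeta> :: 'a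
  proof -
    let ?p = "bracket (\<xi> + \<eta>)" and ?q = "bracket \<eta>" and ?r = "bracket (\<xi> + \<zeta>)"
    have "bracket \<zeta> = bracket (((\<xi> + \<zeta>) + (- (\<xi> + \<eta>))) + \<eta>)" by simp
    also have "\<dots> \<le> bracket ((\<xi> + \<zeta>) + (- (\<xi> + \<eta>))) + ?q" by (rule bracket_triangle)
    also have "\<dots> \<le> ?r + bracket (- (\<xi> + \<eta>)) + ?q" by (intro add_right_mono bracket_triangle)
    also have "\<dots> = ?r + ?p + ?q" unfolding bracket_minus ..
    also have "\<dots> \<le> 3 * max ?p (max ?q ?r)" by linarith
    finally have "bracket \<zeta> powr s \<le> (3 * max ?p (max ?q ?r)) powr s" using s by (intro powr_mono2) auto
    also have "\<dots> = 3 powr s * (max ?p (max ?q ?r)) powr s" by (intro powr_mult)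
    also have "\<dots> \<le> 3 powr s * (?p powr s + ?q powr s + ?r powr s)"
      by (intro mult_left_mono) (auto simp: max_def)
    finally have w: "bracket \<zeta> powr s \<le> 3 powr s * (?p powr s + ?q powr s + ?r powr s)" .
    have "kap \<xi> * (a (\<xi> + \<eta>) * b \<eta> * (c (\<xi> + \<zeta>) * (bracket \<zeta> powr s * d \<zeta>))) = (kap \<xi> * (a (\<xi> + \<eta>) * b \<eta> * (c (\<xi> + \<zeta>) * d \<zeta>))) * bracket \<zeta> powr s"
      by (simp only: mult_ac)
    also have "\<dots> \<le> (kap \<xi> * (a (\<xi> + \<eta>) * b \<eta> * (c (\<xi> + \<zeta>) * d \<zeta>))) * (3 powr s * (?p powr s + ?q powr s + ?r powr s))"
      by (intro mult_left_mono w) (auto simp: nn nnabc)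
    also have "\<dots> = ?R" by (simp add: A_def B_def D_def algebra_simps)
    finally show ?thesis .
  qed
  have "quad \<gamma> a b c (\<lambda>\<zeta>. bracket \<zeta> powr s * d \<zeta>)
    \<le> (\<integral>\<^sup>+\<xi>. \<integral>\<^sup>+\<eta>. \<integral>\<^sup>+\<zeta>. ennreal (3 powr s) * ennreal (kap \<xi> * (A (\<xi> + \<eta>) * b \<eta> * (c (\<xi> + \<zeta>) * d \<zeta>)))
     + ennreal (3 powr s) * ennreal (kap \<xi> * (a (\<xi> + \<eta>) * B \<eta> * (c (\<xi> + \<zeta>) * d \<zeta>)))
     + ennreal (3 powr s) * ennreal (kap \<xi> * (a (\<xi> + \<eta>) * b \<eta> * (D (\<xi> + \<zeta>) * d \<zeta>))) \<partial>lborel \<partial>lborel \<partial>lborel)"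
    unfolding quad_def
  proof (intro nn_integral_mono)
    fix \<xi> \<eta> \<zeta> :: 'a
    show "ennreal (kap \<xi> * (a (\<xi> + \<eta>) * b \<eta> * (c (\<xi> + \<zeta>) * (bracket \<zeta> powr s * d \<zeta>)))) \<le> 
      ennreal (3 powr s) * ennreal (kap \<xi> * (A (\<xi> + \<eta>) * b \<eta> * (c (\<xi> + \<zeta>) * d \<zeta>)))
     + ennreal (3 powr s) * ennreal (kap \<xi> * (a (\<xi> + \<eta>) * B \<eta> * (c (\<xi> + \<zeta>) * d \<zeta>)))
     + ennreal (3 powr s) * ennreal (kap \<xi> * (a (\<xi> + \<eta>) * b \<eta> * (D (\<xi> + \<zeta>) * d \<zeta>)))"
      using ennreal_leI[OF pw[of \<xi> \<eta> \<zeta>]] nn nnabc nnA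
      by (simp only: ennreal_plus ennreal_mult'[OF powr_ge_zero] mult_nonneg_nonneg add_nonneg_nonneg powr_ge_zero)
  qed
  also have "\<dots> = ennreal (3 powr s) * quad \<gamma> A b c d + ennreal (3 powr s) * quad \<gamma> a B c d + ennreal (3 powr s) * quad \<gamma> a b D d"
    unfolding quad_def by (simp add: nn_integral_add nn_integral_cmult)
  also have "\<dots> \<le> ennreal (3 powr s) * ennreal (C * ((na * nc) * (nb * nd))) + ennreal (3 powr s) * ennreal (C * ((nb * nc) * (na * nd)))
      + ennreal (3 powr s) * ennreal (C * ((na * nb) * (nc * nd)))"
  proof -
    have sA: "sq_bound A na" and sB: "sq_bound B nb" and sD: "sq_bound D nc"
      using a b c unfolding A_def[abs_def] B_def[abs_def] D_def[abs_def] .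
    note ha = half[OF a m(1) nnabc(1)] and hb = half[OF b m(2) nnabc(2)] and hc = half[OF c m(3) nnabc(3)]
    show ?thesis
      by (intro add_mono mult_left_mono
          quad_bound_1[OF sA d hb hc m(2,3) nnabc(2,3)] quad_bound_2[OF sB d ha hc m(1,3) nnabc(1,3)]
          quad_bound_3[OF sD d ha hb m(1,2) nnabc(1,2)]) auto
  qed
  also have "\<dots> = ennreal (3 * 3 powr s * C * (na * nb * nc * nd))"
  proof -
    have "3 powr s * (C * ((na * nc) * (nb * nd))) + 3 powr s * (C * ((nb * nc) * (na * nd))) + 3 powr s * (C * ((na * nb) * (nc * nd)))
      = 3 * 3 powr s * C * (na * nb * nc * nd)" by (simp add: algebra_simps)
    then show ?thesis using nn C0
      by (simp only: ennreal_mult'[symmetric] ennreal_plus[symmetric] mult_nonneg_nonneg add_nonneg_nonneg powr_ge_zero)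
  qed
  finally show ?thesis .
qed

end

section \<open>Riesz potentials by Gaussian subordination\<close>

definition sub_weight :: "real \<Rightarrow> real \<Rightarrow> real" where
  "sub_weight \<gamma> t = indicator {0..} t * t powr (\<gamma> / 2 - 1)"

lemma sub_weight_nonneg [simp]: "0 \<le> sub_weight \<gamma> t" by (simp add: sub_weight_def)

lemma measurable_sub_weight [measurable]: "sub_weight \<gamma> \<in> borel_measurable borel"
  unfolding sub_weight_def[abs_def] by measurable

text \<open>The substitution of \<open>|z|^2 * t\<close> into Euler's integral for
  \<open>Gamma (\<gamma> / 2)\<close>.\<close>

lemma subordination:
  assumes \<gamma>: "0 < \<gamma>" and z: "(z::'a::euclidean_space) \<noteq> 0"
  shows "(\<integral>\<^sup>+t. ennreal (sub_weight \<gamma> t * exp (- t * (norm z)\<^sup>2)) \<partial>lborel) = ennreal (Gamma (\<gamma> / 2) * norm z powr (- \<gamma>))"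
proof -
  define b where "b = (norm z)\<^sup>2"
  have b: "0 < b" using z by (simp add: b_def)
  define I where "I = (\<integral>\<^sup>+t. ennreal (sub_weight \<gamma> t * exp (- t * b)) \<partial>lborel)"
  define f where "f t = ennreal (indicator {0..} t * t powr (\<gamma> / 2 - 1) / exp t)" for t
  have [measurable]: "f \<in> borel_measurable borel" unfolding f_def by measurable
  have "ennreal (Gamma (\<gamma> / 2)) = (\<integral>\<^sup>+t. f t \<partial>lborel)"
    using Gamma_conv_nn_integral_real[of "\<gamma> / 2"] \<gamma> by (simp add: f_def)
  also have "\<dots> = ennreal b * (\<integral>\<^sup>+t. f (0 + b * t) \<partial>lborel)"
    using nn_integral_real_affine[of f b 0] b by simp
  also have "(\<integral>\<^sup>+t. f (0 + b * t) \<partial>lborel) = (\<integral>\<^sup>+t. ennreal (b powr (\<gamma> / 2 - 1)) * ennreal (sub_weight \<gamma> t * exp (- t * b)) \<partial>lborel)"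
  proof (rule nn_integral_cong)
    fix t :: real
    show "f (0 + b * t) = ennreal (b powr (\<gamma> / 2 - 1)) * ennreal (sub_weight \<gamma> t * exp (- t * b))"
    proof (cases "t \<ge> 0")
      case True
      then have "(b * t) powr (\<gamma> / 2 - 1) / exp (b * t) = b powr (\<gamma> / 2 - 1) * (t powr (\<gamma> / 2 - 1) * exp (- t * b))"
        using b by (simp add: powr_mult exp_minus field_simps)
      with True b show ?thesis by (simp add: f_def sub_weight_def ennreal_mult'[symmetric])
    next
      case False
      then have "b * t < 0" using b by (simp add: mult_pos_neg)
      with False show ?thesis by (simp add: f_def sub_weight_def)
    qed
  qed
  also have "\<dots> = ennreal (b powr (\<gamma> / 2 - 1)) * I" unfolding I_def by (rule nn_integral_cmult) measurable
  finally have "ennreal (Gamma (\<gamma> / 2)) = ennreal (b powr (\<gamma> / 2)) * I"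
    using b by (simp add: mult.assoc[symmetric] ennreal_mult'[symmetric] powr_mult_base)
  then have "ennreal (b powr (- \<gamma> / 2)) * ennreal (Gamma (\<gamma> / 2)) = ennreal (b powr (- \<gamma> / 2) * b powr (\<gamma> / 2)) * I"
    by (simp add: mult.assoc[symmetric] ennreal_mult'[symmetric])
  also have "b powr (- \<gamma> / 2) * b powr (\<gamma> / 2) = 1" using b by (simp add: powr_add[symmetric])
  finally have "I = ennreal (b powr (- \<gamma> / 2)) * ennreal (Gamma (\<gamma> / 2))" by simp
  also have "b powr (- \<gamma> / 2) = norm z powr (- \<gamma>)"
  proof -
    have "b = norm z powr 2" using z by (simp add: b_def)
    then have "b powr (- \<gamma> / 2) = norm z powr (2 * (- \<gamma> / 2))" by (simp only: powr_powr)
    then show ?thesis by simp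
  qed
  finally show ?thesis by (simp add: I_def b_def ennreal_mult'[symmetric] mult.commute)
qed

text \<open>Rescaling time by \<open>a^2\<close> extracts the power of \<open>a\<close>, and it
  remains to see that the integral for \<open>a = 1\<close> is finite. The exact constant would be
  \<open>4 powr \<sigma> * Gamma \<sigma>\<close>; the application is an inequality, so a bound is
  enough.\<close>

lemma heat_weight_bound:
  assumes \<sigma>: "0 < \<sigma>"
  shows "\<exists>D\<ge>0. \<forall>a>0. (\<integral>\<^sup>+t. ennreal (indicator {0..} t * t powr (- \<sigma> - 1) * exp (- a\<^sup>2 / (4 * t))) \<partial>lborel)
    \<le> ennreal (D * a powr (- (2 * \<sigma>)))"
proof -
  define f where "f t = indicator {0..} t * t powr (- \<sigma> - 1) * exp (- 1 / (4 * t))" for t :: real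
  have [measurable]: "f \<in> borel_measurable borel" unfolding f_def by measurable
  define p where "p = \<sigma> + 1"
  have p: "1 < p" using \<sigma> by (simp add: p_def)
  \<comment> \<open>The maximum of \<open>y powr p * exp (- y / 4)\<close>, attained at
    \<open>y = 4 * p\<close>, where \<open>y\<close> stands for \<open>1 / t\<close>.\<close>
  define K where "K = exp (p * (ln (4 * p) - 1))"
  obtain C where C: "0 \<le> C" "(\<integral>\<^sup>+x. ennreal (norm x powr (- p)) * indicator (- cball 0 1) x \<partial>(lborel :: real measure)) \<le> ennreal (C * 1 powr (real DIM(real) - p))"
    using nn_integral_powr_outside_cball[of p, where 'a = real] p by (metis DIM_real less_numeral_extra(1) of_nat_1)
  have K: "t powr (- p) * exp (- 1 / (4 * t)) \<le> K" if t: "0 < t" for t :: real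
  proof -
    define y where "y = 1 / t"
    have y: "0 < y" using t by (simp add: y_def)
    have "ln (y / (4 * p)) \<le> y / (4 * p) - 1" using y p by (intro ln_le_minus_one) auto
    then have "ln y \<le> y / (4 * p) - 1 + ln (4 * p)" using y p by (simp add: ln_div)
    then have "p * ln y \<le> p * (y / (4 * p) - 1 + ln (4 * p))" using p by (intro mult_left_mono) auto
    also have "\<dots> = y / 4 + p * (ln (4 * p) - 1)" using p by (simp add: field_simps)
    finally have le: "p * ln y - y / 4 \<le> p * (ln (4 * p) - 1)" by simp
    have "t powr (- p) = exp (p * ln y)" using t by (simp add: powr_def y_def ln_div)
    moreover have "- 1 / (4 * t) = - y / 4" using t by (simp add: y_def)
    ultimately have "t powr (- p) * exp (- 1 / (4 * t)) = exp (p * ln y + - y / 4)" by (simp only: mult_exp_exp)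
    also have "\<dots> \<le> K" unfolding K_def using le by simp
    finally show ?thesis .
  qed
  define D where "D = K + C"
  have "(\<integral>\<^sup>+t. ennreal (f t) \<partial>lborel) \<le> (\<integral>\<^sup>+t. ennreal K * indicator {0..1} t + ennreal (norm t powr (- p)) * indicator (- cball 0 1) t \<partial>(lborel :: real measure))"
  proof (rule nn_integral_mono)
    fix t :: real
    consider "t < 0" | "t = 0" | "0 < t" "t \<le> 1" | "1 < t" by linarith
    then show "ennreal (f t) \<le> ennreal K * indicator {0..1} t + ennreal (norm t powr (- p)) * indicator (- cball 0 1) t"
    proof cases
      case 3
      then show ?thesis using K[of t] by (simp add: f_def p_def ennreal_leI)
    next
      case 4
      then have "t powr (- p) * exp (- 1 / (4 * t)) \<le> t powr (- p) * 1" by (intro mult_left_mono) auto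
      with 4 show ?thesis by (simp add: f_def p_def ennreal_leI)
    qed (auto simp: f_def)
  qed
  also have "\<dots> = (\<integral>\<^sup>+t. ennreal K * indicator {0..1} t \<partial>(lborel :: real measure)) + (\<integral>\<^sup>+x. ennreal (norm x powr (- p)) * indicator (- cball 0 1) x \<partial>(lborel :: real measure))"
    by (rule nn_integral_add) measurable
  also have "\<dots> \<le> ennreal K + ennreal C" using C(2) by (intro add_mono) (auto simp: nn_integral_cmult)
  also have "\<dots> = ennreal D" using C(1) by (simp add: D_def K_def)
  finally have D: "(\<integral>\<^sup>+t. ennreal (f t) \<partial>lborel) \<le> ennreal D" .
  have "(\<integral>\<^sup>+t. ennreal (indicator {0..} t * t powr (- \<sigma> - 1) * exp (- a\<^sup>2 / (4 * t))) \<partial>lborel) \<le> ennreal (D * a powr (- (2 * \<sigma>)))"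
    if a: "0 < a" for a :: real
  proof -
    define h where "h t = ennreal (indicator {0..} t * t powr (- \<sigma> - 1) * exp (- a\<^sup>2 / (4 * t)))" for t
    have [measurable]: "h \<in> borel_measurable borel" unfolding h_def by measurable
    have "(\<integral>\<^sup>+t. h t \<partial>lborel) = ennreal (a\<^sup>2) * (\<integral>\<^sup>+t. h (0 + a\<^sup>2 * t) \<partial>lborel)"
      using nn_integral_real_affine[of h "a\<^sup>2" 0] a by simp
    also have "(\<integral>\<^sup>+t. h (0 + a\<^sup>2 * t) \<partial>lborel) = (\<integral>\<^sup>+t. ennreal ((a\<^sup>2) powr (- \<sigma> - 1)) * ennreal (f t) \<partial>lborel)"
    proof (rule nn_integral_cong)
      fix t :: real
      show "h (0 + a\<^sup>2 * t) = ennreal ((a\<^sup>2) powr (- \<sigma> - 1)) * ennreal (f t)"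
      proof (cases "t \<ge> 0")
        case True
        then have "(a\<^sup>2 * t) powr (- \<sigma> - 1) = (a\<^sup>2) powr (- \<sigma> - 1) * t powr (- \<sigma> - 1)" by (intro powr_mult)
        moreover have "- a\<^sup>2 / (4 * (a\<^sup>2 * t)) = - 1 / (4 * t)" using a by simp
        ultimately show ?thesis using True by (simp add: h_def f_def ennreal_mult'[symmetric])
      next
        case False
        then have "a\<^sup>2 * t < 0" using a by (simp add: mult_pos_neg)
        with False show ?thesis by (simp add: h_def f_def)
      qed
    qed
    also have "\<dots> = ennreal ((a\<^sup>2) powr (- \<sigma> - 1)) * (\<integral>\<^sup>+t. ennreal (f t) \<partial>lborel)"
      by (rule nn_integral_cmult) measurable
    also have "ennreal (a\<^sup>2) * \<dots> \<le> ennreal (a\<^sup>2) * (ennreal ((a\<^sup>2) powr (- \<sigma> - 1)) * ennreal D)"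
      by (intro mult_left_mono D) auto
    also have "\<dots> = ennreal (D * a powr (- (2 * \<sigma>)))"
    proof -
      have "a\<^sup>2 = a powr 2" using a by simp
      then have "a\<^sup>2 * ((a\<^sup>2) powr (- \<sigma> - 1) * D) = D * a powr (- (2 * \<sigma>))"
        by (simp add: powr_powr powr_add[symmetric] algebra_simps flip: mult.assoc)
      moreover have "0 \<le> D" using C(1) by (simp add: D_def K_def)
      ultimately show ?thesis by (simp add: ennreal_mult'[symmetric])
    qed
    finally show ?thesis by (simp add: h_def)
  qed
  moreover have "0 \<le> D" using C(1) by (simp add: D_def K_def)
  ultimately show ?thesis by blast
qed

text \<open>Positive phase and no normalising factor: exactly the inner integral of
  \<open>gaussian_smoothing\<close>.\<close>

definition FI :: "('a::euclidean_space \<Rightarrow> complex) \<Rightarrow> 'a \<Rightarrow> complex" where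
  "FI F \<xi> = (LINT y|lborel. cis (y \<bullet> \<xi>) * F y)"

lemma measurable_FI [measurable]:
  assumes [measurable]: "F \<in> borel_measurable borel" shows "FI F \<in> borel_measurable borel"
  unfolding FI_def[abs_def] by measurable

lemma FI_le: "cmod (FI F \<xi>) \<le> (LINT y|lborel. cmod (F y))"
  unfolding FI_def using integral_norm_bound[of lborel "\<lambda>y. cis (y \<bullet> \<xi>) * F y"] by (simp add: norm_mult)

text \<open>\<open>gaussian_smoothing\<close> at the dual time \<open>1 / (4 * t)\<close>, solved
  for its right-hand side.\<close>

lemma heat_representation:
  fixes F :: "'a::euclidean_space \<Rightarrow> complex"
  assumes t: "0 < t" and F: "integrable lborel F"
  shows "(LINT y|lborel. exp (- t * (norm (x - y))\<^sup>2) * F y)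
    = (4 * pi * t) powr (- real DIM('a) / 2) * (LINT \<xi>|lborel. cis (- (x \<bullet> \<xi>)) * exp (- (norm \<xi>)\<^sup>2 / (4 * t)) * FI F \<xi>)"
proof -
  define s where "s = 1 / (4 * t)"
  have s: "0 < s" using t by (simp add: s_def)
  have e1: "- s * (norm \<xi>)\<^sup>2 = - (norm \<xi>)\<^sup>2 / (4 * t)" for \<xi> :: 'a by (simp add: s_def)
  have e2: "- (norm (x - y))\<^sup>2 / (4 * s) = - t * (norm (x - y))\<^sup>2" for y using t by (simp add: s_def)
  have e3: "pi / s = 4 * pi * t" by (simp add: s_def)
  have c: "complex_of_real ((4 * pi * t) powr (- real DIM('a) / 2)) * complex_of_real ((4 * pi * t) powr (real DIM('a) / 2)) = 1"
    using t by (simp add: powr_add[symmetric] flip: of_real_mult)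
  show ?thesis
    using gaussian_smoothing[OF s F, of x] unfolding e1 e2 e3 FI_def[symmetric]
    by (simp only: mult.assoc[symmetric] c mult_1)
qed

lemma heat_representation_bound:
  fixes F :: "'a::euclidean_space \<Rightarrow> complex"
  assumes t: "0 < t" and F: "integrable lborel F"
  shows "ennreal (cmod (LINT y|lborel. exp (- t * (norm (x - y))\<^sup>2) * F y))
    \<le> ennreal ((4 * pi * t) powr (- real DIM('a) / 2)) * (\<integral>\<^sup>+\<xi>. ennreal (exp (- (norm \<xi>)\<^sup>2 / (4 * t)) * cmod (FI F \<xi>)) \<partial>lborel)"
proof -
  have [measurable]: "F \<in> borel_measurable borel" using F by auto
  have int: "integrable lborel (\<lambda>\<xi>. cis (- (x \<bullet> \<xi>)) * exp (- (norm \<xi>)\<^sup>2 / (4 * t)) * FI F \<xi>)"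
  proof (rule Bochner_Integration.integrable_bound)
    show "integrable lborel (\<lambda>\<xi>::'a. exp (- (1 / (4 * t)) * (norm \<xi>)\<^sup>2) * (LINT y|lborel. cmod (F y)))"
      using t by (intro integrable_mult_left gaussian_integral(1)) auto
    show "AE \<xi> in lborel. cmod (cis (- (x \<bullet> \<xi>)) * exp (- (norm \<xi>)\<^sup>2 / (4 * t)) * FI F \<xi>)
        \<le> norm (exp (- (1 / (4 * t)) * (norm \<xi>)\<^sup>2) * (LINT y|lborel. cmod (F y)))"
      using order_trans[OF FI_le abs_ge_self] by (intro AE_I2) (auto simp: norm_mult abs_mult intro!: mult_left_mono)
  qed measurable
  have "ennreal (cmod (LINT y|lborel. exp (- t * (norm (x - y))\<^sup>2) * F y))
      = ennreal ((4 * pi * t) powr (- real DIM('a) / 2)) * ennreal (cmod (LINT \<xi>|lborel. cis (- (x \<bullet> \<xi>)) * exp (- (norm \<xi>)\<^sup>2 / (4 * t)) * FI F \<xi>))"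
    unfolding heat_representation[OF t F] by (simp add: norm_mult ennreal_mult')
  also have "\<dots> \<le> ennreal ((4 * pi * t) powr (- real DIM('a) / 2)) * (\<integral>\<^sup>+\<xi>. ennreal (exp (- (norm \<xi>)\<^sup>2 / (4 * t)) * cmod (FI F \<xi>)) \<partial>lborel)"
    using integral_norm_bound_ennreal[OF int] by (intro mult_left_mono) (auto simp: norm_mult)
  finally show ?thesis .
qed

text \<open>\<open>D\<close> is the constant of \<open>heat_weight_bound\<close> for
  \<open>\<sigma> = (N - \<gamma>) / 2\<close>, the exponent that arises when the Gaussian transform
  meets the subordination weight.\<close>

locale subord =
  fixes \<gamma> :: real and N :: real and D :: real and dim_type :: "'a::euclidean_space itself"
  assumes \<gamma>: "0 < \<gamma>" "\<gamma> < N" and N: "N = real DIM('a)" and D0: "0 \<le> D"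
    and D: "\<And>a. 0 < a \<Longrightarrow> (\<integral>\<^sup>+t. ennreal (indicator {0..} t * t powr (- ((N - \<gamma>) / 2) - 1) * exp (- a\<^sup>2 / (4 * t))) \<partial>lborel)
      \<le> ennreal (D * a powr (- (2 * ((N - \<gamma>) / 2))))"
begin

definition G where "G = Gamma (\<gamma> / 2)"
text \<open>Three sources: the constant of the Gaussian transform, the time integral and the
  division by the Gamma value of the subordination formula.\<close>

definition cst where "cst = (4 * pi) powr (- N / 2) * D / G"

lemma G: "0 < G" using \<gamma> by (simp add: G_def Gamma_real_pos)

lemma cst0: "0 \<le> cst" using D0 G by (simp add: cst_def)

text \<open>By Tonelli the time integral is taken at fixed frequency; its bound is the multiple of
  \<open>|\<xi>| powr (\<gamma> - N)\<close> that plays the role of the transformed Riesz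
  kernel.\<close>

lemma sub_swap:
  fixes \<Phi> :: "'a \<Rightarrow> real"
  assumes [measurable]: "\<Phi> \<in> borel_measurable borel" and nn: "\<And>\<xi>. 0 \<le> \<Phi> \<xi>"
  shows "(\<integral>\<^sup>+t. ennreal (sub_weight \<gamma> t) * (ennreal ((4 * pi * t) powr (- N / 2)) * (\<integral>\<^sup>+\<xi>. ennreal (exp (- (norm \<xi>)\<^sup>2 / (4 * t)) * \<Phi> \<xi>) \<partial>lborel)) \<partial>lborel)
    \<le> ennreal (G * cst) * (\<integral>\<^sup>+\<xi>. ennreal (norm \<xi> powr (\<gamma> - N) * \<Phi> \<xi>) \<partial>lborel)"
proof -
  define w where "w t = indicator {0..} t * t powr (- ((N - \<gamma>) / 2) - 1)" for t :: real
  have [measurable]: "w \<in> borel_measurable borel" unfolding w_def by measurable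
  have w0: "0 \<le> w t" for t by (simp add: w_def)
  \<comment> \<open>The exponents add up to \<open>\<gamma> / 2 - 1 - N / 2 = - \<sigma> - 1\<close>
    with \<open>\<sigma> = (N - \<gamma>) / 2\<close>.\<close>
  have w: "sub_weight \<gamma> t * (4 * pi * t) powr (- N / 2) = (4 * pi) powr (- N / 2) * w t" for t
  proof (cases "t \<ge> 0")
    case True
    have "t powr (\<gamma> / 2 - 1) * t powr (- N / 2) = t powr (- ((N - \<gamma>) / 2) - 1)"
      by (simp add: powr_add[symmetric] diff_divide_distrib algebra_simps)
    moreover have "(4 * pi * t) powr (- N / 2) = (4 * pi) powr (- N / 2) * t powr (- N / 2)" by (intro powr_mult)
    ultimately show ?thesis using True by (simp add: sub_weight_def w_def mult_ac)
  qed (simp add: sub_weight_def w_def)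
  have "(\<integral>\<^sup>+t. ennreal (sub_weight \<gamma> t) * (ennreal ((4 * pi * t) powr (- N / 2)) * (\<integral>\<^sup>+\<xi>. ennreal (exp (- (norm \<xi>)\<^sup>2 / (4 * t)) * \<Phi> \<xi>) \<partial>lborel)) \<partial>lborel)
     = (\<integral>\<^sup>+t. \<integral>\<^sup>+\<xi>. ennreal ((4 * pi) powr (- N / 2)) * (ennreal (w t * exp (- (norm \<xi>)\<^sup>2 / (4 * t))) * ennreal (\<Phi> \<xi>)) \<partial>lborel \<partial>lborel)"
  proof (rule nn_integral_cong)
    fix t :: real
    have "ennreal (sub_weight \<gamma> t) * (ennreal ((4 * pi * t) powr (- N / 2)) * (\<integral>\<^sup>+\<xi>. ennreal (exp (- (norm \<xi>)\<^sup>2 / (4 * t)) * \<Phi> \<xi>) \<partial>lborel))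
       = ennreal (sub_weight \<gamma> t * (4 * pi * t) powr (- N / 2)) * (\<integral>\<^sup>+\<xi>. ennreal (exp (- (norm \<xi>)\<^sup>2 / (4 * t)) * \<Phi> \<xi>) \<partial>lborel)"
      by (simp add: ennreal_mult' mult.assoc)
    also have "\<dots> = ennreal ((4 * pi) powr (- N / 2) * w t) * (\<integral>\<^sup>+\<xi>. ennreal (exp (- (norm \<xi>)\<^sup>2 / (4 * t)) * \<Phi> \<xi>) \<partial>lborel)"
      by (simp only: w)
    also have "\<dots> = (\<integral>\<^sup>+\<xi>. ennreal ((4 * pi) powr (- N / 2) * w t) * ennreal (exp (- (norm \<xi>)\<^sup>2 / (4 * t)) * \<Phi> \<xi>) \<partial>lborel)"
      by (rule nn_integral_cmult[symmetric]) measurable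
    also have "\<dots> = (\<integral>\<^sup>+\<xi>. ennreal ((4 * pi) powr (- N / 2)) * (ennreal (w t * exp (- (norm \<xi>)\<^sup>2 / (4 * t))) * ennreal (\<Phi> \<xi>)) \<partial>lborel)"
      using w0 nn by (simp add: ennreal_mult' mult_ac)
    finally show "ennreal (sub_weight \<gamma> t) * (ennreal ((4 * pi * t) powr (- N / 2)) * (\<integral>\<^sup>+\<xi>. ennreal (exp (- (norm \<xi>)\<^sup>2 / (4 * t)) * \<Phi> \<xi>) \<partial>lborel))
       = (\<integral>\<^sup>+\<xi>. ennreal ((4 * pi) powr (- N / 2)) * (ennreal (w t * exp (- (norm \<xi>)\<^sup>2 / (4 * t))) * ennreal (\<Phi> \<xi>)) \<partial>lborel)" .
  qed
  also have "\<dots> = (\<integral>\<^sup>+\<xi>. \<integral>\<^sup>+t. ennreal ((4 * pi) powr (- N / 2)) * (ennreal (w t * exp (- (norm \<xi>)\<^sup>2 / (4 * t))) * ennreal (\<Phi> \<xi>)) \<partial>lborel \<partial>lborel)"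
    by (rule lborel_pair.Fubini') measurable
  also have "\<dots> = (\<integral>\<^sup>+\<xi>. ennreal ((4 * pi) powr (- N / 2)) * ((\<integral>\<^sup>+t. ennreal (w t * exp (- (norm \<xi>)\<^sup>2 / (4 * t))) \<partial>lborel) * ennreal (\<Phi> \<xi>)) \<partial>lborel)"
    by (simp add: nn_integral_cmult nn_integral_multc)
  also have "\<dots> \<le> (\<integral>\<^sup>+\<xi>. ennreal (G * cst) * ennreal (norm \<xi> powr (\<gamma> - N) * \<Phi> \<xi>) \<partial>lborel)"
  proof (rule nn_integral_mono_AE, use AE_lborel_singleton[of 0] in eventually_elim)
    case (elim \<xi>)
    have "(\<integral>\<^sup>+t. ennreal (w t * exp (- (norm \<xi>)\<^sup>2 / (4 * t))) \<partial>lborel) \<le> ennreal (D * norm \<xi> powr (\<gamma> - N))"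
    proof -
      have "- (2 * ((N - \<gamma>) / 2)) = \<gamma> - N" by (simp add: field_simps)
      moreover have "0 < norm \<xi>" using elim by simp
      ultimately show ?thesis using D[of "norm \<xi>"] by (simp only: w_def)
    qed
    then have "ennreal ((4 * pi) powr (- N / 2)) * ((\<integral>\<^sup>+t. ennreal (w t * exp (- (norm \<xi>)\<^sup>2 / (4 * t))) \<partial>lborel) * ennreal (\<Phi> \<xi>))
       \<le> ennreal ((4 * pi) powr (- N / 2)) * (ennreal (D * norm \<xi> powr (\<gamma> - N)) * ennreal (\<Phi> \<xi>))"
      by (intro mult_left_mono mult_right_mono) auto
    also have "\<dots> = ennreal (((4 * pi) powr (- N / 2) * D) * (norm \<xi> powr (\<gamma> - N) * \<Phi> \<xi>))"
      using D0 nn by (simp add: ennreal_mult'[symmetric] mult_ac)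
    also have "(4 * pi) powr (- N / 2) * D = G * cst" using G by (simp add: cst_def)
    finally show ?case using G cst0 by (simp add: ennreal_mult')
  qed
  also have "\<dots> = ennreal (G * cst) * (\<integral>\<^sup>+\<xi>. ennreal (norm \<xi> powr (\<gamma> - N) * \<Phi> \<xi>) \<partial>lborel)"
    by (rule nn_integral_cmult) measurable
  finally show ?thesis .
qed

text \<open>For a non-negative density Tonelli exchanges space and subordination time. In the heat
  representation the point \<open>x\<close> occurs only in a phase of modulus 1, so taking absolute
  values makes the bound uniform in \<open>x\<close>.\<close>

lemma hardy_pointwise:
  fixes F :: "'a \<Rightarrow> real"
  assumes F: "integrable lborel F" and nn: "\<And>y. 0 \<le> F y"
  shows "(\<integral>\<^sup>+y. ennreal (norm (x - y) powr (- \<gamma>) * F y) \<partial>lborel)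
    \<le> ennreal cst * (\<integral>\<^sup>+\<xi>. ennreal (norm \<xi> powr (\<gamma> - N) * cmod (FI (\<lambda>y. of_real (F y)) \<xi>)) \<partial>lborel)"
proof -
  have [measurable]: "F \<in> borel_measurable borel" using F by auto
  have "ennreal G * (\<integral>\<^sup>+y. ennreal (norm (x - y) powr (- \<gamma>) * F y) \<partial>lborel)
      = (\<integral>\<^sup>+y. ennreal (G * norm (x - y) powr (- \<gamma>)) * ennreal (F y) \<partial>lborel)"
    using G nn by (subst nn_integral_cmult[symmetric]) (auto simp: ennreal_mult'[symmetric] mult.assoc)
  also have "\<dots> = (\<integral>\<^sup>+y. (\<integral>\<^sup>+t. ennreal (sub_weight \<gamma> t * exp (- t * (norm (x - y))\<^sup>2)) \<partial>lborel) * ennreal (F y) \<partial>lborel)"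
  proof (rule nn_integral_cong_AE, rule eventually_mono[OF AE_lborel_singleton[of x]])
    fix y assume "y \<noteq> x"
    then have xy: "x - y \<noteq> 0" by simp
    show "ennreal (G * norm (x - y) powr (- \<gamma>)) * ennreal (F y) = (\<integral>\<^sup>+t. ennreal (sub_weight \<gamma> t * exp (- t * (norm (x - y))\<^sup>2)) \<partial>lborel) * ennreal (F y)"
      by (simp only: subordination[OF \<gamma>(1) xy] G_def)
  qed
  also have "\<dots> = (\<integral>\<^sup>+y. \<integral>\<^sup>+t. ennreal (sub_weight \<gamma> t * exp (- t * (norm (x - y))\<^sup>2)) * ennreal (F y) \<partial>lborel \<partial>lborel)"
    by (simp add: nn_integral_multc)
  also have "\<dots> = (\<integral>\<^sup>+t. \<integral>\<^sup>+y. ennreal (sub_weight \<gamma> t * exp (- t * (norm (x - y))\<^sup>2)) * ennreal (F y) \<partial>lborel \<partial>lborel)"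
    by (rule lborel_pair.Fubini'[symmetric]) measurable
  also have "\<dots> \<le> (\<integral>\<^sup>+t. ennreal (sub_weight \<gamma> t) * (ennreal ((4 * pi * t) powr (- N / 2)) * (\<integral>\<^sup>+\<xi>. ennreal (exp (- (norm \<xi>)\<^sup>2 / (4 * t)) * cmod (FI (\<lambda>y. of_real (F y)) \<xi>)) \<partial>lborel)) \<partial>lborel)"
  proof (rule nn_integral_mono_AE, use AE_lborel_singleton[of "0::real"] in eventually_elim)
    case (elim t)
    show ?case
    proof (cases "0 < t")
      case True
      have int: "integrable lborel (\<lambda>y. exp (- t * (norm (x - y))\<^sup>2) * F y)"
        using True by (intro Bochner_Integration.integrable_bound[OF F]) (auto simp: abs_mult intro!: AE_I2 mult_left_le_one_le)
      have "(\<integral>\<^sup>+y. ennreal (sub_weight \<gamma> t * exp (- t * (norm (x - y))\<^sup>2)) * ennreal (F y) \<partial>lborel)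
          = (\<integral>\<^sup>+y. ennreal (sub_weight \<gamma> t) * ennreal (exp (- t * (norm (x - y))\<^sup>2) * F y) \<partial>lborel)"
        by (simp add: ennreal_mult' mult.assoc)
      also have "\<dots> = ennreal (sub_weight \<gamma> t) * (\<integral>\<^sup>+y. ennreal (exp (- t * (norm (x - y))\<^sup>2) * F y) \<partial>lborel)"
        by (rule nn_integral_cmult) measurable
      also have "(\<integral>\<^sup>+y. ennreal (exp (- t * (norm (x - y))\<^sup>2) * F y) \<partial>lborel) = ennreal (LINT y|lborel. exp (- t * (norm (x - y))\<^sup>2) * F y)"
        using nn by (intro nn_integral_eq_integral[OF int]) auto
      also have "(LINT y|lborel. exp (- t * (norm (x - y))\<^sup>2) * F y) = cmod (LINT y|lborel. exp (- t * (norm (x - y))\<^sup>2) * complex_of_real (F y))"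
      proof -
        have "0 \<le> (LINT y|lborel. exp (- t * (norm (x - y))\<^sup>2) * F y)" using nn by (intro integral_nonneg_AE) auto
        then show ?thesis by (simp only: of_real_mult[symmetric] integral_complex_of_real norm_of_real abs_of_nonneg)
      qed
      also have "ennreal (sub_weight \<gamma> t) * ennreal \<dots> \<le> ennreal (sub_weight \<gamma> t) * (ennreal ((4 * pi * t) powr (- N / 2)) * (\<integral>\<^sup>+\<xi>. ennreal (exp (- (norm \<xi>)\<^sup>2 / (4 * t)) * cmod (FI (\<lambda>y. of_real (F y)) \<xi>)) \<partial>lborel))"
        unfolding N using F by (intro mult_left_mono heat_representation_bound True) auto
      finally show ?thesis .
    next
      case False
      with elim have "sub_weight \<gamma> t = 0" by (simp add: sub_weight_def)
      then show ?thesis by simp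
    qed
  qed
  also have "\<dots> \<le> ennreal (G * cst) * (\<integral>\<^sup>+\<xi>. ennreal (norm \<xi> powr (\<gamma> - N) * cmod (FI (\<lambda>y. of_real (F y)) \<xi>)) \<partial>lborel)"
    by (rule sub_swap) auto
  also have "\<dots> = ennreal G * (ennreal cst * (\<integral>\<^sup>+\<xi>. ennreal (norm \<xi> powr (\<gamma> - N) * cmod (FI (\<lambda>y. of_real (F y)) \<xi>)) \<partial>lborel))"
    using G cst0 by (simp add: ennreal_mult mult.assoc)
  finally show ?thesis using G by (simp add: ennreal_mult_le_mult_iff)
qed

text \<open>The uniform bound \<open>M\<close> legitimises all exchanges with the subordination
  time, which becomes the outermost variable. At each fixed time the pairing is an absolutely
  convergent frequency integral, and absolute values are taken only after that identity.\<close>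

lemma riesz_pairing:
  fixes F H :: "'a \<Rightarrow> complex"
  assumes F: "integrable lborel F" and H: "integrable lborel H"
    and M: "\<And>x. (\<integral>\<^sup>+y. ennreal (norm (x - y) powr (- \<gamma>) * cmod (F y)) \<partial>lborel) \<le> ennreal M"
  shows "ennreal (cmod (LINT x|lborel. (LINT y|lborel. of_real (norm (x - y) powr (- \<gamma>)) * F y) * H x))
    \<le> ennreal cst * (\<integral>\<^sup>+\<xi>. ennreal (norm \<xi> powr (\<gamma> - N) * (cmod (FI F \<xi>) * cmod (FI H (- \<xi>)))) \<partial>lborel)"
proof -
  have [measurable]: "F \<in> borel_measurable borel" "H \<in> borel_measurable borel" using F H by auto
  define k where "k t z = sub_weight \<gamma> t * exp (- t * (norm z)\<^sup>2)" for t and z :: 'a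
  have k0: "0 \<le> k t z" for t z by (simp add: k_def)
  have [measurable]: "(\<lambda>(t, z). k t z) \<in> borel_measurable (borel \<Otimes>\<^sub>M borel)" unfolding k_def by measurable
  have mk [measurable (raw)]: "(\<lambda>w. k (f w) (g w)) \<in> borel_measurable L" if [measurable]: "f \<in> borel_measurable L" "g \<in> borel_measurable L"
    for f g and L :: "'b measure" unfolding k_def by measurable
  have kn: "(\<integral>\<^sup>+t. ennreal (k t z) \<partial>lborel) = ennreal (G * norm z powr (- \<gamma>))" if "z \<noteq> 0" for z
    unfolding k_def G_def by (rule subordination[OF \<gamma>(1) that])
  have ki: "(LINT t|lborel. complex_of_real (k t z)) = of_real (G * norm z powr (- \<gamma>))" if "z \<noteq> 0" for z
  proof -
    have "(LINT t|lborel. k t z) = G * norm z powr (- \<gamma>)"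
      using kn[OF that] G k0 by (intro nn_integral_eq_integrable[THEN iffD1, THEN conjunct2]) auto
    then show ?thesis by (simp only: integral_complex_of_real)
  qed
  have fin1: "(\<integral>\<^sup>+y. \<integral>\<^sup>+t. norm (complex_of_real (k t (x - y)) * F y) \<partial>lborel \<partial>lborel) \<le> ennreal (G * M)" for x
  proof -
    have "(\<integral>\<^sup>+y. \<integral>\<^sup>+t. norm (complex_of_real (k t (x - y)) * F y) \<partial>lborel \<partial>lborel)
        = (\<integral>\<^sup>+y. (\<integral>\<^sup>+t. ennreal (k t (x - y)) \<partial>lborel) * ennreal (cmod (F y)) \<partial>lborel)"
      by (simp add: norm_mult k0 ennreal_mult' nn_integral_multc)
    also have "\<dots> = (\<integral>\<^sup>+y. ennreal G * ennreal (norm (x - y) powr (- \<gamma>) * cmod (F y)) \<partial>lborel)"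
      using AE_lborel_singleton[of x] G
      by (intro nn_integral_cong_AE) (auto simp: kn ennreal_mult' mult.assoc elim!: eventually_mono)
    also have "\<dots> = ennreal G * (\<integral>\<^sup>+y. ennreal (norm (x - y) powr (- \<gamma>) * cmod (F y)) \<partial>lborel)"
      by (rule nn_integral_cmult) measurable
    also have "\<dots> \<le> ennreal G * ennreal M" by (intro mult_left_mono M) auto
    finally show ?thesis using G by (simp add: ennreal_mult')
  qed
  define g where "g x t = (LINT y|lborel. complex_of_real (k t (x - y)) * F y)" for x t
  have mg [measurable]: "(\<lambda>(x, t). g x t) \<in> borel_measurable (lborel \<Otimes>\<^sub>M lborel)" unfolding g_def by measurable
  have step1: "of_real G * (LINT y|lborel. of_real (norm (x - y) powr (- \<gamma>)) * F y) = (LINT t|lborel. g x t)" for x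
  proof -
    have "of_real G * (LINT y|lborel. of_real (norm (x - y) powr (- \<gamma>)) * F y) = (LINT y|lborel. of_real G * (of_real (norm (x - y) powr (- \<gamma>)) * F y))"
      by (rule integral_mult_right_zero[symmetric])
    also have "\<dots> = (LINT y|lborel. LINT t|lborel. complex_of_real (k t (x - y)) * F y)"
    proof (rule integral_cong_AE)
      show "AE y in lborel. of_real G * (of_real (norm (x - y) powr (- \<gamma>)) * F y) = (LINT t|lborel. complex_of_real (k t (x - y)) * F y)"
      proof (rule eventually_mono[OF AE_lborel_singleton[of x]])
        fix y assume "y \<noteq> x"
        then have xy: "x - y \<noteq> 0" by simp
        show "of_real G * (of_real (norm (x - y) powr (- \<gamma>)) * F y) = (LINT t|lborel. complex_of_real (k t (x - y)) * F y)"
          by (simp only: integral_mult_left_zero ki[OF xy] of_real_mult mult.assoc)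
      qed
    qed measurable
    also have "\<dots> = (LINT t|lborel. g x t)"
      unfolding g_def
      by (rule lborel_pair.Fubini_bounded(2)[symmetric]) (measurable, use fin1[of x] in \<open>auto simp: order_le_less_trans[OF _ ennreal_less_top]\<close>)
    finally show ?thesis .
  qed
  have gle: "(\<integral>\<^sup>+t. ennreal (cmod (g x t)) \<partial>lborel) \<le> ennreal (G * M)" for x
  proof -
    have "(\<integral>\<^sup>+t. ennreal (cmod (g x t)) \<partial>lborel) \<le> (\<integral>\<^sup>+t. \<integral>\<^sup>+y. norm (complex_of_real (k t (x - y)) * F y) \<partial>lborel \<partial>lborel)"
    proof (rule nn_integral_mono)
      fix t
      show "ennreal (cmod (g x t)) \<le> (\<integral>\<^sup>+y. norm (complex_of_real (k t (x - y)) * F y) \<partial>lborel)"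
        by (cases "integrable lborel (\<lambda>y. complex_of_real (k t (x - y)) * F y)")
           (auto simp: g_def not_integrable_integral_eq intro: integral_norm_bound_ennreal)
    qed
    also have "\<dots> = (\<integral>\<^sup>+y. \<integral>\<^sup>+t. norm (complex_of_real (k t (x - y)) * F y) \<partial>lborel \<partial>lborel)"
      by (rule lborel_pair.Fubini') measurable
    finally show ?thesis using fin1[of x] by (rule order_trans)
  qed
  have fin2: "(\<integral>\<^sup>+x. \<integral>\<^sup>+t. norm (g x t * H x) \<partial>lborel \<partial>lborel) < \<infinity>"
  proof -
    have "(\<integral>\<^sup>+x. \<integral>\<^sup>+t. norm (g x t * H x) \<partial>lborel \<partial>lborel) = (\<integral>\<^sup>+x. (\<integral>\<^sup>+t. ennreal (cmod (g x t)) \<partial>lborel) * ennreal (cmod (H x)) \<partial>lborel)"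
      by (simp add: norm_mult ennreal_mult' nn_integral_multc)
    also have "\<dots> \<le> (\<integral>\<^sup>+x. ennreal (G * M) * ennreal (cmod (H x)) \<partial>lborel)"
      by (intro nn_integral_mono mult_right_mono gle) auto
    also have "\<dots> = ennreal (G * M) * (\<integral>\<^sup>+x. ennreal (cmod (H x)) \<partial>lborel)"
      by (rule nn_integral_cmult) measurable
    also have "\<dots> < \<infinity>" using H by (auto simp: ennreal_mult_less_top integrable_iff_bounded)
    finally show ?thesis .
  qed
  have int2: "of_real G * (LINT x|lborel. (LINT y|lborel. of_real (norm (x - y) powr (- \<gamma>)) * F y) * H x) = (LINT t|lborel. LINT x|lborel. g x t * H x)"
  proof -
    have "of_real G * (LINT x|lborel. (LINT y|lborel. of_real (norm (x - y) powr (- \<gamma>)) * F y) * H x)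
       = (LINT x|lborel. LINT t|lborel. g x t * H x)"
      by (simp only: integral_mult_left_zero step1[symmetric] mult.assoc integral_mult_right_zero)
    also have "\<dots> = (LINT t|lborel. LINT x|lborel. g x t * H x)"
      by (rule lborel_pair.Fubini_bounded(2)[OF _ fin2, symmetric]) measurable
    finally show ?thesis .
  qed
  \<comment> \<open>For positive \<open>t\<close> the convolution is replaced by its heat
    representation, and Fubini carries the phase over to \<open>H\<close>, where it produces
    \<open>FI H (- \<xi>)\<close>.\<close>
  have pt: "ennreal (cmod (LINT x|lborel. g x t * H x)) \<le> ennreal (sub_weight \<gamma> t) * (ennreal ((4 * pi * t) powr (- N / 2)) *
      (\<integral>\<^sup>+\<xi>. ennreal (exp (- (norm \<xi>)\<^sup>2 / (4 * t)) * (cmod (FI F \<xi>) * cmod (FI H (- \<xi>)))) \<partial>lborel))" if t: "0 < t" for t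
  proof -
    define E where "E \<xi> = exp (- (norm (\<xi>::'a))\<^sup>2 / (4 * t))" for \<xi>
    have [measurable]: "E \<in> borel_measurable borel" unfolding E_def by measurable
    have E0: "0 \<le> E \<xi>" for \<xi> by (simp add: E_def)
    have Efin: "(\<integral>\<^sup>+\<xi>. ennreal (E \<xi>) \<partial>lborel) < \<infinity>"
      using gaussian_integral(3)[of "1 / (4 * t)", where 'a = 'a] t by (simp add: E_def)
    define h where "h x \<xi> = cis (- (x \<bullet> \<xi>)) * E \<xi> * FI F \<xi> * H x" for x \<xi>
    have [measurable]: "case_prod h \<in> borel_measurable (lborel \<Otimes>\<^sub>M lborel)" unfolding h_def[abs_def] by measurable
    define L where "L = (LINT y|lborel. cmod (F y))"
    have fin: "(\<integral>\<^sup>+x. \<integral>\<^sup>+\<xi>. norm (h x \<xi>) \<partial>lborel \<partial>lborel) < \<infinity>"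
    proof -
      have "(\<integral>\<^sup>+x. \<integral>\<^sup>+\<xi>. norm (h x \<xi>) \<partial>lborel \<partial>lborel) \<le> (\<integral>\<^sup>+x. \<integral>\<^sup>+\<xi>. ennreal (E \<xi>) * (ennreal L * ennreal (cmod (H x))) \<partial>lborel \<partial>lborel)"
      proof (intro nn_integral_mono)
        fix x \<xi>
        have "norm (h x \<xi>) \<le> E \<xi> * (L * cmod (H x))"
          using FI_le[of F \<xi>] E0[of \<xi>] by (auto simp: h_def norm_mult L_def mult.assoc intro!: mult_left_mono mult_right_mono)
        moreover have "0 \<le> L" unfolding L_def by (rule integral_nonneg_AE) simp
        ultimately show "ennreal (norm (h x \<xi>)) \<le> ennreal (E \<xi>) * (ennreal L * ennreal (cmod (H x)))"
          using E0 by (simp add: ennreal_mult'[symmetric] ennreal_leI)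
      qed
      also have "\<dots> = (\<integral>\<^sup>+\<xi>. ennreal (E \<xi>) \<partial>lborel) * (ennreal L * (\<integral>\<^sup>+x. ennreal (cmod (H x)) \<partial>lborel))"
        by (simp add: nn_integral_cmult nn_integral_multc)
      also have "\<dots> < \<infinity>" using Efin H by (auto simp: ennreal_mult_less_top integrable_iff_bounded)
      finally show ?thesis .
    qed
    have gt: "g x t = of_real (sub_weight \<gamma> t * (4 * pi * t) powr (- N / 2)) * (LINT \<xi>|lborel. cis (- (x \<bullet> \<xi>)) * E \<xi> * FI F \<xi>)" for x
    proof -
      have "g x t = (LINT y|lborel. of_real (sub_weight \<gamma> t) * (exp (- t * (norm (x - y))\<^sup>2) * F y))"
        unfolding g_def k_def by (rule Bochner_Integration.integral_cong) (simp_all only: of_real_mult mult.assoc)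
      also have "\<dots> = of_real (sub_weight \<gamma> t) * (LINT y|lborel. exp (- t * (norm (x - y))\<^sup>2) * F y)"
        by (rule integral_mult_right_zero)
      finally show ?thesis unfolding heat_representation[OF t F] E_def N by (simp only: of_real_mult mult.assoc)
    qed
    have "(LINT x|lborel. g x t * H x) = (LINT x|lborel. of_real (sub_weight \<gamma> t * (4 * pi * t) powr (- N / 2)) * (LINT \<xi>|lborel. h x \<xi>))"
      unfolding gt h_def integral_mult_left_zero by (rule Bochner_Integration.integral_cong) (simp_all only: mult.assoc)
    also have "\<dots> = of_real (sub_weight \<gamma> t * (4 * pi * t) powr (- N / 2)) * (LINT x|lborel. LINT \<xi>|lborel. h x \<xi>)"
      by (rule integral_mult_right_zero)
    also have "(LINT x|lborel. LINT \<xi>|lborel. h x \<xi>) = (LINT \<xi>|lborel. LINT x|lborel. h x \<xi>)"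
      by (rule lborel_pair.Fubini_bounded(2)[OF _ fin, symmetric]) measurable
    also have "\<dots> = (LINT \<xi>|lborel. E \<xi> * FI F \<xi> * FI H (- \<xi>))"
    proof (rule Bochner_Integration.integral_cong[OF refl])
      fix \<xi>
      have "(LINT x|lborel. h x \<xi>) = (LINT x|lborel. E \<xi> * FI F \<xi> * (cis (x \<bullet> - \<xi>) * H x))"
        unfolding h_def by (rule Bochner_Integration.integral_cong) (simp_all add: mult_ac)
      then show "(LINT x|lborel. h x \<xi>) = E \<xi> * FI F \<xi> * FI H (- \<xi>)" by (simp only: FI_def[of H] integral_mult_right_zero)
    qed
    finally have eq: "cmod (LINT x|lborel. g x t * H x) = (sub_weight \<gamma> t * (4 * pi * t) powr (- N / 2)) * cmod (LINT \<xi>|lborel. E \<xi> * FI F \<xi> * FI H (- \<xi>))"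
      by (simp add: norm_mult)
    have "ennreal (cmod (LINT \<xi>|lborel. E \<xi> * FI F \<xi> * FI H (- \<xi>))) \<le> (\<integral>\<^sup>+\<xi>. ennreal (E \<xi> * (cmod (FI F \<xi>) * cmod (FI H (- \<xi>)))) \<partial>lborel)"
    \<comment> \<open>Outside the integrable case the Bochner integral is 0 by convention, so the
      estimate persists.\<close>
    proof (cases "integrable lborel (\<lambda>\<xi>. E \<xi> * FI F \<xi> * FI H (- \<xi>))")
      case True
      from integral_norm_bound_ennreal[OF this] show ?thesis using E0 by (simp add: norm_mult mult.assoc)
    qed (simp add: not_integrable_integral_eq)
    then have "ennreal (sub_weight \<gamma> t * (4 * pi * t) powr (- N / 2)) * ennreal (cmod (LINT \<xi>|lborel. E \<xi> * FI F \<xi> * FI H (- \<xi>)))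
      \<le> ennreal (sub_weight \<gamma> t * (4 * pi * t) powr (- N / 2)) * (\<integral>\<^sup>+\<xi>. ennreal (E \<xi> * (cmod (FI F \<xi>) * cmod (FI H (- \<xi>)))) \<partial>lborel)"
      by (rule mult_left_mono) auto
    then show ?thesis unfolding eq E_def by (simp only: ennreal_mult' sub_weight_nonneg powr_ge_zero mult_nonneg_nonneg mult.assoc)
  qed
  have "ennreal G * ennreal (cmod (LINT x|lborel. (LINT y|lborel. of_real (norm (x - y) powr (- \<gamma>)) * F y) * H x))
      = ennreal (cmod (LINT t|lborel. LINT x|lborel. g x t * H x))"
    unfolding int2[symmetric] using G by (simp add: norm_mult ennreal_mult')
  also have "\<dots> \<le> (\<integral>\<^sup>+t. ennreal (cmod (LINT x|lborel. g x t * H x)) \<partial>lborel)"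
    by (cases "integrable lborel (\<lambda>t. LINT x|lborel. g x t * H x)")
       (auto simp: not_integrable_integral_eq intro: integral_norm_bound_ennreal)
  also have "\<dots> \<le> (\<integral>\<^sup>+t. ennreal (sub_weight \<gamma> t) * (ennreal ((4 * pi * t) powr (- N / 2)) * (\<integral>\<^sup>+\<xi>. ennreal (exp (- (norm \<xi>)\<^sup>2 / (4 * t)) * (cmod (FI F \<xi>) * cmod (FI H (- \<xi>)))) \<partial>lborel)) \<partial>lborel)"
  proof (rule nn_integral_mono_AE, use AE_lborel_singleton[of "0::real"] in eventually_elim)
    case (elim t)
    show ?case
    proof (cases "0 < t")
      case True then show ?thesis by (rule pt)
    next
      case False
      with elim have "k t z = 0" for z by (simp add: k_def sub_weight_def)
      then show ?thesis by (simp add: g_def)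
    qed
  qed
  also have "\<dots> \<le> ennreal (G * cst) * (\<integral>\<^sup>+\<xi>. ennreal (norm \<xi> powr (\<gamma> - N) * (cmod (FI F \<xi>) * cmod (FI H (- \<xi>)))) \<partial>lborel)"
    by (rule sub_swap) auto
  also have "\<dots> = ennreal G * (ennreal cst * (\<integral>\<^sup>+\<xi>. ennreal (norm \<xi> powr (\<gamma> - N) * (cmod (FI F \<xi>) * cmod (FI H (- \<xi>)))) \<partial>lborel))"
    using G cst0 by (simp add: ennreal_mult mult.assoc)
  finally show ?thesis using G by (simp add: ennreal_mult_le_mult_iff)
qed

end

lemma subord_exists:
  assumes "0 < \<gamma>" "\<gamma> < real DIM('a::euclidean_space)"
  shows "\<exists>D. subord TYPE('a) \<gamma> (real DIM('a)) D"
proof -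
  obtain D where "0 \<le> D" "\<And>a. 0 < a \<Longrightarrow> (\<integral>\<^sup>+t. ennreal (indicator {0..} t * t powr (- ((real DIM('a) - \<gamma>) / 2) - 1) * exp (- a\<^sup>2 / (4 * t))) \<partial>lborel)
      \<le> ennreal (D * a powr (- (2 * ((real DIM('a) - \<gamma>) / 2))))"
    using heat_weight_bound[of "(real DIM('a) - \<gamma>) / 2"] assms by auto
  then show ?thesis using assms by (intro exI[of _ D]) (auto simp: subord_def)
qed

section \<open>Sobolev spaces and the Hartree nonlinearity\<close>

text \<open>\<open>Sobolev s\<close> is just a subset of \<open>Ltwo\<close>, with no topology of
  its own. This map and \<open>unweighted\<close> identify it isometrically with the Banach space
  \<open>Ltwo\<close> on the Fourier side, where fixed points, integrals and derivatives are
  taken.\<close>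

definition weighted :: "real \<Rightarrow> 'a::euclidean_space Ltwo \<Rightarrow> 'a Ltwo" where
  "weighted s u = to_Ltwo (bessel_weight s u)"

text \<open>For non-negative \<open>s\<close> the multiplier is bounded by 1, so this inverse is a
  bounded linear map on all of \<open>Ltwo\<close> and carries limits and integrals back.\<close>

definition unweighted :: "real \<Rightarrow> 'a::euclidean_space Ltwo \<Rightarrow> 'a Ltwo" where
  "unweighted s a = ifourier (fmul (\<lambda>\<xi>. of_real (bracket \<xi> powr (- s))) a)"

lemma bessel_weight_eq: "bessel_weight s u \<xi> = of_real (bracket \<xi> powr s) * repr (fourier u) \<xi>"
  by (simp add: bessel_weight_def bracket_powr)

lemma measurable_bessel_weight [measurable]: "bessel_weight s u \<in> borel_measurable borel"
  unfolding bessel_weight_eq[abs_def] using borel_measurable_repr[of "fourier u"] by measurable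

lemma bracket_powr_neg_le: "0 \<le> s \<Longrightarrow> bracket x powr (- s) \<le> 1"
  using powr_mono[of "- s" 0 "bracket x"] bracket_ge_1[of x] by simp

lemma bounded_multiplier_bracket:
  assumes "0 \<le> s" shows "bounded_multiplier (\<lambda>\<xi>. of_real (bracket \<xi> powr (- s)))"
  using bracket_powr_neg_le[OF assms] by (intro bounded_multiplierI[where B = 1]) auto

lemma bracket_powr_cancel: "bracket \<xi> powr s * bracket \<xi> powr (- s) = 1"
  using bracket_pos[of \<xi>] by (subst powr_add[symmetric]) (simp del: bracket_pos)

lemma AE_bessel_weight_unweighted:
  assumes "0 \<le> s" shows "AE \<xi> in lborel. bessel_weight s (unweighted s a) \<xi> = repr a \<xi>"
  using AE_fmul[OF bounded_multiplier_bracket[OF assms], of a]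
proof eventually_elim
  case (elim \<xi>)
  have "complex_of_real (bracket \<xi> powr s) * complex_of_real (bracket \<xi> powr (- s)) = 1"
    by (simp only: of_real_mult[symmetric] bracket_powr_cancel of_real_1)
  then show ?case unfolding bessel_weight_eq unweighted_def fourier_ifourier elim
    by (simp only: mult.assoc[symmetric] mult_1)
qed

lemma unweighted_in_Sobolev: "0 \<le> s \<Longrightarrow> unweighted s a \<in> Sobolev s"
  unfolding Sobolev_def mem_Collect_eq
  by (rule square_integrable_cong_AE[OF square_integrable_repr[of a]])
     (use AE_bessel_weight_unweighted[of s a] in \<open>auto elim: eventually_mono\<close>)

lemma weighted_unweighted [simp]: "0 \<le> s \<Longrightarrow> weighted s (unweighted s a) = a"
  unfolding weighted_def using unweighted_in_Sobolev[of s a] AE_bessel_weight_unweighted[of s a]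
  by (intro to_Ltwo_eqI) (auto simp: Sobolev_def elim: eventually_mono)

lemma unweighted_weighted:
  assumes "u \<in> Sobolev s" "0 \<le> s" shows "unweighted s (weighted s u) = u"
proof -
  have sq: "square_integrable (bessel_weight s u)" using assms by (simp add: Sobolev_def)
  have "fmul (\<lambda>\<xi>. of_real (bracket \<xi> powr (- s))) (weighted s u) = to_Ltwo (\<lambda>\<xi>. of_real (bracket \<xi> powr (- s)) * bessel_weight s u \<xi>)"
    unfolding weighted_def by (rule fmul_to_Ltwo[OF bounded_multiplier_bracket[OF assms(2)] sq])
  also have "(\<lambda>\<xi>. of_real (bracket \<xi> powr (- s)) * bessel_weight s u \<xi>) = repr (fourier u)"
  proof
    fix \<xi> :: 'a
    have "complex_of_real (bracket \<xi> powr (- s)) * complex_of_real (bracket \<xi> powr s) = 1"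
      by (simp only: of_real_mult[symmetric] mult.commute[of "_ powr (- s)"] bracket_powr_cancel of_real_1)
    then show "of_real (bracket \<xi> powr (- s)) * bessel_weight s u \<xi> = repr (fourier u) \<xi>"
      unfolding bessel_weight_eq by (simp only: mult.assoc[symmetric] mult_1)
  qed
  finally show ?thesis by (simp add: unweighted_def)
qed

lemma Sobolev_norm_eq: "u \<in> Sobolev s \<Longrightarrow> Sobolev_norm s u = norm (weighted s u)"
  unfolding Sobolev_norm_def weighted_def Sobolev_def
  by (simp add: power2_norm_to_Ltwo[symmetric])

lemma bounded_linear_unweighted: "0 \<le> s \<Longrightarrow> bounded_linear (unweighted s)"
  unfolding unweighted_def[abs_def]
  by (rule bounded_linear_compose[OF bounded_linear_ifourier bounded_linear_fmul[OF bounded_multiplier_bracket]])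

lemma unweighted_add: "0 \<le> s \<Longrightarrow> unweighted s (a + b) = unweighted s a + unweighted s b"
  by (rule linear_add[OF bounded_linear.linear[OF bounded_linear_unweighted]])

lemma unweighted_diff: "0 \<le> s \<Longrightarrow> unweighted s (a - b) = unweighted s a - unweighted s b"
  by (rule linear_diff[OF bounded_linear.linear[OF bounded_linear_unweighted]])

lemma unweighted_inj: "0 \<le> s \<Longrightarrow> unweighted s a = unweighted s b \<Longrightarrow> a = b"
  by (metis weighted_unweighted)

lemma sq_bound_fourier:
  assumes "u \<in> Sobolev s"
  shows "sq_bound (\<lambda>\<xi>. bracket \<xi> powr s * cmod (repr (fourier u) \<xi>)) (norm (weighted s u))"
proof -
  have "(\<integral>\<^sup>+\<xi>. ennreal ((cmod (bessel_weight s u \<xi>))\<^sup>2) \<partial>lborel) = ennreal ((norm (weighted s u))\<^sup>2)"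
    unfolding weighted_def using assms by (intro nn_integral_to_Ltwo) (simp add: Sobolev_def)
  then show ?thesis
    using borel_measurable_repr[of "fourier u"] by (simp add: sq_bound_def bessel_weight_eq norm_mult)
qed

text \<open>The potential generated by the real part of \<open>f * cnj g\<close>. The two-argument
  version lets a difference of two potentials again be a potential, namely of the difference and the
  sum.\<close>

definition hartree_form :: "real \<Rightarrow> 'a::euclidean_space Ltwo \<Rightarrow> 'a Ltwo \<Rightarrow> 'a \<Rightarrow> real" where
  "hartree_form \<gamma> f g x = (LINT y|lborel. norm (x - y) powr (- \<gamma>) * (repr f y \<bullet> repr g y))"

definition hartree_term :: "real \<Rightarrow> 'a::euclidean_space Ltwo \<Rightarrow> 'a Ltwo \<Rightarrow> 'a Ltwo \<Rightarrow> 'a Ltwo" where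
  "hartree_term \<gamma> f g w = to_Ltwo (\<lambda>x. of_real (hartree_form \<gamma> f g x) * repr w x)"

lemma measurable_hartree_form [measurable]: "hartree_form \<gamma> f g \<in> borel_measurable borel"
  unfolding hartree_form_def[abs_def] by measurable

lemma hartree_potential_eq: "hartree_potential \<gamma> u = hartree_form \<gamma> u u"
  by (rule ext) (simp add: hartree_potential_def convolution_def hartree_form_def power2_norm_eq_inner)

section \<open>Correlations of transforms as majorants\<close>

definition corr :: "('a::euclidean_space \<Rightarrow> real) \<Rightarrow> ('a \<Rightarrow> real) \<Rightarrow> 'a \<Rightarrow> ennreal" where
  "corr a b \<xi> = (\<integral>\<^sup>+\<eta>. ennreal (a (\<xi> + \<eta>) * b \<eta>) \<partial>lborel)"

lemma measurable_corr [measurable]: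
  assumes [measurable]: "a \<in> borel_measurable borel" "b \<in> borel_measurable borel"
  shows "corr a b \<in> borel_measurable borel"
  unfolding corr_def[abs_def] by measurable

lemma corr_minus:
  assumes [measurable]: "a \<in> borel_measurable borel" "b \<in> borel_measurable borel"
  shows "corr a b (- \<xi>) = corr b a \<xi>"
  unfolding corr_def using nn_integral_translate[of "\<lambda>\<eta>. ennreal (a (- \<xi> + \<eta>) * b \<eta>)" \<xi>]
  by (simp add: mult.commute)

abbreviation abs_fourier :: "'a::euclidean_space Ltwo \<Rightarrow> 'a \<Rightarrow> real" where
  "abs_fourier u \<equiv> (\<lambda>\<xi>. cmod (repr (fourier u) \<xi>))"

lemma FI_product_le: "ennreal (cmod (FI (\<lambda>y. repr f y * cnj (repr g y)) (- \<xi>))) \<le> corr (abs_fourier f) (abs_fourier g) \<xi>"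
proof -
  have "FI (\<lambda>y. repr f y * cnj (repr g y)) (- \<xi>) = (LINT \<eta>|lborel. repr (fourier f) (\<xi> + \<eta>) * cnj (repr (fourier g) \<eta>))"
    using fourier_product[of \<xi> f g] by (simp add: FI_def)
  then show ?thesis
    unfolding corr_def
    by (cases "integrable lborel (\<lambda>\<eta>. repr (fourier f) (\<xi> + \<eta>) * cnj (repr (fourier g) \<eta>))")
       (use integral_norm_bound_ennreal[of lborel "\<lambda>\<eta>. repr (fourier f) (\<xi> + \<eta>) * cnj (repr (fourier g) \<eta>)"] in
         \<open>auto simp: norm_mult not_integrable_integral_eq\<close>)
qed

lemma quad_corr:
  fixes a b c d :: "'a::euclidean_space \<Rightarrow> real"
  assumes [measurable]: "a \<in> borel_measurable borel" "b \<in> borel_measurable borel" "c \<in> borel_measurable borel" "d \<in> borel_measurable borel"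
    and nn: "\<And>x. 0 \<le> a x" "\<And>x. 0 \<le> b x" "\<And>x. 0 \<le> c x" "\<And>x. 0 \<le> d x"
  shows "(\<integral>\<^sup>+\<xi>. ennreal (norm \<xi> powr (\<gamma> - real DIM('a))) * (corr a b \<xi> * corr c d \<xi>) \<partial>lborel) = quad \<gamma> a b c d"
  unfolding quad_def
proof (rule nn_integral_cong)
  fix \<xi> :: 'a
  have "(\<integral>\<^sup>+\<eta>. \<integral>\<^sup>+\<zeta>. ennreal (norm \<xi> powr (\<gamma> - real DIM('a)) * (a (\<xi> + \<eta>) * b \<eta> * (c (\<xi> + \<zeta>) * d \<zeta>))) \<partial>lborel \<partial>lborel)
    = (\<integral>\<^sup>+\<eta>. \<integral>\<^sup>+\<zeta>. ennreal (norm \<xi> powr (\<gamma> - real DIM('a))) * (ennreal (a (\<xi> + \<eta>) * b \<eta>) * ennreal (c (\<xi> + \<zeta>) * d \<zeta>)) \<partial>lborel \<partial>lborel)"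
    using nn by (intro nn_integral_cong) (simp only: ennreal_mult' ennreal_mult powr_ge_zero mult_nonneg_nonneg mult.assoc)
  also have "\<dots> = ennreal (norm \<xi> powr (\<gamma> - real DIM('a))) * (corr a b \<xi> * corr c d \<xi>)"
    unfolding corr_def by (simp add: nn_integral_cmult nn_integral_multc)
  finally show "ennreal (norm \<xi> powr (\<gamma> - real DIM('a))) * (corr a b \<xi> * corr c d \<xi>)
    = (\<integral>\<^sup>+\<eta>. \<integral>\<^sup>+\<zeta>. ennreal (norm \<xi> powr (\<gamma> - real DIM('a)) * (a (\<xi> + \<eta>) * b \<eta> * (c (\<xi> + \<zeta>) * d \<zeta>))) \<partial>lborel \<partial>lborel)" ..
qed

text \<open>The mixed density is at most the sum of the two diagonal ones, so control of each of
  these suffices.\<close>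

lemma integrable_hartree_form_integrand:
  assumes "\<And>u. u \<in> {f, g} \<Longrightarrow> (\<integral>\<^sup>+y. ennreal (norm (x - y) powr (- \<gamma>) * (cmod (repr u y))\<^sup>2) \<partial>lborel) \<le> ennreal (M u)"
  shows "integrable lborel (\<lambda>y. norm (x - y) powr (- \<gamma>) * (repr f y \<bullet> repr g y))"
    and "(\<integral>\<^sup>+y. ennreal (norm (x - y) powr (- \<gamma>) * \<bar>repr f y \<bullet> repr g y\<bar>) \<partial>lborel) \<le> ennreal (M f) + ennreal (M g)"
proof -
  have le: "\<bar>a \<bullet> b\<bar> \<le> (cmod a)\<^sup>2 + (cmod b)\<^sup>2" for a b :: complex
    using Cauchy_Schwarz_ineq2[of a b] sum_squares_bound[of "cmod a" "cmod b"] mult_nonneg_nonneg[OF norm_ge_zero[of a] norm_ge_zero[of b]]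
    by linarith
  have "(\<integral>\<^sup>+y. ennreal (norm (x - y) powr (- \<gamma>) * \<bar>repr f y \<bullet> repr g y\<bar>) \<partial>lborel)
     \<le> (\<integral>\<^sup>+y. ennreal (norm (x - y) powr (- \<gamma>) * (cmod (repr f y))\<^sup>2) + ennreal (norm (x - y) powr (- \<gamma>) * (cmod (repr g y))\<^sup>2) \<partial>lborel)"
    using mult_left_mono[OF le powr_ge_zero]
    by (intro nn_integral_mono) (auto simp: distrib_left ennreal_plus[symmetric] intro!: ennreal_leI simp del: ennreal_plus)
  also have "\<dots> \<le> ennreal (M f) + ennreal (M g)"
    by (subst nn_integral_add) (auto intro!: add_mono assms)
  finally show *: "(\<integral>\<^sup>+y. ennreal (norm (x - y) powr (- \<gamma>) * \<bar>repr f y \<bullet> repr g y\<bar>) \<partial>lborel) \<le> ennreal (M f) + ennreal (M g)" .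
  show "integrable lborel (\<lambda>y. norm (x - y) powr (- \<gamma>) * (repr f y \<bullet> repr g y))"
  proof (rule integrableI_bounded)
    have "(\<integral>\<^sup>+y. norm (norm (x - y) powr (- \<gamma>) * (repr f y \<bullet> repr g y)) \<partial>lborel) \<le> ennreal (M f) + ennreal (M g)"
      using * by (simp add: abs_mult)
    then show "(\<integral>\<^sup>+y. norm (norm (x - y) powr (- \<gamma>) * (repr f y \<bullet> repr g y)) \<partial>lborel) < \<infinity>"
      by (rule order_le_less_trans) simp
  qed measurable
qed

locale hartree = riesz \<gamma> \<alpha> C dim_type + subord \<gamma> N D dim_type
  for \<gamma> \<alpha> C N D :: real and dim_type :: "'a::euclidean_space itself" +
  fixes s :: real
  assumes s: "\<gamma> / 2 \<le> s" "0 \<le> s"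
begin

text \<open>\<open>hardy_pointwise\<close> reduces the potential of \<open>|f|^2\<close> to the
  transform of \<open>f * cnj f\<close>, whose modulus is at most a correlation of
  \<open>abs_fourier f\<close> with itself; \<open>corr_bound\<close> estimates that.\<close>

lemma hardy:
  fixes f :: "'a Ltwo"
  assumes f: "f \<in> Sobolev s"
  shows "(\<integral>\<^sup>+y. ennreal (norm (x - y) powr (- \<gamma>) * (cmod (repr f y))\<^sup>2) \<partial>lborel) \<le> ennreal (cst * C * (norm (weighted s f))\<^sup>2)"
proof -
  have half: "sq_bound (\<lambda>\<xi>. bracket \<xi> powr (\<gamma> / 2) * abs_fourier f \<xi>) (norm (weighted s f))"
    by (rule sq_bound_mono[OF sq_bound_fourier[OF f]])
      (use s bracket_ge_1 in \<open>auto intro!: mult_right_mono powr_mono\<close>)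
  have int: "integrable lborel (\<lambda>y. (cmod (repr f y))\<^sup>2)"
    using square_integrable_repr[of f] by (simp add: square_integrable_def)
  have "(\<integral>\<^sup>+y. ennreal (norm (x - y) powr (- \<gamma>) * (cmod (repr f y))\<^sup>2) \<partial>lborel)
    \<le> ennreal cst * (\<integral>\<^sup>+\<xi>. ennreal (norm \<xi> powr (\<gamma> - N) * cmod (FI (\<lambda>y. of_real ((cmod (repr f y))\<^sup>2)) \<xi>)) \<partial>lborel)"
    by (rule hardy_pointwise[OF int]) simp
  also have "(\<integral>\<^sup>+\<xi>. ennreal (norm \<xi> powr (\<gamma> - N) * cmod (FI (\<lambda>y. of_real ((cmod (repr f y))\<^sup>2)) \<xi>)) \<partial>lborel)
     = (\<integral>\<^sup>+\<xi>. ennreal (norm \<xi> powr (\<gamma> - N) * cmod (FI (\<lambda>y. repr f y * cnj (repr f y)) (- \<xi>))) \<partial>lborel)"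
    using nn_integral_reflect[of "\<lambda>\<xi>. ennreal (norm \<xi> powr (\<gamma> - N) * cmod (FI (\<lambda>y. repr f y * cnj (repr f y)) \<xi>))" 0]
    unfolding complex_norm_square by simp
  also have "\<dots> \<le> (\<integral>\<^sup>+\<xi>. \<integral>\<^sup>+\<eta>. ennreal (kap \<xi> * (abs_fourier f (\<xi> + \<eta>) * abs_fourier f \<eta>)) \<partial>lborel \<partial>lborel)"
  proof (rule nn_integral_mono)
    fix \<xi> :: 'a
    have "ennreal (norm \<xi> powr (\<gamma> - N)) * ennreal (cmod (FI (\<lambda>y. repr f y * cnj (repr f y)) (- \<xi>))) \<le> ennreal (norm \<xi> powr (\<gamma> - N)) * corr (abs_fourier f) (abs_fourier f) \<xi>"
      by (intro mult_left_mono FI_product_le) auto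
    also have "\<dots> = (\<integral>\<^sup>+\<eta>. ennreal (kap \<xi> * (abs_fourier f (\<xi> + \<eta>) * abs_fourier f \<eta>)) \<partial>lborel)"
      unfolding corr_def N by (subst nn_integral_cmult[symmetric]) (auto simp: ennreal_mult')
    finally show "ennreal (norm \<xi> powr (\<gamma> - N) * cmod (FI (\<lambda>y. repr f y * cnj (repr f y)) (- \<xi>))) \<le> (\<integral>\<^sup>+\<eta>. ennreal (kap \<xi> * (abs_fourier f (\<xi> + \<eta>) * abs_fourier f \<eta>)) \<partial>lborel)"
      by (simp add: ennreal_mult')
  qed
  also have "\<dots> \<le> ennreal (C * (norm (weighted s f) * norm (weighted s f)))"
    by (rule corr_bound[OF half half]) auto
  finally show ?thesis using C0 cst0 by (simp add: ennreal_mult'[symmetric] power2_eq_square mult.assoc mult_left_mono)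
qed

lemma hartree_form_integrable:
  fixes f g :: "'a Ltwo"
  assumes "f \<in> Sobolev s" "g \<in> Sobolev s"
  shows "integrable lborel (\<lambda>y. norm (x - y) powr (- \<gamma>) * (repr f y \<bullet> repr g y))"
  using assms by (intro integrable_hartree_form_integrand(1)[where M = "\<lambda>u. cst * C * (norm (weighted s u))\<^sup>2"] hardy) auto

lemma hartree_form_abs_le:
  fixes f g :: "'a Ltwo"
  assumes "f \<in> Sobolev s" "g \<in> Sobolev s"
  shows "(\<integral>\<^sup>+y. ennreal (norm (x - y) powr (- \<gamma>) * \<bar>repr f y \<bullet> repr g y\<bar>) \<partial>lborel)
    \<le> ennreal (cst * C * (norm (weighted s f))\<^sup>2 + cst * C * (norm (weighted s g))\<^sup>2)"
proof -
  have "(\<integral>\<^sup>+y. ennreal (norm (x - y) powr (- \<gamma>) * \<bar>repr f y \<bullet> repr g y\<bar>) \<partial>lborel)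
      \<le> ennreal (cst * C * (norm (weighted s f))\<^sup>2) + ennreal (cst * C * (norm (weighted s g))\<^sup>2)"
    using assms by (intro integrable_hartree_form_integrand(2)[where M = "\<lambda>u. cst * C * (norm (weighted s u))\<^sup>2"] hardy) auto
  then show ?thesis using cst0 C0 by simp
qed

lemma hartree_form_bounded:
  fixes f g :: "'a Ltwo"
  assumes "f \<in> Sobolev s" "g \<in> Sobolev s"
  shows "\<bar>hartree_form \<gamma> f g x\<bar> \<le> cst * C * (norm (weighted s f))\<^sup>2 + cst * C * (norm (weighted s g))\<^sup>2"
proof -
  have "ennreal \<bar>hartree_form \<gamma> f g x\<bar> \<le> (\<integral>\<^sup>+y. ennreal (norm (x - y) powr (- \<gamma>) * \<bar>repr f y \<bullet> repr g y\<bar>) \<partial>lborel)"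
    using integral_norm_bound_ennreal[OF hartree_form_integrable[OF assms, of x]] by (simp add: hartree_form_def abs_mult)
  also note hartree_form_abs_le[OF assms]
  finally show ?thesis using cst0 C0 by (subst (asm) ennreal_le_iff) auto
qed

lemma bounded_multiplier_hartree_form:
  fixes f g :: "'a Ltwo"
  assumes "f \<in> Sobolev s" "g \<in> Sobolev s"
  shows "bounded_multiplier (\<lambda>x. of_real (hartree_form \<gamma> f g x))"
  using hartree_form_bounded[OF assms] by (intro bounded_multiplierI[where B = "cst * C * (norm (weighted s f))\<^sup>2 + cst * C * (norm (weighted s g))\<^sup>2"]) auto

text \<open>\<open>cst\<close> comes from the pairing with the Riesz kernel,
  \<open>3 * 3 powr s * C\<close> from \<open>quad_bound\<close>, and 2 from the two products into
  which the real density is split.\<close>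

definition Kh where "Kh = 2 * cst * (3 * 3 powr s * C)"

lemma Kh0: "0 \<le> Kh" using cst0 C0 by (simp add: Kh_def)

text \<open>The dual form of the trilinear estimate. \<open>k\<close> is an honest element of
  \<open>Ltwo\<close> but enters only through its norm of order \<open>-s\<close>; on the Fourier
  side this is the unweighted factor \<open>d\<close> of \<open>quad_bound\<close>.\<close>

lemma hartree_term_pairing:
  fixes f g w k :: "'a Ltwo"
  assumes f: "f \<in> Sobolev s" and g: "g \<in> Sobolev s" and w: "w \<in> Sobolev s"
    and k: "sq_bound (\<lambda>\<xi>. bracket \<xi> powr (- s) * abs_fourier k \<xi>) n"
  shows "cmod (cinner (hartree_term \<gamma> f g w) k) \<le> Kh * (norm (weighted s f) * norm (weighted s g) * norm (weighted s w) * n)"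
proof -
  let ?F = "\<lambda>y. complex_of_real (repr f y \<bullet> repr g y)" and ?H = "\<lambda>x. repr w x * cnj (repr k x)"
  have n: "0 \<le> n" using k by (simp add: sq_bound_def)
  define d where "d \<xi> = bracket \<xi> powr (- s) * abs_fourier k \<xi>" for \<xi>
  have d: "sq_bound d n" using k by (simp add: d_def[abs_def])
  have dk: "bracket \<xi> powr s * d \<xi> = abs_fourier k \<xi>" for \<xi>
    unfolding d_def mult.assoc[symmetric] bracket_powr_cancel by simp
  have iF: "integrable lborel ?F"
    using integrable_inner_square_integrable[OF square_integrable_repr square_integrable_repr, of f g]
    by (rule integrable_of_real)
  have iH: "integrable lborel ?H"
    by (intro integrable_mult_square_integrable square_integrable_cnj) auto
  have ifg: "integrable lborel (\<lambda>y. repr f y * cnj (repr g y))" "integrable lborel (\<lambda>y. repr g y * cnj (repr f y))"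
    by (intro integrable_mult_square_integrable square_integrable_cnj; simp)+
  \<comment> \<open>The real density is the mean of \<open>f * cnj g\<close> and
    \<open>g * cnj f\<close>, each of which is accessible to \<open>fourier_product\<close>. The
    factor one half is given away.\<close>
  have FIF: "cmod (FI ?F \<xi>) \<le> cmod (FI (\<lambda>y. repr f y * cnj (repr g y)) \<xi>) + cmod (FI (\<lambda>y. repr g y * cnj (repr f y)) \<xi>)" for \<xi>
  proof -
    have e: "cis (y \<bullet> \<xi>) * ?F y = (cis (y \<bullet> \<xi>) * (repr f y * cnj (repr g y)) + cis (y \<bullet> \<xi>) * (repr g y * cnj (repr f y))) / 2" for y
    proof -
      have "?F y = (repr f y * cnj (repr g y) + repr g y * cnj (repr f y)) / 2"
        by (simp add: complex_eq_iff inner_complex_def)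
      then show ?thesis by (simp only: distrib_left times_divide_eq_right)
    qed
    have i: "integrable lborel (\<lambda>y. cis (y \<bullet> \<xi>) * h y)" if "integrable lborel h" for h :: "'a \<Rightarrow> complex"
      using fourier_integral_integrable[OF that, of "- \<xi>"] by simp
    have "FI ?F \<xi> = (FI (\<lambda>y. repr f y * cnj (repr g y)) \<xi> + FI (\<lambda>y. repr g y * cnj (repr f y)) \<xi>) / 2"
      unfolding FI_def e by (simp add: i ifg)
    moreover have "cmod ((a + b) / 2) \<le> (cmod a + cmod b) / 2" for a b by (simp add: norm_divide norm_triangle_ineq)
    ultimately have "cmod (FI ?F \<xi>) \<le> (cmod (FI (\<lambda>y. repr f y * cnj (repr g y)) \<xi>) + cmod (FI (\<lambda>y. repr g y * cnj (repr f y)) \<xi>)) / 2"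
      by (simp only:)
    also have "\<dots> \<le> cmod (FI (\<lambda>y. repr f y * cnj (repr g y)) \<xi>) + cmod (FI (\<lambda>y. repr g y * cnj (repr f y)) \<xi>)" by simp
    finally show ?thesis .
  qed
  have "cinner (hartree_term \<gamma> f g w) k = (LINT x|lborel. (LINT y|lborel. of_real (norm (x - y) powr (- \<gamma>)) * ?F y) * ?H x)"
  proof -
    have "cinner (hartree_term \<gamma> f g w) k = (LINT x|lborel. of_real (hartree_form \<gamma> f g x) * repr w x * cnj (repr k x))"
      using cinner_to_Ltwo[OF square_integrable_multiplier[OF bounded_multiplier_hartree_form[OF f g] square_integrable_repr[of w]] square_integrable_repr[of k]]
      by (simp add: hartree_term_def)
    also have "\<dots> = (LINT x|lborel. (LINT y|lborel. of_real (norm (x - y) powr (- \<gamma>)) * ?F y) * ?H x)"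
      by (rule Bochner_Integration.integral_cong) (simp_all add: hartree_form_def mult.assoc flip: of_real_mult)
    finally show ?thesis .
  qed
  also have "ennreal (cmod \<dots>) \<le> ennreal cst * (\<integral>\<^sup>+\<xi>. ennreal (norm \<xi> powr (\<gamma> - N) * (cmod (FI ?F \<xi>) * cmod (FI ?H (- \<xi>)))) \<partial>lborel)"
    by (rule riesz_pairing[OF iF iH]) (use hartree_form_abs_le[OF f g] in \<open>simp\<close>)
  also have "\<dots> \<le> ennreal cst * (quad \<gamma> (abs_fourier g) (abs_fourier f) (abs_fourier w) (abs_fourier k) + quad \<gamma> (abs_fourier f) (abs_fourier g) (abs_fourier w) (abs_fourier k))"
  proof (rule mult_left_mono)
    have "(\<integral>\<^sup>+\<xi>. ennreal (norm \<xi> powr (\<gamma> - N) * (cmod (FI ?F \<xi>) * cmod (FI ?H (- \<xi>)))) \<partial>lborel)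
       \<le> (\<integral>\<^sup>+\<xi>. ennreal (norm \<xi> powr (\<gamma> - N)) * (corr (abs_fourier g) (abs_fourier f) \<xi> * corr (abs_fourier w) (abs_fourier k) \<xi>)
          + ennreal (norm \<xi> powr (\<gamma> - N)) * (corr (abs_fourier f) (abs_fourier g) \<xi> * corr (abs_fourier w) (abs_fourier k) \<xi>) \<partial>lborel)"
    proof (rule nn_integral_mono)
      fix \<xi> :: 'a
      have 1: "ennreal (cmod (FI (\<lambda>y. repr f y * cnj (repr g y)) \<xi>)) \<le> corr (abs_fourier g) (abs_fourier f) \<xi>"
        using FI_product_le[of f g "- \<xi>"] by (simp add: corr_minus)
      have 2: "ennreal (cmod (FI (\<lambda>y. repr g y * cnj (repr f y)) \<xi>)) \<le> corr (abs_fourier f) (abs_fourier g) \<xi>"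
        using FI_product_le[of g f "- \<xi>"] by (simp add: corr_minus)
      have 3: "ennreal (cmod (FI ?H (- \<xi>))) \<le> corr (abs_fourier w) (abs_fourier k) \<xi>" by (rule FI_product_le)
      have "ennreal (cmod (FI ?F \<xi>)) \<le> ennreal (cmod (FI (\<lambda>y. repr f y * cnj (repr g y)) \<xi>)) + ennreal (cmod (FI (\<lambda>y. repr g y * cnj (repr f y)) \<xi>))"
        using ennreal_leI[OF FIF[of \<xi>]] by (simp add: ennreal_plus)
      also have "\<dots> \<le> corr (abs_fourier g) (abs_fourier f) \<xi> + corr (abs_fourier f) (abs_fourier g) \<xi>" by (intro add_mono 1 2)
      finally have "ennreal (cmod (FI ?F \<xi>)) * ennreal (cmod (FI ?H (- \<xi>))) \<le> (corr (abs_fourier g) (abs_fourier f) \<xi> + corr (abs_fourier f) (abs_fourier g) \<xi>) * corr (abs_fourier w) (abs_fourier k) \<xi>"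
        using 3 by (intro mult_mono) auto
      then have "ennreal (norm \<xi> powr (\<gamma> - N)) * (ennreal (cmod (FI ?F \<xi>)) * ennreal (cmod (FI ?H (- \<xi>))))
         \<le> ennreal (norm \<xi> powr (\<gamma> - N)) * ((corr (abs_fourier g) (abs_fourier f) \<xi> + corr (abs_fourier f) (abs_fourier g) \<xi>) * corr (abs_fourier w) (abs_fourier k) \<xi>)"
        by (rule mult_left_mono) simp
      then show "ennreal (norm \<xi> powr (\<gamma> - N) * (cmod (FI ?F \<xi>) * cmod (FI ?H (- \<xi>)))) \<le>
          ennreal (norm \<xi> powr (\<gamma> - N)) * (corr (abs_fourier g) (abs_fourier f) \<xi> * corr (abs_fourier w) (abs_fourier k) \<xi>)
          + ennreal (norm \<xi> powr (\<gamma> - N)) * (corr (abs_fourier f) (abs_fourier g) \<xi> * corr (abs_fourier w) (abs_fourier k) \<xi>)"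
        by (simp add: ennreal_mult' distrib_left distrib_right)
    qed
    also have "\<dots> = quad \<gamma> (abs_fourier g) (abs_fourier f) (abs_fourier w) (abs_fourier k) + quad \<gamma> (abs_fourier f) (abs_fourier g) (abs_fourier w) (abs_fourier k)"
      unfolding N by (subst nn_integral_add) (simp_all add: quad_corr)
    finally show "(\<integral>\<^sup>+\<xi>. ennreal (norm \<xi> powr (\<gamma> - N) * (cmod (FI ?F \<xi>) * cmod (FI ?H (- \<xi>)))) \<partial>lborel)
      \<le> quad \<gamma> (abs_fourier g) (abs_fourier f) (abs_fourier w) (abs_fourier k) + quad \<gamma> (abs_fourier f) (abs_fourier g) (abs_fourier w) (abs_fourier k)" .
  qed simp
  also have "\<dots> \<le> ennreal cst * (ennreal (3 * 3 powr s * C * (norm (weighted s g) * norm (weighted s f) * norm (weighted s w) * n)) + ennreal (3 * 3 powr s * C * (norm (weighted s f) * norm (weighted s g) * norm (weighted s w) * n)))"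
    using quad_bound[OF s sq_bound_fourier[OF g] sq_bound_fourier[OF f] sq_bound_fourier[OF w] d]
      quad_bound[OF s sq_bound_fourier[OF f] sq_bound_fourier[OF g] sq_bound_fourier[OF w] d]
    by (intro mult_left_mono add_mono) (simp_all add: dk)
  also have "\<dots> = ennreal (Kh * (norm (weighted s f) * norm (weighted s g) * norm (weighted s w) * n))"
    using n C0 cst0 by (simp add: Kh_def ennreal_plus[symmetric] ennreal_mult'[symmetric] mult_ac del: ennreal_plus)
  finally show ?thesis using Kh0 n by (subst (asm) ennreal_le_iff) auto
qed

text \<open>Duality with the term itself as test function: its transform is multiplied by
  \<open>bracket \<xi> powr (2 * s)\<close>. Membership in \<open>Sobolev s\<close> is not yet
  known, so a cut-off at radius \<open>R\<close> keeps the test function in \<open>Ltwo\<close>; the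
  bound does not depend on \<open>R\<close>, and Fatou removes the cut-off.\<close>

lemma hartree_term_Sobolev:
  fixes f g w :: "'a Ltwo"
  assumes f: "f \<in> Sobolev s" and g: "g \<in> Sobolev s" and w: "w \<in> Sobolev s"
  shows "hartree_term \<gamma> f g w \<in> Sobolev s" (is "?h \<in> _")
    and "norm (weighted s (hartree_term \<gamma> f g w)) \<le> Kh * (norm (weighted s f) * norm (weighted s g) * norm (weighted s w))" (is "_ \<le> ?M")
proof -
  have M0: "0 \<le> ?M" using Kh0 by simp
  let ?X = "repr (fourier ?h)"
  have R: "(\<integral>\<^sup>+\<xi>. ennreal (indicator (cball 0 (real R)) \<xi> * (cmod (bessel_weight s ?h \<xi>))\<^sup>2) \<partial>lborel) \<le> ennreal (?M\<^sup>2)" (is "?I \<le> _") for R :: nat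
  proof -
    \<comment> \<open>The exponent \<open>2 * s\<close> makes the pairing equal to the truncated
      square norm of order \<open>s\<close>, while the test function has order \<open>-s\<close>
      norm the square root of the same quantity.\<close>
    let ?m = "\<lambda>\<xi>::'a. complex_of_real (indicator (cball 0 (real R)) \<xi> * bracket \<xi> powr (2 * s))"
    have m: "bounded_multiplier ?m"
    proof (rule bounded_multiplierI)
      show "cmod (?m \<xi>) \<le> sqrt (1 + (real R)\<^sup>2) powr (2 * s)" for \<xi>
        using s(2) by (auto simp: indicator_def bracket_def intro!: powr_mono2 real_sqrt_le_mono power_mono)
    qed measurable
    define k where "k = ifourier (fmul ?m (fourier ?h))"
    have fk: "AE \<xi> in lborel. repr (fourier k) \<xi> = ?m \<xi> * ?X \<xi>"
      unfolding k_def fourier_ifourier by (rule AE_fmul[OF m])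
    have b2: "bracket \<xi> powr (2 * s) = bracket \<xi> powr s * bracket \<xi> powr s" for \<xi> :: 'a
      by (simp add: powr_add[symmetric])
    define g where "g \<xi> = indicator (cball 0 (real R)) \<xi> * (cmod (bessel_weight s ?h \<xi>))\<^sup>2" for \<xi>
    have gb [measurable]: "g \<in> borel_measurable borel" unfolding g_def[abs_def] by measurable
    have g_eq: "of_real (g \<xi>) = ?X \<xi> * cnj (?m \<xi> * ?X \<xi>)" for \<xi>
    proof -
      have "(cmod (bessel_weight s ?h \<xi>))\<^sup>2 = bracket \<xi> powr (2 * s) * (cmod (?X \<xi>))\<^sup>2"
        by (simp add: bessel_weight_eq norm_mult power_mult_distrib b2 power2_eq_square)
      then have "complex_of_real (g \<xi>) = ?m \<xi> * complex_of_real ((cmod (?X \<xi>))\<^sup>2)" by (simp add: g_def)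
      also have "\<dots> = ?X \<xi> * cnj (?m \<xi> * ?X \<xi>)" unfolding complex_norm_square by simp
      finally show ?thesis .
    qed
    have gi': "integrable lborel (\<lambda>\<xi>. ?X \<xi> * cnj (?m \<xi> * ?X \<xi>))"
      by (intro integrable_mult_square_integrable square_integrable_cnj square_integrable_multiplier[OF m]) auto
    have gi: "integrable lborel g"
      using gi' unfolding g_eq[symmetric] complex_of_real_integrable_eq .
    define x where "x = (LINT \<xi>|lborel. g \<xi>)"
    have x0: "0 \<le> x" unfolding x_def by (intro Bochner_Integration.integral_nonneg) (simp add: g_def)
    have gx: "?I = ennreal x"
      unfolding g_def[symmetric] x_def by (rule nn_integral_eq_integral[OF gi]) (simp add: g_def)
    have "cinner ?h k = cinner (fourier ?h) (fourier k)" by (simp add: cinner_fourier)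
    also have "\<dots> = (LINT \<xi>|lborel. ?X \<xi> * cnj (?m \<xi> * ?X \<xi>))"
      unfolding cinner_repr by (rule integral_cong_AE, measurable) (use fk in \<open>auto elim: eventually_mono\<close>)
    also have "\<dots> = of_real x" unfolding g_eq[symmetric] x_def by simp
    finally have cx: "cmod (cinner ?h k) = x" using x0 by simp
    have "sq_bound (\<lambda>\<xi>. bracket \<xi> powr (- s) * abs_fourier k \<xi>) (sqrt x)"
      unfolding sq_bound_def
    proof (intro conjI allI)
      have "(\<integral>\<^sup>+\<xi>. ennreal ((bracket \<xi> powr (- s) * abs_fourier k \<xi>)\<^sup>2) \<partial>lborel) = ?I"
      proof (rule nn_integral_cong_AE)
        show "AE \<xi> in lborel. ennreal ((bracket \<xi> powr (- s) * abs_fourier k \<xi>)\<^sup>2) = ennreal (indicator (cball 0 (real R)) \<xi> * (cmod (bessel_weight s ?h \<xi>))\<^sup>2)"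
          using fk
        proof eventually_elim
          case (elim \<xi>)
          have "bracket \<xi> powr (- s) * abs_fourier k \<xi> = indicator (cball 0 (real R)) \<xi> * (bracket \<xi> powr s * cmod (?X \<xi>)) * (bracket \<xi> powr s * bracket \<xi> powr (- s))"
            unfolding elim b2 by (simp add: norm_mult)
          also have "\<dots> = indicator (cball 0 (real R)) \<xi> * cmod (bessel_weight s ?h \<xi>)"
            unfolding bracket_powr_cancel by (simp add: bessel_weight_eq norm_mult)
          finally show ?case by (simp add: indicator_def)
        qed
      qed
      then show "(\<integral>\<^sup>+\<xi>. ennreal ((bracket \<xi> powr (- s) * abs_fourier k \<xi>)\<^sup>2) \<partial>lborel) \<le> ennreal ((sqrt x)\<^sup>2)"
        using gx x0 by simp
    qed (use x0 in simp_all)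
    \<comment> \<open>The pairing is \<open>x\<close> and the test function is measured by
      \<open>sqrt x\<close>; dividing by \<open>sqrt x\<close> closes the estimate.\<close>
    from hartree_term_pairing[OF f g w this] have "x \<le> ?M * sqrt x" unfolding cx by (simp add: mult_ac)
    have "sqrt x \<le> ?M"
    proof (cases "x = 0")
      case False
      have "sqrt x * sqrt x \<le> ?M * sqrt x" using \<open>x \<le> ?M * sqrt x\<close> x0 by simp
      moreover have "0 < sqrt x" using False x0 by simp
      ultimately show ?thesis by (rule mult_right_le_imp_le)
    qed (use M0 in simp)
    then have "x \<le> ?M\<^sup>2" using x0 power_mono[of "sqrt x" ?M 2] by simp
    then show ?thesis unfolding gx by (rule ennreal_leI)
  qed
  have "(\<integral>\<^sup>+\<xi>. ennreal ((cmod (bessel_weight s ?h \<xi>))\<^sup>2) \<partial>lborel)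
     = (\<integral>\<^sup>+\<xi>. liminf (\<lambda>R. ennreal (indicator (cball 0 (real R)) \<xi> * (cmod (bessel_weight s ?h \<xi>))\<^sup>2)) \<partial>lborel)"
  proof (rule nn_integral_cong)
    fix \<xi> :: 'a
    have "\<forall>\<^sub>F R in sequentially. ennreal (indicator (cball 0 (real R)) \<xi> * (cmod (bessel_weight s ?h \<xi>))\<^sup>2) = ennreal ((cmod (bessel_weight s ?h \<xi>))\<^sup>2)"
      using eventually_ge_at_top[of "nat \<lceil>norm \<xi>\<rceil>"]
    proof eventually_elim
      case (elim R)
      then have "norm \<xi> \<le> real R" by linarith
      then show ?case by simp
    qed
    then have "(\<lambda>R. ennreal (indicator (cball 0 (real R)) \<xi> * (cmod (bessel_weight s ?h \<xi>))\<^sup>2)) \<longlonglongrightarrow> ennreal ((cmod (bessel_weight s ?h \<xi>))\<^sup>2)"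
      by (rule tendsto_eventually)
    then show "ennreal ((cmod (bessel_weight s ?h \<xi>))\<^sup>2) = liminf (\<lambda>R. ennreal (indicator (cball 0 (real R)) \<xi> * (cmod (bessel_weight s ?h \<xi>))\<^sup>2))"
      by (rule lim_imp_Liminf[OF sequentially_bot, symmetric])
  qed
  also have "\<dots> \<le> liminf (\<lambda>R. \<integral>\<^sup>+\<xi>. ennreal (indicator (cball 0 (real R)) \<xi> * (cmod (bessel_weight s ?h \<xi>))\<^sup>2) \<partial>lborel)"
    by (rule nn_integral_liminf) measurable
  also have "\<dots> \<le> ennreal (?M\<^sup>2)"
    using R by (intro Liminf_le) (auto intro!: always_eventually)
  finally have fin: "(\<integral>\<^sup>+\<xi>. ennreal ((cmod (bessel_weight s ?h \<xi>))\<^sup>2) \<partial>lborel) \<le> ennreal (?M\<^sup>2)" .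
  then have sq: "square_integrable (bessel_weight s ?h)"
    by (intro square_integrableI_nn) (auto intro: order_le_less_trans)
  then show "?h \<in> Sobolev s" by (simp add: Sobolev_def)
  have "(norm (weighted s ?h))\<^sup>2 \<le> ?M\<^sup>2"
    using fin unfolding nn_integral_to_Ltwo[OF sq] weighted_def[symmetric] by (subst (asm) ennreal_le_iff) auto
  then show "norm (weighted s ?h) \<le> ?M" using M0 power2_le_imp_le by blast
qed

end

lemma hartree_exists:
  assumes "0 < \<gamma>" "\<gamma> < real DIM('a::euclidean_space)" "\<gamma> / 2 \<le> s" "0 \<le> s"
  shows "\<exists>\<alpha> C D. hartree TYPE('a) \<gamma> \<alpha> C (real DIM('a)) D s"
proof -
  obtain \<alpha> C where "0 \<le> C" "\<And>p z::'a. (\<integral>\<^sup>+\<xi>. ennreal (norm \<xi> powr (\<gamma> - real DIM('a)) * weight_ratio \<alpha> z (p - \<xi>) \<xi>) \<partial>lborel)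
      \<le> ennreal (C * bracket z powr \<gamma>)"
    using riesz_kernel_bound[OF assms(1,2)] by blast
  moreover obtain D where "subord TYPE('a) \<gamma> (real DIM('a)) D" using subord_exists[OF assms(1,2)] by blast
  ultimately show ?thesis using assms(3,4)
    by (intro exI[of _ \<alpha>] exI[of _ C] exI[of _ D]) (auto simp: hartree_def riesz_def hartree_axioms_def)
qed

section \<open>A Banach-valued ordinary differential equation with cubic growth\<close>

text \<open>Continuity in time is required only along continuous curves. This fits the free flow,
  which depends on time strongly continuously.\<close>

locale cubic_ode =
  fixes G :: "real \<Rightarrow> 'b::banach \<Rightarrow> 'b" and K :: real
  assumes K0: "0 \<le> K" and G0: "\<And>t. G t 0 = 0"
    and lip: "\<And>t a b. norm (G t a - G t b) \<le> K * (norm a + norm b)\<^sup>2 * norm (a - b)"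
    and cont: "\<And>T a. continuous_on {0..T} a \<Longrightarrow> continuous_on {0..T} (\<lambda>t. G t (a t))"
begin

lemma lip_ball:
  assumes "norm a \<le> B" "norm b \<le> B" shows "norm (G t a - G t b) \<le> K * (2 * B)\<^sup>2 * norm (a - b)"
proof -
  have "(norm a + norm b)\<^sup>2 \<le> (2 * B)\<^sup>2" using assms by (intro power_mono) auto
  then have "K * (norm a + norm b)\<^sup>2 * norm (a - b) \<le> K * (2 * B)\<^sup>2 * norm (a - b)"
    using K0 by (intro mult_right_mono mult_left_mono) auto
  with lip[of t a b] show ?thesis by linarith
qed

lemma existence:
  fixes a0 :: 'b
  shows "\<exists>T>0. \<exists>a. continuous_on {0..T} a \<and> (\<forall>t\<in>{0..T}. norm (a t) \<le> 2 * norm a0) \<and>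
    (\<forall>t\<in>{0..T}. a t = a0 + integral {0..t} (\<lambda>\<tau>. G \<tau> (a \<tau>)))"
proof -
  define B where "B = 2 * norm a0"
  define L where "L = K * (2 * B)\<^sup>2"
  \<comment> \<open>\<open>L * T \<le> 1 / 2\<close> makes the Picard map a contraction with factor
    one half. It also preserves the ball, as the integral contributes at most \<open>B / 2\<close>
    and the datum exactly \<open>B / 2\<close>. The added 1 avoids division by zero.\<close>
  define T where "T = 1 / (2 * (L + 1))"
  have B0: "0 \<le> B" by (simp add: B_def)
  have L0: "0 \<le> L" using K0 by (simp add: L_def)
  have T0: "0 < T" using L0 by (simp add: T_def)
  have LT: "L * T \<le> 1 / 2" using L0 by (simp add: T_def field_simps)
  \<comment> \<open>Bounded continuous functions live on the whole line, so time is clamped to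
    \<open>{0..T}\<close>; on that interval the clamped equation is the original one.\<close>
  define cl where "cl t = max 0 (min t T)" for t :: real
  have cl: "cl t \<in> {0..T}" for t using T0 by (simp add: cl_def)
  have cl_id: "cl t = t" if "t \<in> {0..T}" for t using that by (simp add: cl_def)
  have cont_f: "continuous_on {0..t} (\<lambda>\<tau>. G \<tau> (apply_bcontfun f \<tau>))" for f t
    by (intro cont continuous_on_apply_bcontfun continuous_on_id)
  define P where "P f t = a0 + integral {0..cl t} (\<lambda>\<tau>. G \<tau> (apply_bcontfun f \<tau>))" for f t
  define S where "S = {f :: real \<Rightarrow>\<^sub>C 'b. \<forall>t. norm (apply_bcontfun f t) \<le> B}"
  have P_diff: "norm (P f t - P g t) \<le> 1 / 2 * dist f g" if "f \<in> S" "g \<in> S" for f g t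
  proof -
    have "P f t - P g t = integral {0..cl t} (\<lambda>\<tau>. G \<tau> (apply_bcontfun f \<tau>) - G \<tau> (apply_bcontfun g \<tau>))"
      unfolding P_def by (subst integral_diff) (auto intro!: integrable_continuous_real cont_f)
    also have "norm \<dots> \<le> (L * dist f g) * (cl t - 0)"
    proof (rule integral_bound)
      fix \<tau> assume "\<tau> \<in> {0..cl t}"
      have "norm (G \<tau> (apply_bcontfun f \<tau>) - G \<tau> (apply_bcontfun g \<tau>)) \<le> L * norm (apply_bcontfun f \<tau> - apply_bcontfun g \<tau>)"
        unfolding L_def using that by (intro lip_ball) (auto simp: S_def)
      also have "\<dots> \<le> L * dist f g" using dist_bounded[of f \<tau> g] L0 by (intro mult_left_mono) (auto simp: dist_norm)
      finally show "norm (G \<tau> (apply_bcontfun f \<tau>) - G \<tau> (apply_bcontfun g \<tau>)) \<le> L * dist f g" .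
    qed (use cl[of t] in \<open>auto intro!: continuous_on_diff cont_f\<close>)
    also have "\<dots> \<le> (L * dist f g) * T" using cl[of t] L0 by (intro mult_left_mono) auto
    also have "\<dots> \<le> 1 / 2 * dist f g" using mult_right_mono[OF LT, of "dist f g"] by (simp add: mult_ac)
    finally show ?thesis .
  qed
  have zero_S: "0 \<in> S" using B0 by (simp add: S_def)
  have P_bound: "norm (P f t) \<le> B" if "f \<in> S" for f t
  proof -
    have "norm (integral {0..cl t} (\<lambda>\<tau>. G \<tau> (apply_bcontfun f \<tau>))) \<le> (L * B) * (cl t - 0)"
    proof (rule integral_bound)
      fix \<tau> assume "\<tau> \<in> {0..cl t}"
      have "norm (G \<tau> (apply_bcontfun f \<tau>) - G \<tau> 0) \<le> L * norm (apply_bcontfun f \<tau> - 0)"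
        unfolding L_def using that B0 by (intro lip_ball) (auto simp: S_def)
      also have "\<dots> \<le> L * B" using that L0 by (intro mult_left_mono) (auto simp: S_def)
      finally show "norm (G \<tau> (apply_bcontfun f \<tau>)) \<le> L * B" by (simp add: G0)
    qed (use cl[of t] in \<open>auto intro!: cont_f\<close>)
    also have "\<dots> \<le> (L * B) * T" using cl[of t] L0 B0 by (intro mult_left_mono) auto
    also have "\<dots> \<le> B / 2" using mult_right_mono[OF LT B0] by (simp add: mult_ac)
    finally show ?thesis unfolding P_def using norm_triangle_ineq[of a0 "integral {0..cl t} (\<lambda>\<tau>. G \<tau> (apply_bcontfun f \<tau>))"]
      by (simp add: B_def)
  qed
  have P_cont: "continuous_on UNIV (P f)" for f
  proof -
    have "continuous_on {0..T} (\<lambda>u. integral {0..u} (\<lambda>\<tau>. G \<tau> (apply_bcontfun f \<tau>)))"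
      by (intro indefinite_integral_continuous_1 integrable_continuous_real cont_f)
    moreover have "continuous_on UNIV cl" unfolding cl_def[abs_def] by (intro continuous_intros)
    ultimately have "continuous_on UNIV (\<lambda>t. integral {0..cl t} (\<lambda>\<tau>. G \<tau> (apply_bcontfun f \<tau>)))"
      by (rule continuous_on_compose2) (use cl in auto)
    then show ?thesis unfolding P_def[abs_def] by (intro continuous_intros)
  qed
  have P_bc: "P f \<in> bcontfun" if "f \<in> S" for f
    using P_cont P_bound[OF that] by (intro bcontfun_normI)
  have ap: "apply_bcontfun (Bcontfun (P f)) = P f" if "f \<in> S" for f
    using P_bc[OF that] by (rule Bcontfun_inverse)
  have "\<exists>!f\<in>S. Bcontfun (P f) = f"
  proof (rule Banach_fix)
    have "closed S"
    proof -
      have "S = (\<Inter>t. (\<lambda>f. apply_bcontfun f t) -` cball 0 B)" by (auto simp: S_def)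
      moreover have "closed ((\<lambda>f. apply_bcontfun f t) -` cball (0::'b) B)" for t :: real
      proof (rule continuous_closed_vimage)
        fix f :: "real \<Rightarrow>\<^sub>C 'b"
        show "isCont (\<lambda>f. apply_bcontfun f t) f"
          unfolding continuous_at_eps_delta
        proof (intro allI impI)
          fix e :: real assume "0 < e"
          then show "\<exists>d>0. \<forall>x'. dist x' f < d \<longrightarrow> dist (apply_bcontfun x' t) (apply_bcontfun f t) < e"
            using dist_bounded[of _ t f] by (intro exI[of _ e]) (auto intro: order_le_less_trans)
        qed
      qed simp
      ultimately show ?thesis by auto
    qed
    then show "Topological_Spaces.complete S" by (simp add: complete_eq_closed)
    show "S \<noteq> {}" using zero_S by auto
    show "(\<lambda>f. Bcontfun (P f)) ` S \<subseteq> S"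
      using P_bound ap by (auto simp: S_def)
    show "dist (Bcontfun (P f)) (Bcontfun (P g)) \<le> 1 / 2 * dist f g" if "f \<in> S" "g \<in> S" for f g
      by (rule dist_bound) (use that P_diff ap in \<open>simp add: dist_norm\<close>)
  qed simp_all
  then obtain f where f: "f \<in> S" "Bcontfun (P f) = f" by auto
  have fP: "apply_bcontfun f t = P f t" for t using ap[OF f(1)] unfolding f(2) by simp
  show ?thesis
  proof (intro exI[of _ T] exI[of _ "apply_bcontfun f"] conjI ballI T0)
    show "continuous_on {0..T} (apply_bcontfun f)" by (intro continuous_on_apply_bcontfun continuous_on_id)
    show "norm (apply_bcontfun f t) \<le> 2 * norm a0" for t using f(1) by (simp add: S_def B_def)
    show "apply_bcontfun f t = a0 + integral {0..t} (\<lambda>\<tau>. G \<tau> (apply_bcontfun f \<tau>))" if "t \<in> {0..T}" for t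
      using fP[of t] unfolding P_def cl_id[OF that] .
  qed
qed

text \<open>Any two continuous solutions are bounded on the compact interval, hence subject to a
  common Lipschitz constant. The exponential weight replaces a smallness condition on
  \<open>T\<close>.\<close>

lemma uniqueness:
  fixes a b :: "real \<Rightarrow> 'b"
  assumes ca: "continuous_on {0..T} a" and cb: "continuous_on {0..T} b"
    and a: "\<And>t. t \<in> {0..T} \<Longrightarrow> a t = a0 + integral {0..t} (\<lambda>\<tau>. G \<tau> (a \<tau>))"
    and b: "\<And>t. t \<in> {0..T} \<Longrightarrow> b t = a0 + integral {0..t} (\<lambda>\<tau>. G \<tau> (b \<tau>))"
    and t: "t \<in> {0..T}"
  shows "a t = b t"
proof -
  have T0: "0 \<le> T" using t by simp
  have "bounded (a ` {0..T})" "bounded (b ` {0..T})"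
    by (intro compact_imp_bounded compact_continuous_image ca cb compact_Icc)+
  then obtain A' B' where "\<And>t. t \<in> {0..T} \<Longrightarrow> norm (a t) \<le> A'" "\<And>t. t \<in> {0..T} \<Longrightarrow> norm (b t) \<le> B'"
    unfolding bounded_iff by blast
  then have B: "\<And>t. t \<in> {0..T} \<Longrightarrow> norm (a t) \<le> max A' B'" "\<And>t. t \<in> {0..T} \<Longrightarrow> norm (b t) \<le> max A' B'"
    by (meson max.coboundedI1 max.coboundedI2)+
  define L where "L = K * (2 * max A' B')\<^sup>2 + 1"
  have L0: "0 < L" using K0 by (simp add: L_def add_nonneg_pos)
  have G_le: "norm (G \<tau> (a \<tau>) - G \<tau> (b \<tau>)) \<le> L * norm (a \<tau> - b \<tau>)" if "\<tau> \<in> {0..T}" for \<tau>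
  proof -
    have "norm (G \<tau> (a \<tau>) - G \<tau> (b \<tau>)) \<le> K * (2 * max A' B')\<^sup>2 * norm (a \<tau> - b \<tau>)"
      using that by (intro lip_ball B)
    then show ?thesis by (simp add: L_def distrib_right add_increasing2)
  qed
  \<comment> \<open>With rate \<open>2 * L\<close> the integral of
    \<open>L * exp (2 * L * \<tau>)\<close> is at most half of the exponential at the endpoint, so
    the maximum \<open>m\<close> satisfies \<open>m \<le> m / 2\<close>.\<close>
  let ?w = "\<lambda>t. exp (- (2 * L * t)) * norm (a t - b t)"
  have "\<exists>t0\<in>{0..T}. \<forall>t\<in>{0..T}. ?w t \<le> ?w t0"
    using T0 by (intro continuous_attains_sup compact_Icc continuous_intros ca cb) auto
  then obtain t0 where t0: "t0 \<in> {0..T}" and max: "\<And>t. t \<in> {0..T} \<Longrightarrow> ?w t \<le> ?w t0" by blast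
  define m where "m = ?w t0"
  have m0: "0 \<le> m" by (simp add: m_def)
  have le: "norm (a \<tau> - b \<tau>) \<le> m * exp (2 * L * \<tau>)" if "\<tau> \<in> {0..T}" for \<tau>
    using max[OF that] unfolding m_def[symmetric] by (simp add: exp_minus field_simps)
  have sub: "{0..t0} \<subseteq> {0..T}" using t0 by auto
  have ia: "(\<lambda>\<tau>. G \<tau> (a \<tau>)) integrable_on {0..t0}" "(\<lambda>\<tau>. G \<tau> (b \<tau>)) integrable_on {0..t0}"
    by (intro integrable_continuous_real continuous_on_subset[OF cont sub] ca cb)+
  have I: "((\<lambda>\<tau>. m * L * exp (2 * L * \<tau>)) has_integral (m / 2 * exp (2 * L * t0) - m / 2 * exp (2 * L * 0))) {0..t0}"
    using t0 L0 by (intro fundamental_theorem_of_calculus)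
      (auto simp: has_real_derivative_iff_has_vector_derivative[symmetric] intro!: derivative_eq_intros)
  have "norm (a t0 - b t0) = norm (integral {0..t0} (\<lambda>\<tau>. G \<tau> (a \<tau>) - G \<tau> (b \<tau>)))"
    using a[OF t0] b[OF t0] by (simp add: integral_diff ia)
  also have "\<dots> \<le> integral {0..t0} (\<lambda>\<tau>. m * L * exp (2 * L * \<tau>))"
  proof (rule integral_norm_bound_integral)
    show "norm (G \<tau> (a \<tau>) - G \<tau> (b \<tau>)) \<le> m * L * exp (2 * L * \<tau>)" if "\<tau> \<in> {0..t0}" for \<tau>
    proof -
      have "\<tau> \<in> {0..T}" using that sub by auto
      then have "L * norm (a \<tau> - b \<tau>) \<le> L * (m * exp (2 * L * \<tau>))" using L0 by (intro mult_left_mono le) auto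
      with G_le[OF \<open>\<tau> \<in> {0..T}\<close>] show ?thesis by (simp add: mult_ac)
    qed
    show "(\<lambda>\<tau>. m * L * exp (2 * L * \<tau>)) integrable_on {0..t0}" using I by blast
  qed (intro integrable_diff ia)
  also have "\<dots> = m / 2 * exp (2 * L * t0) - m / 2" using integral_unique[OF I] by simp
  also have "\<dots> \<le> m / 2 * exp (2 * L * t0)" using m0 by simp
  finally have "m \<le> exp (- (2 * L * t0)) * (m / 2 * exp (2 * L * t0))"
    unfolding m_def by (intro mult_left_mono) auto
  then have "m \<le> m / 2" by (simp add: exp_minus field_simps)
  then have "m \<le> 0" by simp
  with m0 have "m = 0" by simp
  then show ?thesis using le[OF t] by simp
qed

end

section \<open>The interaction picture\<close>

lemma Sobolev_add: "u \<in> Sobolev s \<Longrightarrow> v \<in> Sobolev s \<Longrightarrow> 0 \<le> s \<Longrightarrow> u + v \<in> Sobolev s"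
  using unweighted_in_Sobolev[of s "weighted s u + weighted s v"] by (simp add: unweighted_add unweighted_weighted)

lemma Sobolev_diff: "u \<in> Sobolev s \<Longrightarrow> v \<in> Sobolev s \<Longrightarrow> 0 \<le> s \<Longrightarrow> u - v \<in> Sobolev s"
  using unweighted_in_Sobolev[of s "weighted s u - weighted s v"] by (simp add: unweighted_diff unweighted_weighted)

lemma weighted_add: "u \<in> Sobolev s \<Longrightarrow> v \<in> Sobolev s \<Longrightarrow> 0 \<le> s \<Longrightarrow> weighted s (u + v) = weighted s u + weighted s v"
  using weighted_unweighted[of s "weighted s u + weighted s v"] by (simp add: unweighted_add unweighted_weighted del: weighted_unweighted)

lemma weighted_diff: "u \<in> Sobolev s \<Longrightarrow> v \<in> Sobolev s \<Longrightarrow> 0 \<le> s \<Longrightarrow> weighted s (u - v) = weighted s u - weighted s v"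
  using weighted_unweighted[of s "weighted s u - weighted s v"] by (simp add: unweighted_diff unweighted_weighted del: weighted_unweighted)

lemma unweighted_scaleC: "0 \<le> s \<Longrightarrow> unweighted s (scaleC c a) = scaleC c (unweighted s a)"
  by (simp add: unweighted_def fmul_scaleC bounded_multiplier_bracket ifourier_scaleC)

section \<open>The free flow on the Fourier side\<close>

definition flow :: "real \<Rightarrow> 'a::euclidean_space Ltwo \<Rightarrow> 'a Ltwo" where
  "flow t = fmul (\<lambda>\<xi>. cis (t * (norm \<xi>)\<^sup>2))"

lemma bounded_multiplier_flow: "bounded_multiplier (\<lambda>\<xi>. cis (t * (norm \<xi>)\<^sup>2))"
  by (rule bounded_multiplierI[where B = 1]) auto

lemma norm_flow [simp]: "norm (flow t a) = norm a"
  unfolding flow_def by (rule norm_fmul_eq) auto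

lemma flow_flow [simp]: "flow t (flow r a) = flow (t + r) a"
  by (simp add: flow_def fmul_fmul bounded_multiplier_flow cis_mult distrib_right)

lemma flow_0 [simp]: "flow 0 a = a"
  by (simp add: flow_def)

lemma flow_scaleC: "flow t (scaleC c a) = scaleC c (flow t a)"
  by (simp add: flow_def fmul_scaleC bounded_multiplier_flow)

lemma bounded_linear_flow: "bounded_linear (flow t)"
  unfolding flow_def by (rule bounded_linear_fmul[OF bounded_multiplier_flow])

lemma flow_diff: "flow t (a - b) = flow t a - flow t b"
  by (rule linear_diff[OF bounded_linear.linear[OF bounded_linear_flow]])

lemma flow_add: "flow t (a + b) = flow t a + flow t b"
  by (rule linear_add[OF bounded_linear.linear[OF bounded_linear_flow]])

lemma flow_zero [simp]: "flow t 0 = 0"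
  by (rule linear_0[OF bounded_linear.linear[OF bounded_linear_flow]])

lemma scaleC_zero [simp]: "scaleC c 0 = 0"
  by (rule linear_0[OF bounded_linear.linear[OF bounded_linear_scaleC]])

text \<open>Strong continuity at the fixed limit \<open>b\<close>, together with the isometry
  property for the error \<open>a n - b\<close>.\<close>

lemma flow_LIMSEQ:
  assumes "t \<longlonglongrightarrow> r" "a \<longlonglongrightarrow> b" shows "(\<lambda>n. flow (t n) (a n)) \<longlonglongrightarrow> flow r b"
proof -
  have "(\<lambda>n. flow (t n) b) \<longlonglongrightarrow> flow r b"
    unfolding flow_def by (rule fmul_tendsto[where B = 1]) (auto intro!: tendsto_intros assms)
  moreover have "(\<lambda>n. flow (t n) (a n - b)) \<longlonglongrightarrow> 0"
    using assms(2) by (simp add: LIM_zero tendsto_norm_zero_iff[symmetric, of "\<lambda>n. flow (t n) (a n - b)"] tendsto_norm_zero)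
  ultimately show ?thesis using tendsto_add[of "\<lambda>n. flow (t n) b" "flow r b" sequentially "\<lambda>n. flow (t n) (a n - b)" 0]
    by (simp add: flow_diff)
qed

lemma continuous_on_flow:
  fixes f :: "real \<Rightarrow> real"
  assumes "continuous_on S f" "continuous_on S a" shows "continuous_on S (\<lambda>t. flow (f t) (a t))"
  using assms unfolding continuous_on_sequentially by (auto simp: o_def intro!: flow_LIMSEQ)

lemma propagator_eq: "propagator t u = ifourier (flow t (fourier u))"
  by (simp add: propagator_def inv_fourier flow_def fmul_def)

lemma propagator_unweighted: "0 \<le> s \<Longrightarrow> propagator t (unweighted s a) = unweighted s (flow t a)"
  by (simp add: propagator_eq unweighted_def fourier_ifourier flow_def fmul_fmul bounded_multiplier_flow bounded_multiplier_bracket mult.commute)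

section \<open>Local Lipschitz estimate for the cubic terms\<close>

context hartree
begin

text \<open>Polarisation: the real inner product of \<open>u - v\<close> and \<open>u + v\<close> is
  the difference of the squared moduli.\<close>

lemma hartree_form_diff:
  fixes u v :: "'a Ltwo"
  assumes u: "u \<in> Sobolev s" and v: "v \<in> Sobolev s"
  shows "hartree_form \<gamma> (u - v) (u + v) x = hartree_form \<gamma> u u x - hartree_form \<gamma> v v x"
proof -
  have "hartree_form \<gamma> (u - v) (u + v) x = (LINT y|lborel. norm (x - y) powr (- \<gamma>) * (repr u y \<bullet> repr u y) - norm (x - y) powr (- \<gamma>) * (repr v y \<bullet> repr v y))"
    unfolding hartree_form_def
  proof (rule integral_cong_AE)
    show "AE y in lborel. norm (x - y) powr (- \<gamma>) * (repr (u - v) y \<bullet> repr (u + v) y)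
      = norm (x - y) powr (- \<gamma>) * (repr u y \<bullet> repr u y) - norm (x - y) powr (- \<gamma>) * (repr v y \<bullet> repr v y)"
      using AE_plus_Ltwo[of u v] AE_minus_Ltwo[of u v]
    proof eventually_elim
      case (elim y)
      have "(a - b) \<bullet> (a + b) = a \<bullet> a - b \<bullet> b" for a b :: complex
        by (simp only: inner_diff_left inner_add_right) (simp add: inner_commute)
      then show ?case unfolding elim by (simp only: right_diff_distrib)
    qed
  qed measurable
  also have "\<dots> = hartree_form \<gamma> u u x - hartree_form \<gamma> v v x"
    unfolding hartree_form_def by (rule Bochner_Integration.integral_diff) (intro hartree_form_integrable assms)+
  finally show ?thesis .
qed

lemma square_integrable_hartree_term:
  fixes f g w :: "'a Ltwo"
  assumes "f \<in> Sobolev s" "g \<in> Sobolev s"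
  shows "square_integrable (\<lambda>x. of_real (hartree_form \<gamma> f g x) * repr w x)"
  by (rule square_integrable_multiplier[OF bounded_multiplier_hartree_form[OF assms]]) simp

lemma AE_hartree_term:
  fixes f g w :: "'a Ltwo"
  assumes "f \<in> Sobolev s" "g \<in> Sobolev s"
  shows "AE x in lborel. repr (hartree_term \<gamma> f g w) x = of_real (hartree_form \<gamma> f g x) * repr w x"
  unfolding hartree_term_def by (rule AE_repr_to_Ltwo[OF square_integrable_hartree_term[OF assms]])

text \<open>The product is telescoped, first in the potential and then in the last factor, so that
  every summand contains \<open>u - v\<close> and remains of the form
  \<open>hartree_term\<close>.\<close>

lemma hartree_term_diff:
  fixes u v :: "'a Ltwo"
  assumes u: "u \<in> Sobolev s" and v: "v \<in> Sobolev s"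
  shows "hartree_term \<gamma> u u u - hartree_term \<gamma> v v v = hartree_term \<gamma> (u - v) (u + v) u + hartree_term \<gamma> v v (u - v)"
proof -
  note uv = Sobolev_add[OF u v s(2)] Sobolev_diff[OF u v s(2)]
  show ?thesis unfolding Ltwo_eq_iff
    using AE_minus_Ltwo[of "hartree_term \<gamma> u u u" "hartree_term \<gamma> v v v"] AE_plus_Ltwo[of "hartree_term \<gamma> (u - v) (u + v) u" "hartree_term \<gamma> v v (u - v)"]
      AE_hartree_term[OF u u, of u] AE_hartree_term[OF v v, of v] AE_hartree_term[OF uv(2,1), of u] AE_hartree_term[OF v v, of "u - v"] AE_minus_Ltwo[of u v]
    by eventually_elim (simp add: hartree_form_diff[OF u v], simp add: algebra_simps)
qed

lemma hartree_term_lipschitz: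
  fixes u v :: "'a Ltwo"
  assumes u: "u \<in> Sobolev s" and v: "v \<in> Sobolev s"
  shows "norm (weighted s (hartree_term \<gamma> u u u) - weighted s (hartree_term \<gamma> v v v))
    \<le> Kh * (norm (weighted s u) + norm (weighted s v))\<^sup>2 * norm (weighted s u - weighted s v)"
proof -
  note uv = Sobolev_add[OF u v s(2)] Sobolev_diff[OF u v s(2)]
  let ?a = "weighted s u" and ?b = "weighted s v"
  have "weighted s (hartree_term \<gamma> u u u) - weighted s (hartree_term \<gamma> v v v) = weighted s (hartree_term \<gamma> (u - v) (u + v) u) + weighted s (hartree_term \<gamma> v v (u - v))"
    using hartree_term_diff[OF u v] by (simp add: weighted_diff[symmetric] weighted_add[symmetric] hartree_term_Sobolev u v uv s)
  also have "norm \<dots> \<le> Kh * (norm (?a - ?b) * norm (?a + ?b) * norm ?a) + Kh * (norm ?b * norm ?b * norm (?a - ?b))"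
    using hartree_term_Sobolev(2)[OF uv(2,1) u] hartree_term_Sobolev(2)[OF v v uv(2)] u v s(2)
    by (intro norm_triangle_le add_mono) (simp_all add: weighted_diff weighted_add)
  also have "\<dots> \<le> Kh * (norm (?a - ?b) * (norm ?a + norm ?b) * norm ?a) + Kh * (norm ?b * norm ?b * norm (?a - ?b))"
    using Kh0 by (intro add_mono mult_left_mono mult_right_mono norm_triangle_ineq) auto
  also have "\<dots> = Kh * norm (?a - ?b) * ((norm ?a + norm ?b) * norm ?a + norm ?b * norm ?b)" by (simp add: algebra_simps)
  also have "\<dots> \<le> Kh * norm (?a - ?b) * (norm ?a + norm ?b)\<^sup>2"
    using Kh0 by (intro mult_left_mono) (auto simp: power2_eq_square algebra_simps)
  finally show ?thesis by (simp add: mult_ac)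
qed

end

locale nls = h1: hartree \<gamma>1 \<alpha>1 C1 N D1 dim_type s + h2: hartree \<gamma>2 \<alpha>2 C2 N D2 dim_type s
  for \<gamma>1 \<alpha>1 C1 D1 \<gamma>2 \<alpha>2 C2 D2 N s :: real and dim_type :: "'a::euclidean_space itself"
begin

lemma s0: "0 \<le> s" using h1.s by simp

lemma nonlinearity_eq:
  fixes u :: "'a Ltwo"
  assumes u: "u \<in> Sobolev s"
  shows "nonlinearity \<gamma>1 \<gamma>2 u = hartree_term \<gamma>1 u u u - hartree_term \<gamma>2 u u u"
  unfolding nonlinearity_def hartree_potential_eq hartree_term_def
  by (rule to_Ltwo_diff) (intro h1.square_integrable_hartree_term h2.square_integrable_hartree_term u)+

text \<open>The nonlinearity transported to weighted Fourier coordinates, where it is a locally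
  Lipschitz map of \<open>Ltwo\<close> into itself.\<close>

definition Ns :: "'a Ltwo \<Rightarrow> 'a Ltwo" where
  "Ns a = weighted s (nonlinearity \<gamma>1 \<gamma>2 (unweighted s a))"

lemma nonlinearity_Sobolev:
  fixes u :: "'a Ltwo"
  assumes u: "u \<in> Sobolev s" shows "nonlinearity \<gamma>1 \<gamma>2 u \<in> Sobolev s"
  unfolding nonlinearity_eq[OF u] by (intro Sobolev_diff h1.hartree_term_Sobolev h2.hartree_term_Sobolev u s0)

lemma unweighted_Ns: "unweighted s (Ns a) = nonlinearity \<gamma>1 \<gamma>2 (unweighted s a)"
  unfolding Ns_def by (intro unweighted_weighted nonlinearity_Sobolev unweighted_in_Sobolev s0)

lemma Ns_lipschitz: "norm (Ns a - Ns b) \<le> (h1.Kh + h2.Kh) * (norm a + norm b)\<^sup>2 * norm (a - b)"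
proof -
  note e = unweighted_in_Sobolev[OF s0]
  let ?h = "\<lambda>\<gamma> a. weighted s (hartree_term \<gamma> (unweighted s a) (unweighted s a) (unweighted s a))"
  have eq: "Ns a = ?h \<gamma>1 a - ?h \<gamma>2 a" for a
    unfolding Ns_def nonlinearity_eq[OF e] by (intro weighted_diff h1.hartree_term_Sobolev h2.hartree_term_Sobolev e s0)
  have "norm (Ns a - Ns b) = norm ((?h \<gamma>1 a - ?h \<gamma>1 b) - (?h \<gamma>2 a - ?h \<gamma>2 b))"
    unfolding eq by (rule arg_cong[where f = norm]) simp
  also have "\<dots> \<le> norm (?h \<gamma>1 a - ?h \<gamma>1 b) + norm (?h \<gamma>2 a - ?h \<gamma>2 b)" by (rule norm_triangle_ineq4)
  also have "\<dots> \<le> h1.Kh * (norm a + norm b)\<^sup>2 * norm (a - b) + h2.Kh * (norm a + norm b)\<^sup>2 * norm (a - b)"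
    using h1.hartree_term_lipschitz[OF e e, of a b] h2.hartree_term_lipschitz[OF e e, of a b] by (simp add: s0)
  finally show ?thesis by (simp add: distrib_right)
qed

lemma Ns_0: "Ns 0 = 0"
proof -
  note e = unweighted_in_Sobolev[OF s0, of 0]
  have "weighted s (hartree_term \<gamma>1 (unweighted s 0) (unweighted s 0) (unweighted s (0 :: 'a Ltwo))) = 0" "weighted s (hartree_term \<gamma>2 (unweighted s 0) (unweighted s 0) (unweighted s (0 :: 'a Ltwo))) = 0"
    using h1.hartree_term_Sobolev(2)[OF e e e] h2.hartree_term_Sobolev(2)[OF e e e] by (simp_all add: s0)
  moreover have "Ns 0 = weighted s (hartree_term \<gamma>1 (unweighted s 0) (unweighted s 0) (unweighted s 0)) - weighted s (hartree_term \<gamma>2 (unweighted s 0) (unweighted s 0) (unweighted s 0))"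
    unfolding Ns_def nonlinearity_eq[OF e] by (intro weighted_diff h1.hartree_term_Sobolev h2.hartree_term_Sobolev e s0)
  ultimately show ?thesis by simp
qed

lemma Ns_cont: "isCont Ns a"
proof -
  have "((\<lambda>b. (h1.Kh + h2.Kh) * (norm b + norm a)\<^sup>2 * norm (b - a)) \<longlongrightarrow> (h1.Kh + h2.Kh) * (norm a + norm a)\<^sup>2 * norm (a - a)) (at a)"
    by (intro tendsto_intros)
  then have lim: "((\<lambda>b. (h1.Kh + h2.Kh) * (norm b + norm a)\<^sup>2 * norm (b - a)) \<longlongrightarrow> 0) (at a)"
    by (simp only: diff_self norm_zero mult_zero_right)
  have "((\<lambda>b. Ns b - Ns a) \<longlongrightarrow> 0) (at a)"
    by (rule Lim_null_comparison[OF always_eventually lim]) (intro allI Ns_lipschitz)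
  then show ?thesis unfolding isCont_def by (rule LIM_zero_cancel)
qed

text \<open>Right-hand side of the interaction picture: in Duhamel's formula \<open>flow t\<close>
  is pulled out, which leaves \<open>flow (- \<tau>)\<close> in front of the nonlinearity and the
  factor \<open>- \<i>\<close>.\<close>

definition G :: "real \<Rightarrow> 'a Ltwo \<Rightarrow> 'a Ltwo" where
  "G t a = scaleC (- \<i>) (flow (- t) (Ns (flow t a)))"

lemma continuous_on_Ns: "continuous_on S f \<Longrightarrow> continuous_on S (\<lambda>t. Ns (f t))"
  by (rule continuous_on_compose2[of UNIV]) (auto simp: Ns_cont continuous_at_imp_continuous_on)

sublocale ode: cubic_ode G "h1.Kh + h2.Kh"
proof
  show "0 \<le> h1.Kh + h2.Kh" using h1.Kh0 h2.Kh0 by simp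
  show "G t 0 = 0" for t
    by (simp add: G_def Ns_0 flow_zero scaleC_zero)
  show "norm (G t a - G t b) \<le> (h1.Kh + h2.Kh) * (norm a + norm b)\<^sup>2 * norm (a - b)" for t a b
  proof -
    have "G t a - G t b = scaleC (- \<i>) (flow (- t) (Ns (flow t a) - Ns (flow t b)))"
      unfolding G_def flow_diff by (rule linear_diff[OF bounded_linear.linear[OF bounded_linear_scaleC], symmetric])
    then show ?thesis
      using Ns_lipschitz[of "flow t a" "flow t b"] by (simp add: norm_scaleC flow_diff[symmetric])
  qed
  show "continuous_on {0..T} (\<lambda>t. G t (a t))" if "continuous_on {0..T} a" for T a
    unfolding G_def using that
    by (intro bounded_linear.continuous_on[OF bounded_linear_scaleC] continuous_on_flow continuous_on_Ns continuous_intros)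
qed

text \<open>Picard's integral is taken in weighted Fourier coordinates, Duhamel's in
  \<open>Ltwo\<close> itself. A bounded linear map carries one into the other together with its
  integrability, and injectivity of \<open>unweighted\<close> and of the flow gives both
  directions.\<close>

lemma duhamel_iff:
  fixes \<psi> :: "real \<Rightarrow> 'a Ltwo"
  assumes a: "continuous_on {0..T} a" and \<psi>: "\<And>t. t \<in> {0..T} \<Longrightarrow> \<psi> t = unweighted s (flow t (a t))"
  shows "duhamel_solution \<gamma>1 \<gamma>2 s (unweighted s a0) T \<psi> \<longleftrightarrow> (\<forall>t\<in>{0..T}. a t = a0 + integral {0..t} (\<lambda>\<tau>. G \<tau> (a \<tau>)))"
proof -
  have cs: "continuous_in_Sobolev s T \<psi>"
    unfolding continuous_in_Sobolev_def
  proof (intro ballI conjI)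
    fix t assume t: "t \<in> {0..T}"
    show "\<psi> t \<in> Sobolev s" unfolding \<psi>[OF t] by (rule unweighted_in_Sobolev[OF s0])
    have "continuous_on {0..T} (\<lambda>r. flow r (a r))" by (intro continuous_on_flow continuous_intros a)
    then have "((\<lambda>r. flow r (a r)) \<longlongrightarrow> flow t (a t)) (at t within {0..T})" using t by (simp add: continuous_on_def)
    then have "((\<lambda>r. norm (flow r (a r) - flow t (a t))) \<longlongrightarrow> 0) (at t within {0..T})"
      by (intro tendsto_norm_zero LIM_zero)
    then show "((\<lambda>r. Sobolev_norm s (\<psi> r - \<psi> t)) \<longlongrightarrow> 0) (at t within {0..T})"
    proof (rule Lim_transform_eventually)
      show "\<forall>\<^sub>F r in at t within {0..T}. norm (flow r (a r) - flow t (a t)) = Sobolev_norm s (\<psi> r - \<psi> t)"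
        unfolding eventually_at_filter
        by (intro always_eventually allI impI)
          (simp add: \<psi> t unweighted_diff[symmetric] s0 Sobolev_norm_eq unweighted_in_Sobolev del: atLeastAtMost_iff)
    qed
  qed
  have "((\<lambda>t'. propagator (t - t') (nonlinearity \<gamma>1 \<gamma>2 (\<psi> t'))) integrable_on {0..t} \<and>
        \<psi> t = propagator t (unweighted s a0) - scaleC \<i> (integral {0..t} (\<lambda>t'. propagator (t - t') (nonlinearity \<gamma>1 \<gamma>2 (\<psi> t')))))
     \<longleftrightarrow> a t = a0 + integral {0..t} (\<lambda>\<tau>. G \<tau> (a \<tau>))" if t: "t \<in> {0..T}" for t
  proof -
    \<comment> \<open>The factor \<open>\<i>\<close> cancels the \<open>- \<i>\<close> in
      \<open>G\<close>, so that the image of the integrand is precisely the propagated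
      nonlinearity.\<close>
    let ?\<Lambda> = "\<lambda>b. unweighted s (flow t (scaleC \<i> b))" and ?I = "integral {0..t} (\<lambda>\<tau>. G \<tau> (a \<tau>))"
    have bl: "bounded_linear ?\<Lambda>"
      by (intro bounded_linear_compose[OF bounded_linear_unweighted[OF s0]] bounded_linear_compose[OF bounded_linear_flow] bounded_linear_scaleC)
    have "continuous_on {0..t} (\<lambda>\<tau>. G \<tau> (a \<tau>))"
      by (intro ode.cont continuous_on_subset[OF a]) (use t in auto)
    then have "((\<lambda>\<tau>. G \<tau> (a \<tau>)) has_integral ?I) {0..t}"
      by (intro integrable_integral integrable_continuous_real)
    from has_integral_linear[OF this bl]
    have "((\<lambda>\<tau>. ?\<Lambda> (G \<tau> (a \<tau>))) has_integral ?\<Lambda> ?I) {0..t}" by (simp add: o_def)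
    also have "?this \<longleftrightarrow> ((\<lambda>\<tau>. propagator (t - \<tau>) (nonlinearity \<gamma>1 \<gamma>2 (\<psi> \<tau>))) has_integral ?\<Lambda> ?I) {0..t}"
    proof (rule has_integral_cong)
      fix \<tau> assume "\<tau> \<in> {0..t}"
      then have "\<tau> \<in> {0..T}" using t by auto
      then show "?\<Lambda> (G \<tau> (a \<tau>)) = propagator (t - \<tau>) (nonlinearity \<gamma>1 \<gamma>2 (\<psi> \<tau>))"
        unfolding \<psi>[OF \<open>\<tau> \<in> {0..T}\<close>] unweighted_Ns[symmetric] propagator_unweighted[OF s0] G_def
        by (simp add: flow_scaleC)
    qed
    finally have I: "((\<lambda>\<tau>. propagator (t - \<tau>) (nonlinearity \<gamma>1 \<gamma>2 (\<psi> \<tau>))) has_integral ?\<Lambda> ?I) {0..t}" .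
    have "scaleC \<i> (?\<Lambda> ?I) = - unweighted s (flow t ?I)"
      using scaleC_of_real[of "-1" "unweighted s (flow t ?I)"] by (simp add: flow_scaleC unweighted_scaleC[OF s0])
    then have "(\<psi> t = propagator t (unweighted s a0) - scaleC \<i> (?\<Lambda> ?I)) \<longleftrightarrow> unweighted s (flow t (a t)) = unweighted s (flow t (a0 + ?I))"
      unfolding \<psi>[OF t] propagator_unweighted[OF s0] flow_add unweighted_add[OF s0] by simp
    also have "\<dots> \<longleftrightarrow> a t = a0 + ?I"
    proof
      assume "unweighted s (flow t (a t)) = unweighted s (flow t (a0 + ?I))"
      then have "flow (- t) (flow t (a t)) = flow (- t) (flow t (a0 + ?I))" using unweighted_inj[OF s0] by metis
      then show "a t = a0 + ?I" unfolding flow_flow by simp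
    qed simp
    finally show ?thesis using I integral_unique[OF I] by (simp add: has_integral_integrable)
  qed
  then show ?thesis unfolding duhamel_solution_def using cs by auto
qed

text \<open>Uniqueness concerns arbitrary Duhamel solutions. Continuity in the Sobolev norm is
  continuity of \<open>weighted s (v t)\<close>, so undoing the flow yields a continuous curve to
  which the equivalence applies.\<close>

lemma duhamel_solution_interaction:
  fixes v :: "real \<Rightarrow> 'a Ltwo"
  assumes "duhamel_solution \<gamma>1 \<gamma>2 s (unweighted s a0) T v"
  obtains b where "continuous_on {0..T} b" "\<And>t. t \<in> {0..T} \<Longrightarrow> v t = unweighted s (flow t (b t))"
    "\<And>t. t \<in> {0..T} \<Longrightarrow> b t = a0 + integral {0..t} (\<lambda>\<tau>. G \<tau> (b \<tau>))"
proof -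
  define b where "b t = flow (- t) (weighted s (v t))" for t
  have v: "v t \<in> Sobolev s" "((\<lambda>r. Sobolev_norm s (v r - v t)) \<longlongrightarrow> 0) (at t within {0..T})" if "t \<in> {0..T}" for t
    using assms that by (auto simp: duhamel_solution_def continuous_in_Sobolev_def)
  have "continuous_on {0..T} (\<lambda>t. weighted s (v t))"
    unfolding continuous_on_def
  proof
    fix t assume t: "t \<in> {0..T}"
    have "\<forall>\<^sub>F r in at t within {0..T}. Sobolev_norm s (v r - v t) = norm (weighted s (v r) - weighted s (v t))"
      unfolding eventually_at_filter
      by (intro always_eventually allI impI) (simp add: Sobolev_norm_eq Sobolev_diff weighted_diff v t s0 del: atLeastAtMost_iff)
    from Lim_transform_eventually[OF v(2)[OF t] this]
    show "((\<lambda>t. weighted s (v t)) \<longlongrightarrow> weighted s (v t)) (at t within {0..T})"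
      by (intro LIM_zero_cancel[where l = "weighted s (v t)"]) (simp add: tendsto_norm_zero_iff)
  qed
  then have b: "continuous_on {0..T} b" unfolding b_def[abs_def] by (intro continuous_on_flow continuous_intros)
  moreover have vb: "v t = unweighted s (flow t (b t))" if "t \<in> {0..T}" for t
    using v(1)[OF that] s0 by (simp add: b_def unweighted_weighted)
  ultimately show ?thesis using duhamel_iff[OF b vb] assms that by blast
qed

end

section \<open>Conservation of mass and energy\<close>

lemma has_vector_derivative_iff_quotient:
  fixes f :: "real \<Rightarrow> 'b::real_normed_vector"
  shows "(f has_vector_derivative D) (at t within S) \<longleftrightarrow> ((\<lambda>r. (f r - f t) /\<^sub>R (r - t)) \<longlongrightarrow> D) (at t within S)"
proof -
  have eq: "norm (f r - f t - (r - t) *\<^sub>R D) / norm (r - t) = norm ((f r - f t) /\<^sub>R (r - t) - D)" if "r \<noteq> t" for r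
  proof -
    have "f r - f t - (r - t) *\<^sub>R D = (r - t) *\<^sub>R ((f r - f t) /\<^sub>R (r - t) - D)" using that by (simp add: scaleR_diff_right)
    then show ?thesis using that by simp
  qed
  have "(f has_vector_derivative D) (at t within S) \<longleftrightarrow> ((\<lambda>r. norm (f r - f t - (r - t) *\<^sub>R D) / norm (r - t)) \<longlongrightarrow> 0) (at t within S)"
    unfolding has_vector_derivative_def has_derivative_iff_norm by (simp add: bounded_linear_scaleR_left)
  also have "\<dots> \<longleftrightarrow> ((\<lambda>r. norm ((f r - f t) /\<^sub>R (r - t) - D)) \<longlongrightarrow> 0) (at t within S)"
    by (intro filterlim_cong refl) (auto simp: eventually_at_filter eq[unfolded real_norm_def] intro!: always_eventually)
  also have "\<dots> \<longleftrightarrow> ((\<lambda>r. (f r - f t) /\<^sub>R (r - t)) \<longlongrightarrow> D) (at t within S)"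
    by (simp only: tendsto_norm_zero_iff LIM_zero_iff)
  finally show ?thesis .
qed

text \<open>Bounded for \<open>p \<le> q\<close>, which is how derivatives of order \<open>p\<close>
  act on weighted coordinates. With a natural exponent, \<open>p = 0\<close> gives the pure bracket
  multiplier even at the origin, where \<open>0 powr 0\<close> would be 0.\<close>

definition rmul :: "nat \<Rightarrow> real \<Rightarrow> 'a::euclidean_space Ltwo \<Rightarrow> 'a Ltwo" where
  "rmul p q = fmul (\<lambda>\<xi>. of_real (norm \<xi> ^ p * bracket \<xi> powr (- q)))"

lemma norm_power_bracket_le:
  assumes "real p \<le> q" shows "norm \<xi> ^ p * bracket \<xi> powr (- q) \<le> 1"
proof -
  have "norm \<xi> ^ p * bracket \<xi> powr (- q) \<le> bracket \<xi> ^ p * bracket \<xi> powr (- q)"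
    by (intro mult_right_mono power_mono bracket_ge_norm) auto
  also have "\<dots> = bracket \<xi> powr (- (q - real p))"
    by (subst powr_realpow[symmetric]) (simp_all add: powr_add[symmetric])
  also have "\<dots> \<le> 1" using assms by (intro bracket_powr_neg_le) simp
  finally show ?thesis .
qed

lemma bounded_multiplier_rmul:
  "real p \<le> q \<Longrightarrow> bounded_multiplier (\<lambda>\<xi>. of_real (norm \<xi> ^ p * bracket \<xi> powr (- q)))"
proof (rule bounded_multiplierI[where B = 1])
  show "cmod (of_real (norm \<xi> ^ p * bracket \<xi> powr (- q))) \<le> 1" if "real p \<le> q" for \<xi> :: 'a
    unfolding norm_of_real using norm_power_bracket_le[OF that, of \<xi>] by simp
qed measurable

lemma bounded_linear_rmul: "real p \<le> q \<Longrightarrow> bounded_linear (rmul p q)"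
  unfolding rmul_def by (intro bounded_linear_fmul bounded_multiplier_rmul)

lemma rmul_rmul:
  assumes "real p \<le> q" "real p' \<le> q'" shows "rmul p q (rmul p' q' u) = rmul (p + p') (q + q') u"
proof -
  have "complex_of_real (norm \<xi> ^ p * bracket \<xi> powr (- q)) * of_real (norm \<xi> ^ p' * bracket \<xi> powr (- q'))
     = of_real (norm \<xi> ^ (p + p') * bracket \<xi> powr (- (q + q')))" for \<xi> :: 'a
  proof -
    have "bracket \<xi> powr (- (q + q')) = bracket \<xi> powr (- q) * bracket \<xi> powr (- q')"
      by (simp add: powr_add[symmetric])
    then show ?thesis by (simp add: power_add)
  qed
  then show ?thesis unfolding rmul_def using assms by (simp add: fmul_fmul bounded_multiplier_rmul del: of_real_mult)
qed

lemma rmul_flow: "real p \<le> q \<Longrightarrow> rmul p q (flow t u) = flow t (rmul p q u)"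
  unfolding rmul_def flow_def by (subst (1 2) fmul_fmul) (simp_all add: bounded_multiplier_flow bounded_multiplier_rmul mult.commute del: of_real_mult)

lemma rmul_scaleC: "real p \<le> q \<Longrightarrow> rmul p q (scaleC c u) = scaleC c (rmul p q u)"
  unfolding rmul_def by (intro fmul_scaleC bounded_multiplier_rmul)

text \<open>The symbol is real, so the operator is self-adjoint; this moves brackets from one side
  of a pairing to the other.\<close>

lemma inner_rmul:
  assumes "real p \<le> q" shows "rmul p q u \<bullet> v = u \<bullet> rmul p q v"
  unfolding inner_Ltwo_def
proof (rule integral_cong_AE)
  show "AE \<xi> in lborel. repr (rmul p q u) \<xi> \<bullet> repr v \<xi> = repr u \<xi> \<bullet> repr (rmul p q v) \<xi>"
    using AE_fmul[OF bounded_multiplier_rmul[OF assms], of u] AE_fmul[OF bounded_multiplier_rmul[OF assms], of v]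
    unfolding rmul_def
  proof eventually_elim
    case (elim \<xi>)
    have "(of_real r * a) \<bullet> b = a \<bullet> (of_real r * b)" for r and a b :: complex
      by (simp add: scaleR_conv_of_real[symmetric])
    then show ?case unfolding elim .
  qed
qed measurable

lemma unweighted_eq_rmul: "unweighted s a = ifourier (rmul 0 s a)"
  by (simp add: unweighted_def rmul_def)

lemma inner_ifourier: "ifourier u \<bullet> ifourier v = u \<bullet> v"
  using inner_fourier[of "ifourier u" "ifourier v"] by (simp add: fourier_ifourier)

lemma inner_flow: "flow t u \<bullet> flow t v = u \<bullet> v"
  by (simp only: dot_norm flow_add[symmetric] norm_flow)

lemma inner_scaleC_ii_commute: "scaleC \<i> u \<bullet> v = - (u \<bullet> scaleC \<i> v)"
  using inner_scaleC_scaleC[of \<i> u "scaleC \<i> v"] scaleC_of_real[of "-1" v] by simp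

text \<open>A time derivative of the free flow costs two powers of \<open>|\<xi>|\<close>; the
  condition \<open>p + 2 \<le> q\<close> says that the bracket can pay for them.\<close>

lemma rmul_flow_derivative:
  assumes p: "real p \<le> q" "real (p + 2) \<le> q"
  shows "((\<lambda>t. rmul p q (flow t u)) has_vector_derivative scaleC \<i> (rmul (p + 2) q (flow t u))) (at t within S)"
proof -
  have "((\<lambda>r. (rmul p q (flow r u) - rmul p q (flow t u)) /\<^sub>R (r - t)) \<longlongrightarrow> scaleC \<i> (rmul (p + 2) q (flow t u))) (at t within S)"
    unfolding tendsto_at_iff_sequentially
  proof (intro allI impI)
    fix X :: "nat \<Rightarrow> real" assume XS: "\<forall>n. X n \<in> S - {t}" and X: "X \<longlonglongrightarrow> t"
    then have ne: "X n - t \<noteq> 0" for n by (metis DiffE insertI1 right_minus_eq)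
    let ?d = "\<lambda>n \<xi>::'a. (cis ((X n - t) * (norm \<xi>)\<^sup>2) - 1) / of_real (X n - t)"
    let ?b = "\<lambda>\<xi>::'a. complex_of_real (norm \<xi> ^ p * bracket \<xi> powr (- q))"
    have bd: "cmod (?d n \<xi>) \<le> (norm \<xi>)\<^sup>2" for n \<xi>
    proof -
      have "cmod (?d n \<xi>) \<le> \<bar>(X n - t) * (norm \<xi>)\<^sup>2\<bar> / \<bar>X n - t\<bar>"
        unfolding norm_divide norm_of_real by (intro divide_right_mono norm_cis_minus_one_le) simp
      then show ?thesis using ne[of n] by (simp add: abs_mult)
    qed
    \<comment> \<open>The difference quotient of the phase is at most \<open>|\<xi>|^2\<close>,
      which the bracket absorbs. The bound is uniform in \<open>n\<close>, as
      \<open>fmul_tendsto\<close> requires.\<close>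
    have bd': "cmod (?d n \<xi> * ?b \<xi>) \<le> 1" for n \<xi>
    proof -
      have "cmod (?d n \<xi> * ?b \<xi>) \<le> (norm \<xi>)\<^sup>2 * (norm \<xi> ^ p * bracket \<xi> powr (- q))"
        unfolding norm_mult[of "?d n \<xi>"] norm_of_real by (intro mult_mono bd) auto
      also have "\<dots> = norm \<xi> ^ (p + 2) * bracket \<xi> powr (- q)" by (simp add: power_add power2_eq_square)
      finally show ?thesis using norm_power_bracket_le[OF p(2), of \<xi>] by linarith
    qed
    have m: "bounded_multiplier (\<lambda>\<xi>. ?d n \<xi> * ?b \<xi>)" for n
      by (rule bounded_multiplierI[OF _ bd']) measurable
    have eq: "(rmul p q (flow (X n) u) - rmul p q (flow t u)) /\<^sub>R (X n - t) = fmul (\<lambda>\<xi>. ?d n \<xi> * ?b \<xi>) (flow t u)" for n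
      unfolding Ltwo_eq_iff
      using AE_scaleR_Ltwo[of "inverse (X n - t)" "rmul p q (flow (X n) u) - rmul p q (flow t u)"]
        AE_minus_Ltwo[of "rmul p q (flow (X n) u)" "rmul p q (flow t u)"] AE_fmul[OF m, of n "flow t u"]
        AE_fmul[OF bounded_multiplier_rmul[OF p(1)], of "flow (X n) u"] AE_fmul[OF bounded_multiplier_rmul[OF p(1)], of "flow t u"]
        AE_fmul[OF bounded_multiplier_flow, of "X n - t" "flow t u"]
    proof eventually_elim
      case (elim \<xi>)
      have f: "repr (flow (X n) u) \<xi> = cis ((X n - t) * (norm \<xi>)\<^sup>2) * repr (flow t u) \<xi>"
        using elim(6) unfolding flow_def[symmetric] by simp
      show ?case unfolding elim(1,2,3) elim(4,5)[folded rmul_def] f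
        by (simp only: scaleR_conv_of_real of_real_inverse) (simp only: divide_inverse algebra_simps mult_1_left)
    qed
    have "(\<lambda>n. fmul (\<lambda>\<xi>. ?d n \<xi> * ?b \<xi>) (flow t u)) \<longlonglongrightarrow> fmul (\<lambda>\<xi>. \<i> * of_real ((norm \<xi>)\<^sup>2) * ?b \<xi>) (flow t u)"
    proof (rule fmul_tendsto[where B = 1])
      show "(\<lambda>n. ?d n \<xi> * ?b \<xi>) \<longlonglongrightarrow> \<i> * of_real ((norm \<xi>)\<^sup>2) * ?b \<xi>" for \<xi>
        using X ne by (intro tendsto_mult tendsto_const cis_difference_quotient_tendsto) (auto simp: LIM_zero)
    qed (use bd' in \<open>auto simp del: of_real_mult\<close>)
    also have "fmul (\<lambda>\<xi>. \<i> * of_real ((norm \<xi>)\<^sup>2) * ?b \<xi>) (flow t u) = scaleC \<i> (rmul (p + 2) q (flow t u))"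
      unfolding rmul_def scaleC_def fmul_def[of "\<lambda>\<xi>. \<i> * of_real ((norm \<xi>)\<^sup>2) * ?b \<xi>"]
    proof (rule to_Ltwo_cong_AE)
      show "AE \<xi> in lborel. \<i> * of_real ((norm \<xi>)\<^sup>2) * ?b \<xi> * repr (flow t u) \<xi>
          = \<i> * repr (fmul (\<lambda>\<xi>. of_real (norm \<xi> ^ (p + 2) * bracket \<xi> powr (- q))) (flow t u)) \<xi>"
        using AE_fmul[OF bounded_multiplier_rmul[OF p(2)], of "flow t u"]
        by eventually_elim (simp add: power_add power2_eq_square)
      have "bounded_multiplier (\<lambda>\<xi>::'a. \<i> * of_real ((norm \<xi>)\<^sup>2) * ?b \<xi>)"
      proof (rule bounded_multiplierI[where B = 1])
        show "cmod (\<i> * of_real ((norm \<xi>)\<^sup>2) * ?b \<xi>) \<le> 1" for \<xi>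
          using norm_power_bracket_le[OF p(2), of \<xi>] by (simp add: norm_mult norm_power power_add power2_eq_square mult_ac)
      qed measurable
      then show "square_integrable (\<lambda>\<xi>. \<i> * of_real ((norm \<xi>)\<^sup>2) * ?b \<xi> * repr (flow t u) \<xi>)"
        by (rule square_integrable_multiplier) simp
      show "square_integrable (\<lambda>\<xi>. \<i> * repr (fmul (\<lambda>\<xi>. of_real (norm \<xi> ^ (p + 2) * bracket \<xi> powr (- q))) (flow t u)) \<xi>)"
        by (rule square_integrable_mult) simp
    qed
    finally show "((\<lambda>r. (rmul p q (flow r u) - rmul p q (flow t u)) /\<^sub>R (r - t)) \<circ> X) \<longlonglongrightarrow> scaleC \<i> (rmul (p + 2) q (flow t u))"
      unfolding eq[symmetric] by (simp add: o_def)
  qed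
  then show ?thesis by (simp only: has_vector_derivative_iff_quotient)
qed

text \<open>A product rule under strong continuity: one part of the quotient differentiates the flow
  at the fixed vector \<open>a t\<close>, the other keeps the moving \<open>flow r\<close> in front
  of the quotient of \<open>a\<close>, where \<open>flow_LIMSEQ\<close> passes to the limit.\<close>

lemma rmul_flow_has_vector_derivative:
  assumes a: "(a has_vector_derivative a') (at t within S)" and p: "real p \<le> q" "real (p + 2) \<le> q"
  shows "((\<lambda>t. rmul p q (flow t (a t))) has_vector_derivative
      scaleC \<i> (rmul (p + 2) q (flow t (a t))) + rmul p q (flow t a')) (at t within S)"
proof -
  have "((\<lambda>r. (rmul p q (flow r (a t)) - rmul p q (flow t (a t))) /\<^sub>R (r - t)) \<longlongrightarrow> scaleC \<i> (rmul (p + 2) q (flow t (a t)))) (at t within S)"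
    using rmul_flow_derivative[OF p, of "a t" t S] unfolding has_vector_derivative_iff_quotient .
  moreover have "((\<lambda>r. rmul p q (flow r ((a r - a t) /\<^sub>R (r - t)))) \<longlongrightarrow> rmul p q (flow t a')) (at t within S)"
  proof (rule bounded_linear.tendsto[OF bounded_linear_rmul[OF p(1)]])
    have "((\<lambda>r. (a r - a t) /\<^sub>R (r - t)) \<longlongrightarrow> a') (at t within S)" using a unfolding has_vector_derivative_iff_quotient .
    then show "((\<lambda>r. flow r ((a r - a t) /\<^sub>R (r - t))) \<longlongrightarrow> flow t a') (at t within S)"
      unfolding tendsto_at_iff_sequentially by (auto simp: o_def intro!: flow_LIMSEQ)
  qed
  ultimately have "((\<lambda>r. (rmul p q (flow r (a t)) - rmul p q (flow t (a t))) /\<^sub>R (r - t) + rmul p q (flow r ((a r - a t) /\<^sub>R (r - t)))) \<longlongrightarrow>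
      scaleC \<i> (rmul (p + 2) q (flow t (a t))) + rmul p q (flow t a')) (at t within S)"
    by (rule tendsto_add)
  moreover have "(rmul p q (flow r (a t)) - rmul p q (flow t (a t))) /\<^sub>R (r - t) + rmul p q (flow r ((a r - a t) /\<^sub>R (r - t)))
     = (rmul p q (flow r (a r)) - rmul p q (flow t (a t))) /\<^sub>R (r - t)" for r
  proof -
    have "rmul p q (flow r ((a r - a t) /\<^sub>R (r - t))) = (rmul p q (flow r (a r)) - rmul p q (flow r (a t))) /\<^sub>R (r - t)"
    proof -
      note l = bounded_linear.linear[OF bounded_linear_compose[OF bounded_linear_rmul[OF p(1)] bounded_linear_flow[of r]]]
      show ?thesis unfolding linear_cmul[OF l] linear_diff[OF l] ..
    qed
    then show ?thesis by (simp add: scaleR_diff_right)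
  qed
  ultimately show ?thesis unfolding has_vector_derivative_iff_quotient by simp
qed

lemma hartree_energy_eq: "hartree_energy \<gamma> u = (LINT x|lborel. hartree_form \<gamma> u u x * (cmod (repr u x))\<^sup>2)"
  unfolding hartree_energy_def hartree_form_def
  by (rule Bochner_Integration.integral_cong)
    (simp_all add: power2_norm_eq_inner powr_minus_divide integral_mult_left_zero[symmetric] integral_mult_right_zero[symmetric] mult_ac)

section \<open>Differences and derivatives of the Hartree energy\<close>

context hartree
begin

lemma hartree_form_energy_integrable:
  fixes u v w :: "'a Ltwo"
  assumes u: "u \<in> Sobolev s" shows "integrable lborel (\<lambda>x. hartree_form \<gamma> u u x * (repr v x \<bullet> repr w x))"
proof -
  have "integrable lborel (\<lambda>x. (of_real (hartree_form \<gamma> u u x) * repr v x) \<bullet> repr w x)"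
    by (rule integrable_inner_square_integrable[OF square_integrable_hartree_term[OF u u]]) simp
  then show ?thesis by (simp add: scaleR_conv_of_real[symmetric])
qed

text \<open>Fubini for a symmetric kernel; Hardy's inequality for \<open>u\<close> alone makes the
  double integral finite.\<close>

lemma hartree_form_symmetric:
  fixes u v :: "'a Ltwo"
  assumes u: "u \<in> Sobolev s"
  shows "(LINT x|lborel. hartree_form \<gamma> u u x * (cmod (repr v x))\<^sup>2) = (LINT x|lborel. hartree_form \<gamma> v v x * (cmod (repr u x))\<^sup>2)"
proof -
  let ?f = "\<lambda>x y. norm (x - y) powr (- \<gamma>) * (cmod (repr u y))\<^sup>2 * (cmod (repr v x))\<^sup>2"
  define M where "M = cst * C * (norm (weighted s u))\<^sup>2"
  have "(\<integral>\<^sup>+x. \<integral>\<^sup>+y. norm (?f x y) \<partial>lborel \<partial>lborel) \<le> (\<integral>\<^sup>+x. ennreal M * ennreal ((cmod (repr v x))\<^sup>2) \<partial>lborel)"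
  proof (rule nn_integral_mono)
    fix x :: 'a
    have "(\<integral>\<^sup>+y. norm (?f x y) \<partial>lborel) = (\<integral>\<^sup>+y. ennreal (norm (x - y) powr (- \<gamma>) * (cmod (repr u y))\<^sup>2) \<partial>lborel) * ennreal ((cmod (repr v x))\<^sup>2)"
      by (simp add: nn_integral_multc[symmetric] ennreal_mult'[symmetric] abs_mult)
    also have "\<dots> \<le> ennreal M * ennreal ((cmod (repr v x))\<^sup>2)"
      unfolding M_def by (intro mult_right_mono hardy u) simp
    finally show "(\<integral>\<^sup>+y. norm (?f x y) \<partial>lborel) \<le> ennreal M * ennreal ((cmod (repr v x))\<^sup>2)" .
  qed
  also have "\<dots> = ennreal M * ennreal ((norm v)\<^sup>2)" by (simp add: nn_integral_cmult nn_integral_repr)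
  also have "\<dots> < \<infinity>" by (simp add: ennreal_mult_less_top)
  finally have fin: "(\<integral>\<^sup>+x. \<integral>\<^sup>+y. norm (?f x y) \<partial>lborel \<partial>lborel) < \<infinity>" .
  have "(LINT x|lborel. hartree_form \<gamma> u u x * (cmod (repr v x))\<^sup>2) = (LINT x|lborel. LINT y|lborel. ?f x y)"
    by (simp add: hartree_form_def power2_norm_eq_inner)
  also have "\<dots> = (LINT y|lborel. LINT x|lborel. ?f x y)"
    by (rule lborel_pair.Fubini_bounded(2)[OF _ fin, symmetric]) measurable
  also have "\<dots> = (LINT x|lborel. hartree_form \<gamma> v v x * (cmod (repr u x))\<^sup>2)"
    unfolding hartree_form_def integral_mult_left_zero[symmetric]
    by (intro Bochner_Integration.integral_cong refl) (simp add: norm_minus_commute power2_norm_eq_inner mult_ac)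
  finally show ?thesis .
qed

text \<open>Equal to \<open>(V v + V u) (v + u)\<close> with \<open>V\<close> the potential, but
  expanded so that every summand is a \<open>hartree_term\<close> with a bound in
  \<open>Sobolev s\<close>. The first two contain \<open>v - u\<close> and disappear in the limit;
  what survives is four times the cubic term.\<close>

definition Q :: "'a Ltwo \<Rightarrow> 'a Ltwo \<Rightarrow> 'a Ltwo" where
  "Q v u = hartree_term \<gamma> (v - u) (v + u) (v + u) + 2 *\<^sub>R hartree_term \<gamma> u u (v - u) + 4 *\<^sub>R hartree_term \<gamma> u u u"

text \<open>Multiplying out leaves the two cross terms in which the potential of one function meets
  the density of the other; these cancel by \<open>hartree_form_symmetric\<close>.\<close>

lemma hartree_energy_diff:
  fixes u v :: "'a Ltwo"
  assumes u: "u \<in> Sobolev s" and v: "v \<in> Sobolev s"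
  shows "hartree_energy \<gamma> v - hartree_energy \<gamma> u = Q v u \<bullet> (v - u)"
proof -
  let ?h = "\<lambda>u v w. LINT x|lborel. hartree_form \<gamma> u u x * (repr v x \<bullet> repr w x)"
  note uv = Sobolev_add[OF v u s(2)] Sobolev_diff[OF v u s(2)]
  have "Q v u \<bullet> (v - u) = (LINT x|lborel. (hartree_form \<gamma> v v x * (repr v x \<bullet> repr v x) - hartree_form \<gamma> u u x * (repr u x \<bullet> repr u x))
      + (hartree_form \<gamma> u u x * (repr v x \<bullet> repr v x) - hartree_form \<gamma> v v x * (repr u x \<bullet> repr u x)))"
    unfolding inner_Ltwo_def
  proof (rule integral_cong_AE)
    show "AE x in lborel. repr (Q v u) x \<bullet> repr (v - u) x = (hartree_form \<gamma> v v x * (repr v x \<bullet> repr v x) - hartree_form \<gamma> u u x * (repr u x \<bullet> repr u x))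
      + (hartree_form \<gamma> u u x * (repr v x \<bullet> repr v x) - hartree_form \<gamma> v v x * (repr u x \<bullet> repr u x))"
      unfolding Q_def
      using AE_plus_Ltwo[of "hartree_term \<gamma> (v - u) (v + u) (v + u) + 2 *\<^sub>R hartree_term \<gamma> u u (v - u)" "4 *\<^sub>R hartree_term \<gamma> u u u"]
        AE_plus_Ltwo[of "hartree_term \<gamma> (v - u) (v + u) (v + u)" "2 *\<^sub>R hartree_term \<gamma> u u (v - u)"]
        AE_scaleR_Ltwo[of 2 "hartree_term \<gamma> u u (v - u)"] AE_scaleR_Ltwo[of 4 "hartree_term \<gamma> u u u"]
        AE_hartree_term[OF uv(2,1), of "v + u"] AE_hartree_term[OF u u, of "v - u"] AE_hartree_term[OF u u, of u]
        AE_plus_Ltwo[of v u] AE_minus_Ltwo[of v u]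
    proof eventually_elim
      case (elim x)
      define V U a b where "V = hartree_form \<gamma> v v x" and "U = hartree_form \<gamma> u u x" and "a = repr v x" and "b = repr u x"
      have "of_real (V - U) * (a + b) + 2 *\<^sub>R (of_real U * (a - b)) + 4 *\<^sub>R (of_real U * b) = (V + U) *\<^sub>R (a + b)"
        by (simp add: scaleR_conv_of_real algebra_simps)
      moreover have "(a + b) \<bullet> (a - b) = a \<bullet> a - b \<bullet> b"
        by (simp only: inner_diff_right inner_add_left) (simp add: inner_commute)
      ultimately show ?case unfolding elim hartree_form_diff[OF v u] V_def[symmetric] U_def[symmetric] a_def[symmetric] b_def[symmetric]
        by (simp only: inner_scaleR_left) (simp add: algebra_simps)
    qed
  qed measurable
  also have "\<dots> = (?h v v v - ?h u u u) + (?h u v v - ?h v u u)"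
    using hartree_form_energy_integrable[OF u] hartree_form_energy_integrable[OF v] by simp
  also have "?h u v v = ?h v u u" using hartree_form_symmetric[OF u, of v] by (simp add: power2_norm_eq_inner)
  finally show ?thesis by (simp add: hartree_energy_eq power2_norm_eq_inner)
qed

lemma Q_unweighted:
  fixes x y :: "'a Ltwo"
  defines "u \<equiv> unweighted s x" and "v \<equiv> unweighted s y"
  shows "Q v u = unweighted s (weighted s (hartree_term \<gamma> (v - u) (v + u) (v + u)) + 2 *\<^sub>R weighted s (hartree_term \<gamma> u u (v - u)) + 4 *\<^sub>R weighted s (hartree_term \<gamma> u u u))"
proof -
  have e: "u \<in> Sobolev s" "v \<in> Sobolev s" unfolding u_def v_def by (rule unweighted_in_Sobolev[OF s(2)])+
  note uv = Sobolev_add[OF e(2,1) s(2)] Sobolev_diff[OF e(2,1) s(2)]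
  show ?thesis
    unfolding Q_def unweighted_add[OF s(2)] linear_cmul[OF bounded_linear.linear[OF bounded_linear_unweighted[OF s(2)]]]
    by (simp only: unweighted_weighted[OF hartree_term_Sobolev(1)[OF uv(2,1,1)] s(2)] unweighted_weighted[OF hartree_term_Sobolev(1)[OF e(1,1) uv(2)] s(2)]
      unweighted_weighted[OF hartree_term_Sobolev(1)[OF e(1,1,1)] s(2)])
qed

text \<open>In the pairing of \<open>Q\<close> with the increment one bracket is shifted. The left
  factor converges in order 1, because all bounds hold in order \<open>s \<ge> 1\<close>; the right
  factor only has to be differentiable in order \<open>-1\<close>, which is the hypothesis on
  \<open>rmul 0 (1 + s)\<close>.\<close>

lemma hartree_energy_derivative:
  fixes w :: "real \<Rightarrow> 'a Ltwo"
  assumes s1: "1 \<le> s" and w: "(w \<longlongrightarrow> w t) (at t within S)"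
    and d: "((\<lambda>t. rmul 0 (1 + s) (w t)) has_vector_derivative d') (at t within S)"
  shows "((\<lambda>t. hartree_energy \<gamma> (unweighted s (w t))) has_vector_derivative
    4 * (rmul 0 (s - 1) (weighted s (hartree_term \<gamma> (unweighted s (w t)) (unweighted s (w t)) (unweighted s (w t)))) \<bullet> d')) (at t within S)"
proof -
  let ?u = "unweighted s (w t)" and ?v = "\<lambda>r. unweighted s (w r)"
  let ?A = "\<lambda>r. weighted s (hartree_term \<gamma> (?v r - ?u) (?v r + ?u) (?v r + ?u))" and ?B = "\<lambda>r. weighted s (hartree_term \<gamma> ?u ?u (?v r - ?u))"
    and ?n = "weighted s (hartree_term \<gamma> ?u ?u ?u)"
  let ?q = "\<lambda>r. ?A r + 2 *\<^sub>R ?B r + 4 *\<^sub>R ?n"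
  note e = unweighted_in_Sobolev[OF s(2)]
  have eq: "(hartree_energy \<gamma> (?v r) - hartree_energy \<gamma> ?u) /\<^sub>R (r - t)
     = rmul 0 (s - 1) (?q r) \<bullet> ((rmul 0 (1 + s) (w r) - rmul 0 (1 + s) (w t)) /\<^sub>R (r - t))" for r
  proof -
    have "hartree_energy \<gamma> (?v r) - hartree_energy \<gamma> ?u = unweighted s (?q r) \<bullet> unweighted s (w r - w t)"
      unfolding hartree_energy_diff[OF e e] Q_unweighted unweighted_diff[OF s(2)] ..
    also have "\<dots> = rmul 0 (1 + (s - 1)) (?q r) \<bullet> rmul 0 s (w r - w t)"
      by (simp add: unweighted_eq_rmul inner_ifourier)
    \<comment> \<open>The exponent \<open>s\<close> is written as \<open>1 + (s - 1)\<close>; the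
      bracket of exponent 1 goes over to the increment and the rest stays.\<close>
    also have "rmul 0 (1 + (s - 1)) (?q r) = rmul 0 1 (rmul 0 (s - 1) (?q r))"
      using rmul_rmul[of 0 1 0 "s - 1" "?q r"] s1 by simp
    also have "\<dots> \<bullet> rmul 0 s (w r - w t) = rmul 0 (s - 1) (?q r) \<bullet> rmul 0 1 (rmul 0 s (w r - w t))"
      by (rule inner_rmul) simp
    also have "rmul 0 1 (rmul 0 s (w r - w t)) = rmul 0 (1 + s) (w r) - rmul 0 (1 + s) (w t)"
      using rmul_rmul[of 0 1 0 s "w r - w t"] s1
        linear_diff[OF bounded_linear.linear[OF bounded_linear_rmul[of 0 "1 + s"]], of "w r" "w t"] by simp
    finally show ?thesis by simp
  qed
  have \<delta>: "((\<lambda>r. norm (w r - w t)) \<longlongrightarrow> 0) (at t within S)" by (intro tendsto_norm_zero LIM_zero w)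
  have "(?A \<longlongrightarrow> 0) (at t within S)"
  proof (rule Lim_null_comparison[OF always_eventually])
    show "\<forall>r. norm (?A r) \<le> Kh * (norm (w r - w t) * norm (w r + w t) * norm (w r + w t))"
      using hartree_term_Sobolev(2)[OF Sobolev_diff[OF e e s(2)] Sobolev_add[OF e e s(2)] Sobolev_add[OF e e s(2)]]
      by (simp add: weighted_diff weighted_add e s(2))
    have "((\<lambda>r. Kh * (norm (w r - w t) * norm (w r + w t) * norm (w r + w t))) \<longlongrightarrow> Kh * (0 * norm (w t + w t) * norm (w t + w t))) (at t within S)"
      by (intro tendsto_intros \<delta> w)
    then show "((\<lambda>r. Kh * (norm (w r - w t) * norm (w r + w t) * norm (w r + w t))) \<longlongrightarrow> 0) (at t within S)" by simp
  qed
  moreover have "(?B \<longlongrightarrow> 0) (at t within S)"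
  proof (rule Lim_null_comparison[OF always_eventually])
    show "\<forall>r. norm (?B r) \<le> Kh * (norm (w t) * norm (w t) * norm (w r - w t))"
      using hartree_term_Sobolev(2)[OF e e Sobolev_diff[OF e e s(2)]] by (simp add: weighted_diff e s(2))
    have "((\<lambda>r. Kh * (norm (w t) * norm (w t) * norm (w r - w t))) \<longlongrightarrow> Kh * (norm (w t) * norm (w t) * 0)) (at t within S)"
      by (intro tendsto_intros \<delta>)
    then show "((\<lambda>r. Kh * (norm (w t) * norm (w t) * norm (w r - w t))) \<longlongrightarrow> 0) (at t within S)" by simp
  qed
  ultimately have "(?q \<longlongrightarrow> 0 + 2 *\<^sub>R 0 + 4 *\<^sub>R ?n) (at t within S)"
    by (intro tendsto_intros)
  then have q: "(?q \<longlongrightarrow> 4 *\<^sub>R ?n) (at t within S)" by simp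
  have "((\<lambda>r. rmul 0 (s - 1) (?q r) \<bullet> ((rmul 0 (1 + s) (w r) - rmul 0 (1 + s) (w t)) /\<^sub>R (r - t))) \<longlongrightarrow> rmul 0 (s - 1) (4 *\<^sub>R ?n) \<bullet> d') (at t within S)"
    using d s1 unfolding has_vector_derivative_iff_quotient
    by (intro tendsto_inner bounded_linear.tendsto[OF bounded_linear_rmul q]) simp_all
  also have "rmul 0 (s - 1) (4 *\<^sub>R ?n) \<bullet> d' = 4 * (rmul 0 (s - 1) ?n \<bullet> d')"
    using s1 by (simp add: linear_cmul[OF bounded_linear.linear[OF bounded_linear_rmul]])
  finally show ?thesis unfolding has_vector_derivative_iff_quotient eq .
qed

lemma inner_hartree_term:
  fixes u :: "'a Ltwo"
  assumes u: "u \<in> Sobolev s" shows "u \<bullet> scaleC \<i> (hartree_term \<gamma> u u u) = 0"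
proof -
  have "u \<bullet> scaleC \<i> (hartree_term \<gamma> u u u) = (LINT x|(lborel :: 'a measure). (0 :: real))"
    unfolding inner_Ltwo_def
  proof (rule integral_cong_AE)
    show "AE x in lborel. repr u x \<bullet> repr (scaleC \<i> (hartree_term \<gamma> u u u)) x = (0 :: real)"
      using AE_scaleC[of \<i> "hartree_term \<gamma> u u u"] AE_hartree_term[OF u u, of u]
      by eventually_elim (simp add: inner_complex_def)
  qed measurable
  then show ?thesis by simp
qed

end

text \<open>The bound \<open>1 \<le> s\<close> makes \<open>|\<xi>|\<close> times the transform
  square-integrable, so the weak gradient exists and its norm is read off from the
  multiplier.\<close>

lemma gradient_unweighted:
  fixes w :: "'a::euclidean_space Ltwo"
  assumes s1: "1 \<le> s"
  shows "(LINT x|lborel. (\<Sum>b\<in>Basis. (cmod (repr (weak_partial b (unweighted s w)) x))\<^sup>2)) = (norm (rmul 1 s w))\<^sup>2"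
proof -
  have "fourier (unweighted s w) = rmul 0 s w" by (simp add: unweighted_eq_rmul fourier_ifourier)
  then have AE: "AE \<xi> in lborel. repr (rmul 1 s w) \<xi> = of_real (norm \<xi>) * repr (fourier (unweighted s w)) \<xi>"
    using AE_fmul[OF bounded_multiplier_rmul, of 0 s w] AE_fmul[OF bounded_multiplier_rmul, of 1 s w] s1
    unfolding rmul_def by auto
  have sq: "square_integrable (\<lambda>\<xi>. of_real (norm \<xi>) * repr (fourier (unweighted s w)) \<xi>)"
    by (rule square_integrable_cong_AE[OF square_integrable_repr AE]) measurable
  then show ?thesis using weak_gradient_norm[OF sq] to_Ltwo_eqI[OF sq AE] by simp
qed

section \<open>Conservation laws along a solution in the interaction picture\<close>

locale nls_trajectory = nls \<gamma>1 \<alpha>1 C1 D1 \<gamma>2 \<alpha>2 C2 D2 N s dim_type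
  for \<gamma>1 \<alpha>1 C1 D1 \<gamma>2 \<alpha>2 C2 D2 N s :: real and dim_type :: "'a::euclidean_space itself" +
  fixes T :: real and a0 :: "'a Ltwo" and a :: "real \<Rightarrow> 'a Ltwo"
  assumes a_cont: "continuous_on {0..T} a"
    and a_eq: "\<And>t. t \<in> {0..T} \<Longrightarrow> a t = a0 + integral {0..t} (\<lambda>\<tau>. G \<tau> (a \<tau>))"
    and s1: "1 \<le> s"
begin

lemma a_derivative:
  assumes t: "t \<in> {0..T}" shows "(a has_vector_derivative G t (a t)) (at t within {0..T})"
proof (rule has_vector_derivative_transform[OF t])
  have "((\<lambda>u. integral {0..u} (\<lambda>\<tau>. G \<tau> (a \<tau>))) has_vector_derivative G t (a t)) (at t within {0..T})"
    by (rule integral_has_vector_derivative[OF ode.cont[OF a_cont] t])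
  then show "((\<lambda>t. a0 + integral {0..t} (\<lambda>\<tau>. G \<tau> (a \<tau>))) has_vector_derivative G t (a t)) (at t within {0..T})"
    by (auto intro!: derivative_eq_intros)
qed (rule a_eq)

lemma flow_G: "flow t (G t b) = scaleC (- \<i>) (Ns (flow t b))"
  by (simp add: G_def flow_scaleC)

lemma scaleC_minus_ii: "scaleC (- \<i>) u = - scaleC \<i> u"
  using scaleC_scaleC[of "-1" \<i> u] scaleC_of_real[of "-1" "scaleC \<i> u"] by simp

lemma Ns_eq:
  fixes w :: "'a Ltwo"
  defines "u \<equiv> unweighted s w"
  shows "Ns w = weighted s (hartree_term \<gamma>1 u u u) - weighted s (hartree_term \<gamma>2 u u u)"
proof -
  have e: "u \<in> Sobolev s" unfolding u_def by (rule unweighted_in_Sobolev[OF s0])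
  show ?thesis
    unfolding Ns_def u_def[symmetric] nonlinearity_eq[OF e] by (intro weighted_diff h1.hartree_term_Sobolev h2.hartree_term_Sobolev e s0)
qed

lemma constant_if_derivative_zero:
  fixes f :: "real \<Rightarrow> real"
  assumes "\<And>t. t \<in> {0..T} \<Longrightarrow> (f has_vector_derivative 0) (at t within {0..T})" "t \<in> {0..T}"
  shows "f t = f 0"
proof -
  obtain c where c: "\<And>t. t \<in> {0..T} \<Longrightarrow> f t = c"
    using has_vector_derivative_zero_constant[OF convex_real_interval(5) assms(1)] by blast
  show ?thesis using c[OF assms(2)] c[of 0] assms(2) by simp
qed

lemma has_vector_derivative_inner_self:
  fixes f :: "real \<Rightarrow> 'c::real_inner"
  assumes "(f has_vector_derivative f') (at t within S)"
  shows "((\<lambda>t. f t \<bullet> f t) has_vector_derivative 2 * (f t \<bullet> f')) (at t within S)"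
  using bounded_bilinear.has_vector_derivative[OF bounded_bilinear_inner assms assms] by (simp add: inner_commute)

lemma mass_conservation:
  assumes t: "t \<in> {0..T}" shows "norm (unweighted s (flow t (a t))) = norm (unweighted s a0)"
proof -
  have r0: "real 0 \<le> s" using s0 by simp
  have n: "norm (unweighted s (flow t b)) = sqrt (rmul 0 s b \<bullet> rmul 0 s b)" for t b
    by (simp add: unweighted_eq_rmul rmul_flow[OF r0] norm_eq_sqrt_inner[symmetric])
  have "rmul 0 s (a t) \<bullet> rmul 0 s (a t) = rmul 0 s (a 0) \<bullet> rmul 0 s (a 0)"
  proof (rule constant_if_derivative_zero[OF _ t])
    fix t assume t: "t \<in> {0..T}"
    let ?u = "unweighted s (flow t (a t))"
    have u: "?u \<in> Sobolev s" by (rule unweighted_in_Sobolev[OF s0])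
    \<comment> \<open>Applying the isometry \<open>flow t\<close> on both sides turns the derivative
      of the mass into the pairing of the solution with \<open>- \<i>\<close> times the
      nonlinearity.\<close>
    have "rmul 0 s (a t) \<bullet> rmul 0 s (G t (a t)) = flow t (rmul 0 s (a t)) \<bullet> flow t (rmul 0 s (G t (a t)))" by (simp add: inner_flow)
    also have "\<dots> = ?u \<bullet> unweighted s (flow t (G t (a t)))"
      unfolding unweighted_eq_rmul inner_ifourier rmul_flow[OF r0] ..
    also have "unweighted s (flow t (G t (a t))) = - scaleC \<i> (nonlinearity \<gamma>1 \<gamma>2 ?u)"
      by (simp only: flow_G unweighted_scaleC[OF s0] unweighted_Ns) (rule scaleC_minus_ii)
    also have "?u \<bullet> \<dots> = 0"
      using h1.inner_hartree_term[OF u] h2.inner_hartree_term[OF u]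
      by (simp add: nonlinearity_eq[OF u] inner_diff_right linear_diff[OF bounded_linear.linear[OF bounded_linear_scaleC]])
    finally show "((\<lambda>t. rmul 0 s (a t) \<bullet> rmul 0 s (a t)) has_vector_derivative 0) (at t within {0..T})"
      using has_vector_derivative_inner_self[OF bounded_linear.has_vector_derivative[OF bounded_linear_rmul[OF r0] a_derivative[OF t]]] by simp
  qed
  moreover have "a 0 = a0" using a_eq[of 0] t by simp
  ultimately show ?thesis using n[of t "a t"] n[of 0 a0] by simp
qed

text \<open>The derivative of the potential energy pairs the nonlinearity with the time derivative
  of the solution, whose linear part yields the negative of the kinetic contribution by
  self-adjointness. Its nonlinear part pairs a vector with \<open>\<i>\<close> times itself and
  vanishes.\<close>

lemma energy_conservation:
  assumes t: "t \<in> {0..T}" shows "energy \<gamma>1 \<gamma>2 (unweighted s (flow t (a t))) = energy \<gamma>1 \<gamma>2 (unweighted s a0)"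
proof -
  have p: "real 1 \<le> s" "real 0 \<le> 1 + s" "real (0 + 2) \<le> 1 + s" "real 0 \<le> s - 1" "real 0 \<le> s" using s1 by auto
  \<comment> \<open>In the kinetic term the flow may be dropped, as it is an isometry commuting with
    \<open>rmul\<close>; so that term is differentiated through \<open>a\<close> alone, without loss
    of derivatives.\<close>
  let ?E = "\<lambda>t. 1/2 * (rmul 1 s (a t) \<bullet> rmul 1 s (a t)) + 1/4 * hartree_energy \<gamma>2 (unweighted s (flow t (a t))) - 1/4 * hartree_energy \<gamma>1 (unweighted s (flow t (a t)))"
  have E: "energy \<gamma>1 \<gamma>2 (unweighted s (flow t (a t))) = ?E t" for t
    unfolding energy_def gradient_unweighted[OF s1] by (simp only: rmul_flow[OF p(1)] power2_norm_eq_inner inner_flow)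
  have "?E t = ?E 0"
  proof (rule constant_if_derivative_zero[OF _ t])
    fix t assume t: "t \<in> {0..T}"
    define w where "w = flow t (a t)"
    let ?u = "unweighted s w"
    let ?n = "\<lambda>\<gamma>. weighted s (hartree_term \<gamma> ?u ?u ?u)"
    let ?d = "scaleC \<i> (rmul (0 + 2) (1 + s) w) + rmul 0 (1 + s) (flow t (G t (a t)))"
    define n where "n = Ns w"
    have wc: "((\<lambda>r. flow r (a r)) \<longlongrightarrow> flow t (a t)) (at t within {0..T})"
      using continuous_on_flow[OF continuous_on_id a_cont] t unfolding continuous_on_def by auto
    have d: "((\<lambda>t. rmul 0 (1 + s) (flow t (a t))) has_vector_derivative ?d) (at t within {0..T})"
      unfolding w_def by (rule rmul_flow_has_vector_derivative[OF a_derivative[OF t] p(2,3)])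
    let ?x = "rmul 1 s w" and ?y = "rmul 1 s n"
    have "(?E has_vector_derivative 1/2 * (2 * (rmul 1 s (a t) \<bullet> rmul 1 s (G t (a t)))) + 1/4 * (4 * (rmul 0 (s - 1) (?n \<gamma>2) \<bullet> ?d))
       - 1/4 * (4 * (rmul 0 (s - 1) (?n \<gamma>1) \<bullet> ?d))) (at t within {0..T})"
      using h1.hartree_energy_derivative[OF s1 wc d] h2.hartree_energy_derivative[OF s1 wc d]
        has_vector_derivative_inner_self[OF bounded_linear.has_vector_derivative[OF bounded_linear_rmul[OF p(1)] a_derivative[OF t]]]
      unfolding w_def[symmetric]
      by (intro has_vector_derivative_diff has_vector_derivative_add has_vector_derivative_mult_right)
    moreover have "rmul 1 s (a t) \<bullet> rmul 1 s (G t (a t)) = - (?x \<bullet> scaleC \<i> ?y)"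
    proof -
      have "rmul 1 s (a t) \<bullet> rmul 1 s (G t (a t)) = flow t (rmul 1 s (a t)) \<bullet> flow t (rmul 1 s (G t (a t)))" by (simp add: inner_flow)
      also have "\<dots> = ?x \<bullet> rmul 1 s (scaleC (- \<i>) n)" unfolding w_def n_def rmul_flow[OF p(1), symmetric] flow_G ..
      finally show ?thesis by (simp only: rmul_scaleC[OF p(1)]) (simp only: scaleC_minus_ii inner_minus_right)
    qed
    moreover have "rmul 0 (s - 1) (?n \<gamma>1) \<bullet> ?d - rmul 0 (s - 1) (?n \<gamma>2) \<bullet> ?d = - (?x \<bullet> scaleC \<i> ?y)"
    proof -
      have "rmul 0 (s - 1) (?n \<gamma>1) \<bullet> ?d - rmul 0 (s - 1) (?n \<gamma>2) \<bullet> ?d = rmul 0 (s - 1) n \<bullet> ?d"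
        by (simp only: n_def Ns_eq inner_diff_left linear_diff[OF bounded_linear.linear[OF bounded_linear_rmul[OF p(4)]]])
      also have "\<dots> = n \<bullet> rmul 0 (s - 1) ?d" by (rule inner_rmul[OF p(4)])
      \<comment> \<open>The derivative is separated into its linear and its nonlinear part, both
        still multiplied by negative powers of the bracket.\<close>
      also have "rmul 0 (s - 1) ?d = scaleC \<i> (rmul 0 (s - 1) (rmul (0 + 2) (1 + s) w)) - scaleC \<i> (rmul 0 (s - 1) (rmul 0 (1 + s) n))"
        by (simp only: linear_diff[OF bounded_linear.linear[OF bounded_linear_rmul[OF p(4)]]] rmul_scaleC[OF p(4)] rmul_scaleC[OF p(2)]
          flow_G w_def[symmetric] n_def[symmetric] scaleC_minus_ii
          linear_neg[OF bounded_linear.linear[OF bounded_linear_rmul[OF p(2)]]] add_uminus_conv_diff)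
      \<comment> \<open>The bracket exponents add up to \<open>2 * s\<close>, so the two powers of
        \<open>|\<xi>|\<close> can be shared equally between the two sides of the pairing.\<close>
      also have "rmul 0 (s - 1) (rmul (0 + 2) (1 + s) w) = rmul 1 s (rmul 1 s w)"
        unfolding rmul_rmul[OF p(4,3)] rmul_rmul[OF p(1,1)] by (simp add: numeral_2_eq_2)
      also have "rmul 0 (s - 1) (rmul 0 (1 + s) n) = rmul 0 s (rmul 0 s n)"
        unfolding rmul_rmul[OF p(4,2)] rmul_rmul[OF p(5,5)] by simp
      also have "n \<bullet> (scaleC \<i> (rmul 1 s ?x) - scaleC \<i> (rmul 0 s (rmul 0 s n))) = ?y \<bullet> scaleC \<i> ?x - rmul 0 s n \<bullet> scaleC \<i> (rmul 0 s n)"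
        by (simp only: inner_diff_right inner_rmul[OF p(1)] inner_rmul[OF p(5)] rmul_scaleC[OF p(1)] rmul_scaleC[OF p(5)])
      also have "\<dots> = - (?x \<bullet> scaleC \<i> ?y)"
        using inner_scaleC_ii_commute[of ?x ?y] inner_scaleC_ii[of "rmul 0 s n"] by (simp add: inner_commute)
      finally show ?thesis .
    qed
    ultimately show "(?E has_vector_derivative 0) (at t within {0..T})" by (simp add: algebra_simps)
  qed
  moreover have "flow 0 (a 0) = a0" using a_eq[of 0] t by simp
  ultimately show ?thesis using E[of t] E[of 0] by simp
qed

end

text \<open>\<open>esssup\<close> is the top element for a function that is not measurable;
  continuity supplies the measurability.\<close>

lemma Linfty_Sobolev_norm_le:
  assumes "continuous_on {0..T} (\<lambda>t. Sobolev_norm s (\<psi> t))" "\<And>t. t \<in> {0..T} \<Longrightarrow> Sobolev_norm s (\<psi> t) \<le> B"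
  shows "Linfty_Sobolev_norm s T \<psi> \<le> ereal B"
  unfolding Linfty_Sobolev_norm_def
proof (rule esssup_I)
  have "(\<lambda>t. Sobolev_norm s (\<psi> t)) \<in> borel_measurable (lebesgue_on {0..T})"
    by (rule continuous_imp_measurable_on_sets_lebesgue[OF assms(1)]) simp
  then show "(\<lambda>t. ereal (Sobolev_norm s (\<psi> t))) \<in> borel_measurable (lebesgue_on {0..T})" by simp
  show "AE t in lebesgue_on {0..T}. ereal (Sobolev_norm s (\<psi> t)) \<le> ereal B"
    using assms(2) by (intro AE_I2) simp
qed

theorem theorem1p6:
  fixes \<gamma>1 \<gamma>2 s :: real
  assumes "0 < \<gamma>2" and "\<gamma>2 < \<gamma>1" and "\<gamma>1 < real CARD('n::finite)"
    and "s \<ge> \<gamma>1 / 2" and "s \<ge> 1"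
  shows "\<exists>C>0. \<forall>\<psi>0 \<in> (Sobolev s :: (real ^ 'n) Ltwo set).
    \<exists>T>0. \<exists>\<psi>. duhamel_solution \<gamma>1 \<gamma>2 s \<psi>0 T \<psi> \<and>
      (\<forall>v. duhamel_solution \<gamma>1 \<gamma>2 s \<psi>0 T v \<longrightarrow> (\<forall>t\<in>{0..T}. v t = \<psi> t)) \<and>
      Linfty_Sobolev_norm s T \<psi> \<le> ereal (C * Sobolev_norm s \<psi>0) \<and>
      (\<forall>t\<in>{0..<T}. norm (\<psi> t) = norm \<psi>0 \<and> energy \<gamma>1 \<gamma>2 (\<psi> t) = energy \<gamma>1 \<gamma>2 \<psi>0)"
\<comment> \<open>The constant 2 is the ratio between the radius of the Picard ball and the norm of
  the datum. It is chosen before \<open>\<psi>0\<close>; only \<open>T\<close> depends on the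
  datum.\<close>
proof (rule exI[of _ 2], rule conjI, simp, rule ballI)
  have s0: "0 \<le> s" using assms by simp
  obtain \<alpha>1 C1 D1 \<alpha>2 C2 D2 where "hartree TYPE(real ^ 'n) \<gamma>1 \<alpha>1 C1 (real DIM(real ^ 'n)) D1 s"
    "hartree TYPE(real ^ 'n) \<gamma>2 \<alpha>2 C2 (real DIM(real ^ 'n)) D2 s"
    using hartree_exists[where 'a = "real ^ 'n", of \<gamma>1 s] hartree_exists[where 'a = "real ^ 'n", of \<gamma>2 s] assms by auto
  then interpret nls \<gamma>1 \<alpha>1 C1 D1 \<gamma>2 \<alpha>2 C2 D2 "real DIM(real ^ 'n)" s "TYPE(real ^ 'n)"
    by (simp add: nls_def)
  fix \<psi>0 :: "(real ^ 'n) Ltwo" assume \<psi>0: "\<psi>0 \<in> Sobolev s"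
  define a0 where "a0 = weighted s \<psi>0"
  have e0: "unweighted s a0 = \<psi>0" unfolding a0_def by (rule unweighted_weighted[OF \<psi>0 s0])
  obtain T a where T: "0 < T" and a: "continuous_on {0..T} a" and bound: "\<And>t. t \<in> {0..T} \<Longrightarrow> norm (a t) \<le> 2 * norm a0"
    and eq: "\<And>t. t \<in> {0..T} \<Longrightarrow> a t = a0 + integral {0..t} (\<lambda>\<tau>. G \<tau> (a \<tau>))"
    using ode.existence[of a0] by blast
  interpret tr: nls_trajectory \<gamma>1 \<alpha>1 C1 D1 \<gamma>2 \<alpha>2 C2 D2 "real DIM(real ^ 'n)" s "TYPE(real ^ 'n)" T a0 a
    by unfold_locales (use a eq assms in auto)
  let ?\<psi> = "\<lambda>t. unweighted s (flow t (a t))"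
  \<comment> \<open>The flow is an isometry in weighted coordinates, so the bound from the
    fixed-point argument is already the Sobolev bound.\<close>
  have norm: "Sobolev_norm s (?\<psi> t) = norm (a t)" for t
    by (simp add: Sobolev_norm_eq unweighted_in_Sobolev s0)
  show "\<exists>T>0. \<exists>\<psi>. duhamel_solution \<gamma>1 \<gamma>2 s \<psi>0 T \<psi> \<and>
      (\<forall>v. duhamel_solution \<gamma>1 \<gamma>2 s \<psi>0 T v \<longrightarrow> (\<forall>t\<in>{0..T}. v t = \<psi> t)) \<and>
      Linfty_Sobolev_norm s T \<psi> \<le> ereal (2 * Sobolev_norm s \<psi>0) \<and>
      (\<forall>t\<in>{0..<T}. norm (\<psi> t) = norm \<psi>0 \<and> energy \<gamma>1 \<gamma>2 (\<psi> t) = energy \<gamma>1 \<gamma>2 \<psi>0)"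
  proof (intro exI[of _ T] exI[of _ ?\<psi>] conjI T allI impI ballI)
    show "duhamel_solution \<gamma>1 \<gamma>2 s \<psi>0 T ?\<psi>"
      using duhamel_iff[OF a refl, of a0] eq by (simp add: e0)
    show "v t = ?\<psi> t" if v: "duhamel_solution \<gamma>1 \<gamma>2 s \<psi>0 T v" and t: "t \<in> {0..T}" for v t
    proof -
      obtain b where b: "continuous_on {0..T} b" "\<And>t. t \<in> {0..T} \<Longrightarrow> v t = unweighted s (flow t (b t))"
        "\<And>t. t \<in> {0..T} \<Longrightarrow> b t = a0 + integral {0..t} (\<lambda>\<tau>. G \<tau> (b \<tau>))"
        using duhamel_solution_interaction[of a0 T v] v by (auto simp: e0)
      then show ?thesis using ode.uniqueness[OF b(1) a b(3) eq t] t by simp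
    qed
    show "Linfty_Sobolev_norm s T ?\<psi> \<le> ereal (2 * Sobolev_norm s \<psi>0)"
      using bound by (intro Linfty_Sobolev_norm_le) (auto simp: norm Sobolev_norm_eq[OF \<psi>0] a0_def intro!: continuous_intros a)
    show "norm (?\<psi> t) = norm \<psi>0" if "t \<in> {0..<T}" for t
      using tr.mass_conservation[of t] that by (simp add: e0)
    show "energy \<gamma>1 \<gamma>2 (?\<psi> t) = energy \<gamma>1 \<gamma>2 \<psi>0" if "t \<in> {0..<T}" for t
      using tr.energy_conservation[of t] that by (simp add: e0)
  qed
qed

end
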